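(* Let $F=\mathbb R$, let $G$ be a connected reductive group over $\mathbb R$, $S\subset G$ a maximal torus, and $R\subset X^*(S)$ the root system of $G$. Let $\rho_i\in\frac12X^*(S)$ be half the sum of the positive imaginary roots (with respect to some fixed order). There are natural isomorphisms $S(\mathbb R)_\pm\to S(\mathbb R)_{\rho_i}$ between the double cover attached to $R$ and the Adams–Vogan $\rho_i$-cover, as well as between their $L$-groups, that identify the two versions of the local correspondence (between parameters and genuine characters).
   Context: **The cover $S(\mathbb R)_\pm$.** $\Gamma=\mathrm{Gal}(\mathbb C/\mathbb R)=\{1,\sigma\}$, $\Sigma=\Gamma\times\{\pm1\}$. $\alpha\in R$ is symmetric (imaginary) if $\sigma\alpha=-\alpha$; otherwise it is asymmetric. $S(\mathbb R)_\pm$ is the group of classes $[\gamma,\epsilon,(\delta_\alpha)_{\alpha\in R_{\rm sym}}]$ with $\gamma\in S(\mathbb R)$, $\epsilon\in\{\pm1\}$, $\delta_\alpha\in\mathbb C^\times$, $\delta_{-\alpha}=\overline{\delta_\alpha}$, $\delta_\alpha/\delta_{-\alpha}=\alpha(\gamma)$, with componentwise multiplication, modulo $(\gamma,\epsilon,(\delta_\alpha))\sim(\gamma,\eta\epsilon,(\eta_\alpha\delta_\alpha))$ for $\eta_\alpha=\eta_{-\alpha}\in\mathbb R^\times$ and $\eta=\prod_{\alpha\in R_{\rm sym}/\pm}\mathrm{sgn}(\eta_\alpha)$. It is an extension of $S(\mathbb R)$ by $\{\pm1\}$. Genuine characters are those nontrivial on $\{\pm1\}$. **$L$-group of $S(\mathbb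 R)_\pm$.** $\hat S=X^*(S)\otimes\mathbb C^\times$, $c^x=x\otimes c$. A gauge is $p:R\to\{\pm1\}$ with $p(-\alpha)=-p(\alpha)$. $t_p(\sigma',\tau)=\prod(-1)^\alpha$ over $\alpha\in R$ with $p(\alpha)=1,p(\sigma'^{-1}\alpha)=-1,p((\sigma'\tau)^{-1}\alpha)=1$. ${}^LS_\pm=\hat S\boxtimes_{t_p}\Gamma$, $(s\boxtimes\sigma)(s'\boxtimes\sigma')=s\,\sigma(s')t_p(\sigma,\sigma')\boxtimes\sigma\sigma'$. Models for gauges $p,q$ are identified by $s\boxtimes\tau\mapsto s\,s_{p/q}(\tau)\boxtimes\tau$, $s_{p/q}(\tau)=\prod(-1)^\alpha$ over $\alpha$ with [$p(\alpha)=1,p(\tau^{-1}\alpha)=-1,q(\alpha)=q(\tau^{-1}\alpha)=1$] or [$p(\alpha)=p(\tau^{-1}\alpha)=1,q(\alpha)=-1,q(\tau^{-1}\alpha)=1$]. Parameters are continuous homomorphisms $W_{\mathbb R}\to{}^LS_\pm$ over $\Gamma$ up to $\hat S$-conjugacy. **Local correspondence for $S(\mathbb R)_\pm$.** For $\alpha\in R$ let $F_\alpha\supset F_{\pm\alpha}$ be the fixed fields of $\mathrm{Stab}(\alpha,\Gamma)\subset\mathrm{Stab}(\{\pm\alpha\},\Gamma)$, and $W_\alpha\subset W_{\pm\alpha}\subset W=W_{\mathbb R}$ the preimages. $\chi$-data: characters $\chi_\alpha:F_\alpha^\times\to\mathbb C^\times$ with $\chi_{\sigma\alpha}=\chi_\alpha\circ\sigma^{-1}$,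 $\chi_{-\alpha}=\chi_\alpha^{-1}$, $\chi_\alpha|_{\mathbb R^\times}=\mathrm{sgn}$ for imaginary $\alpha$. The genuine character $\chi_S([\gamma,\epsilon,(\delta_\alpha)])=\epsilon\prod_{R_{\rm asym}/\Sigma}\chi_\alpha(\alpha(\gamma))\prod_{R_{\rm sym}/\Gamma}\chi_\alpha(\delta_\alpha)$ has parameter $w\mapsto r_{p,\chi}(w)\boxtimes w$, $r_{p,\chi}(w)=\prod_{\alpha\in R/\Sigma}\prod_i\chi_\alpha(v_0(u_i(w)))^{w_i^{-1}\alpha}$, where $w_i$ represent $W_{\pm\alpha}\backslash W$, $v_0\in W_\alpha$, $v_1\in W_{\pm\alpha}\smallsetminus W_\alpha$ (if $\alpha$ is imaginary), $w_iw=u_i(w)w_j$ with $u_i(w)\in W_{\pm\alpha}$, $v_0u=v_0(u)v_j$ with $v_0(u)\in W_\alpha$, $p(w_i^{-1}\alpha)=1$. The correspondence is the bijection extending this compatibly with multiplication by characters of $S(\mathbb R)$ and their parameters in $H^1(W,\hat S)$. **Adams–Vogan cover.** For $\gamma\in\frac12X^*(S)$, $S_\gamma=\{(s,z)\in S\times\mathbb G_m\mid(2\gamma)(s)=z^2\}$ and $S(\mathbb R)_\gamma$ is the preimage of $S(\mathbb R)$ in $S_\gamma(\mathbb C)$; it is a double cover of $S(\mathbb R)$ with genuine character $(s,z)\mapsto z$, denoted $\gamma$. Its $L$-group is generated by $\hat S$ and an element $\hat\delta$ acting on $\hat S$ as $\sigma$, with $\hat\delta^2=\exp(2\pi i\gamma)$,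 where $\exp:X_*(\hat S)\otimes\mathbb C\to\hat S$. Write $W_{\mathbb R}=\mathbb C^\times\cup\mathbb C^\times j$, $j^2=-1$, $jzj^{-1}=\bar z$. For $\gamma$ imaginary ($\sigma\gamma=-\gamma$) the Adams–Vogan correspondence between parameters (homomorphisms $W_{\mathbb R}\to\langle\hat S,\hat\delta\rangle$ over $\Gamma$, up to $\hat S$-conjugacy) and genuine characters of $S(\mathbb R)_\gamma$ is the one compatible with multiplication by characters of $S(\mathbb R)$ under which the character $\gamma$ has parameter $z\mapsto(z/\bar z)^\gamma:=(z/|z|)^{2\gamma}$, $j\mapsto\hat\delta$. *)

theory Defs
  imports
    "HOL-Analysis.Analysis"
    "HOL-Computational_Algebra.Polynomial"
    "HOL-Algebra.Coset"
begin

section \<open>Linear algebraic groups over the real numbers\<close>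

text \<open>A linear algebraic group over the reals is given by its group of complex points, a
  Zariski closed subgroup of the general linear group that is stable under complex conjugation
  (by Galois descent this is the same as being defined over the reals).\<close>

type_synonym 'n cmat = "complex ^ 'n ^ 'n"

inductive polyfun :: "('n::finite cmat \<Rightarrow> complex) \<Rightarrow> bool" where
  "polyfun (\<lambda>_. c)"
| "polyfun (\<lambda>g. g $ i $ j)"
| "polyfun f \<Longrightarrow> polyfun h \<Longrightarrow> polyfun (\<lambda>g. f g + h g)"
| "polyfun f \<Longrightarrow> polyfun h \<Longrightarrow> polyfun (\<lambda>g. f g * h g)"

definition zclosed :: "('n::finite cmat) set \<Rightarrow> bool" where
  "zclosed Z \<longleftrightarrow>
     (\<exists>I. (\<forall>f\<in>I. polyfun f) \<and> Z = {g. invertible g \<and> (\<forall>f\<in>I. f g = 0)})"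

definition zconnected :: "('n::finite cmat) set \<Rightarrow> bool" where
  "zconnected Z \<longleftrightarrow>
     \<not> (\<exists>A B. zclosed A \<and> zclosed B \<and> A \<noteq> {} \<and> B \<noteq> {} \<and> A \<inter> B = {} \<and> A \<union> B = Z)"

definition alg_group :: "('n::finite cmat) set \<Rightarrow> bool" where
  "alg_group G \<longleftrightarrow> zclosed G \<and> mat 1 \<in> G \<and> (\<forall>g\<in>G. \<forall>h\<in>G. g ** h \<in> G) \<and>
     (\<forall>g\<in>G. matrix_inv g \<in> G)"

definition over_reals :: "('n::finite cmat) set \<Rightarrow> bool" where
  "over_reals G \<longleftrightarrow> (\<forall>g\<in>G. map_matrix cnj g \<in> G)"

definition real_points :: "('n::finite cmat) set \<Rightarrow> ('n cmat) set" where
  "real_points G = {g \<in> G. map_matrix cnj g = g}"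

definition unipotent :: "'n::finite cmat \<Rightarrow> bool" where
  "unipotent g \<longleftrightarrow> (\<exists>k::nat. (((**) (g - mat 1)) ^^ k) (mat 1) = 0)"

text \<open>Triviality of the geometric unipotent radical.\<close>

definition connected_reductive :: "('n::finite cmat) set \<Rightarrow> bool" where
  "connected_reductive G \<longleftrightarrow> alg_group G \<and> zconnected G \<and>
     (\<forall>U. alg_group U \<and> zconnected U \<and> U \<subseteq> G \<and> (\<forall>u\<in>U. unipotent u) \<and>
          (\<forall>g\<in>G. \<forall>u\<in>U. g ** u ** matrix_inv g \<in> U) \<longrightarrow> U = {mat 1})"

definition torus :: "('n::finite cmat) set \<Rightarrow> bool" where
  "torus S \<longleftrightarrow> alg_group S \<and> zconnected S \<and>
     (\<exists>P::'n cmat. invertible P \<and>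
          (\<forall>s\<in>S. \<forall>i j. i \<noteq> j \<longrightarrow> (P ** s ** matrix_inv P) $ i $ j = 0))"

definition maximal_torus :: "('n::finite cmat) set \<Rightarrow> ('n cmat) set \<Rightarrow> bool" where
  "maximal_torus S G \<longleftrightarrow> torus S \<and> S \<subseteq> G \<and>
     (\<forall>T. torus T \<and> S \<subseteq> T \<and> T \<subseteq> G \<longrightarrow> T = S)"

text \<open>Zariski tangent space at the identity; \<open>mat t ** A\<close> is the scalar multiple of \<open>A\<close> by \<open>t\<close>.\<close>

definition lie_algebra :: "('n::finite cmat) set \<Rightarrow> ('n cmat) set" where
  "lie_algebra G = {A. \<forall>f. polyfun f \<and> (\<forall>g\<in>G. f g = 0) \<longrightarrow>
     ((\<lambda>t::complex. f (mat 1 + mat t ** A)) has_field_derivative 0) (at 0)}"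


section \<open>Characters, cocharacters, roots\<close>

text \<open>Characters of \<open>S\<close> are extended by the value 1 outside \<open>S\<close> and cocharacters by the identity
  matrix at 0, so that equality of functions is equality of (co)characters.  The groups
  \<open>X\<^sup>*(S)\<close> and \<open>X\<^sub>*(S)\<close> are written multiplicatively (pointwise).\<close>

type_synonym 'n chr = "'n cmat \<Rightarrow> complex"
type_synonym 'n cochr = "complex \<Rightarrow> 'n cmat"

definition chars :: "('n::finite cmat) set \<Rightarrow> ('n chr) set" where
  "chars S = {x. (\<exists>f k. polyfun f \<and> (\<forall>s\<in>S. x s = f s / det s ^ k)) \<and>
     (\<forall>s\<in>S. x s \<noteq> 0) \<and> (\<forall>s\<in>S. \<forall>t\<in>S. x (s ** t) = x s * x t) \<and> (\<forall>s. s \<notin> S \<longrightarrow> x s = 1)}"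

definition cochars :: "('n::finite cmat) set \<Rightarrow> ('n cochr) set" where
  "cochars S = {l.
     (\<forall>i j. \<exists>(P::complex poly) k. \<forall>z. z \<noteq> 0 \<longrightarrow> l z $ i $ j = poly P z / z ^ k) \<and>
     (\<forall>z. z \<noteq> 0 \<longrightarrow> l z \<in> S) \<and>
     (\<forall>z w. z \<noteq> 0 \<longrightarrow> w \<noteq> 0 \<longrightarrow> l (z * w) = l z ** l w) \<and> l 0 = mat 1}"

definition pairing :: "'n::finite chr \<Rightarrow> 'n cochr \<Rightarrow> int" where
  "pairing x l = (THE k. \<forall>z. z \<noteq> 0 \<longrightarrow> x (l z) = z powi k)"

definition cneg :: "'n::finite chr \<Rightarrow> 'n chr" where
  "cneg x = (\<lambda>s. inverse (x s))"

definition csig :: "'n::finite chr \<Rightarrow> 'n chr" where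
  "csig x = (\<lambda>s. cnj (x (map_matrix cnj s)))"

definition ysig :: "'n::finite cochr \<Rightarrow> 'n cochr" where
  "ysig l = (\<lambda>z. map_matrix cnj (l (cnj z)))"

text \<open>The Galois group \<open>\<Gamma>\<close> is modelled by \<open>bool\<close>, with \<open>False\<close> the identity and \<open>True\<close> the
  complex conjugation; the product of \<open>a\<close> and \<open>b\<close> is \<open>a \<noteq> b\<close>, and every element is its own inverse.\<close>

definition gact :: "bool \<Rightarrow> 'n::finite chr \<Rightarrow> 'n chr" where
  "gact b x = (if b then csig x else x)"

definition roots :: "('n::finite cmat) set \<Rightarrow> ('n cmat) set \<Rightarrow> ('n chr) set" where
  "roots G S = {x \<in> chars S. x \<noteq> (\<lambda>_. 1) \<and>
     (\<exists>A\<in>lie_algebra G. A \<noteq> 0 \<and> (\<forall>s\<in>S. s ** A ** matrix_inv s = mat (x s) ** A))}"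

definition imaginary :: "'n::finite chr \<Rightarrow> bool" where
  "imaginary x \<longleftrightarrow> csig x = cneg x"

definition Rsym :: "('n::finite chr) set \<Rightarrow> ('n chr) set" where
  "Rsym R = {x \<in> R. imaginary x}"

definition Rasym :: "('n::finite chr) set \<Rightarrow> ('n chr) set" where
  "Rasym R = {x \<in> R. \<not> imaginary x}"

definition gal_orbit :: "'n::finite chr \<Rightarrow> ('n chr) set" where
  "gal_orbit x = {x, csig x}"

definition pm_orbit :: "'n::finite chr \<Rightarrow> ('n chr) set" where
  "pm_orbit x = {x, cneg x}"

definition sigma_orbit :: "'n::finite chr \<Rightarrow> ('n chr) set" where
  "sigma_orbit x = {x, cneg x, csig x, cneg (csig x)}"

text \<open>Product over a set of orbits of a function that is constant on each of these orbits.\<close>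

definition orbit_prod :: "'a set set \<Rightarrow> ('a \<Rightarrow> 'b::comm_monoid_mult) \<Rightarrow> 'b" where
  "orbit_prod Q f = (\<Prod>B\<in>Q. f (SOME x. x \<in> B))"

text \<open>Translation invariant total orders on \<open>X\<^sup>*(S)\<close>.\<close>

definition group_order :: "('n::finite cmat) set \<Rightarrow> ('n chr \<times> 'n chr) set \<Rightarrow> bool" where
  "group_order S r \<longleftrightarrow> linear_order_on (chars S) r \<and>
     (\<forall>x\<in>chars S. \<forall>y\<in>chars S. \<forall>z\<in>chars S.
        (x, y) \<in> r \<longrightarrow> ((\<lambda>s. x s * z s), (\<lambda>s. y s * z s)) \<in> r)"

definition pos_imag :: "('n::finite chr) set \<Rightarrow> ('n chr \<times> 'n chr) set \<Rightarrow> ('n chr) set" where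
  "pos_imag R r = {x \<in> R. imaginary x \<and> ((\<lambda>_. 1), x) \<in> r}"

text \<open>An element \<open>\<gamma>\<close> of \<open>\<onehalf>X\<^sup>*(S)\<close> is represented throughout by the character \<open>2\<gamma>\<close>.  The following
  is \<open>2\<rho>\<^sub>i\<close>, the sum of the positive imaginary roots.\<close>

definition two_rho_i :: "('n::finite chr) set \<Rightarrow> ('n chr \<times> 'n chr) set \<Rightarrow> 'n chr" where
  "two_rho_i R r = (\<lambda>s. \<Prod>x\<in>pos_imag R r. x s)"


section \<open>The Weil group and the dual torus\<close>

text \<open>The pair \<open>(z, b)\<close> stands for \<open>z\<close> if \<open>b\<close> is \<open>False\<close>, and for \<open>z j\<close> if \<open>b\<close> is \<open>True\<close>.\<close>

definition weil :: "(complex \<times> bool) monoid" where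
  "weil = \<lparr>carrier = {w. fst w \<noteq> 0},
     mult = (\<lambda>(z, a) (z', b).
       (z * (if a then cnj z' else z') * (if a \<and> b then - 1 else 1), a \<noteq> b)),
     one = (1, False)\<rparr>"

text \<open>The isomorphism of the abelianized Weil group with the nonzero reals: the norm on the nonzero
  complex numbers, \<open>- 1\<close> at \<open>j\<close>.\<close>

definition weil_ab :: "complex \<times> bool \<Rightarrow> complex" where
  "weil_ab w = (if snd w then - 1 else 1) * fst w * cnj (fst w)"

text \<open>\<open>X\<^sup>*(S) \<otimes> \<complex>\<^sup>\<times>\<close> is realised as \<open>Hom(X\<^sub>*(S), \<complex>\<^sup>\<times>)\<close>, the element \<open>c\<^sup>x = x \<otimes> c\<close> being
  \<open>l \<mapsto> c\<^bsup>\<langle>x,l\<rangle>\<^esup>\<close>.  Values outside \<open>X\<^sub>*(S)\<close> are 1.\<close>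

type_synonym 'n dual = "'n cochr \<Rightarrow> complex"

definition dual_torus :: "('n::finite cmat) set \<Rightarrow> ('n dual) set" where
  "dual_torus S = {s. (\<forall>l\<in>cochars S. s l \<noteq> 0) \<and>
     (\<forall>l\<in>cochars S. \<forall>m\<in>cochars S. s (\<lambda>z. l z ** m z) = s l * s m) \<and>
     (\<forall>l. l \<notin> cochars S \<longrightarrow> s l = 1)}"

definition tens :: "('n::finite cmat) set \<Rightarrow> 'n chr \<Rightarrow> complex \<Rightarrow> 'n dual" where
  "tens S x c = (\<lambda>l. if l \<in> cochars S then c powi pairing x l else 1)"

definition dual_act :: "bool \<Rightarrow> 'n::finite dual \<Rightarrow> 'n dual" where
  "dual_act b s = (\<lambda>l. s (if b then ysig l else l))"

text \<open>\<open>\<hat>S \<boxtimes>\<^sub>t \<Gamma>\<close>, the extension of \<open>\<Gamma>\<close> by the dual torus with 2-cocycle \<open>t\<close>.\<close>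

definition twisted_L ::
  "('n::finite cmat) set \<Rightarrow> (bool \<Rightarrow> bool \<Rightarrow> 'n dual) \<Rightarrow> ('n dual \<times> bool) monoid" where
  "twisted_L S t = \<lparr>carrier = dual_torus S \<times> UNIV,
     mult = (\<lambda>(s, a) (s', b). ((\<lambda>l. s l * dual_act a s' l * t a b l), a \<noteq> b)),
     one = ((\<lambda>_. 1), False)\<rparr>"

definition L_conj ::
  "('n dual \<times> bool) monoid \<Rightarrow> 'n::finite dual \<Rightarrow> 'n dual \<times> bool \<Rightarrow> 'n dual \<times> bool" where
  "L_conj L t x = (t, False) \<otimes>\<^bsub>L\<^esub> x \<otimes>\<^bsub>L\<^esub> inv\<^bsub>L\<^esub> (t, False)"

definition params :: "('n::finite dual \<times> bool) monoid \<Rightarrow> (complex \<times> bool \<Rightarrow> 'n dual \<times> bool) set" where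
  "params L = {\<phi> \<in> hom weil L. continuous_on (carrier weil) \<phi> \<and>
     (\<forall>w\<in>carrier weil. snd (\<phi> w) = snd w)}"


section \<open>The local correspondence for tori\<close>

definition Cx :: "complex monoid" where
  "Cx = \<lparr>carrier = UNIV - {0}, mult = (*), one = 1\<rparr>"

definition torus_characters :: "('n::finite cmat) set \<Rightarrow> ('n cmat \<Rightarrow> complex) set" where
  "torus_characters S = {\<psi>. continuous_on (real_points S) \<psi> \<and>
     (\<forall>s\<in>real_points S. \<psi> s \<noteq> 0) \<and>
     (\<forall>s\<in>real_points S. \<forall>t\<in>real_points S. \<psi> (s ** t) = \<psi> s * \<psi> t)}"

definition weil_cocycles :: "('n::finite cmat) set \<Rightarrow> (complex \<times> bool \<Rightarrow> 'n dual) set" where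
  "weil_cocycles S = {a. continuous_on (carrier weil) a \<and>
     (\<forall>w\<in>carrier weil. a w \<in> dual_torus S) \<and>
     (\<forall>w\<in>carrier weil. \<forall>v\<in>carrier weil.
        a (w \<otimes>\<^bsub>weil\<^esub> v) = (\<lambda>l. a w l * dual_act (snd w) (a v) l))}"

text \<open>Langlands' correspondence between characters of \<open>S(\<real>)\<close> and classes in \<open>H\<^sup>1(W, \<hat>S)\<close>, pinned
  down by functoriality.  The group \<open>S(\<real>)\<close> is generated by the norms \<open>l(z) \<sigma>(l(z))\<close> of complex
  points and by the images of the nonzero reals under the cocharacters defined over the reals
  (Tate--Nakayama).  On the former the correspondence is base change to the complex numbers,
  on the latter it is class field theory for the multiplicative group.\<close>

definition torus_llc ::
  "('n::finite cmat) set \<Rightarrow> ('n cmat \<Rightarrow> complex) \<Rightarrow> (complex \<times> bool \<Rightarrow> 'n dual) \<Rightarrow> bool" where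
  "torus_llc S \<psi> a \<longleftrightarrow> \<psi> \<in> torus_characters S \<and> a \<in> weil_cocycles S \<and>
     (\<forall>l\<in>cochars S. \<forall>z. z \<noteq> 0 \<longrightarrow> \<psi> (l z ** map_matrix cnj (l z)) = a (z, False) l) \<and>
     (\<forall>l\<in>cochars S. ysig l = l \<longrightarrow> (\<forall>w\<in>carrier weil. \<psi> (l (weil_ab w)) = a w l))"


section \<open>The double cover attached to a set of roots\<close>

text \<open>Triples \<open>(\<gamma>, \<epsilon>, (\<delta>\<^sub>\<alpha>))\<close>; the components \<open>\<delta>\<^sub>\<alpha>\<close> for \<open>\<alpha>\<close> not symmetric are set to 1.\<close>

definition pm_triples ::
  "('n::finite cmat) set \<Rightarrow> ('n chr) set \<Rightarrow> ('n cmat \<times> real \<times> ('n chr \<Rightarrow> complex)) monoid" where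
  "pm_triples S R = \<lparr>
     carrier = {(g, e, d). g \<in> real_points S \<and> e \<in> {1, -1} \<and>
       (\<forall>x\<in>Rsym R. d x \<noteq> 0 \<and> d (cneg x) = cnj (d x) \<and> d x / d (cneg x) = x g) \<and>
       (\<forall>x. x \<notin> Rsym R \<longrightarrow> d x = 1)},
     mult = (\<lambda>(g, e, d) (g', e', d'). (g ** g', e * e', (\<lambda>x. d x * d' x))),
     one = (mat 1, 1, (\<lambda>_. 1))\<rparr>"

text \<open>The equivalence relation is translation by the following subgroup, so that the cover is the
  quotient group and the class of a triple is its coset.\<close>

definition pm_scalings ::
  "('n::finite chr) set \<Rightarrow> ('n cmat \<times> real \<times> ('n chr \<Rightarrow> complex)) set" where
  "pm_scalings R =
     {(mat 1, orbit_prod (pm_orbit ` Rsym R) (\<lambda>x. sgn (h x)), (\<lambda>x. complex_of_real (h x))) | h.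
       (\<forall>x\<in>Rsym R. h x \<noteq> 0 \<and> h (cneg x) = h x) \<and> (\<forall>x. x \<notin> Rsym R \<longrightarrow> h x = (1::real))}"

type_synonym 'n pm_pt = "('n cmat \<times> real \<times> ('n chr \<Rightarrow> complex)) set"

definition pm_class ::
  "('n::finite cmat) set \<Rightarrow> ('n chr) set \<Rightarrow> 'n cmat \<times> real \<times> ('n chr \<Rightarrow> complex) \<Rightarrow> 'n pm_pt" where
  "pm_class S R t = pm_scalings R #>\<^bsub>pm_triples S R\<^esub> t"

definition pm_cover :: "('n::finite cmat) set \<Rightarrow> ('n chr) set \<Rightarrow> 'n pm_pt monoid" where
  "pm_cover S R = pm_triples S R Mod pm_scalings R"

text \<open>The quotient topology.\<close>

definition pm_topology :: "('n::finite cmat) set \<Rightarrow> ('n chr) set \<Rightarrow> 'n pm_pt topology" where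
  "pm_topology S R = topology (\<lambda>U. U \<subseteq> carrier (pm_cover S R) \<and>
     openin (top_of_set (carrier (pm_triples S R)))
            {t \<in> carrier (pm_triples S R). pm_class S R t \<in> U})"

definition pm_genuine :: "('n::finite cmat) set \<Rightarrow> ('n chr) set \<Rightarrow> ('n pm_pt \<Rightarrow> complex) set" where
  "pm_genuine S R = {X \<in> hom (pm_cover S R) Cx. continuous_map (pm_topology S R) euclidean X \<and>
     X (pm_class S R (mat 1, -1, (\<lambda>_. 1))) \<noteq> 1}"


subsection \<open>Its L-group\<close>

definition gauge_on :: "('n::finite chr) set \<Rightarrow> ('n chr \<Rightarrow> int) \<Rightarrow> bool" where
  "gauge_on R p \<longleftrightarrow> (\<forall>x\<in>R. p x \<in> {1, -1} \<and> p (cneg x) = - p x)"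

text \<open>In the next two definitions inverses in \<open>\<Gamma>\<close> are omitted, since \<open>\<Gamma>\<close> has exponent 2.\<close>

definition t_gauge ::
  "('n::finite cmat) set \<Rightarrow> ('n chr) set \<Rightarrow> ('n chr \<Rightarrow> int) \<Rightarrow> bool \<Rightarrow> bool \<Rightarrow> 'n dual" where
  "t_gauge S R p a b = (\<lambda>l.
     \<Prod>x\<in>{x \<in> R. p x = 1 \<and> p (gact a x) = -1 \<and> p (gact (a \<noteq> b) x) = 1}. tens S x (-1) l)"

definition s_gauge ::
  "('n::finite cmat) set \<Rightarrow> ('n chr) set \<Rightarrow> ('n chr \<Rightarrow> int) \<Rightarrow> ('n chr \<Rightarrow> int) \<Rightarrow> bool \<Rightarrow> 'n dual" where
  "s_gauge S R p q a = (\<lambda>l.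
     \<Prod>x\<in>{x \<in> R. (p x = 1 \<and> p (gact a x) = -1 \<and> q x = 1 \<and> q (gact a x) = 1) \<or>
                  (p x = 1 \<and> p (gact a x) = 1 \<and> q x = -1 \<and> q (gact a x) = 1)}. tens S x (-1) l)"

definition pm_L :: "('n::finite cmat) set \<Rightarrow> ('n chr) set \<Rightarrow> ('n chr \<Rightarrow> int) \<Rightarrow> ('n dual \<times> bool) monoid" where
  "pm_L S R p = twisted_L S (t_gauge S R p)"

definition change_gauge ::
  "('n::finite cmat) set \<Rightarrow> ('n chr) set \<Rightarrow> ('n chr \<Rightarrow> int) \<Rightarrow> ('n chr \<Rightarrow> int) \<Rightarrow>
   'n dual \<times> bool \<Rightarrow> 'n dual \<times> bool" where
  "change_gauge S R p q = (\<lambda>(s, a). ((\<lambda>l. s l * s_gauge S R p q a l), a))"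


subsection \<open>\<open>\<chi>\<close>-data and the local correspondence\<close>

text \<open>\<open>F\<^sub>\<alpha>\<^sup>\<times>\<close>, and the preimages \<open>W\<^sub>\<alpha>\<close> and \<open>W\<^sub>\<plusminus>\<^sub>\<alpha>\<close> of the stabilizers in \<open>\<Gamma>\<close>.\<close>

definition F_units :: "'n::finite chr \<Rightarrow> complex set" where
  "F_units x = (if csig x = x then \<real> else UNIV) - {0}"

definition W_stab :: "'n::finite chr \<Rightarrow> (complex \<times> bool) set" where
  "W_stab x = {w \<in> carrier weil. gact (snd w) x = x}"

definition W_stab_pm :: "'n::finite chr \<Rightarrow> (complex \<times> bool) set" where
  "W_stab_pm x = {w \<in> carrier weil. gact (snd w) x \<in> {x, cneg x}}"

text \<open>The map from \<open>W\<^sub>\<alpha>\<close> to \<open>F\<^sub>\<alpha>\<^sup>\<times>\<close> through which characters of \<open>F\<^sub>\<alpha>\<^sup>\<times>\<close> are evaluated on \<open>W\<^sub>\<alpha>\<close>.\<close>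

definition to_F :: "'n::finite chr \<Rightarrow> complex \<times> bool \<Rightarrow> complex" where
  "to_F x w = (if csig x = x then weil_ab w else fst w)"

definition chi_data :: "('n::finite chr) set \<Rightarrow> ('n chr \<Rightarrow> complex \<Rightarrow> complex) \<Rightarrow> bool" where
  "chi_data R chi \<longleftrightarrow> (\<forall>x\<in>R.
     continuous_on (F_units x) (chi x) \<and>
     (\<forall>u\<in>F_units x. chi x u \<noteq> 0) \<and>
     (\<forall>u\<in>F_units x. \<forall>v\<in>F_units x. chi x (u * v) = chi x u * chi x v) \<and>
     (\<forall>u\<in>F_units x. chi (csig x) u = chi x (cnj u)) \<and>
     (\<forall>u\<in>F_units x. chi (cneg x) u = inverse (chi x u)) \<and>
     (imaginary x \<longrightarrow> (\<forall>c::real. c \<noteq> 0 \<longrightarrow> chi x (of_real c) = of_real (sgn c))))"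

definition chi_S_triple ::
  "('n::finite chr) set \<Rightarrow> ('n chr \<Rightarrow> complex \<Rightarrow> complex) \<Rightarrow>
   'n cmat \<times> real \<times> ('n chr \<Rightarrow> complex) \<Rightarrow> complex" where
  "chi_S_triple R chi = (\<lambda>(g, e, d). of_real e *
     orbit_prod (sigma_orbit ` Rasym R) (\<lambda>x. chi x (x g)) *
     orbit_prod (gal_orbit ` Rsym R) (\<lambda>x. chi x (d x)))"

definition chi_S :: "('n::finite chr) set \<Rightarrow> ('n chr \<Rightarrow> complex \<Rightarrow> complex) \<Rightarrow> 'n pm_pt \<Rightarrow> complex" where
  "chi_S R chi c = chi_S_triple R chi (SOME t. t \<in> c)"

text \<open>Representatives \<open>\<alpha>\<close> of \<open>R/\<Sigma>\<close>, and for each of them the set of representatives \<open>w\<^sub>i\<close> of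
  \<open>W\<^sub>\<plusminus>\<^sub>\<alpha> \ W\<close> and the elements \<open>v\<^sub>0\<close>, \<open>v\<^sub>1\<close>.  The condition \<open>p(w\<^sub>i\<inverse>\<alpha>) = 1\<close> can only be met when the
  gauge \<open>p\<close> takes the same value at \<open>\<alpha>\<close> and \<open>\<sigma>\<alpha>\<close> for asymmetric \<open>\<alpha>\<close>.  Other gauges are reached
  through the identification of models.\<close>

record 'n choices =
  reps :: "'n chr set"
  transv :: "'n chr \<Rightarrow> (complex \<times> bool) set"
  vzero :: "'n chr \<Rightarrow> complex \<times> bool"
  vone :: "'n chr \<Rightarrow> complex \<times> bool"

definition valid_choices ::
  "('n::finite chr) set \<Rightarrow> ('n chr \<Rightarrow> int) \<Rightarrow> 'n choices \<Rightarrow> bool" where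
  "valid_choices R p D \<longleftrightarrow>
     reps D \<subseteq> R \<and> (\<forall>x\<in>R. \<exists>!y. y \<in> reps D \<and> y \<in> sigma_orbit x) \<and>
     (\<forall>x\<in>reps D.
        transv D x \<subseteq> carrier weil \<and>
        (\<forall>w\<in>carrier weil. \<exists>!v. v \<in> transv D x \<and> w \<otimes>\<^bsub>weil\<^esub> inv\<^bsub>weil\<^esub> v \<in> W_stab_pm x) \<and>
        (\<forall>v\<in>transv D x. p (gact (snd (inv\<^bsub>weil\<^esub> v)) x) = 1) \<and>
        vzero D x \<in> W_stab x \<and>
        (imaginary x \<longrightarrow> vone D x \<in> W_stab_pm x - W_stab x))"

text \<open>\<open>u\<^sub>i(w)\<close>, for \<open>v = w\<^sub>i\<close>, and \<open>v\<^sub>0(u)\<close>.\<close>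

definition u_elt :: "'n::finite choices \<Rightarrow> 'n chr \<Rightarrow> complex \<times> bool \<Rightarrow> complex \<times> bool \<Rightarrow> complex \<times> bool" where
  "u_elt D x v w = (THE u. u \<in> W_stab_pm x \<and>
     (\<exists>v'\<in>transv D x. v \<otimes>\<^bsub>weil\<^esub> w = u \<otimes>\<^bsub>weil\<^esub> v'))"

definition v0_elt :: "'n::finite choices \<Rightarrow> 'n chr \<Rightarrow> complex \<times> bool \<Rightarrow> complex \<times> bool" where
  "v0_elt D x u = (THE y. y \<in> W_stab x \<and>
     (vzero D x \<otimes>\<^bsub>weil\<^esub> u = y \<otimes>\<^bsub>weil\<^esub> vzero D x \<or>
      (imaginary x \<and> vzero D x \<otimes>\<^bsub>weil\<^esub> u = y \<otimes>\<^bsub>weil\<^esub> vone D x)))"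

definition r_chi ::
  "('n::finite cmat) set \<Rightarrow> ('n chr \<Rightarrow> complex \<Rightarrow> complex) \<Rightarrow> 'n choices \<Rightarrow> complex \<times> bool \<Rightarrow> 'n dual" where
  "r_chi S chi D w = (\<lambda>l. \<Prod>x\<in>reps D. \<Prod>v\<in>transv D x.
     tens S (gact (snd (inv\<^bsub>weil\<^esub> v)) x) (chi x (to_F x (v0_elt D x (u_elt D x v w)))) l)"

text \<open>\<open>pm_llc S R chi p X \<phi>\<close>: the parameter \<open>\<phi>\<close> into the model with gauge \<open>p\<close> corresponds to the
  genuine character \<open>X\<close>, that is, \<open>X\<close> is the product of \<open>\<chi>\<^sub>S\<close> and a character \<open>\<psi>\<close> of \<open>S(\<real>)\<close>,
  \<open>\<psi>\<close> has parameter \<open>a\<close>, and \<open>\<phi>\<close> is conjugate to the image of \<open>w \<mapsto> a(w) r(w) \<boxtimes> w\<close> under the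
  identification of models.\<close>

definition pm_llc ::
  "('n::finite cmat) set \<Rightarrow> ('n chr) set \<Rightarrow> ('n chr \<Rightarrow> complex \<Rightarrow> complex) \<Rightarrow> ('n chr \<Rightarrow> int) \<Rightarrow>
   ('n pm_pt \<Rightarrow> complex) \<Rightarrow> (complex \<times> bool \<Rightarrow> 'n dual \<times> bool) \<Rightarrow> bool" where
  "pm_llc S R chi p X \<phi> \<longleftrightarrow>
     (\<exists>q D \<psi> a. \<exists>t\<in>dual_torus S.
        gauge_on R q \<and> valid_choices R q D \<and> torus_llc S \<psi> a \<and>
        (\<forall>(g, e, d)\<in>carrier (pm_triples S R).
           X (pm_class S R (g, e, d)) = chi_S R chi (pm_class S R (g, e, d)) * \<psi> g) \<and>
        (\<forall>w\<in>carrier weil.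
           \<phi> w = L_conj (pm_L S R p) t
                   (change_gauge S R q p ((\<lambda>l. a w l * r_chi S chi D w l), snd w))))"


section \<open>The Adams--Vogan cover\<close>

text \<open>Here \<open>x\<close> is the character \<open>2\<gamma>\<close>.\<close>

definition av_cover :: "('n::finite cmat) set \<Rightarrow> 'n chr \<Rightarrow> ('n cmat \<times> complex) monoid" where
  "av_cover S x = \<lparr>
     carrier = {(s, z). s \<in> real_points S \<and> z \<noteq> 0 \<and> x s = z\<^sup>2},
     mult = (\<lambda>(s, z) (s', z'). (s ** s', z * z')),
     one = (mat 1, 1)\<rparr>"

definition av_genuine :: "('n::finite cmat) set \<Rightarrow> 'n chr \<Rightarrow> ('n cmat \<times> complex \<Rightarrow> complex) set" where
  "av_genuine S x = {X \<in> hom (av_cover S x) Cx. continuous_on (carrier (av_cover S x)) X \<and>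
     X (mat 1, -1) \<noteq> 1}"

definition exp_2pi_i_half :: "('n::finite cmat) set \<Rightarrow> 'n chr \<Rightarrow> 'n dual" where
  "exp_2pi_i_half S x =
     (\<lambda>l. if l \<in> cochars S then exp (2 * of_real pi * \<i> * (of_int (pairing x l) / 2)) else 1)"

text \<open>The pair \<open>(s, b)\<close> stands for \<open>s\<close> if \<open>b\<close> is \<open>False\<close> and for \<open>s \<hat>\<delta>\<close> if \<open>b\<close> is \<open>True\<close>.\<close>

definition av_L :: "('n::finite cmat) set \<Rightarrow> 'n chr \<Rightarrow> ('n dual \<times> bool) monoid" where
  "av_L S x = twisted_L S (\<lambda>a b. if a \<and> b then exp_2pi_i_half S x else (\<lambda>_. 1))"

definition av_llc ::
  "('n::finite cmat) set \<Rightarrow> 'n chr \<Rightarrow> ('n cmat \<times> complex \<Rightarrow> complex) \<Rightarrow>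
   (complex \<times> bool \<Rightarrow> 'n dual \<times> bool) \<Rightarrow> bool" where
  "av_llc S x X \<phi> \<longleftrightarrow>
     (\<exists>\<psi> a. \<exists>t\<in>dual_torus S.
        torus_llc S \<psi> a \<and>
        (\<forall>(s, z)\<in>carrier (av_cover S x). X (s, z) = z * \<psi> s) \<and>
        (\<forall>(z, b)\<in>carrier weil.
           \<phi> (z, b) = L_conj (av_L S x) t
              ((\<lambda>l. a (z, b) l * tens S x (z / of_real (cmod z)) l), b)))"

end

(* The roots are symmetric under x |-> -x: otherwise, a root vector X whose opposite root space is
   zero is orthogonal to the Lie algebra under the trace form of the given representation, because
   weight spaces of nonopposite weights are orthogonal.  The radical r of the trace form on the Lie
   algebra g satisfies that [g, r] consists of nilpotent matrices (Cartan's criterion), so that exp (t X)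
   lies in the normal unipotent subgroup {u. tr (u h) = tr h for all h in G}, which is trivial
   because G is reductive.

   Given this, the isomorphism of covers sends [g, e, d] to (g, e * prod d_x / |d_x|) over the positive
   imaginary roots x: as d_x / cnj d_x = x(g), the square of the second entry is (2 rho_i)(g), and
   rescaling d_x by a real eta_x changes the product by the sign of eta_x.  For the gauges p that are
   Galois invariant on asymmetric roots, the cocycle t_p is (2 rho_i)(-1), which is the square of the
   Adams--Vogan element, so that both L-groups coincide; for other gauges one passes to such a gauge.
   With chi-data, chi_x(d_x) differs from d_x / |d_x| by eta_x(d_x), where eta_x = chi_x(z) / (z / |z|)
   is trivial on the reals, so that eta_x(d_x) depends on x(g) only.  Hence chi_S is rho_i times a
   character of S(R), and its parameter is that of rho_i times the Langlands parameter of that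
   character, where asymmetric roots contribute the pullbacks of chi_x under x. *)
theory Submission
  imports Defs
    "HOL-Computational_Algebra.Polynomial_Factorial"
    "HOL-Computational_Algebra.Fundamental_Theorem_Algebra"
    "HOL-Computational_Algebra.Field_as_Ring"
begin

section \<open>The trace form and nilpotent matrices\<close>

text \<open>The symmetry of the roots shapes the first half: gauges, sign orbits and the cover all
  rely on it, while \<open>roots\<close> only records weights of S on the tangent space and
  reductivity is only triviality of the unipotent radical. To place a root vector X in [g, r] one
  needs a diagonal H in the Lie algebra with [H, X] = X. It exists because the root has infinite
  order, the order on characters excluding torsion.

  On the dual side the reference gauge is the sign of x for imaginary x, and the sign of the norm of
  x under \<sigma> otherwise. For another gauge p, the product of (-1)^x over half of the asymmetric
  roots where p jumps from 1 to -1 trivializes the surplus of t_p, and the isomorphism multiplies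
  the \<sigma>-component by it. Combined with change of gauge these products agree only up to a
  coboundary, so the isomorphisms are compatible up to conjugacy, which parameters do not see.

  The values of r at j depend on the auxiliary choices through at most one nonzero constant per
  orbit. It is carried along as \<kappa>, since the correspondence for tori holds with each of its
  values.\<close>

text \<open>Multiplication on the vector type is componentwise; this copy of the matrices carries the
  matrix product as a ring multiplication.\<close>

typedef (overloaded) ('n::finite) sqmat = "UNIV :: (complex ^ 'n ^ 'n) set"
  morphisms Rep_sqmat Sq by simp

setup_lifting type_definition_sqmat

lemma matrix_add_rdistrib': "(A + B) ** C = A ** C + B ** (C :: ('n::finite) cmat)"
  by (simp add: vec_eq_iff matrix_matrix_mult_def distrib_right sum.distrib)

instantiation sqmat :: (finite) ring_1
begin
lift_definition zero_sqmat :: "'a sqmat" is "0" .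
lift_definition one_sqmat :: "'a sqmat" is "mat 1" .
lift_definition plus_sqmat :: "'a sqmat \<Rightarrow> 'a sqmat \<Rightarrow> 'a sqmat" is "(+)" .
lift_definition minus_sqmat :: "'a sqmat \<Rightarrow> 'a sqmat \<Rightarrow> 'a sqmat" is "(-)" .
lift_definition uminus_sqmat :: "'a sqmat \<Rightarrow> 'a sqmat" is "uminus" .
lift_definition times_sqmat :: "'a sqmat \<Rightarrow> 'a sqmat \<Rightarrow> 'a sqmat" is "(**)" .
instance
proof
  show "(0::'a sqmat) \<noteq> 1"
    by transfer (auto simp: mat_def vec_eq_iff)
qed (transfer; simp add: matrix_mul_assoc matrix_add_ldistrib matrix_add_rdistrib')+
end

text \<open>Complex scalars act through scalar matrices, so that complex linearity can be expressed
  within the ring.\<close>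

lift_definition sc :: "complex \<Rightarrow> ('n::finite) sqmat" is "\<lambda>c. mat c" .
lift_definition tr :: "('n::finite) sqmat \<Rightarrow> complex" is trace .

lemma mat_times_component: "(mat c ** A) $ i $ j = c * A $ i $ j"
  and times_mat_component: "(A ** mat c) $ i $ j = c * (A :: ('n::finite) cmat) $ i $ j"
  by (simp_all add: matrix_matrix_mult_def mat_def if_distrib[of "\<lambda>x. x * _"]
      if_distrib[of "\<lambda>x. _ * x"] sum.delta sum.delta' mult.commute cong: if_cong)

lemma mat_commute: "A ** mat c = mat c ** (A :: ('n::finite) cmat)"
  by (simp add: vec_eq_iff mat_times_component times_mat_component)

lemma sc_0 [simp]: "sc 0 = 0"
  and sc_1 [simp]: "sc 1 = 1"
  and sc_add: "sc (a + b) = sc a + sc b"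
  and sc_diff: "sc (a - b) = sc a - sc b"
  and sc_mult: "sc (a * b) = sc a * sc b"
  by (transfer, simp add: mat_def vec_eq_iff mat_times_component[unfolded mat_def])+

lemma sc_minus: "sc (- c) = - sc c"
  using sc_diff[of 0 c] by simp

lemma sc_commute: "a * sc c = sc c * a"
  by transfer (rule mat_commute)

lemma sc_left_commute: "a * (sc c * b) = sc c * (a * b)"
  by (metis mult.assoc sc_commute)

lemma sc_sc_commute: "sc a * (sc b * v) = sc b * (sc a * v)"
  by (rule sc_left_commute)

lemma tr_add: "tr (a + b) = tr a + tr b"
  and tr_diff: "tr (a - b) = tr a - tr b"
  and tr_0 [simp]: "tr 0 = 0"
  and tr_mult_commute: "tr (a * b) = tr (b * a)"
  and tr_sc: "tr (sc c * a) = c * tr a"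
      apply (transfer, rule trace_add)
     apply (transfer, rule trace_sub)
    apply (transfer, simp add: trace_def)
   apply (transfer, rule trace_mul_sym)
  apply (transfer, simp add: trace_def mat_times_component sum_distrib_left)
  done

lemma tr_sum: "tr (sum f A) = (\<Sum>x\<in>A. tr (f x))"
  by (induction A rule: infinite_finite_induct) (auto simp: tr_add)

section \<open>Polynomials evaluated at linear operators on matrices\<close>

definition sc_linear :: "(('n::finite) sqmat \<Rightarrow> 'n sqmat) \<Rightarrow> bool" where
  "sc_linear T \<longleftrightarrow> (\<forall>u v. T (u + v) = T u + T v) \<and> (\<forall>c v. T (sc c * v) = sc c * T v)"

lemma sc_linear_0: "sc_linear T \<Longrightarrow> T 0 = 0"
  unfolding sc_linear_def by (metis add_cancel_right_right add.right_neutral)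

text \<open>p(T) v by Horner's rule. T is an arbitrary operator on matrices because both left
  multiplication and the bracket with a fixed matrix are needed.\<close>

definition pev :: "complex poly \<Rightarrow> (('n::finite) sqmat \<Rightarrow> 'n sqmat) \<Rightarrow> 'n sqmat \<Rightarrow> 'n sqmat" where
  "pev p T = fold_coeffs (\<lambda>c F v. sc c * v + T (F v)) p (\<lambda>_. 0)"

lemma pev_0 [simp]: "pev 0 T v = 0"
  by (simp add: pev_def)

lemma pev_pCons:
  assumes "sc_linear T"
  shows "pev (pCons c p) T v = sc c * v + T (pev p T v)"
proof (cases "c = 0 \<and> p = 0")
  case True
  then show ?thesis using sc_linear_0[OF assms] by (simp add: pev_def)
next
  case False
  then show ?thesis by (auto simp: pev_def)
qed

lemma pev_lin_rules:
  assumes "sc_linear T"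
  shows "T (u + v) = T u + T v" "T (sc c * v) = sc c * T v" "T 0 = 0" "T (u - v) = T u - T v"
proof -
  show 1: "T (u + v) = T u + T v" for u v using assms by (auto simp: sc_linear_def)
  show 2: "T (sc c * v) = sc c * T v" using assms by (auto simp: sc_linear_def)
  show 3: "T 0 = 0" by (rule sc_linear_0[OF assms])
  have "T (u - v) + T v = T u" by (simp flip: 1)
  then show "T (u - v) = T u - T v" by (simp add: eq_diff_eq)
qed

lemma pev_add:
  assumes "sc_linear T"
  shows "pev (p + q) T v = pev p T v + pev q T v"
proof (induction p q rule: poly_induct2)
  case (pCons a p b q)
  then show ?case by (simp add: pev_pCons[OF assms] pev_lin_rules[OF assms] sc_add algebra_simps)
qed simp

lemma pev_smult:
  assumes "sc_linear T"
  shows "pev (smult c p) T v = sc c * pev p T v"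
  by (induction p) (simp_all add: pev_pCons[OF assms] pev_lin_rules[OF assms] sc_mult distrib_left mult.assoc)

lemma pev_const: "sc_linear T \<Longrightarrow> pev [:c:] T v = sc c * v"
  by (simp add: pev_pCons pev_lin_rules)

lemma pev_1: "sc_linear T \<Longrightarrow> pev 1 T v = v"
  using pev_const[of T 1 v] by (simp add: one_pCons)

lemma sc_linear_pev: 
  assumes "sc_linear T" shows "sc_linear (pev p T)"
  unfolding sc_linear_def
proof (intro conjI allI)
  show "pev p T (u + v) = pev p T u + pev p T v" for u v
    by (induction p) (simp_all add: pev_pCons[OF assms] pev_lin_rules[OF assms] algebra_simps)
  show "pev p T (sc c * v) = sc c * pev p T v" for c v
    by (induction p) (simp_all add: pev_pCons[OF assms] pev_lin_rules[OF assms] distrib_left sc_sc_commute)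
qed

lemma pev_mult:
  assumes "sc_linear T"
  shows "pev (p * q) T v = pev p T (pev q T v)"
  by (induction p) (simp_all add: pev_pCons[OF assms] pev_lin_rules[OF assms] pev_add[OF assms] pev_smult[OF assms])

lemma pev_diff:
  assumes "sc_linear T"
  shows "pev (p - q) T v = pev p T v - pev q T v"
  using pev_add[OF assms, of "p - q" q v] by (simp add: algebra_simps)

lemma pev_sum:
  assumes "sc_linear T"
  shows "pev (sum f A) T v = (\<Sum>x\<in>A. pev (f x) T v)"
  by (induction A rule: infinite_finite_induct) (simp_all add: pev_add[OF assms])

lemma pev_vsum:
  assumes "sc_linear T"
  shows "pev p T (sum f A) = (\<Sum>x\<in>A. pev p T (f x))"
  using pev_lin_rules[OF sc_linear_pev[OF assms]]
  by (induction A rule: infinite_finite_induct) simp_all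

lemma pev_dvd:
  assumes "sc_linear T" "p dvd q" "pev p T v = 0"
  shows "pev q T v = 0"
proof -
  obtain r where "q = r * p" using assms(2) by (metis dvdE mult.commute)
  then show ?thesis using assms by (simp add: pev_mult pev_lin_rules(3) sc_linear_pev)
qed

lemma pev_linear_power:
  assumes "sc_linear T"
  shows "pev ([:- c, 1:] ^ k) T v = ((\<lambda>v. T v - sc c * v) ^^ k) v"
proof (induction k)
  case (Suc k)
  then show ?case using Suc
    by (simp add: pev_mult[OF assms] pev_pCons[OF assms] pev_lin_rules[OF assms] sc_minus del: mult_pCons_left)
qed (simp add: pev_1[OF assms])

text \<open>On a vector annihilated by p(T) the value of q(T) depends only on q modulo p. This turns
  interpolation congruences into eigenvalue equations.\<close>

lemma pev_congruent:
  assumes "sc_linear T" "p dvd q - [:g:]" "pev p T v = 0"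
  shows "pev q T v = sc g * v"
  using pev_dvd[OF assms] by (simp add: pev_diff[OF assms(1)] pev_const[OF assms(1)])

lemma pev_invariant:
  assumes "sc_linear T" "\<And>u. u \<in> Q \<Longrightarrow> T u \<in> Q" "\<And>c u. u \<in> Q \<Longrightarrow> sc c * u \<in> Q"
    "\<And>u v. u \<in> Q \<Longrightarrow> v \<in> Q \<Longrightarrow> u + v \<in> Q" "v \<in> Q"
  shows "pev p T v \<in> Q"
proof (induction p)
  case 0
  have "sc 0 * v \<in> Q" using assms by blast
  then show ?case by simp
next
  case (pCons a p)
  then show ?case using assms by (simp add: pev_pCons)
qed

section \<open>Chinese remaindering with powers of linear polynomials\<close>

lemma coprime_linear_polys:
  fixes a b :: complex
  assumes "a \<noteq> b"
  shows "coprime ([:- a, 1:] ^ N) ([:- b, 1:] ^ M)"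
proof -
  have "coprime [:- a, 1:] [:- b, 1:]"
  proof (rule coprimeI)
    fix c assume "c dvd [:- a, 1:]" "c dvd [:- b, 1:]"
    then have "c dvd [:- a, 1:] - [:- b, 1:]" by (rule dvd_diff)
    then have "c dvd [:b - a:]" by simp
    moreover have "is_unit [:b - a:]" using assms by (simp add: is_unit_const_poly_iff dvd_field_iff)
    ultimately show "is_unit c" by (rule dvd_unit_imp_unit)
  qed
  then show ?thesis by simp
qed

lemma prod_linear_polys_dvd:
  assumes "finite (A :: complex set)" "\<And>a. a \<in> A \<Longrightarrow> [:- a, 1:] ^ N dvd q"
  shows "(\<Prod>a\<in>A. [:- a, 1:] ^ N) dvd q"
  using assms
proof (induction A rule: finite_induct)
  case (insert a A)
  have "coprime ([:- a, 1:] ^ N) (\<Prod>a\<in>A. [:- a, 1:] ^ N)"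
    using insert by (intro prod_coprime_right coprime_linear_polys) auto
  then show ?case using insert by (simp add: divides_mult)
qed simp

text \<open>Chinese remainder theorem for the moduli (X - a)^N. Constant residues to high order make
  q(T) a scalar on generalized eigenvectors, not only on eigenvectors.\<close>

lemma poly_interpolation:
  assumes "finite (A :: complex set)"
  shows "\<exists>q. \<forall>a\<in>A. [:- a, 1:] ^ N dvd q - [:g a:]"
  using assms
proof (induction A rule: finite_induct)
  case (insert a A)
  then obtain q where q: "\<forall>b\<in>A. [:- b, 1:] ^ N dvd q - [:g b:]" by blast
  let ?P = "\<Prod>b\<in>A. [:- b, 1:] ^ N" and ?L = "[:- a, 1:] ^ N"
  have "coprime ?P ?L"
    using insert by (intro prod_coprime_left coprime_linear_polys) auto
  then have "gcd ?P ?L = 1" by simp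
  then obtain u v where uv: "u * ?P + v * ?L = 1"
    by (metis bezout_coefficients_fst_snd)
  \<comment> \<open>The correction is divisible by every earlier modulus, and u P is 1 modulo the
    new one.\<close>
  let ?q = "q + u * ?P * ([:g a:] - q)"
  have "?q - [:g a:] = (1 - u * ?P) * (q - [:g a:])" by (simp add: algebra_simps)
  also have "1 - u * ?P = v * ?L" using uv by (simp add: algebra_simps)
  finally have 1: "?L dvd ?q - [:g a:]" by simp
  have 2: "[:- b, 1:] ^ N dvd ?q - [:g b:]" if b: "b \<in> A" for b
  proof -
    have eq: "?q - [:g b:] = (q - [:g b:]) + u * ?P * ([:g a:] - q)" by (simp add: algebra_simps)
    have "[:- b, 1:] ^ N dvd ?P" using insert b by (intro dvd_prodI) auto
    then show ?thesis unfolding eq using q b by (intro dvd_add) auto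
  qed
  from 1 2 show ?case by blast
qed auto

lemma sc_linear_times: "sc_linear (\<lambda>v. x * v)"
  by (simp add: sc_linear_def distrib_left sc_left_commute)

lemma sc_linear_bracket: "sc_linear (\<lambda>v. x * v - v * x)"
  by (simp add: sc_linear_def algebra_simps sc_left_commute)

lemma pev_times: "pev p (\<lambda>v. x * v) v = pev p (\<lambda>v. x * v) 1 * v"
  by (induction p) (simp_all add: pev_pCons[OF sc_linear_times] algebra_simps)

abbreviation ev :: "complex poly \<Rightarrow> ('n::finite) sqmat \<Rightarrow> 'n sqmat" where
  "ev p x \<equiv> pev p (\<lambda>v. x * v) 1"

lemma ev_mult: "ev (p * q) x = ev p x * ev q x"
  by (simp add: pev_mult[OF sc_linear_times] flip: pev_times)

lemma ev_linear_power: "ev ([:- c, 1:] ^ k) x = (x - sc c) ^ k"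
proof (induction k)
  case 0
  then show ?case by (simp add: pev_1[OF sc_linear_times])
next
  case (Suc k)
  have "ev [:- c, 1:] x = x - sc c"
    by (simp add: pev_pCons[OF sc_linear_times] sc_minus)
  then show ?case using Suc by (simp add: ev_mult del: mult_pCons_left)
qed

text \<open>Left multiplication by u and right multiplication by w commute, so every term in the
  expansion of the 2N-th power has N factors on one side. The exponents i and j record the factors
  already spent.\<close>

lemma bracket_power_vanishes:
  assumes "u ^ N * b = 0" "b * w ^ N = (0 :: 'a::ring_1)"
  shows "2 * N \<le> i + j + m \<Longrightarrow> ((\<lambda>v. u * v - v * w) ^^ m) (u ^ i * b * w ^ j) = 0"
proof (induction m arbitrary: i j)
  case 0
  then consider "N \<le> i" | "N \<le> j" by linarith
  then show ?case
  proof cases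
    case 1
    then have "u ^ i * b * w ^ j = u ^ (i - N) * (u ^ N * b) * w ^ j"
      by (simp flip: power_add mult.assoc)
    then show ?thesis by (simp add: assms)
  next
    case 2
    then have "u ^ i * b * w ^ j = u ^ i * ((b * w ^ N) * w ^ (j - N))"
      by (simp add: mult.assoc flip: power_add)
    then show ?thesis by (simp add: assms)
  qed
next
  case (Suc m)
  let ?T = "\<lambda>v. u * v - v * w"
  have lin: "(?T ^^ m) (x - y) = (?T ^^ m) x - (?T ^^ m) y" for m x y
    by (induction m) (simp_all add: left_diff_distrib right_diff_distrib)
  have "?T (u ^ i * b * w ^ j) = u ^ Suc i * b * w ^ j - u ^ i * b * w ^ Suc j"
    by (simp add: mult.assoc flip: power_Suc2)
  then have "(?T ^^ Suc m) (u ^ i * b * w ^ j)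
      = (?T ^^ m) (u ^ Suc i * b * w ^ j) - (?T ^^ m) (u ^ i * b * w ^ Suc j)"
    by (simp only: funpow_Suc_right o_apply lin)
  also have "\<dots> = 0" using Suc.IH[of "Suc i" j] Suc.IH[of i "Suc j"] Suc.prems by simp
  finally show ?case .
qed

section \<open>Polynomial functions, determinants and traces\<close>

lemma polyfun_sum: "(\<And>x. x \<in> A \<Longrightarrow> polyfun (f x)) \<Longrightarrow> polyfun (\<lambda>g. \<Sum>x\<in>A. f x g)"
  by (induction A rule: infinite_finite_induct) (auto intro: polyfun.intros)

lemma polyfun_prod: "(\<And>x. x \<in> A \<Longrightarrow> polyfun (f x)) \<Longrightarrow> polyfun (\<lambda>g. \<Prod>x\<in>A. f x g)"
  by (induction A rule: infinite_finite_induct) (auto intro: polyfun.intros)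

lemma polyfun_det: "polyfun (det :: ('n::finite) cmat \<Rightarrow> complex)"
  unfolding det_def by (intro polyfun_sum polyfun_prod polyfun.intros)

lemma polyfun_poly_curve:
  assumes "polyfun f" "\<And>i j. \<exists>p. \<forall>t. c t $ i $ j = poly p t"
  shows "\<exists>p. \<forall>t. f (c t) = poly p t"
  using assms(1)
proof induction
  case (1 a)
  then show ?case by (intro exI[of _ "[:a:]"]) simp
next
  case (2 i j)
  then show ?case by (rule assms(2))
next
  case (3 f h)
  then obtain p q where "\<forall>t. f (c t) = poly p t" "\<forall>t. h (c t) = poly q t" by blast
  then show ?case by (intro exI[of _ "p + q"]) simp
next
  case (4 f h)
  then obtain p q where "\<forall>t. f (c t) = poly p t" "\<forall>t. h (c t) = poly q t" by blast
  then show ?case by (intro exI[of _ "p * q"]) simp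
qed

lemma poly_no_root_const:
  assumes "\<And>t::complex. poly p t \<noteq> 0"
  shows "\<exists>c. p = [:c:]"
  using fundamental_theorem_of_algebra[of p] assms by (metis constant_degree degree_eq_zeroE)

text \<open>These are the units of the Laurent polynomial ring: once the power of X is split off, no
  root remains and the cofactor is constant.\<close>

lemma poly_no_nonzero_root:
  assumes "\<And>t::complex. t \<noteq> 0 \<Longrightarrow> poly p t \<noteq> 0"
  obtains c k where "c \<noteq> 0" "p = monom c k"
proof -
  have "p \<noteq> 0" using assms[of 1] by auto
  then obtain r where r: "p = [:- 0, 1:] ^ Polynomial.order 0 p * r" "\<not> [:- 0, 1:] dvd r"
    using order_decomp by blast
  have "poly r t \<noteq> 0" for t
  proof (cases "t = 0")
    case True
    then show ?thesis using r(2) by (simp add: poly_eq_0_iff_dvd)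
  next
    case False
    then have "poly ([:- 0, 1:] ^ Polynomial.order 0 p * r) t \<noteq> 0" using assms r(1) by metis
    then show ?thesis by auto
  qed
  then obtain c where c: "r = [:c:]" using poly_no_root_const by blast
  have "c \<noteq> 0" using c r(2) by auto
  moreover have "p = monom c (Polynomial.order 0 p)"
    using r(1) unfolding c by (simp add: monom_altdef)
  ultimately show ?thesis using that by blast
qed

text \<open>Any permutation other than the identity moves at least two indices, so an off-diagonal
  factor that vanishes at 0 survives differentiation. Only the diagonal product contributes.\<close>

lemma det_has_field_derivative_trace:
  fixes X :: "('n::finite) cmat"
  shows "((\<lambda>t. det (mat 1 + mat t ** X)) has_field_derivative trace X) (at 0)"
proof -
  let ?m = "\<lambda>t i j. (if i = j then 1 else 0) + t * X $ i $ j"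
  let ?P = "{p. p permutes (UNIV :: 'n set)}"
  let ?D = "\<lambda>p. \<Sum>i\<in>UNIV. X $ i $ p i * (\<Prod>k\<in>UNIV - {i}. if k = p k then 1 else 0)"
  have eq: "det (mat 1 + mat t ** X) = (\<Sum>p\<in>?P. of_int (sign p) * (\<Prod>i\<in>UNIV. ?m t i (p i)))" for t
    by (simp add: det_def mat_times_component) (simp add: mat_def)
  have "((\<lambda>t. \<Sum>p\<in>?P. of_int (sign p) * (\<Prod>i\<in>UNIV. ?m t i (p i)))
     has_field_derivative (\<Sum>p\<in>?P. of_int (sign p) * ?D p)) (at 0)"
  proof (intro DERIV_sum DERIV_cmult)
    fix p
    have "((\<lambda>t. \<Prod>i\<in>UNIV. ?m t i (p i)) has_field_derivative
      (\<Sum>i\<in>UNIV. X $ i $ p i * (\<Prod>k\<in>UNIV - {i}. ?m 0 k (p k)))) (at 0)"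
      by (rule has_field_derivative_prod) (auto intro!: derivative_eq_intros)
    then show "((\<lambda>t. \<Prod>i\<in>UNIV. ?m t i (p i)) has_field_derivative ?D p) (at 0)"
      by simp
  qed
  moreover have "(\<Sum>p\<in>?P. of_int (sign p) * ?D p) = trace X"
  proof -
    have "?D p = 0" if p: "p \<in> ?P" "p \<noteq> id" for p
    proof (rule sum.neutral, rule ballI)
      fix i
      obtain j where j: "p j \<noteq> j" using p(2) by (metis eq_id_iff)
      have inj: "inj p" using p(1) permutes_inj by blast
      have "\<exists>k. k \<noteq> i \<and> p k \<noteq> k"
      proof (cases "j = i")
        case True
        then show ?thesis using j inj by (metis inj_eq)
      qed (use j in blast)
      then have "(\<Prod>k\<in>UNIV - {i}. if k = p k then 1 else 0 :: complex) = 0"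
        by (intro prod_zero) (simp, force)
      then show "X $ i $ p i * (\<Prod>k\<in>UNIV - {i}. if k = p k then 1 else 0) = 0" by simp
    qed
    then have "(\<Sum>p\<in>?P. of_int (sign p) * ?D p) = (\<Sum>p\<in>{id}. of_int (sign p) * ?D p)"
      by (intro sum.mono_neutral_right) (auto simp: finite_permutations permutes_id)
    also have "\<dots> = trace X" by (simp add: trace_def sign_id)
    finally show ?thesis .
  qed
  ultimately show ?thesis by (simp add: eq)
qed

lift_definition dt :: "('n::finite) sqmat \<Rightarrow> complex" is det .

lemma dt_1 [simp]: "dt 1 = 1" and dt_mult: "dt (a * b) = dt a * dt b"
  by (transfer, simp add: det_I det_mul)+

lemma dt_poly: "\<exists>p. \<forall>t. dt (a + sc t * b) = poly p t"
proof transfer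
  fix a b :: "'a cmat"
  show "\<exists>p. \<forall>t. det (a + mat t ** b) = poly p t"
  proof (rule polyfun_poly_curve[OF polyfun_det])
    show "\<exists>p. \<forall>t. (a + mat t ** b) $ i $ j = poly p t" for i j
      by (intro exI[of _ "[:a $ i $ j, b $ i $ j:]"]) (simp add: mat_times_component)
  qed
qed

lemma dt_has_field_derivative: "((\<lambda>t. dt (1 + sc t * a)) has_field_derivative tr a) (at 0)"
  by transfer (rule det_has_field_derivative_trace)

lemma dt_invertible: "dt a \<noteq> 0 \<Longrightarrow> \<exists>b. b * a = 1"
  by transfer (use invertible_det_nz in \<open>auto simp: invertible_def\<close>)

lemma geometric_inverse: "(1 - y) * (\<Sum>i<k. y ^ i) = 1 - (y :: 'a::ring_1) ^ k"
  by (induction k) (simp_all add: left_diff_distrib distrib_left)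

text \<open>By the geometric series 1 + t a is invertible for all t, so its determinant is a
  polynomial in t without roots, hence constant; the trace is its derivative at 0.\<close>

lemma dt_one_plus_nilpotent:
  assumes "a ^ k = 0"
  shows "dt (1 + sc t * a) = 1" "tr a = 0"
proof -
  have pw: "(sc t * a) ^ k = sc (t ^ k) * a ^ k" for t k
    by (induction k) (simp_all add: sc_mult mult.assoc sc_left_commute[of a])
  obtain p where p: "\<And>t. dt (1 + sc t * a) = poly p t" using dt_poly by blast
  have "poly p t \<noteq> 0" for t
  proof -
    have "(1 + sc t * a) * (\<Sum>i<k. (sc (- t) * a) ^ i) = 1 - (sc (- t) * a) ^ k"
      using geometric_inverse[of "sc (- t) * a" k] by (simp add: sc_minus)
    then have "dt (1 + sc t * a) * dt (\<Sum>i<k. (sc (- t) * a) ^ i) = 1"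
      by (simp flip: dt_mult add: pw assms)
    then show ?thesis by (auto simp: p)
  qed
  then obtain c where c: "p = [:c:]" using poly_no_root_const by blast
  have "c = 1" using p[of 0] c by simp
  then show eq: "dt (1 + sc t * a) = 1" for t by (simp add: p c)
  have "((\<lambda>t. dt (1 + sc t * a)) has_field_derivative 0) (at 0)" unfolding eq by simp
  then show "tr a = 0" using dt_has_field_derivative DERIV_unique by blast
qed

text \<open>The matrices (1 - e) + z e are invertible for nonzero z, so their determinant is a
  monomial with value 1 at 1, that is z^k. Differentiation at z = 1 gives the trace k, and k = 0
  makes 1 - e invertible. The exponent k plays the role of the rank of e.\<close>

lemma tr_idempotent:
  assumes "e * e = e"
  obtains m :: nat where "tr e = of_nat m" "m = 0 \<Longrightarrow> e = 0"
proof -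
  obtain p where p: "\<And>z. dt ((1 - e) + sc z * e) = poly p z" using dt_poly by blast
  have nz: "poly p z \<noteq> 0" if "z \<noteq> 0" for z
  proof -
    have "((1 - e) + sc z * e) * ((1 - e) + sc (1 / z) * e)
      = (1 - e) * (1 - e) + (1 - e) * (sc (1 / z) * e) + sc z * e * (1 - e) + sc z * e * (sc (1 / z) * e)"
      by (simp only: distrib_left distrib_right ac_simps)
    also have "(1 - e) * (sc (1 / z) * e) = sc (1 / z) * ((1 - e) * e)" by (rule sc_left_commute)
    also have "sc z * e * (sc (1 / z) * e) = sc (z * (1 / z)) * (e * e)"
      by (simp only: sc_mult mult.assoc sc_left_commute[of e])
    also have "(1 - e) * e = 0" by (simp add: left_diff_distrib assms)
    also have "sc z * e * (1 - e) = 0" by (simp add: right_diff_distrib mult.assoc assms)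
    also have "(1 - e) * (1 - e) = 1 - e" by (simp add: left_diff_distrib right_diff_distrib assms)
    finally have "((1 - e) + sc z * e) * ((1 - e) + sc (1 / z) * e) = 1" using that by (simp add: assms)
    then have "dt ((1 - e) + sc z * e) * dt ((1 - e) + sc (1 / z) * e) = 1"
      by (simp flip: dt_mult)
    then show ?thesis by (auto simp: p)
  qed
  obtain c k where ck: "p = monom c k" using poly_no_nonzero_root nz by metis
  have "c = 1" using p[of 1] by (simp add: ck poly_monom)
  then have pz: "dt ((1 - e) + sc z * e) = z ^ k" for z by (simp add: p ck poly_monom)
  have "dt (1 + sc t * e) = (1 + t) ^ k" for t
    using pz[of "1 + t"] by (simp add: sc_add algebra_simps)
  then have "((\<lambda>t. (1 + t) ^ k) has_field_derivative tr e) (at 0)"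
    using dt_has_field_derivative[of e] by simp
  moreover have "((\<lambda>t. (1 + t) ^ k) has_field_derivative of_nat k) (at (0::complex))"
    by (auto intro!: derivative_eq_intros)
  ultimately have "tr e = of_nat k" by (rule DERIV_unique)
  moreover have "e = 0" if "k = 0"
  proof -
    have "dt (1 - e) \<noteq> 0" using pz[of 0] that by simp
    then obtain b where "b * (1 - e) = 1" using dt_invertible by blast
    then have "e = b * ((1 - e) * e)" by (simp flip: mult.assoc)
    also have "(1 - e) * e = 0" using assms by (simp add: algebra_simps)
    finally show ?thesis by simp
  qed
  ultimately show ?thesis using that by blast
qed

section \<open>Spectral projections and Cartan's criterion\<close>

lemma ev_monom: "ev (monom c k) x = sc c * x ^ k"
proof -
  have "ev [:0, 1:] x = x" by (simp add: pev_pCons[OF sc_linear_times])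
  then have "ev ([:0, 1:] ^ k) x = x ^ k"
    by (induction k) (simp_all add: ev_mult pev_1[OF sc_linear_times] del: mult_pCons_left)
  then show ?thesis by (simp add: monom_altdef pev_smult[OF sc_linear_times])
qed

lemma ev_eq_sum: "ev p x = (\<Sum>i\<le>degree p. sc (coeff p i) * x ^ i)"
  by (subst poly_as_sum_of_monoms[of p, symmetric])
     (simp only: pev_sum[OF sc_linear_times] ev_monom)

text \<open>A repeated value gives a two-term relation. It is separated because linear dependence is
  a property of the set of values, not of the sequence.\<close>

lemma linear_relation_of_sequence:
  fixes f :: "nat \<Rightarrow> 'a::euclidean_space"
  obtains n c where "\<exists>i\<le>n. c i \<noteq> (0::real)" "(\<Sum>i\<le>n. c i *\<^sub>R f i) = 0"
proof (cases "inj_on f {..DIM('a)}")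
  case False
  then obtain i j where ij: "i \<le> DIM('a)" "j \<le> DIM('a)" "i \<noteq> j" "f i = f j"
    by (auto simp: inj_on_def)
  define c :: "nat \<Rightarrow> real" where "c k = (if k = i then 1 else 0) - (if k = j then 1 else 0)" for k
  have "(\<Sum>k\<le>DIM('a). c k *\<^sub>R f k) =
     (\<Sum>k\<le>DIM('a). (if k = i then f k else 0)) - (\<Sum>k\<le>DIM('a). (if k = j then f k else 0))"
    unfolding sum_subtractf[symmetric] by (intro sum.cong) (auto simp: c_def)
  also have "\<dots> = 0" using ij by simp
  finally have "(\<Sum>k\<le>DIM('a). c k *\<^sub>R f k) = 0" .
  moreover have "c i \<noteq> 0" using ij by (simp add: c_def)
  ultimately show ?thesis using that[of "DIM('a)" c] ij(1) by auto
next
  case True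
  then have "card (f ` {..DIM('a)}) = Suc (DIM('a))" by (simp add: card_image)
  then have "dependent (f ` {..DIM('a)})" by (intro dependent_biggerset_general) (auto, metis DIM_ge_Suc0 dim_subset_UNIV le_imp_less_Suc)
  then obtain u where u: "\<exists>v\<in>f ` {..DIM('a)}. u v \<noteq> 0" "(\<Sum>v\<in>f ` {..DIM('a)}. u v *\<^sub>R v) = 0"
    by (auto simp: dependent_finite)
  then have "(\<Sum>i\<le>DIM('a). u (f i) *\<^sub>R f i) = 0"
    by (simp add: sum.reindex[OF True])
  with u(1) show ?thesis using that[of "DIM('a)" "\<lambda>i. u (f i)"] by auto
qed

text \<open>Matrices form a real Euclidean space, so the powers of a satisfy a relation with real
  coefficients, which is already an annihilating polynomial.\<close>

lemma annihilating_poly: "\<exists>p. p \<noteq> 0 \<and> ev p (a :: ('n::finite) sqmat) = 0"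
proof -
  obtain n c where c: "\<exists>i\<le>n. c i \<noteq> (0::real)" "(\<Sum>i\<le>n. c i *\<^sub>R Rep_sqmat (a ^ i)) = 0"
    by (rule linear_relation_of_sequence)
  define p where "p = (\<Sum>i\<le>n. monom (complex_of_real (c i)) i)"
  have coeff: "coeff p i = c i" if "i \<le> n" for i
    using that by (simp add: p_def coeff_sum)
  have "p \<noteq> 0" using c(1) coeff by force
  have Rep_sum: "Rep_sqmat (sum g A) = (\<Sum>x\<in>A. Rep_sqmat (g x))" for g :: "nat \<Rightarrow> 'n sqmat" and A
    by (induction A rule: infinite_finite_induct) (simp_all add: zero_sqmat.rep_eq plus_sqmat.rep_eq)
  have Rep_sc: "Rep_sqmat (sc (complex_of_real r) * b) = r *\<^sub>R Rep_sqmat b" for r b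
    by (simp add: times_sqmat.rep_eq sc.rep_eq vec_eq_iff mat_times_component) (simp add: scaleR_conv_of_real)
  have "ev p a = (\<Sum>i\<le>n. sc (complex_of_real (c i)) * a ^ i)"
    by (simp only: p_def pev_sum[OF sc_linear_times] ev_monom)
  then have "Rep_sqmat (ev p a) = 0" using c(2) by (simp add: Rep_sum Rep_sc)
  then have "ev p a = 0" by (metis Rep_sqmat_inverse zero_sqmat.rep_eq)
  with \<open>p \<noteq> 0\<close> show ?thesis by blast
qed

text \<open>The \<open>d z\<close> are congruent to 1 at z and to 0 at the other points, modulo N-th
  powers, so they evaluate to the projections onto generalized eigenspaces. Their vanishing at 0
  makes the projections for nonzero z combinations of positive powers of a.\<close>

lemma spectral_decomposition:
  fixes a :: "('n::finite) sqmat"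
  obtains A :: "complex set" and N :: nat and d :: "complex \<Rightarrow> complex poly"
  where "finite A" "0 \<in> A" "N > 0"
    "(\<Sum>z\<in>A. ev (d z) a) = 1"
    "\<And>z. z \<in> A \<Longrightarrow> ev (d z) a * ev (d z) a = ev (d z) a"
    "\<And>z. z \<in> A \<Longrightarrow> (a - sc z) ^ N * ev (d z) a = 0"
    "\<And>z w. z \<in> A \<Longrightarrow> w \<in> A \<Longrightarrow> z \<noteq> w \<Longrightarrow> ev (d z) a * ev (d w) a = 0"
    "\<And>z. z \<in> A \<Longrightarrow> z \<noteq> 0 \<Longrightarrow> poly (d z) 0 = 0"
proof -
  obtain p where p: "p \<noteq> 0" "ev p a = 0" using annihilating_poly by blast
  \<comment> \<open>0 is included even if it is not an eigenvalue; its projection is then 0, and the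
    other \<open>d z\<close> have no constant term.\<close>
  define A where "A = insert 0 {z. poly p z = 0}"
  \<comment> \<open>Larger than the multiplicity of every root of p, and positive also when p is
    constant.\<close>
  define N where "N = Suc (degree p)"
  define L where "L z = [:- z, 1:] ^ N" for z :: complex
  have fin: "finite A" using p by (simp add: A_def poly_roots_finite)
  have N: "N > 0" by (simp add: N_def)
  have "p dvd (\<Prod>z\<in>A. L z)"
  proof -
    have "p = smult (lead_coeff p) (\<Prod>z | poly p z = 0. [:- z, 1:] ^ Polynomial.order z p)"
      by (simp add: complex_poly_decompose)
    also have "\<dots> dvd (\<Prod>z | poly p z = 0. [:- z, 1:] ^ Polynomial.order z p)"
      using p(1) by (subst smult_dvd_iff) auto
    also have "\<dots> dvd (\<Prod>z | poly p z = 0. L z)"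
      unfolding L_def N_def
      by (intro prod_dvd_prod le_imp_power_dvd) (metis order_degree p(1) le_SucI)
    also have "\<dots> dvd (\<Prod>z\<in>A. L z)"
      using fin by (intro prod_dvd_prod_subset) (auto simp: A_def)
    finally show ?thesis .
  qed
  then have P: "ev (\<Prod>z\<in>A. L z) a = 0" using pev_dvd[OF sc_linear_times _ p(2)] by blast
  have vanish: "ev q a = 0" if "\<And>z. z \<in> A \<Longrightarrow> L z dvd q" for q
    using pev_dvd[OF sc_linear_times _ P] prod_linear_polys_dvd[OF fin, of N q] that
    by (auto simp: L_def)
  have "\<forall>z. \<exists>q. \<forall>w\<in>A. L w dvd q - [:if w = z then 1 else 0:]"
    unfolding L_def by (intro allI poly_interpolation[OF fin])
  then obtain d where d: "\<And>z w. w \<in> A \<Longrightarrow> L w dvd d z - [:if w = z then 1 else 0:]"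
    by metis
  have d1: "L z dvd d z - 1" if "z \<in> A" for z using d[of z z] that by (simp add: one_pCons)
  have d0: "L w dvd d z" if "w \<in> A" "w \<noteq> z" for w z using d[of w z] that by simp
  have one: "ev 1 a = 1" by (simp add: pev_1[OF sc_linear_times])
  show ?thesis
  proof (rule that[OF fin _ N])
    show "0 \<in> A" by (simp add: A_def)
    have "ev ((\<Sum>z\<in>A. d z) - 1) a = 0"
    proof (rule vanish)
      fix w assume w: "w \<in> A"
      have "(\<Sum>z\<in>A. d z) - 1 = (d w - 1) + (\<Sum>z\<in>A - {w}. d z)"
        using fin w by (simp add: sum.remove)
      then show "L w dvd (\<Sum>z\<in>A. d z) - 1"
        by (metis (no_types, lifting) DiffE d0[OF w] d1[OF w] dvd_add dvd_sum insertI1)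
    qed
    then show "(\<Sum>z\<in>A. ev (d z) a) = 1"
      by (simp add: pev_diff[OF sc_linear_times] pev_sum[OF sc_linear_times] one)
    show "ev (d z) a * ev (d z) a = ev (d z) a" if z: "z \<in> A" for z
    proof -
      have "ev (d z * (d z - 1)) a = 0"
      proof (rule vanish)
        fix w assume "w \<in> A"
        then show "L w dvd d z * (d z - 1)"
          using d1[of z] d0[of w z] z by (cases "w = z") (auto intro: dvd_mult dvd_mult2)
      qed
      then show ?thesis
        by (simp add: ev_mult pev_diff[OF sc_linear_times] one right_diff_distrib)
    qed
    show "(a - sc z) ^ N * ev (d z) a = 0" if z: "z \<in> A" for z
    proof -
      have "ev (L z * d z) a = 0"
      proof (rule vanish)
        fix w assume "w \<in> A"
        then show "L w dvd L z * d z"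
          using d0[of w z] by (cases "w = z") auto
      qed
      then show ?thesis by (simp only: ev_mult L_def ev_linear_power)
    qed
    show "ev (d z) a * ev (d w) a = 0" if "z \<in> A" "w \<in> A" "z \<noteq> w" for z w
    proof -
      have "ev (d z * d w) a = 0"
      proof (rule vanish)
        fix v assume "v \<in> A"
        then show "L v dvd d z * d w"
          using d0[of v z] d0[of v w] that by (cases "v = z") auto
      qed
      then show ?thesis by (simp only: ev_mult)
    qed
    show "poly (d z) 0 = 0" if "z \<in> A" "z \<noteq> 0" for z
    proof -
      have "L 0 dvd d z" using d0 that by (auto simp: A_def)
      then have "poly (L 0) 0 = 0 \<longrightarrow> poly (d z) 0 = 0" by (auto elim!: dvdE)
      then show ?thesis using N by (simp add: L_def)
    qed
  qed
qed

text \<open>For nonzero z the projection is a combination of positive powers of a, so its trace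
  vanishes, and an idempotent of trace 0 is 0. Only the generalized eigenspace of 0 remains.\<close>

lemma nilpotent_if_tr_powers:
  fixes a :: "('n::finite) sqmat"
  assumes "\<And>k. k > 0 \<Longrightarrow> tr (a ^ k) = 0"
  shows "\<exists>N. a ^ N = 0"
proof -
  obtain A N d where s: "finite A" "0 \<in> A" "N > 0"
    "(\<Sum>z\<in>A. ev (d z) a) = 1"
    "\<And>z. z \<in> A \<Longrightarrow> ev (d z) a * ev (d z) a = ev (d z) a"
    "\<And>z. z \<in> A \<Longrightarrow> (a - sc z) ^ N * ev (d z) a = 0"
    "\<And>z. z \<in> A \<Longrightarrow> z \<noteq> 0 \<Longrightarrow> poly (d z) 0 = 0"
    by (rule spectral_decomposition[of a]) blast
  have "ev (d z) a = 0" if z: "z \<in> A" "z \<noteq> 0" for z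
  proof -
    have "tr (ev (d z) a) = (\<Sum>i\<le>degree (d z). coeff (d z) i * tr (a ^ i))"
      by (simp add: ev_eq_sum tr_sum tr_sc)
    also have "\<dots> = 0"
    proof (rule sum.neutral, rule ballI)
      fix i
      show "coeff (d z) i * tr (a ^ i) = 0"
        using assms[of i] s(7)[OF z] by (cases "i = 0") (simp_all add: poly_0_coeff_0)
    qed
    finally show ?thesis using tr_idempotent[OF s(5)[OF z(1)]] by (metis of_nat_eq_0_iff)
  qed
  then have "(\<Sum>z\<in>A. ev (d z) a) = ev (d 0) a"
    using s(1,2) by (subst sum.remove[of _ 0]) auto
  then have "a ^ N = 0" using s(4) s(6)[OF s(2)] by simp
  then show ?thesis by blast
qed

text \<open>If \<open>x\<close> has eigenvalues \<open>z\<close> with spectral projections \<open>e\<^sub>z\<close>, then \<open>y = \<Sum> cnj z e\<^sub>z\<close> normalizes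
  \<open>Q\<close>, because \<open>ad y\<close> is a polynomial in \<open>ad x\<close>, and the trace of \<open>x y\<close> is the sum of the squares of
  the absolute values of the eigenvalues.\<close>

lemma cartan_nilpotent:
  fixes x :: "('n::finite) sqmat"
  assumes Q: "\<And>c u. u \<in> Q \<Longrightarrow> sc c * u \<in> Q" "\<And>u v. u \<in> Q \<Longrightarrow> v \<in> Q \<Longrightarrow> u + v \<in> Q"
      "\<And>u. u \<in> Q \<Longrightarrow> x * u - u * x \<in> Q"
    and tr: "\<And>y. (\<And>u. u \<in> Q \<Longrightarrow> y * u - u * y \<in> Q) \<Longrightarrow> tr (x * y) = 0"
  shows "\<exists>N. x ^ N = 0"
proof -
  obtain A N d where s: "finite A" "0 \<in> A" "N > 0"
    "(\<Sum>z\<in>A. ev (d z) x) = 1"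
    "\<And>z. z \<in> A \<Longrightarrow> ev (d z) x * ev (d z) x = ev (d z) x"
    "\<And>z. z \<in> A \<Longrightarrow> (x - sc z) ^ N * ev (d z) x = 0"
    by (rule spectral_decomposition[of x]) blast
  define e where "e z = ev (d z) x" for z
  have e: "(\<Sum>z\<in>A. e z) = 1" "\<And>z. z \<in> A \<Longrightarrow> e z * e z = e z"
    "\<And>z. z \<in> A \<Longrightarrow> (x - sc z) ^ N * e z = 0"
    using s unfolding e_def by auto
  have xe: "x * e z = e z * x" for z
  proof -
    have "ev [:0, 1:] x = x" by (simp add: pev_pCons[OF sc_linear_times])
    then have "x * e z = ev ([:0, 1:] * d z) x" by (simp only: ev_mult e_def)
    also have "\<dots> = ev (d z * [:0, 1:]) x" by (simp only: mult.commute)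
    also have "\<dots> = e z * x" using \<open>ev [:0, 1:] x = x\<close> by (simp only: ev_mult e_def)
    finally show ?thesis .
  qed
  have ue: "(x - sc c) * e z = e z * (x - sc c)" for c z
    by (simp add: left_diff_distrib right_diff_distrib xe sc_commute)
  have pw: "(x - sc c) ^ k * e z = e z * (x - sc c) ^ k" for c z k
    by (induction k) (simp_all add: mult.assoc ue flip: mult.assoc[of _ "e z"])
  define y where "y = (\<Sum>z\<in>A. sc (cnj z) * e z)"
  define T where "T v = x * v - v * x" for v
  have T: "sc_linear T" unfolding T_def by (rule sc_linear_bracket)
  \<comment> \<open>Between the eigenvalues z and w the bracket with x has the single generalized
    eigenvalue z - w, with nilpotency order at most 2 N. Hence q has to conjugate the differences to
    that order.\<close>
  obtain q where q: "\<And>c. c \<in> (\<lambda>(z, w). z - w) ` (A \<times> A) \<Longrightarrow> [:- c, 1:] ^ (2 * N) dvd q - [:cnj c:]"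
    using poly_interpolation[OF finite_imageI[OF finite_cartesian_product[OF s(1) s(1)]]] by blast
  have block: "pev q T (e z * a * e w) = sc (cnj (z - w)) * (e z * a * e w)" if zw: "z \<in> A" "w \<in> A" for z w a
  proof (rule pev_congruent[OF T, of "[:- (z - w), 1:] ^ (2 * N)"])
    have "z - w \<in> (\<lambda>(z, w). z - w) ` (A \<times> A)" using zw by force
    then show "[:- (z - w), 1:] ^ (2 * N) dvd q - [:cnj (z - w):]" by (rule q)
    have "(\<lambda>v. T v - sc (z - w) * v) = (\<lambda>v. (x - sc z) * v - v * (x - sc w))"
      by (simp add: fun_eq_iff T_def sc_diff left_diff_distrib right_diff_distrib sc_commute)
    moreover have "(x - sc z) ^ N * (e z * a * e w) = 0"
      using e(3)[OF zw(1)] by (simp flip: mult.assoc)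
    moreover have "(e z * a * e w) * (x - sc w) ^ N = 0"
      using e(3)[OF zw(2)] by (simp add: mult.assoc flip: pw)
    ultimately show "pev ([:- (z - w), 1:] ^ (2 * N)) T (e z * a * e w) = 0"
      using bracket_power_vanishes[of "x - sc z" N "e z * a * e w" "x - sc w" 0 0 "2 * N"]
      by (simp only: pev_linear_power[OF T] power_0 mult_1_left mult_1_right add_0 order_refl)
  qed
  have "pev q T a = y * a - a * y" for a
  proof -
    have "a = (\<Sum>z\<in>A. e z) * a * (\<Sum>w\<in>A. e w)" by (simp add: e(1))
    also have "\<dots> = (\<Sum>z\<in>A. \<Sum>w\<in>A. e z * a * e w)"
      by (simp only: sum_distrib_right[of _ A a] sum_product)
    finally have "pev q T a = (\<Sum>z\<in>A. \<Sum>w\<in>A. pev q T (e z * a * e w))"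
      by (metis (no_types, lifting) pev_vsum[OF T] sum.cong)
    also have "\<dots> = (\<Sum>z\<in>A. \<Sum>w\<in>A. sc (cnj z) * (e z * a * e w) - sc (cnj w) * (e z * a * e w))"
      by (intro sum.cong refl) (simp add: block sc_diff left_diff_distrib)
    also have "\<dots> = (\<Sum>z\<in>A. sc (cnj z) * e z) * a * (\<Sum>w\<in>A. e w)
        - (\<Sum>z\<in>A. e z) * a * (\<Sum>w\<in>A. sc (cnj w) * e w)"
      by (simp only: sum_distrib_right[of _ A a] sum_product sum_subtractf mult.assoc
          sc_left_commute[of "e _"] sc_left_commute[of a])
    also have "\<dots> = y * a - a * y" by (simp add: e(1) y_def)
    finally show ?thesis .
  qed
  then have yQ: "y * u - u * y \<in> Q" if "u \<in> Q" for u
    using pev_invariant[OF T, of Q u q] Q that by (metis T_def)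
  have "tr (x * y) = (\<Sum>z\<in>A. of_real ((cmod z)\<^sup>2) * tr (e z))"
  proof -
    have "tr (x * y) = (\<Sum>z\<in>A. cnj z * tr (x * e z))"
      by (simp add: y_def sum_distrib_left tr_sum sc_left_commute[of x] tr_sc)
    also have "\<dots> = (\<Sum>z\<in>A. of_real ((cmod z)\<^sup>2) * tr (e z))"
    proof (rule sum.cong[OF refl])
      fix z assume z: "z \<in> A"
      \<comment> \<open>The matrix (x - z) e_z is nilpotent, hence of trace 0, which gives tr (x
        e_z) = z tr e_z.\<close>
      have "((x - sc z) * e z) ^ k = (x - sc z) ^ k * e z" if "k > 0" for k
        using that
      proof (induction k rule: nat_induct_non_zero)
        case (Suc k)
        have "((x - sc z) * e z) ^ Suc k = (x - sc z) * (e z * (x - sc z) ^ k) * e z"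
          by (simp add: Suc mult.assoc)
        also have "\<dots> = (x - sc z) ^ Suc k * (e z * e z)" by (simp add: mult.assoc flip: pw)
        finally show ?case using e(2)[OF z] by simp
      qed simp
      then have "((x - sc z) * e z) ^ N = 0" using s(3) e(3)[OF z] by simp
      then have "tr ((x - sc z) * e z) = 0" by (rule dt_one_plus_nilpotent)
      then have "tr (x * e z) = z * tr (e z)" by (simp add: left_diff_distrib tr_diff tr_sc)
      then show "cnj z * tr (x * e z) = of_real ((cmod z)\<^sup>2) * tr (e z)"
        by (simp add: complex_norm_square mult.commute mult.left_commute del: of_real_power)
    qed
    finally show ?thesis .
  qed
  moreover obtain m :: "complex \<Rightarrow> nat" where m: "\<And>z. z \<in> A \<Longrightarrow> tr (e z) = of_nat (m z) \<and> (m z = 0 \<longrightarrow> e z = 0)"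
  proof -
    have "\<exists>m::nat. tr (e z) = of_nat m \<and> (m = 0 \<longrightarrow> e z = 0)" if "z \<in> A" for z
      by (rule tr_idempotent[OF e(2)[OF that]]) blast
    then show ?thesis using that by metis
  qed
  \<comment> \<open>The traces of the projections are natural numbers, so this is a sum of
    nonnegative reals, and every nonzero z has projection 0.\<close>
  ultimately have "of_real (\<Sum>z\<in>A. (cmod z)\<^sup>2 * m z) = (0::complex)"
    using tr[OF yQ] by simp
  then have "(\<Sum>z\<in>A. (cmod z)\<^sup>2 * m z) = 0" by (simp only: of_real_eq_0_iff)
  then have "(cmod z)\<^sup>2 * m z = 0" if "z \<in> A" for z
    using that s(1) by (subst (asm) sum_nonneg_eq_0_iff) auto
  then have "e z = 0" if "z \<in> A" "z \<noteq> 0" for z using m that by fastforce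
  then have "(\<Sum>z\<in>A. e z) = e 0"
    using s(1,2) by (subst sum.remove[of _ 0]) auto
  then have "x ^ N = 0" using e(1) e(3)[OF s(2)] by simp
  then show ?thesis by blast
qed

section \<open>Polarization of traces of products\<close>

definition sq_deriv :: "(complex \<Rightarrow> ('n::finite) sqmat) \<Rightarrow> 'n sqmat \<Rightarrow> complex \<Rightarrow> bool" where
  "sq_deriv A B z \<longleftrightarrow>
     (\<forall>i j. ((\<lambda>t. Rep_sqmat (A t) $ i $ j) has_field_derivative Rep_sqmat B $ i $ j) (at z))"

lemma sq_deriv_const: "sq_deriv (\<lambda>_. a) 0 z"
  by (simp add: sq_deriv_def zero_sqmat.rep_eq)

lemma sq_deriv_affine: "sq_deriv (\<lambda>t. y + sc t * x) x z"
  unfolding sq_deriv_def plus_sqmat.rep_eq times_sqmat.rep_eq sc.rep_eq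
  by (auto simp: mat_times_component intro!: derivative_eq_intros)

lemma sq_deriv_mult:
  assumes "sq_deriv A A' z" "sq_deriv B B' z"
  shows "sq_deriv (\<lambda>t. A t * B t) (A' * B z + A z * B') z"
  unfolding sq_deriv_def
proof (intro allI)
  fix i j
  have "((\<lambda>t. \<Sum>k\<in>UNIV. Rep_sqmat (A t) $ i $ k * Rep_sqmat (B t) $ k $ j) has_field_derivative
     (\<Sum>k\<in>UNIV. Rep_sqmat A' $ i $ k * Rep_sqmat (B z) $ k $ j
        + Rep_sqmat B' $ k $ j * Rep_sqmat (A z) $ i $ k)) (at z)"
    using assms unfolding sq_deriv_def by (intro DERIV_sum DERIV_mult) auto
  then show "((\<lambda>t. Rep_sqmat (A t * B t) $ i $ j) has_field_derivative
      Rep_sqmat (A' * B z + A z * B') $ i $ j) (at z)"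
    by (simp add: times_sqmat.rep_eq plus_sqmat.rep_eq matrix_matrix_mult_def sum.distrib mult.commute)
qed

lemma sq_deriv_tr:
  assumes "sq_deriv A A' z"
  shows "((\<lambda>t. tr (A t)) has_field_derivative tr A') (at z)"
  using assms unfolding sq_deriv_def tr.rep_eq trace_def by (intro DERIV_sum) auto

text \<open>The sum of y^i x y^(m-1-i): the derivative of the m-th power at y in direction x when x
  and y need not commute.\<close>

fun dpow :: "'a::ring_1 \<Rightarrow> 'a \<Rightarrow> nat \<Rightarrow> 'a" where
  "dpow x y 0 = 0"
| "dpow x y (Suc m) = x * y ^ m + y * dpow x y m"

lemma sq_deriv_power: "sq_deriv (\<lambda>t. (y + sc t * x) ^ m) (dpow x y m) 0"
proof (induction m)
  case 0
  then show ?case using sq_deriv_const[of 1 0] by simp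
next
  case (Suc m)
  from sq_deriv_mult[OF sq_deriv_affine[of y x 0] this] show ?case by simp
qed

definition sc_subspace :: "('n::finite) sqmat set \<Rightarrow> bool" where
  "sc_subspace Q \<longleftrightarrow> 0 \<in> Q \<and> (\<forall>u\<in>Q. \<forall>v\<in>Q. u + v \<in> Q) \<and> (\<forall>c. \<forall>u\<in>Q. sc c * u \<in> Q)"

lemma sc_subspaceD:
  assumes "sc_subspace Q"
  shows "0 \<in> Q" "u \<in> Q \<Longrightarrow> v \<in> Q \<Longrightarrow> u + v \<in> Q" "u \<in> Q \<Longrightarrow> sc c * u \<in> Q"
    "u \<in> Q \<Longrightarrow> - u \<in> Q" "u \<in> Q \<Longrightarrow> v \<in> Q \<Longrightarrow> u - v \<in> Q"
proof -
  have *: "0 \<in> Q" "\<And>u v. u \<in> Q \<Longrightarrow> v \<in> Q \<Longrightarrow> u + v \<in> Q" "\<And>c u. u \<in> Q \<Longrightarrow> sc c * u \<in> Q"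
    using assms unfolding sc_subspace_def by blast+
  have neg: "- u \<in> Q" if "u \<in> Q" for u
    using *(3)[OF that, of "- 1"] by (simp add: sc_minus)
  show "0 \<in> Q" "u \<in> Q \<Longrightarrow> v \<in> Q \<Longrightarrow> u + v \<in> Q" "u \<in> Q \<Longrightarrow> sc c * u \<in> Q"
    "u \<in> Q \<Longrightarrow> - u \<in> Q" "u \<in> Q \<Longrightarrow> v \<in> Q \<Longrightarrow> u - v \<in> Q"
    using * neg *(2)[of u "- v"] by auto
qed

text \<open>Modulo shorter products the trace of a product is symmetric in the factors, so that it is
  determined by the traces of powers.\<close>

lemma tr_prod_list_eq_0:
  fixes Q :: "('n::finite) sqmat set"
  assumes Q: "sc_subspace Q" and br: "\<And>u v. u \<in> Q \<Longrightarrow> v \<in> Q \<Longrightarrow> u * v - v * u \<in> Q"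
    and nil: "\<And>u. u \<in> Q \<Longrightarrow> \<exists>N. u ^ N = 0"
  shows "set xs \<subseteq> Q \<Longrightarrow> xs \<noteq> [] \<Longrightarrow> tr (prod_list xs) = 0"
proof (induction "length xs" arbitrary: xs rule: less_induct)
  case less
  define k where "k = length xs"
  have k: "k > 0" using less.prems by (simp add: k_def)
  \<comment> \<open>The two sides differ by the trace of a shorter product, in which x and y are
    replaced by their bracket.\<close>
  have swap: "tr (prod_list ps * x * y * r) = tr (prod_list ps * y * x * r)"
    if "set ps \<subseteq> Q" "x \<in> Q" "y \<in> Q" "length ps + 2 + m = k" "r = y ^ m" for ps x y m r
  proof -
    have "prod_list (replicate m y) = y ^ m" by simp
    then have "prod_list ps * x * y * r - prod_list ps * y * x * r
       = prod_list (ps @ (x * y - y * x) # replicate m y)"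
      using that by (simp add: algebra_simps)
    moreover have "tr \<dots> = 0"
      using that br by (intro less.hyps) (auto simp flip: k_def)
    ultimately have "tr (prod_list ps * x * y * r - prod_list ps * y * x * r) = 0" by simp
    then show ?thesis by (simp add: tr_diff)
  qed
  \<comment> \<open>Up to shorter products, x can be moved to the front of each of the m terms of
    the derivative.\<close>
  have dp: "tr (prod_list ps * dpow x y m) = of_nat m * tr (prod_list ps * x * y ^ (m - 1))"
    if "set ps \<subseteq> Q" "x \<in> Q" "y \<in> Q" "length ps + m = k" for ps x y m
    using that
  proof (induction m arbitrary: ps)
    case (Suc m)
    have "tr (prod_list ps * dpow x y (Suc m))
      = tr (prod_list ps * x * y ^ m) + tr (prod_list (ps @ [y]) * dpow x y m)"
      by (simp add: distrib_left tr_add mult.assoc)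
    also have "tr (prod_list (ps @ [y]) * dpow x y m) = of_nat m * tr (prod_list ps * y * x * y ^ (m - 1))"
      using Suc.IH[of "ps @ [y]"] Suc.prems by simp
    also have "\<dots> = of_nat m * tr (prod_list ps * x * y ^ m)"
    proof (cases m)
      case (Suc l)
      have "tr (prod_list ps * x * y * y ^ l) = tr (prod_list ps * y * x * y ^ l)"
        using Suc.prems Suc by (intro swap[where m = l]) auto
      then show ?thesis using Suc by (simp add: mult.assoc)
    qed simp
    finally show ?case by (simp add: algebra_simps)
  qed simp
  \<comment> \<open>Interpolates between powers (\<open>ps\<close> empty) and arbitrary products
    (\<open>ps\<close> of length k): in each step one factor y is polarized into an independent
    factor.\<close>
  have "tr (prod_list ps * y ^ (k - length ps)) = 0"
    if "set ps \<subseteq> Q" "y \<in> Q" "length ps \<le> k" for ps y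
    using that
  proof (induction ps arbitrary: y rule: rev_induct)
    case Nil
    obtain N where "y ^ N = 0" using nil Nil by blast
    then have "(y ^ N) ^ k = 0" using k by (simp add: zero_power)
    then have "(y ^ k) ^ N = 0" by (metis power_mult mult.commute)
    then show ?case by (simp add: dt_one_plus_nilpotent(2))
  next
    case (snoc x ps)
    define m where "m = k - length ps"
    have m: "m > 0" "length ps + m = k" "k - length (ps @ [x]) = m - 1" using snoc.prems by (auto simp: m_def)
    have "tr (prod_list ps * (y + sc t * x) ^ m) = 0" for t
      using snoc sc_subspaceD[OF Q] unfolding m_def by auto
    moreover have "sq_deriv (\<lambda>t. prod_list ps * (y + sc t * x) ^ m) (prod_list ps * dpow x y m) 0"
      using sq_deriv_mult[OF sq_deriv_const sq_deriv_power] by simp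
    ultimately have "((\<lambda>t. 0) has_field_derivative tr (prod_list ps * dpow x y m)) (at (0::complex))"
      using sq_deriv_tr by force
    then have "tr (prod_list ps * dpow x y m) = 0" using DERIV_unique DERIV_const by blast
    then have "tr (prod_list ps * x * y ^ (m - 1)) = 0" using dp[of ps x y m] snoc.prems m by simp
    then show ?case using m by simp
  qed
  note powers = this
  \<comment> \<open>With \<open>ps\<close> equal to \<open>xs\<close> the exponent of y is 0, so any
    element of Q can stand for y.\<close>
  have "hd xs \<in> Q" using less.prems by (metis hd_in_set subsetD)
  with powers[of xs "hd xs"] show ?case using less.prems by (simp add: k_def)
qed

section \<open>An Engel theorem and the radical of the trace form\<close>

text \<open>The associative algebra generated by Q without unit. The empty product is excluded so
  that all elements can have trace 0.\<close>

inductive_set assoc_span :: "('a::ring_1) set \<Rightarrow> 'a set" for Q where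
  "set xs \<subseteq> Q \<Longrightarrow> xs \<noteq> [] \<Longrightarrow> prod_list xs \<in> assoc_span Q"
| "a \<in> assoc_span Q \<Longrightarrow> b \<in> assoc_span Q \<Longrightarrow> a + b \<in> assoc_span Q"

lemma assoc_span_mult:
  assumes "a \<in> assoc_span Q" "b \<in> assoc_span Q"
  shows "a * b \<in> assoc_span Q"
  using assms(1)
proof induction
  case (1 xs)
  show ?case using assms(2)
  proof induction
    case (1 ys)
    then show ?case using assoc_span.intros(1)[of "xs @ ys" Q] \<open>set xs \<subseteq> Q\<close> by simp
  qed (simp add: distrib_left assoc_span.intros)
qed (simp add: distrib_right assoc_span.intros)

lemma assoc_span_base: "x \<in> Q \<Longrightarrow> x \<in> assoc_span Q"
  using assoc_span.intros(1)[of "[x]" Q] by simp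

lemma assoc_span_sc:
  assumes "sc_subspace Q" "a \<in> assoc_span Q"
  shows "sc c * a \<in> assoc_span Q"
  using assms(2)
proof induction
  case (1 xs)
  then obtain x ys where xs: "xs = x # ys" by (cases xs) auto
  then show ?case
    using assoc_span.intros(1)[of "(sc c * x) # ys" Q] 1 sc_subspaceD(3)[OF assms(1)]
    by (simp add: mult.assoc)
qed (simp add: distrib_left assoc_span.intros)

abbreviation sq_app :: "('n::finite) sqmat \<Rightarrow> complex ^ 'n \<Rightarrow> complex ^ 'n" where
  "sq_app a v \<equiv> Rep_sqmat a *v v"

lemma sq_app_simps:
  "sq_app (a * b) v = sq_app a (sq_app b v)" "sq_app (a + b) v = sq_app a v + sq_app b v"
  "sq_app 1 v = v" "sq_app 0 v = 0" "sq_app (sc (complex_of_real r) * a) v = r *\<^sub>R sq_app a v"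
  "sq_app a (u + v) = sq_app a u + sq_app a v"
      apply (simp add: times_sqmat.rep_eq matrix_vector_mul_assoc)
     apply (simp add: plus_sqmat.rep_eq matrix_vector_mult_add_rdistrib)
    apply (simp add: one_sqmat.rep_eq)
   apply (simp add: zero_sqmat.rep_eq)
  subgoal
    apply (simp add: times_sqmat.rep_eq sc.rep_eq vec_eq_iff matrix_vector_mult_def mat_times_component)
    apply (simp add: scaleR_conv_of_real sum_distrib_left mult.assoc)
    done
  apply (simp add: matrix_vector_right_distrib)
  done

text \<open>The subspaces obtained by applying Q repeatedly to the whole space stabilize at some W
  with Q W = W. If W is not 0, take an invariant proper subspace Y of W of maximal dimension and w
  in W with Q w not inside Y. Then Y and the images of w under the algebra fill W, so w = a w + y
  with a nilpotent, and iteration puts w into Y, a contradiction.\<close>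

lemma nilpotent_products_vanish:
  fixes Q :: "('n::finite) sqmat set"
  assumes Q: "sc_subspace Q" and br: "\<And>u v. u \<in> Q \<Longrightarrow> v \<in> Q \<Longrightarrow> u * v - v * u \<in> Q"
    and nil: "\<And>u. u \<in> Q \<Longrightarrow> \<exists>N. u ^ N = 0"
  shows "\<exists>K. \<forall>xs. set xs \<subseteq> Q \<longrightarrow> length xs = K \<longrightarrow> prod_list xs = 0"
proof -
  have span_nil: "\<exists>N. a ^ N = 0" if a: "a \<in> assoc_span Q" for a
  proof (rule nilpotent_if_tr_powers)
    fix k :: nat assume "k > 0"
    have tr: "tr b = 0" if "b \<in> assoc_span Q" for b
      using that by induction (simp_all add: tr_add tr_prod_list_eq_0[OF Q br nil])
    have "a ^ k \<in> assoc_span Q"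
      using \<open>k > 0\<close> by (induction k rule: nat_induct_non_zero) (simp_all add: a assoc_span_mult)
    then show "tr (a ^ k) = 0" by (rule tr)
  qed
  define V :: "nat \<Rightarrow> (complex ^ 'n) set" where
    "V = rec_nat UNIV (\<lambda>_ W. span {sq_app x v | x v. x \<in> Q \<and> v \<in> W})"
  have V0: "V 0 = UNIV" and VSuc: "V (Suc k) = span {sq_app x v | x v. x \<in> Q \<and> v \<in> V k}" for k
    by (simp_all add: V_def)
  have sub: "subspace (V k)" for k by (cases k) (simp_all add: V0 VSuc)
  have dec: "V (Suc k) \<subseteq> V k" for k
  proof (induction k)
    case (Suc k)
    then show ?case unfolding VSuc[of "Suc k"] by (subst VSuc) (rule span_mono, blast)
  qed (simp add: V0)
  \<comment> \<open>The chain of subspaces decreases, so it is stationary where the dimension is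
    least.\<close>
  obtain K where K: "\<And>k. dim (V K) \<le> dim (V k)"
    using ex_has_least_nat[of "\<lambda>_. True" 0 "\<lambda>k. dim (V k)"] by auto
  define W where "W = V K"
  have W: "span {sq_app x v | x v. x \<in> Q \<and> v \<in> W} = W"
    using subspace_dim_equal[OF sub sub dec K] VSuc by (simp add: W_def)
  have subW: "subspace W" using sub by (simp add: W_def)
  have QW: "sq_app x w \<in> W" if "x \<in> Q" "w \<in> W" for x w
    using that W by (metis (mono_tags, lifting) mem_Collect_eq span_base)
  have appS: "sq_app a y \<in> Y"
    if "a \<in> assoc_span Q" "y \<in> Y" "subspace Y" "\<And>x y. x \<in> Q \<Longrightarrow> y \<in> Y \<Longrightarrow> sq_app x y \<in> Y" for a y Y
    using that(1)
  proof induction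
    case (1 xs)
    have "set xs \<subseteq> Q \<Longrightarrow> sq_app (prod_list xs) y \<in> Y" for xs
      using that(2,4) by (induction xs) (auto simp: sq_app_simps)
    then show ?case using 1 by blast
  qed (simp add: sq_app_simps subspace_add[OF that(3)])
  have "W = {0}"
  proof (rule ccontr)
    assume "W \<noteq> {0}"
    define P where "P Y \<longleftrightarrow> subspace Y \<and> Y \<subseteq> W \<and> Y \<noteq> W \<and> (\<forall>x\<in>Q. \<forall>y\<in>Y. sq_app x y \<in> Y)" for Y
    have "P {0}" using \<open>W \<noteq> {0}\<close> subspace_0[OF subW] by (auto simp: P_def matrix_vector_mult_0_right)
    moreover have "\<forall>Y. P Y \<longrightarrow> dim Y < Suc (dim W)" by (auto simp: P_def dim_subset less_Suc_eq_le)
    ultimately obtain Y where Y: "P Y" "\<And>Z. P Z \<Longrightarrow> dim Z \<le> dim Y"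
      using ex_has_greatest_nat[of P "{0}" dim] by metis
    have subY: "subspace Y" and QY: "\<And>x y. x \<in> Q \<Longrightarrow> y \<in> Y \<Longrightarrow> sq_app x y \<in> Y" and YW: "Y \<subseteq> W" "Y \<noteq> W"
      using Y(1) by (auto simp: P_def)
    obtain x w where xw: "x \<in> Q" "w \<in> W" "sq_app x w \<notin> Y"
    proof (rule ccontr)
      assume "\<not> thesis"
      then have "{sq_app x v | x v. x \<in> Q \<and> v \<in> W} \<subseteq> Y" using that by blast
      then have "span {sq_app x v | x v. x \<in> Q \<and> v \<in> W} \<subseteq> Y"
        by (rule span_minimal[OF _ subY])
      then have "W \<subseteq> Y" by (simp only: W)
      then show False using YW by blast
    qed
    define Z where "Z = {sq_app a w + y | a y. a \<in> assoc_span Q \<and> y \<in> Y}"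
    have 0: "0 \<in> assoc_span Q" using assoc_span_base sc_subspaceD(1)[OF Q] by blast
    have "subspace Z"
      unfolding subspace_def
    proof (intro conjI ballI allI)
      show "0 \<in> Z" unfolding Z_def using 0 subspace_0[OF subY]
        by (intro CollectI exI[of _ 0]) (auto simp: sq_app_simps)
    next
      fix u v assume "u \<in> Z" "v \<in> Z"
      then obtain a y b z where "u = sq_app a w + y" "v = sq_app b w + z"
        "a \<in> assoc_span Q" "b \<in> assoc_span Q" "y \<in> Y" "z \<in> Y" by (auto simp: Z_def)
      then show "u + v \<in> Z" unfolding Z_def
        by (intro CollectI exI[of _ "a + b"] exI[of _ "y + z"])
          (auto simp: sq_app_simps intro: assoc_span.intros subspace_add[OF subY])
    next
      fix r u assume "u \<in> Z"
      then obtain a y where "u = sq_app a w + y" "a \<in> assoc_span Q" "y \<in> Y" by (auto simp: Z_def)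
      then show "r *\<^sub>R u \<in> Z" unfolding Z_def
        by (intro CollectI exI[of _ "sc (complex_of_real r) * a"] exI[of _ "r *\<^sub>R y"])
          (auto simp: sq_app_simps(5) scaleR_add_right intro: assoc_span_sc[OF Q] subspace_scale[OF subY])
    qed
    moreover have "Z \<subseteq> W"
      using appS[OF _ xw(2) subW QW] YW(1) subspace_add[OF subW] by (auto simp: Z_def)
    moreover have "sq_app q z \<in> Z" if "q \<in> Q" "z \<in> Z" for q z
    proof -
      obtain a y where "z = sq_app a w + y" "a \<in> assoc_span Q" "y \<in> Y" using \<open>z \<in> Z\<close> by (auto simp: Z_def)
      then show ?thesis unfolding Z_def using that(1)
        by (intro CollectI exI[of _ "q * a"] exI[of _ "sq_app q y"])
          (auto simp: sq_app_simps QY intro: assoc_span_mult assoc_span_base)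
    qed
    moreover have "Y \<subseteq> Z"
    proof
      fix y assume "y \<in> Y"
      then show "y \<in> Z" unfolding Z_def using 0
        by (intro CollectI exI[of _ 0] exI[of _ y]) (simp add: sq_app_simps)
    qed
    moreover have "sq_app x w \<in> Z"
      unfolding Z_def using subspace_0[OF subY] assoc_span_base[OF xw(1)]
      by (intro CollectI exI[of _ x] exI[of _ 0]) auto
    ultimately have "W \<subseteq> Z"
      using Y(2)[of Z] subspace_dim_equal[OF subY \<open>subspace Z\<close>] xw(3) unfolding P_def by blast
    then obtain a y where ay: "w = sq_app a w + y" "a \<in> assoc_span Q" "y \<in> Y"
      using xw(2) by (auto simp: Z_def)
    \<comment> \<open>The equation w = a w + y is substituted into itself; Y is stable under
      a.\<close>
    have "\<exists>y\<in>Y. w = sq_app (a ^ k) w + y" for k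
    proof (induction k)
      case 0
      then show ?case using subspace_0[OF subY] by (auto simp: sq_app_simps intro!: bexI[of _ 0])
    next
      case (Suc k)
      then obtain z where z: "z \<in> Y" "w = sq_app (a ^ k) w + z" by blast
      have "w = sq_app a (sq_app (a ^ k) w + z) + y" using ay(1) z(2) by simp
      then have "w = sq_app (a ^ Suc k) w + (sq_app a z + y)" by (simp add: sq_app_simps add.assoc)
      then show ?case using appS[OF ay(2) z(1) subY QY] ay(3) subspace_add[OF subY] by blast
    qed
    moreover obtain N where "a ^ N = 0" using span_nil[OF ay(2)] by blast
    ultimately have "w \<in> Y" by (metis add_0 sq_app_simps(4))
    then show False using QY xw by blast
  qed
  have "sq_app (prod_list xs) v \<in> V (length xs)" if "set xs \<subseteq> Q" for xs v
    using that by (induction xs) (auto simp: V0 VSuc sq_app_simps intro!: span_base)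
  then have "prod_list xs = 0" if "set xs \<subseteq> Q" "length xs = K" for xs
  proof -
    have "sq_app (prod_list xs) v = 0" for v
      using \<open>\<And>xs v. set xs \<subseteq> Q \<Longrightarrow> sq_app (prod_list xs) v \<in> V (length xs)\<close>[OF that(1), of v] that(2)
        \<open>W = {0}\<close> by (simp add: W_def)
    then have "Rep_sqmat (prod_list xs) = Rep_sqmat 0"
      by (subst matrix_eq) (simp add: sq_app_simps)
    then show ?thesis by (simp add: Rep_sqmat_inject)
  qed
  then show ?thesis by blast
qed

text \<open>Closing under sums suffices: for a subspace P, scalars are absorbed into the first
  factor of a bracket.\<close>

inductive_set bracket_span :: "('a::ring_1) set \<Rightarrow> 'a set \<Rightarrow> 'a set" for P Q where
  "a \<in> P \<Longrightarrow> b \<in> Q \<Longrightarrow> a * b - b * a \<in> bracket_span P Q"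
| "u \<in> bracket_span P Q \<Longrightarrow> v \<in> bracket_span P Q \<Longrightarrow> u + v \<in> bracket_span P Q"

text \<open>The elements of \<open>[g, r]\<close>, for \<open>r\<close> the radical of the trace form of a Lie algebra \<open>g\<close>, are
  nilpotent by Cartan's criterion, hence products of sufficiently many of them vanish.\<close>

lemma tr_bracket_radical:
  fixes g :: "('n::finite) sqmat set"
  assumes g: "sc_subspace g" and br: "\<And>u v. u \<in> g \<Longrightarrow> v \<in> g \<Longrightarrow> u * v - v * u \<in> g"
    and X: "H \<in> g" "X \<in> g" "X = H * X - X * H" "\<And>a. a \<in> g \<Longrightarrow> tr (X * a) = 0"
  shows "\<exists>N. X ^ N = 0"
    and "h * h' = 1 \<Longrightarrow> h' * h = 1 \<Longrightarrow> (\<And>a. a \<in> g \<Longrightarrow> h * a * h' \<in> g \<and> h' * a * h \<in> g) \<Longrightarrow>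
      k > 0 \<Longrightarrow> tr (X ^ k * h) = 0"
proof -
  define r where "r = {b \<in> g. \<forall>a\<in>g. tr (b * a) = 0}"
  define Q where "Q = bracket_span g r"
  note gD = sc_subspaceD[OF g]
  \<comment> \<open>Invariance of the trace form under brackets.\<close>
  have cyc: "tr ((a * b - b * a) * c) = tr (b * (c * a - a * c))" for a b c :: "'n sqmat"
  proof -
    have "tr (a * b * c) = tr (b * (c * a))" using tr_mult_commute[of a "b * c"] by (simp add: mult.assoc)
    then show ?thesis by (simp add: left_diff_distrib right_diff_distrib tr_diff mult.assoc)
  qed
  have rg: "r \<subseteq> g" by (auto simp: r_def)
  have r_add: "u + v \<in> r" if "u \<in> r" "v \<in> r" for u v
    using that gD by (auto simp: r_def distrib_right tr_add)
  have Qr: "u \<in> r" if "u \<in> Q" for u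
    using that unfolding Q_def
  proof induction
    case (1 a b)
    then show ?case using br rg by (auto simp: r_def cyc)
  qed (rule r_add)
  have Q_sc: "sc c * u \<in> Q" if "u \<in> Q" for c u
    using that unfolding Q_def
  proof induction
    case (1 a b)
    have "sc c * (a * b - b * a) = (sc c * a) * b - b * (sc c * a)"
      by (simp add: right_diff_distrib mult.assoc sc_left_commute[of b])
    then show ?case using 1 gD(3) bracket_span.intros(1) by metis
  qed (simp add: distrib_left bracket_span.intros)
  have XQ: "X \<in> Q" unfolding Q_def using X bracket_span.intros(1)[of H g X r]
    by (auto simp: r_def)
  have Q: "sc_subspace Q"
    unfolding sc_subspace_def
    using Q_sc Q_sc[OF XQ, of 0] bracket_span.intros(2) by (auto simp: Q_def)
  have Qbr: "u * v - v * u \<in> Q" if "u \<in> Q" "v \<in> Q" for u v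
    using that Qr rg bracket_span.intros(1)[of u g v r] by (auto simp: Q_def)
  \<comment> \<open>Cartan's criterion is applied to \<open>g\<close>: for u = [a, b] with b in the
    radical and y normalizing \<open>g\<close>, invariance turns tr (u y) into tr (b [y, a]), which
    is 0.\<close>
  have nil: "\<exists>N. u ^ N = 0" if u: "u \<in> Q" for u
  proof (rule cartan_nilpotent[of g])
    have "u \<in> g" using Qr[OF u] rg by blast
    then show "u * a - a * u \<in> g" if "a \<in> g" for a using br that by blast
    show "sc c * a \<in> g" if "a \<in> g" for c a using that by (rule gD(3))
    show "a + b \<in> g" if "a \<in> g" "b \<in> g" for a b using that by (rule gD(2))
    fix y assume y: "\<And>a. a \<in> g \<Longrightarrow> y * a - a * y \<in> g"
    show "tr (u * y) = 0"
      using u unfolding Q_def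
    proof induction
      case (1 a b)
      then show ?case using y[OF 1(1)] by (auto simp: cyc r_def)
    qed (simp add: distrib_right tr_add)
  qed
  show "\<exists>N. X ^ N = 0" by (rule nil[OF XQ])
  obtain K where K: "\<And>xs. set xs \<subseteq> Q \<Longrightarrow> length xs = K \<Longrightarrow> prod_list xs = 0"
    using nilpotent_products_vanish[OF Q Qbr nil] by blast
  have K': "prod_list xs = 0" if "set xs \<subseteq> Q" "length xs \<ge> K" for xs
  proof -
    have "prod_list (take K xs) * prod_list (drop K xs) = prod_list xs"
      by (metis append_take_drop_id prod_list.append)
    moreover have "prod_list (take K xs) = 0"
      using that set_take_subset[of K xs] by (intro K) auto
    ultimately show ?thesis by simp
  qed
  assume h: "h * h' = 1" "h' * h = 1" and gh: "\<And>a. a \<in> g \<Longrightarrow> h * a * h' \<in> g \<and> h' * a * h \<in> g"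
    and k: "k > 0"
  have hh: "h' * (h * z) = z" "h * (h' * z) = z" for z using h by (simp_all flip: mult.assoc)
  have rh: "h * b * h' \<in> r" if b: "b \<in> r" for b
  proof -
    have "tr (h * b * h' * a) = tr (b * (h' * a * h))" for a
      using tr_mult_commute[of h "b * h' * a"] by (simp add: mult.assoc)
    then show ?thesis using b gh by (auto simp: r_def)
  qed
  have Qh: "h * u * h' \<in> Q" if "u \<in> Q" for u
    using that unfolding Q_def
  proof induction
    case (1 a b)
    have "h * (a * b - b * a) * h' = (h * a * h') * (h * b * h') - (h * b * h') * (h * a * h')"
      by (simp add: right_diff_distrib left_diff_distrib mult.assoc hh)
    then show ?case using 1 gh rh bracket_span.intros(1) by metis
  qed (simp add: distrib_left distrib_right bracket_span.intros)
  \<comment> \<open>Each h is moved to the right at the price of conjugating elements of Q, which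
    preserves Q. Thus a power of X^k h is a long product from Q times a power of h.\<close>
  have "\<exists>xs. set xs \<subseteq> Q \<and> length xs = k * m \<and> (X ^ k * h) ^ m = prod_list xs * h ^ m" for m
  proof (induction m)
    case (Suc m)
    then obtain xs where xs: "set xs \<subseteq> Q" "length xs = k * m" "(X ^ k * h) ^ m = prod_list xs * h ^ m"
      by blast
    have conj: "h * prod_list ys = prod_list (map (\<lambda>u. h * u * h') ys) * h" for ys
    proof (induction ys)
      case (Cons a ys)
      have "prod_list (map (\<lambda>u. h * u * h') (a # ys)) * h
          = h * a * h' * (prod_list (map (\<lambda>u. h * u * h') ys) * h)" by (simp add: mult.assoc)
      also have "\<dots> = h * prod_list (a # ys)" by (simp only: Cons[symmetric]) (simp add: mult.assoc hh)
      finally show ?case by simp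
    qed simp
    let ?ys = "replicate k X @ map (\<lambda>u. h * u * h') xs"
    have "(X ^ k * h) ^ Suc m = X ^ k * (h * prod_list xs) * h ^ m" by (simp add: xs mult.assoc)
    also have "\<dots> = prod_list ?ys * h ^ Suc m" by (simp add: conj mult.assoc)
    finally have "(X ^ k * h) ^ Suc m = prod_list ?ys * h ^ Suc m" .
    moreover have "set ?ys \<subseteq> Q" using xs(1) XQ Qh by auto
    moreover have "length ?ys = k * Suc m" using xs(2) by simp
    ultimately show ?case by blast
  qed simp
  then obtain xs where "set xs \<subseteq> Q" "length xs = k * K" "(X ^ k * h) ^ K = prod_list xs * h ^ K"
    by blast
  then have "(X ^ k * h) ^ K = 0" using K'[of xs] k by simp
  then show "tr (X ^ k * h) = 0" by (rule dt_one_plus_nilpotent(2))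
qed

section \<open>Lie algebras of linear groups\<close>

lemma polyfun_cong: "polyfun f \<Longrightarrow> (\<And>g. f g = h g) \<Longrightarrow> polyfun h"
  by (metis ext)

lemma polyfun_compose:
  assumes "polyfun f" "\<And>i j. polyfun (\<lambda>g. L g $ i $ j)"
  shows "polyfun (\<lambda>g. f (L g))"
  using assms(1) by induction (auto intro: polyfun.intros assms(2))

lemma polyfun_times_left: "polyfun (\<lambda>g. (A ** g) $ i $ j)"
  and polyfun_times_right: "polyfun (\<lambda>g. (g ** A) $ i $ j)"
  unfolding matrix_matrix_mult_def vec_lambda_beta
  by (intro polyfun_sum polyfun.intros)+

lemma polyfun_translate: "polyfun f \<Longrightarrow> polyfun (\<lambda>g. f (A ** g))"
  by (erule polyfun_compose) (rule polyfun_times_left)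

lemma polyfun_conjugate:
  fixes A B :: "('n::finite) cmat"
  assumes "polyfun f" shows "polyfun (\<lambda>g. f (A ** g ** B))"
proof -
  have "polyfun (\<lambda>g. f (g ** B))" using assms by (rule polyfun_compose) (rule polyfun_times_right)
  then show ?thesis by (rule polyfun_translate)
qed

lemma polyfun_trace_times: "polyfun (\<lambda>g. trace (g ** A))"
  unfolding trace_def by (intro polyfun_sum polyfun_times_right)

lemma polyfun_continuous: "polyfun f \<Longrightarrow> continuous_on UNIV f"
  by (induction rule: polyfun.induct) (auto intro!: continuous_intros)

section \<open>Left-invariant derivations of polynomial functions\<close>

text \<open>D collects the partial derivatives. Bundling their polynomiality with the chain rule
  along curves allows one induction over f to prove both.\<close>

definition has_gradient :: "(('n::finite) cmat \<Rightarrow> complex) \<Rightarrow> ('n \<Rightarrow> 'n \<Rightarrow> 'n cmat \<Rightarrow> complex) \<Rightarrow> bool" where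
  "has_gradient f D \<longleftrightarrow> (\<forall>i j. polyfun (D i j)) \<and>
    (\<forall>c B z. (\<forall>i j. ((\<lambda>t. c t $ i $ j) has_field_derivative B $ i $ j) (at z)) \<longrightarrow>
      ((\<lambda>t. f (c t)) has_field_derivative (\<Sum>i\<in>UNIV. \<Sum>j\<in>UNIV. D i j (c z) * B $ i $ j)) (at z))"

lemma has_gradientD:
  assumes "has_gradient f D"
  shows "polyfun (D i j)"
    "(\<And>i j. ((\<lambda>t. c t $ i $ j) has_field_derivative B $ i $ j) (at z)) \<Longrightarrow>
      ((\<lambda>t. f (c t)) has_field_derivative (\<Sum>i\<in>UNIV. \<Sum>j\<in>UNIV. D i j (c z) * B $ i $ j)) (at z)"
  using assms unfolding has_gradient_def by simp_all

lemma polyfun_gradient: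
  assumes "polyfun f"
  shows "\<exists>D. has_gradient f D"
  using assms
proof induction
  case (1 a)
  then show ?case by (intro exI[of _ "\<lambda>_ _ _. 0"]) (auto simp: has_gradient_def intro: polyfun.intros)
next
  case (2 a b)
  have "(\<Sum>i\<in>UNIV. \<Sum>j\<in>UNIV. (if i = a \<and> j = b then 1 else 0) * B $ i $ j) = (B :: 'a cmat) $ a $ b" for B
  proof -
    have "(\<Sum>j\<in>UNIV. (if i = a \<and> j = b then 1 else 0) * B $ i $ j) = (if i = a then B $ i $ b else 0)" for i
      by (cases "i = a") (simp_all add: if_distrib[of "\<lambda>x. x * _"] sum.delta cong: if_cong)
    then show ?thesis by (simp add: sum.delta)
  qed
  then show ?case
    by (intro exI[of _ "\<lambda>i j _. if i = a \<and> j = b then 1 else 0"]) (auto simp: has_gradient_def intro: polyfun.intros)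
next
  case (3 f h)
  then obtain D E where g: "has_gradient f D" "has_gradient h E" by blast
  note D = has_gradientD(1)[OF g(1)] has_gradientD(1)[OF g(2)]
    and d = has_gradientD(2)[OF g(1)] has_gradientD(2)[OF g(2)]
  show ?case
    unfolding has_gradient_def
  proof (intro exI[of _ "\<lambda>i j g. D i j g + E i j g"] conjI allI impI)
    show "polyfun (\<lambda>g. D i j g + E i j g)" for i j
      using D by (intro polyfun.intros)
    fix c and B :: "'a cmat" and z
    assume c: "\<forall>i j. ((\<lambda>t. c t $ i $ j) has_field_derivative B $ i $ j) (at z)"
    show "((\<lambda>t. f (c t) + h (c t)) has_field_derivative
      (\<Sum>i\<in>UNIV. \<Sum>j\<in>UNIV. (D i j (c z) + E i j (c z)) * B $ i $ j)) (at z)"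
      using DERIV_add[OF d(1)[of c B z] d(2)[of c B z]] c
      by (simp add: distrib_right sum.distrib)
  qed
next
  case (4 f h)
  then obtain D E where g: "has_gradient f D" "has_gradient h E" by blast
  note D = has_gradientD(1)[OF g(1)] has_gradientD(1)[OF g(2)]
    and d = has_gradientD(2)[OF g(1)] has_gradientD(2)[OF g(2)]
  show ?case
    unfolding has_gradient_def
  proof (intro exI[of _ "\<lambda>i j g. D i j g * h g + E i j g * f g"] conjI allI impI)
    show "polyfun (\<lambda>g. D i j g * h g + E i j g * f g)" for i j
      using D 4 by (intro polyfun.intros)
    fix c and B :: "'a cmat" and z
    assume c: "\<forall>i j. ((\<lambda>t. c t $ i $ j) has_field_derivative B $ i $ j) (at z)"
    from DERIV_mult[OF d(1)[of c B z] d(2)[of c B z]] c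
    show "((\<lambda>t. f (c t) * h (c t)) has_field_derivative
      (\<Sum>i\<in>UNIV. \<Sum>j\<in>UNIV. (D i j (c z) * h (c z) + E i j (c z) * f (c z)) * B $ i $ j)) (at z)"
      by (simp add: distrib_right sum.distrib sum_distrib_right) (simp add: mult_ac)
  qed
qed

text \<open>The left-invariant derivation attached to Y: the derivative of f at g along the curve g
  (1 + t Y).\<close>

definition lderiv :: "(('n::finite) cmat \<Rightarrow> complex) \<Rightarrow> 'n cmat \<Rightarrow> 'n cmat \<Rightarrow> complex" where
  "lderiv f Y g = deriv (\<lambda>t. f (g + mat t ** (g ** Y))) 0"

lemma line_has_derivative:
  "((\<lambda>t. (g + mat t ** B) $ i $ j) has_field_derivative (B :: ('n::finite) cmat) $ i $ j) (at z)"
  by (simp add: mat_times_component) (auto intro!: derivative_eq_intros)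

lemma lderiv_gradient:
  assumes "has_gradient f D"
  shows "lderiv f Y g = (\<Sum>i\<in>UNIV. \<Sum>j\<in>UNIV. D i j g * (g ** Y) $ i $ j)"
proof -
  have "mat 0 ** B = (0 :: 'a cmat)" for B by (simp add: vec_eq_iff mat_times_component)
  then show ?thesis
    unfolding lderiv_def
    using has_gradientD(2)[OF assms line_has_derivative, of g "g ** Y" 0]
    by (intro DERIV_imp_deriv) simp
qed

lemma lderiv_curve:
  assumes "polyfun f" "\<And>i j. ((\<lambda>t. c t $ i $ j) has_field_derivative (c z ** Y) $ i $ j) (at z)"
  shows "((\<lambda>t. f (c t)) has_field_derivative lderiv f Y (c z)) (at z)"
proof -
  obtain D where D: "has_gradient f D" using polyfun_gradient[OF assms(1)] by blast
  from has_gradientD(2)[OF D, of c "c z ** Y" z, OF assms(2)] show ?thesis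
    by (simp add: lderiv_gradient[OF D])
qed

lemma lderiv_line:
  "polyfun f \<Longrightarrow> ((\<lambda>t. f (g + mat t ** (g ** Y))) has_field_derivative lderiv f Y g) (at 0)"
  using lderiv_curve[of f "\<lambda>t. g + mat t ** (g ** Y)" 0 Y] line_has_derivative[of g "g ** Y" _ _ 0] by simp

lemma polyfun_lderiv:
  assumes "polyfun f" shows "polyfun (lderiv f Y)"
proof -
  obtain D where D: "has_gradient f D" using polyfun_gradient[OF assms] by blast
  have "polyfun (\<lambda>g. \<Sum>i\<in>UNIV. \<Sum>j\<in>UNIV. D i j g * (g ** Y) $ i $ j)"
    by (intro polyfun_sum polyfun.intros(4) has_gradientD(1)[OF D] polyfun_times_right)
  then show ?thesis by (rule polyfun_cong) (simp add: lderiv_gradient[OF D])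
qed

lemma lderiv_add: "polyfun f \<Longrightarrow> lderiv f (Y + Z) g = lderiv f Y g + lderiv f Z g"
  and lderiv_scale: "polyfun f \<Longrightarrow> lderiv f (mat c ** Y) g = c * lderiv f Y g"
proof -
  assume "polyfun f"
  then obtain D where D: "has_gradient f D" using polyfun_gradient by blast
  note D = lderiv_gradient[OF D]
  show "lderiv f (Y + Z) g = lderiv f Y g + lderiv f Z g" for Y Z
    by (simp add: D matrix_add_ldistrib distrib_left sum.distrib)
  have "(g ** (mat c ** Y)) $ i $ j = c * (g ** Y) $ i $ j" for i j
    by (metis mat_commute mat_times_component matrix_mul_assoc)
  then show "lderiv f (mat c ** Y) g = c * lderiv f Y g"
    by (simp add: D sum_distrib_left mult_ac)
qed

lemma lderiv_const: "lderiv (\<lambda>_. a) Y = (\<lambda>_. 0)"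
  by (simp add: lderiv_def fun_eq_iff)

lemma lderiv_entry:
  fixes B :: "('a::finite) cmat"
  shows "lderiv (\<lambda>g. (g ** B) $ i $ j) Y = (\<lambda>g. (g ** (Y ** B)) $ i $ j)"
proof
  fix g :: "'a cmat"
  have eq: "(g + mat t ** (g ** Y)) ** B = g ** B + mat t ** (g ** (Y ** B))" for t
    by (simp add: matrix_add_rdistrib' matrix_mul_assoc)
  show "lderiv (\<lambda>g. (g ** B) $ i $ j) Y g = (g ** (Y ** B)) $ i $ j"
    unfolding lderiv_def eq by (rule DERIV_imp_deriv[OF line_has_derivative])
qed

lemma lderiv_plus:
  assumes "polyfun f" "polyfun h"
  shows "lderiv (\<lambda>g. f g + h g) Y = (\<lambda>g. lderiv f Y g + lderiv h Y g)"
proof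
  show "lderiv (\<lambda>g. f g + h g) Y g = lderiv f Y g + lderiv h Y g" for g
    using DERIV_add[OF lderiv_line[OF assms(1)] lderiv_line[OF assms(2)], of g Y g Y]
    unfolding lderiv_def[of "\<lambda>g. f g + h g"] by (rule DERIV_imp_deriv)
qed

lemma lderiv_mult:
  assumes "polyfun f" "polyfun h"
  shows "lderiv (\<lambda>g. f g * h g) Y = (\<lambda>g. lderiv f Y g * h g + lderiv h Y g * f g)"
proof
  fix g
  have "mat 0 ** B = (0 :: 'a cmat)" for B by (simp add: vec_eq_iff mat_times_component)
  then show "lderiv (\<lambda>g. f g * h g) Y g = lderiv f Y g * h g + lderiv h Y g * f g"
    using DERIV_mult[OF lderiv_line[OF assms(1)] lderiv_line[OF assms(2)], of g Y g Y]
    unfolding lderiv_def[of "\<lambda>g. f g * h g"] by (intro DERIV_imp_deriv) simp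
qed

text \<open>Both sides are derivations in f, so coordinates suffice. There, applying Y and then Z
  replaces g by g Z Y, which determines the sign.\<close>

lemma lderiv_commutator:
  assumes "polyfun f"
  shows "lderiv (lderiv f Y) Z g - lderiv (lderiv f Z) Y g = lderiv f (Z ** Y - Y ** Z) g"
  using assms
proof induction
  case (1 a)
  then show ?case by (simp add: lderiv_const)
next
  case (2 i j)
  have "lderiv (\<lambda>g. g $ i $ j) B = (\<lambda>g. (g ** B) $ i $ j)" for B :: "'a cmat"
    using lderiv_entry[of "mat 1" i j B] by simp
  then show ?case by (simp add: lderiv_entry) (simp add: matrix_matrix_mult_def right_diff_distrib sum_subtractf)
next
  case (3 f h)
  then show ?case by (simp add: lderiv_plus polyfun_lderiv algebra_simps)
next
  case (4 f h)
  then show ?case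
    by (simp add: lderiv_plus lderiv_mult polyfun_lderiv polyfun.intros(4)) (simp add: algebra_simps)
qed

section \<open>The Lie algebra under brackets and the adjoint action\<close>

lemma alg_groupD:
  assumes "alg_group G"
  shows "mat 1 \<in> G" "g \<in> G \<Longrightarrow> h \<in> G \<Longrightarrow> g ** h \<in> G" "g \<in> G \<Longrightarrow> matrix_inv g \<in> G"
    "g \<in> G \<Longrightarrow> g ** matrix_inv g = mat 1" "g \<in> G \<Longrightarrow> matrix_inv g ** g = mat 1"
proof -
  show "mat 1 \<in> G" "g \<in> G \<Longrightarrow> h \<in> G \<Longrightarrow> g ** h \<in> G" "g \<in> G \<Longrightarrow> matrix_inv g \<in> G"
    using assms by (auto simp: alg_group_def)
  assume "g \<in> G"
  then have "invertible g" using assms by (auto simp: alg_group_def zclosed_def)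
  then show "g ** matrix_inv g = mat 1" "matrix_inv g ** g = mat 1"
    unfolding invertible_def matrix_inv_def by (metis (mono_tags, lifting) someI_ex)+
qed

lemma lie_algebraD:
  assumes "Y \<in> lie_algebra G" "polyfun f" "\<And>g. g \<in> G \<Longrightarrow> f g = 0"
  shows "((\<lambda>t. f (mat 1 + mat t ** Y)) has_field_derivative 0) (at 0)"
  using assms unfolding lie_algebra_def by simp

lemma lie_algebra_iff:
  "Y \<in> lie_algebra G \<longleftrightarrow> (\<forall>f. polyfun f \<and> (\<forall>g\<in>G. f g = 0) \<longrightarrow> lderiv f Y (mat 1) = 0)"
proof -
  have "((\<lambda>t. f (mat 1 + mat t ** Y)) has_field_derivative 0) (at 0) \<longleftrightarrow> lderiv f Y (mat 1) = 0"
    if "polyfun f" for f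
    using lderiv_line[OF that, of "mat 1" Y] DERIV_unique by (auto simp: matrix_mul_lid)
  then show ?thesis unfolding lie_algebra_def by blast
qed

text \<open>The function x -> f (g x) vanishes on G as well, so the condition at the identity
  carries over to every point: derivations from the Lie algebra preserve the ideal of G.\<close>

lemma lderiv_vanishes:
  assumes G: "alg_group G" and Y: "Y \<in> lie_algebra G" and f: "polyfun f" "\<And>g. g \<in> G \<Longrightarrow> f g = 0"
    and g: "g \<in> G"
  shows "lderiv f Y g = 0"
proof -
  have "polyfun (\<lambda>x. f (g ** x))" by (rule polyfun_translate[OF f(1)])
  then have "((\<lambda>t. f (g ** (mat 1 + mat t ** Y))) has_field_derivative 0) (at 0)"
    by (rule lie_algebraD[OF Y]) (simp add: f(2) alg_groupD(2)[OF G g])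
  moreover have "g ** (mat 1 + mat t ** Y) = g + mat t ** (g ** Y)" for t
    by (simp add: matrix_add_ldistrib matrix_mul_assoc mat_commute)
  ultimately show ?thesis using lderiv_line[OF f(1), of g Y] DERIV_unique by auto
qed

lemma lie_algebra_add: "Y \<in> lie_algebra G \<Longrightarrow> Z \<in> lie_algebra G \<Longrightarrow> Y + Z \<in> lie_algebra G"
  and lie_algebra_scale: "Y \<in> lie_algebra G \<Longrightarrow> mat c ** Y \<in> lie_algebra G"
  and lie_algebra_0: "0 \<in> lie_algebra G"
proof -
  show "Y \<in> lie_algebra G \<Longrightarrow> Z \<in> lie_algebra G \<Longrightarrow> Y + Z \<in> lie_algebra G"
    "Y \<in> lie_algebra G \<Longrightarrow> mat c ** Y \<in> lie_algebra G"
    by (simp_all add: lie_algebra_iff lderiv_add lderiv_scale)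
  have "lderiv f 0 (mat 1) = 0" if "polyfun f" for f :: "'a cmat \<Rightarrow> complex"
    using lderiv_add[OF that, of 0 0] by simp
  then show "0 \<in> lie_algebra G" by (simp add: lie_algebra_iff)
qed

text \<open>Derivations that preserve the ideal of G are closed under commutators.\<close>

lemma lie_algebra_bracket:
  assumes G: "alg_group G" and Y: "Y \<in> lie_algebra G" and Z: "Z \<in> lie_algebra G"
  shows "Y ** Z - Z ** Y \<in> lie_algebra G"
  unfolding lie_algebra_iff
proof (intro allI impI, elim conjE)
  fix f assume f: "polyfun f" "\<forall>g\<in>G. f g = 0"
  have "lderiv (lderiv f Z) Y (mat 1) = 0" "lderiv (lderiv f Y) Z (mat 1) = 0"
    using f lderiv_vanishes[OF G Y] lderiv_vanishes[OF G Z] polyfun_lderiv alg_groupD(1)[OF G] by metis+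
  then show "lderiv f (Y ** Z - Z ** Y) (mat 1) = 0"
    using lderiv_commutator[OF f(1), of Z Y "mat 1"] by simp
qed

lemma lie_algebra_Ad:
  assumes G: "alg_group G" and Y: "Y \<in> lie_algebra G" and g: "g \<in> G"
  shows "g ** Y ** matrix_inv g \<in> lie_algebra G"
  unfolding lie_algebra_def
proof (intro CollectI allI impI, elim conjE)
  fix f assume f: "polyfun f" "\<forall>g\<in>G. f g = 0"
  have "polyfun (\<lambda>x. f (g ** x ** matrix_inv g))" by (rule polyfun_conjugate[OF f(1)])
  then have "((\<lambda>t. f (g ** (mat 1 + mat t ** Y) ** matrix_inv g)) has_field_derivative 0) (at 0)"
    by (rule lie_algebraD[OF Y]) (simp add: f(2) g alg_groupD[OF G])
  moreover have "g ** (mat 1 + mat t ** Y) ** matrix_inv g = mat 1 + mat t ** (g ** Y ** matrix_inv g)" for t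
    using alg_groupD(4)[OF G g]
    by (simp add: matrix_add_ldistrib matrix_add_rdistrib' matrix_mul_assoc mat_commute[of g])
  ultimately show "((\<lambda>t. f (mat 1 + mat t ** (g ** Y ** matrix_inv g))) has_field_derivative 0) (at 0)"
    by simp
qed

section \<open>One-parameter unipotent groups\<close>

lemma Rep_sqmat_sum: "Rep_sqmat (sum f A) = (\<Sum>x\<in>A. Rep_sqmat (f x))"
  by (induction A rule: infinite_finite_induct) (simp_all add: zero_sqmat.rep_eq plus_sqmat.rep_eq)

lemma Rep_sqmat_sc_component: "Rep_sqmat (sc c * a) $ i $ j = c * Rep_sqmat a $ i $ j"
  by (simp add: times_sqmat.rep_eq sc.rep_eq mat_times_component)

lemma commuting_power_mult:
  assumes "x * z = z * (x :: 'a::monoid_mult)" shows "(x * z) ^ n = x ^ n * z ^ n"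
proof (induction n)
  case (Suc n)
  have "(x * z) ^ Suc n = x * (z * x ^ n) * z ^ n" by (simp add: Suc mult.assoc)
  also have "z * x ^ n = x ^ n * z" using power_commuting_commutes[OF assms] by simp
  finally show ?case by (simp add: mult.assoc)
qed simp

text \<open>The series is 1 plus y times a polynomial in y, hence 1 plus a nilpotent matrix.\<close>

lemma dt_unipotent_series:
  assumes "y ^ N = 0" "c 0 = 1"
  shows "dt (\<Sum>k<N. sc (c k) * y ^ k) = 1"
proof (cases N)
  case 0
  then show ?thesis using assms by simp
next
  case (Suc M)
  define z where "z = (\<Sum>k<M. sc (c (Suc k)) * y ^ k)"
  have yz: "y * z = z * y"
    by (simp add: z_def sum_distrib_left sum_distrib_right sc_left_commute[of y] mult.assoc power_commutes)
  have "(\<Sum>k<N. sc (c k) * y ^ k) = 1 + sc 1 * (y * z)"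
    unfolding Suc sum.lessThan_Suc_shift
    by (simp add: assms(2) z_def sum_distrib_left sc_left_commute[of y])
  moreover have "(y * z) ^ N = 0" by (simp add: commuting_power_mult[OF yz] assms(1))
  ultimately show ?thesis using dt_one_plus_nilpotent(1) by metis
qed

lemma series_poly_curve:
  assumes "polyfun f" "\<And>k. \<exists>p. \<forall>t. c t k = poly p t"
  shows "\<exists>p. \<forall>t. f (Rep_sqmat (\<Sum>k<N. sc (c t k) * y ^ k)) = poly p t"
proof (rule polyfun_poly_curve[OF assms(1)])
  fix i j
  obtain p where "\<And>k t. c t k = poly (p k) t" using assms(2) by metis
  then show "\<exists>p. \<forall>t. Rep_sqmat (\<Sum>k<N. sc (c t k) * y ^ k) $ i $ j = poly p t"
    by (intro exI[of _ "\<Sum>k<N. smult (Rep_sqmat (y ^ k) $ i $ j) (p k)"])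
      (simp add: Rep_sqmat_sum Rep_sqmat_sc_component poly_sum mult.commute)
qed

lemma zclosed_memI:
  assumes "zclosed Z" "det g \<noteq> 0" "\<And>f. polyfun f \<Longrightarrow> \<forall>z\<in>Z. f z = 0 \<Longrightarrow> f g = 0"
  shows "g \<in> Z"
proof -
  obtain I where I: "\<forall>f\<in>I. polyfun f" "Z = {g. invertible g \<and> (\<forall>f\<in>I. f g = 0)}"
    using assms(1) by (auto simp: zclosed_def)
  then show ?thesis using assms(2,3) by (auto simp: invertible_det_nz)
qed

text \<open>For f in the ideal of G the function f (exp (t X)) is polynomial in t. Its derivatives
  at 0 are the values at the identity of iterated derivatives of f along X, which lie in the ideal
  again.\<close>

lemma exp_nilpotent_in_group:
  fixes G :: "(('n::finite) cmat) set"
  assumes G: "alg_group G" and X: "X \<in> lie_algebra G" and nil: "Sq X ^ N = 0"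
  shows "Rep_sqmat (\<Sum>k<N. sc (t ^ k / fact k) * Sq X ^ k) \<in> G"
proof -
  define x where "x = Sq X"
  define E where "E t = (\<Sum>k<N. sc (t ^ k / fact k) * x ^ k)" for t
  have "N \<noteq> 0" using nil by (metis power_0 zero_neq_one)
  then obtain M where M: "N = Suc M" using not0_implies_Suc by blast
  have poly: "\<exists>p. \<forall>t. f (Rep_sqmat (E t)) = poly p t" if "polyfun f" for f
    unfolding E_def
  proof (rule series_poly_curve[OF that])
    fix k
    show "\<exists>p. \<forall>t::complex. t ^ k / fact k = poly p t"
      by (intro exI[of _ "monom (1 / fact k) k"]) (simp add: poly_monom)
  qed
  have E0: "Rep_sqmat (E 0) = mat 1"
    unfolding E_def M sum.lessThan_Suc_shift by (simp add: one_sqmat.rep_eq)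
  have Ex: "E t * x = (\<Sum>k<M. sc (t ^ k / fact k) * x ^ Suc k)" for t
    using nil by (simp add: E_def M distrib_right sum_distrib_right mult.assoc power_commutes flip: x_def)
  have E': "((\<lambda>t. Rep_sqmat (E t) $ i $ j) has_field_derivative (Rep_sqmat (E z) ** X) $ i $ j) (at z)" for i j z
  proof -
    have "((\<lambda>t. \<Sum>k<N. (t ^ k / fact k) * Rep_sqmat (x ^ k) $ i $ j) has_field_derivative
       (\<Sum>k<N. of_nat k * z ^ (k - 1) / fact k * Rep_sqmat (x ^ k) $ i $ j)) (at z)"
      by (intro DERIV_sum) (auto intro!: derivative_eq_intros)
    moreover have "(\<Sum>k<N. of_nat k * z ^ (k - 1) / fact k * Rep_sqmat (x ^ k) $ i $ j)
       = (\<Sum>k<M. z ^ k / fact k * Rep_sqmat (x ^ Suc k) $ i $ j)"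
      unfolding M sum.lessThan_Suc_shift by (simp del: power_Suc of_nat_Suc)
    moreover have "Rep_sqmat (E z) ** X = Rep_sqmat (E z * x)"
      by (simp add: times_sqmat.rep_eq x_def Sq_inverse)
    moreover have "Rep_sqmat (E z * x) $ i $ j = (\<Sum>k<M. z ^ k / fact k * Rep_sqmat (x ^ Suc k) $ i $ j)"
      by (simp only: Ex Rep_sqmat_sum sum_component Rep_sqmat_sc_component)
    moreover have "Rep_sqmat (E t) $ i $ j = (\<Sum>k<N. t ^ k / fact k * Rep_sqmat (x ^ k) $ i $ j)" for t
      by (simp only: E_def Rep_sqmat_sum sum_component Rep_sqmat_sc_component)
    ultimately show ?thesis by simp
  qed
  have "Rep_sqmat (E t) \<in> G"
  proof (rule zclosed_memI)
    show "zclosed G" using G by (simp add: alg_group_def)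
    have "dt (E t) = 1" unfolding E_def by (rule dt_unipotent_series) (use nil in \<open>simp_all add: x_def\<close>)
    then show "det (Rep_sqmat (E t)) \<noteq> 0" by (simp add: dt.rep_eq)
    \<comment> \<open>The induction varies f: the derivative of p is the polynomial that belongs to
      \<open>lderiv f X\<close>.\<close>
    have coeffs: "coeff p n = 0"
      if "polyfun f" "\<forall>g\<in>G. f g = 0" "\<forall>t. f (Rep_sqmat (E t)) = poly p t" for f p n
      using that
    proof (induction n arbitrary: f p)
      case 0
      then have "poly p 0 = 0" using E0 alg_groupD(1)[OF G] by metis
      then show ?case by (simp add: poly_0_coeff_0)
    next
      case (Suc n)
      have "((\<lambda>t. f (Rep_sqmat (E t))) has_field_derivative lderiv f X (Rep_sqmat (E z))) (at z)" for z
        using Suc.prems(1) E' by (rule lderiv_curve)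
      then have "(poly p has_field_derivative lderiv f X (Rep_sqmat (E z))) (at z)" for z
        using Suc.prems(3) by simp
      then have "\<forall>z. lderiv f X (Rep_sqmat (E z)) = poly (pderiv p) z"
        using poly_DERIV DERIV_unique by blast
      moreover have "\<forall>g\<in>G. lderiv f X g = 0"
        using lderiv_vanishes[OF G X] Suc.prems by blast
      ultimately have "coeff (pderiv p) n = 0"
        using Suc.IH polyfun_lderiv[OF Suc.prems(1)] by blast
      then show ?case by (simp add: coeff_pderiv del: of_nat_Suc)
    qed
    fix f assume f: "polyfun f" "\<forall>z\<in>G. f z = 0"
    then obtain p where p: "\<forall>t. f (Rep_sqmat (E t)) = poly p t" using poly by blast
    then have "p = 0" using coeffs[OF f] by (simp add: poly_eq_iff)
    then show "f (Rep_sqmat (E t)) = 0" using p by simp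
  qed
  then show ?thesis by (simp add: E_def x_def)
qed

text \<open>The curve u^t, by the binomial series in the nilpotent u - 1. Each f in the ideal of U
  gives a polynomial in t that vanishes at the natural numbers, where the curve passes through
  powers of u.\<close>

lemma unipotent_power_curve:
  fixes U :: "(('n::finite) cmat) set"
  assumes U: "alg_group U" and u: "u \<in> U" and nil: "(Sq u - 1) ^ N = 0"
  defines "c \<equiv> (\<lambda>t. Rep_sqmat (\<Sum>k<N. sc (t gchoose k) * (Sq u - 1) ^ k))"
  shows "c t \<in> U" "c 0 = mat 1" "c 1 = u" "\<And>f. polyfun f \<Longrightarrow> \<exists>p. \<forall>t. f (c t) = poly p t"
proof -
  define y where "y = Sq u - 1"
  define B where "B t = (\<Sum>k<N. sc (t gchoose k) * y ^ k)" for t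
  have c: "c t = Rep_sqmat (B t)" for t by (simp add: c_def B_def y_def)
  have "N \<noteq> 0" using nil by (metis power_0 zero_neq_one)
  then obtain M where M: "N = Suc M" using not0_implies_Suc by blast
  have poly: "\<exists>p. \<forall>t. f (c t) = poly p t" if "polyfun f" for f
    unfolding c B_def
  proof (rule series_poly_curve[OF that])
    fix k
    show "\<exists>p. \<forall>t::complex. t gchoose k = poly p t"
      by (intro exI[of _ "smult (1 / fact k) (\<Prod>i=0..<k. [:- of_nat i, 1:])"])
        (simp add: gbinomial_prod_rev poly_prod)
  qed
  then show "\<And>f. polyfun f \<Longrightarrow> \<exists>p. \<forall>t. f (c t) = poly p t" .
  have B0: "B 0 = 1"
    unfolding B_def M sum.lessThan_Suc_shift by simp
  have Bs: "B (t + 1) = B t * Sq u" for t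
  proof -
    have "B t * Sq u = B t + B t * y" by (simp add: y_def algebra_simps)
    also have "B t * y = (\<Sum>k<M. sc (t gchoose k) * y ^ Suc k)"
      using nil by (simp add: B_def M distrib_right sum_distrib_right mult.assoc power_commutes flip: y_def)
    also have "B t + \<dots> = 1 + (\<Sum>k<M. sc (t gchoose Suc k) * y ^ Suc k) + (\<Sum>k<M. sc (t gchoose k) * y ^ Suc k)"
      unfolding B_def M sum.lessThan_Suc_shift by simp
    also have "\<dots> = 1 + (\<Sum>k<M. sc ((t + 1) gchoose Suc k) * y ^ Suc k)"
      by (simp add: gbinomial_Suc_Suc sc_add distrib_right sum.distrib)
    also have "\<dots> = B (t + 1)" unfolding B_def M sum.lessThan_Suc_shift by simp
    finally show ?thesis ..
  qed
  show "c 0 = mat 1" by (simp add: c B0 one_sqmat.rep_eq)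
  show "c 1 = u" using Bs[of 0] by (simp add: c B0 Sq_inverse)
  have nat: "c (of_nat m) \<in> U" for m
  proof (induction m)
    case 0
    then show ?case using \<open>c 0 = mat 1\<close> alg_groupD(1)[OF U] by simp
  next
    case (Suc m)
    have "c (of_nat (Suc m)) = c (of_nat m) ** u"
      using Bs[of "of_nat m"] by (simp add: c times_sqmat.rep_eq Sq_inverse add.commute)
    then show ?case using Suc u alg_groupD(2)[OF U] by simp
  qed
  show "c t \<in> U"
  proof (rule zclosed_memI)
    show "zclosed U" using U by (simp add: alg_group_def)
    have "dt (B t) = 1" unfolding B_def by (rule dt_unipotent_series) (use nil in \<open>simp_all add: y_def\<close>)
    then show "det (c t) \<noteq> 0" by (simp add: c dt.rep_eq)
    fix f assume f: "polyfun f" "\<forall>z\<in>U. f z = 0"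
    obtain p where p: "\<forall>t. f (c t) = poly p t" using poly[OF f(1)] by blast
    have "range (of_nat :: nat \<Rightarrow> complex) \<subseteq> {t. poly p t = 0}"
      using f(2) nat by (auto simp flip: p[rule_format])
    moreover have "infinite (range (of_nat :: nat \<Rightarrow> complex))"
      by (rule range_inj_infinite) (rule inj_of_nat)
    ultimately have "p = 0" using poly_roots_finite[of p] finite_subset by blast
    then show "f (c t) = 0" using p by simp
  qed
qed

text \<open>The curve u^t joins 1 to u and pulls Zariski closed sets back to closed sets of the
  complex plane. As the plane is connected, 1 and u cannot be separated.\<close>

lemma zconnected_unipotent:
  fixes U :: "(('n::finite) cmat) set"
  assumes U: "alg_group U" and uni: "\<And>u. u \<in> U \<Longrightarrow> \<exists>N. (Sq u - 1) ^ N = 0"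
  shows "zconnected U"
proof -
  have False
    if AB: "zclosed A" "zclosed B" "B \<noteq> {}" "A \<inter> B = {}" "A \<union> B = U" and 1: "mat 1 \<in> A" for A B
  proof -
    obtain u where u: "u \<in> B" "u \<in> U" using AB by blast
    obtain N where N: "(Sq u - 1) ^ N = 0" using uni[OF u(2)] by blast
    define c where "c = (\<lambda>t. Rep_sqmat (\<Sum>k<N. sc (t gchoose k) * (Sq u - 1) ^ k))"
    have c: "c t \<in> U" "c 0 = mat 1" "c 1 = u" "polyfun f \<Longrightarrow> \<exists>p. \<forall>t. f (c t) = poly p t" for t f
      unfolding c_def by (fact unipotent_power_curve[OF U u(2) N])+
    have closed: "closed {t. c t \<in> Z}" if Z: "zclosed Z" for Z
    proof -
      obtain I where I: "\<forall>f\<in>I. polyfun f" "Z = {g. invertible g \<and> (\<forall>f\<in>I. f g = 0)}"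
        using Z by (auto simp: zclosed_def)
      have "invertible (c t)" for t
        using alg_groupD(4,5)[OF U c(1)] unfolding invertible_def by blast
      then have "{t. c t \<in> Z} = (\<Inter>f\<in>I. {t. f (c t) = 0})" using I(2) by auto
      moreover have "closed {t. f (c t) = 0}" if "f \<in> I" for f
      proof -
        have "polyfun f" using I(1) that by blast
        then obtain p where "\<forall>t. f (c t) = poly p t" using c(4)[of f] by (auto simp only:)
        then show ?thesis by (simp add: closed_Collect_eq continuous_on_poly)
      qed
      ultimately show ?thesis by auto
    qed
    have "connected (UNIV :: complex set)" by (rule connected_UNIV)
    moreover have "UNIV = {t. c t \<in> A} \<union> {t. c t \<in> B}" using c(1) AB(5) by blast
    moreover have "{t. c t \<in> A} \<inter> {t. c t \<in> B} = {}" using AB(4) by blast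
    moreover have "0 \<in> {t. c t \<in> A}" "1 \<in> {t. c t \<in> B}" using c(2,3) 1 u by auto
    ultimately show False
      using closed[OF AB(1)] closed[OF AB(2)] unfolding connected_closed by blast
  qed
  note step = this
  show ?thesis
    unfolding zconnected_def
  proof (intro notI, elim exE conjE)
    fix A B assume AB: "zclosed A" "zclosed B" "A \<noteq> {}" "B \<noteq> {}" "A \<inter> B = {}" "A \<union> B = U"
    then consider "mat 1 \<in> A" | "mat 1 \<in> B" using alg_groupD(1)[OF U] by blast
    then show False
      using step[of A B] step[of B A] AB by cases (auto simp: Int_commute Un_commute)
  qed
qed

text \<open>The elements in the radical of the trace form on the linear span of \<open>G\<close> form a normal
  unipotent subgroup.\<close>

lemma reductive_trace_radical_trivial:
  fixes G :: "(('n::finite) cmat) set"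
  assumes G: "connected_reductive G" and u: "u \<in> G" "\<And>h. h \<in> G \<Longrightarrow> trace (u ** h) = trace h"
  shows "u = mat 1"
proof -
  define U where "U = {u \<in> G. \<forall>h\<in>G. trace (u ** h) = trace h}"
  have ag: "alg_group G" using G by (simp add: connected_reductive_def)
  note gr = alg_groupD[OF ag]
  have UG: "U \<subseteq> G" by (auto simp: U_def)
  have "zclosed U"
  proof -
    obtain I where I: "\<forall>f\<in>I. polyfun f" "G = {g. invertible g \<and> (\<forall>f\<in>I. f g = 0)}"
      using ag by (auto simp: alg_group_def zclosed_def)
    \<comment> \<open>The trace conditions are polynomial in the group element, so U is Zariski
      closed.\<close>
    define J where "J = I \<union> (\<lambda>h g. trace (g ** h) + - trace h) ` G"
    have "polyfun (\<lambda>g. trace (g ** h) + - trace h)" for h :: "'n cmat"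
      by (intro polyfun.intros(3) polyfun_trace_times polyfun.intros(1))
    then have "\<forall>f\<in>J. polyfun f" using I(1) unfolding J_def by blast
    moreover have "(\<forall>f\<in>J. f g = 0) \<longleftrightarrow> (\<forall>f\<in>I. f g = 0) \<and> (\<forall>h\<in>G. trace (g ** h) = trace h)" for g
      by (simp add: J_def ball_Un)
    then have "U = {g. invertible g \<and> (\<forall>f\<in>J. f g = 0)}"
      unfolding U_def by (subst (1) I(2)) auto
    ultimately show ?thesis unfolding zclosed_def by blast
  qed
  have Umult: "v ** w \<in> U" if "v \<in> U" "w \<in> U" for v w
    using that gr(2) by (auto simp: U_def simp flip: matrix_mul_assoc)
  have Uinv: "matrix_inv v \<in> U" if v: "v \<in> U" for v
  proof -
    have "trace (matrix_inv v ** h) = trace h" if h: "h \<in> G" for h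
    proof -
      have vG: "v \<in> G" using v UG by blast
      then have "matrix_inv v ** h \<in> G" using gr h by blast
      then have "trace (v ** (matrix_inv v ** h)) = trace (matrix_inv v ** h)"
        using v by (simp add: U_def)
      then show ?thesis using gr(4)[OF vG] by (simp add: matrix_mul_assoc)
    qed
    then show ?thesis using v gr by (auto simp: U_def)
  qed
  have ag_U: "alg_group U"
    using \<open>zclosed U\<close> Umult Uinv gr(1) by (auto simp: alg_group_def U_def)
  have uni: "\<exists>N. (Sq v - 1) ^ N = 0" if v: "v \<in> U" for v
  proof (rule nilpotent_if_tr_powers)
    fix k :: nat assume "k > 0"
    have vG: "v \<in> G" using v UG by blast
    \<comment> \<open>One factor v - 1 turns the trace into a difference of those for v h and for h,
      and v h lies in G again; therefore h stays general.\<close>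
    have "tr ((Sq v - 1) ^ k * Sq h) = 0" if "h \<in> G" for h
      using \<open>k > 0\<close> that
    proof (induction k arbitrary: h rule: nat_induct_non_zero)
      case 1
      then show ?case using v
        by (simp add: left_diff_distrib tr_diff times_sqmat.abs_eq tr.abs_eq U_def)
    next
      case (Suc k)
      have "(Sq v - 1) ^ Suc k * Sq h = (Sq v - 1) ^ k * (Sq v * Sq h) - (Sq v - 1) ^ k * Sq h"
        by (simp only: power_Suc2 mult.assoc left_diff_distrib right_diff_distrib mult_1_left)
      then show ?case using Suc.IH[of h] Suc.IH[of "v ** h"] Suc.prems gr(2)[OF vG]
        by (simp add: tr_diff times_sqmat.abs_eq)
    qed
    from this[OF gr(1)] show "tr ((Sq v - 1) ^ k) = 0" by (simp flip: one_sqmat.abs_eq)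
  qed
  have "unipotent v" if "v \<in> U" for v
  proof -
    obtain N where N: "(Sq v - 1) ^ N = 0" using uni \<open>v \<in> U\<close> by blast
    have "(((**) (v - mat 1)) ^^ k) (mat 1) = Rep_sqmat ((Sq v - 1) ^ k)" for k
      by (induction k) (simp_all add: one_sqmat.rep_eq times_sqmat.rep_eq minus_sqmat.rep_eq Sq_inverse)
    then show ?thesis unfolding unipotent_def using N by (auto simp: zero_sqmat.rep_eq intro!: exI[of _ N])
  qed
  moreover have "g ** v ** matrix_inv g \<in> U" if g: "g \<in> G" and v: "v \<in> U" for g v
  proof -
    have "trace (g ** v ** matrix_inv g ** h) = trace h" if h: "h \<in> G" for h
    proof -
      have "trace (g ** v ** matrix_inv g ** h) = trace (v ** (matrix_inv g ** h ** g))"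
        using trace_mul_sym[of g "v ** matrix_inv g ** h"] by (simp add: matrix_mul_assoc)
      also have "\<dots> = trace (matrix_inv g ** h ** g)"
        using v gr g h by (simp add: U_def)
      also have "\<dots> = trace h"
        using trace_mul_sym[of "matrix_inv g ** h" g] gr(4)[OF g] by (simp add: matrix_mul_assoc)
      finally show ?thesis .
    qed
    then show ?thesis using gr g v by (auto simp: U_def)
  qed
  ultimately have "U = {mat 1}"
    using G ag_U zconnected_unipotent[OF ag_U uni] UG unfolding connected_reductive_def by blast
  moreover have "u \<in> U" using u by (simp add: U_def)
  ultimately show ?thesis by blast
qed

text \<open>Otherwise the one-parameter group \<open>exp (t X)\<close> would lie in that subgroup.\<close>

lemma reductive_bracket_radical:
  fixes G :: "(('n::finite) cmat) set"
  assumes G: "connected_reductive G" and HX: "H \<in> lie_algebra G" "X \<in> lie_algebra G" "X = H ** X - X ** H"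
    and tr0: "\<And>Y. Y \<in> lie_algebra G \<Longrightarrow> trace (X ** Y) = 0"
  shows "X = 0"
proof -
  have ag: "alg_group G" using G by (simp add: connected_reductive_def)
  define g where "g = Sq ` lie_algebra G"
  have g: "sc_subspace g"
    unfolding sc_subspace_def g_def
    by (auto simp: zero_sqmat.abs_eq plus_sqmat.abs_eq times_sqmat.abs_eq sc.abs_eq
        intro!: imageI lie_algebra_0 lie_algebra_add lie_algebra_scale)
  have br: "u * v - v * u \<in> g" if "u \<in> g" "v \<in> g" for u v
    using that lie_algebra_bracket[OF ag]
    by (auto simp: g_def times_sqmat.abs_eq minus_sqmat.abs_eq)
  have X: "Sq H \<in> g" "Sq X \<in> g" "Sq X = Sq H * Sq X - Sq X * Sq H"
    using HX by (simp_all add: g_def times_sqmat.abs_eq minus_sqmat.abs_eq)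
  have trX: "tr (Sq X * a) = 0" if "a \<in> g" for a
    using that tr0 by (auto simp: g_def times_sqmat.abs_eq tr.abs_eq)
  note rad = tr_bracket_radical[OF g br X trX]
  obtain N where N: "Sq X ^ N = 0" using rad(1) by blast
  define E where "E t = (\<Sum>k<N. sc (t ^ k / fact k) * Sq X ^ k)" for t
  have tr_pow: "tr (Sq X ^ k * Sq h) = 0" if h: "h \<in> G" and k: "k > 0" for h k
  proof (rule rad(2)[of "Sq h" "Sq (matrix_inv h)"])
    have h': "matrix_inv h \<in> G" "matrix_inv (matrix_inv h) = h"
      using alg_groupD[OF ag] h
      by (blast, metis alg_groupD(3-5)[OF ag] matrix_mul_assoc matrix_mul_lid matrix_mul_rid)
    show "Sq h * Sq (matrix_inv h) = 1" "Sq (matrix_inv h) * Sq h = 1"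
      using alg_groupD(4,5)[OF ag h] by (simp_all add: times_sqmat.abs_eq one_sqmat.abs_eq)
    show "Sq h * a * Sq (matrix_inv h) \<in> g \<and> Sq (matrix_inv h) * a * Sq h \<in> g" if "a \<in> g" for a
      using that lie_algebra_Ad[OF ag _ h] lie_algebra_Ad[OF ag _ h'(1)] h'(2)
      by (auto simp: g_def times_sqmat.abs_eq)
  qed (simp_all add: k)
  have "N \<noteq> 0" using N by (metis power_0 zero_neq_one)
  then obtain M where M: "N = Suc M" using not0_implies_Suc by blast
  have E1: "Rep_sqmat (E t) = mat 1" for t
  proof (rule reductive_trace_radical_trivial[OF G])
    show "Rep_sqmat (E t) \<in> G"
      unfolding E_def by (rule exp_nilpotent_in_group[OF ag HX(2) N])
    fix h assume h: "h \<in> G"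
    have "E t * Sq h = Sq h + (\<Sum>k<M. sc (t ^ Suc k / fact (Suc k)) * (Sq X ^ Suc k * Sq h))"
      unfolding E_def M sum.lessThan_Suc_shift
      by (simp add: distrib_right sum_distrib_right mult.assoc del: power_Suc)
    then have "tr (E t * Sq h) = tr (Sq h)"
      by (simp add: tr_add tr_sum tr_sc tr_pow[OF h] del: power_Suc)
    then show "trace (Rep_sqmat (E t) ** h) = trace h"
      by (simp add: tr.rep_eq times_sqmat.rep_eq Sq_inverse)
  qed
  have "X $ i $ j = 0" for i j
  proof -
    have "((\<lambda>t. \<Sum>k<N. (t ^ k / fact k) * Rep_sqmat (Sq X ^ k) $ i $ j) has_field_derivative
       (\<Sum>k<N. of_nat k * 0 ^ (k - 1) / fact k * Rep_sqmat (Sq X ^ k) $ i $ j)) (at 0)"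
      by (intro DERIV_sum) (auto intro!: derivative_eq_intros)
    moreover have "(\<Sum>k<N. (t ^ k / fact k) * Rep_sqmat (Sq X ^ k) $ i $ j) = mat 1 $ i $ j" for t
      using E1[of t] by (simp add: E_def Rep_sqmat_sum flip: Rep_sqmat_sc_component sum_component)
    ultimately have "((\<lambda>t. mat 1 $ i $ j) has_field_derivative
       (\<Sum>k<N. of_nat k * 0 ^ (k - 1) / fact k * Rep_sqmat (Sq X ^ k) $ i $ j)) (at (0 :: complex))"
      by (simp only:)
    from DERIV_unique[OF this DERIV_const]
    have "(\<Sum>k<N. of_nat k * 0 ^ (k - 1) / fact k * Rep_sqmat (Sq X ^ k) $ i $ j) = 0" .
    moreover have "(\<Sum>k<N. of_nat k * 0 ^ (k - 1) / fact k * Rep_sqmat (Sq X ^ k) $ i $ j)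
        = (\<Sum>k<N. if k = 1 then X $ i $ j else 0)"
      by (intro sum.cong) (auto simp: Sq_inverse power_0_left)
    \<comment> \<open>For N at most 1 the series has no linear term, but then X is 0 at
      once.\<close>
    ultimately have "N \<le> 1 \<or> X $ i $ j = 0" by (auto simp: sum.delta split: if_splits)
    moreover have "X = 0" if "N \<le> 1"
    proof -
      have "Sq X ^ 1 = 0" using that N M by (cases M) auto
      then show ?thesis by (metis Sq_inverse UNIV_I power_one_right zero_sqmat.rep_eq)
    qed
    ultimately show ?thesis by auto
  qed
  then show ?thesis by (simp add: vec_eq_iff)
qed

section \<open>Tori and roots\<close>

text \<open>Independence of characters in dual form: every function on a finite set of distinct
  characters is a combination of evaluations at points. The list L holds coefficients and
  points.\<close>

lemma character_interpolation:
  fixes unt :: 's and op :: "'s \<Rightarrow> 's \<Rightarrow> 's" and C :: "('s \<Rightarrow> complex) set"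
  assumes S: "unt \<in> S" "\<And>s t. s \<in> S \<Longrightarrow> t \<in> S \<Longrightarrow> op s t \<in> S" and C: "finite C"
    and mult: "\<And>x s t. x \<in> C \<Longrightarrow> s \<in> S \<Longrightarrow> t \<in> S \<Longrightarrow> x (op s t) = x s * x t"
    and one: "\<And>x. x \<in> C \<Longrightarrow> x unt = 1"
    and distinct: "\<And>x y. x \<in> C \<Longrightarrow> y \<in> C \<Longrightarrow> x \<noteq> y \<Longrightarrow> \<exists>s\<in>S. x s \<noteq> y s"
  shows "\<exists>L. snd ` set L \<subseteq> S \<and> (\<forall>x\<in>C. g x = (\<Sum>(b, s)\<leftarrow>L. b * x s))"
proof -
  have delta: "\<exists>L. snd ` set L \<subseteq> S \<and> (\<Sum>(b, s)\<leftarrow>L. b * x s) = 1 \<and> (\<forall>y\<in>D. (\<Sum>(b, s)\<leftarrow>L. b * y s) = 0)"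
    if x: "x \<in> C" and D: "finite D" "D \<subseteq> C - {x}" for x D
    using D
  proof (induction D rule: finite_induct)
    case empty
    then show ?case using S(1) one[OF x] by (intro exI[of _ "[(1, unt)]"]) simp
  next
    case (insert y D)
    then obtain L where L: "snd ` set L \<subseteq> S" "(\<Sum>(b, s)\<leftarrow>L. b * x s) = 1"
      "\<And>z. z \<in> D \<Longrightarrow> (\<Sum>(b, s)\<leftarrow>L. b * z s) = 0" by auto
    have y: "y \<in> C" "y \<noteq> x" using insert.prems by auto
    obtain t where t: "t \<in> S" "x t \<noteq> y t" using distinct[OF x y(1)] y(2) by metis
    \<comment> \<open>Translation by t minus the scalar y t, divided by x t - y t: this kills y and
      keeps the value 1 at x.\<close>
    define K where "K = map (\<lambda>(b, s). (b / (x t - y t), op s t)) L @ map (\<lambda>(b, s). (- b * y t / (x t - y t), s)) L"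
    have K: "(\<Sum>(b, s)\<leftarrow>K. b * z s) = (\<Sum>(b, s)\<leftarrow>L. b * z s) * (z t - y t) / (x t - y t)" if z: "z \<in> C" for z
    proof -
      have "(\<Sum>(b, s)\<leftarrow>map (\<lambda>(b, s). (b / (x t - y t), op s t)) L. b * z s)
          = (\<Sum>(b, s)\<leftarrow>L. b * z s) * z t / (x t - y t)"
        using L(1) t(1) z by (induction L) (auto simp: mult add_divide_distrib distrib_right)
      moreover have "(\<Sum>(b, s)\<leftarrow>map (\<lambda>(b, s). (- b * y t / (x t - y t), s)) L. b * z s)
          = - ((\<Sum>(b, s)\<leftarrow>L. b * z s) * y t / (x t - y t))"
        by (induction L) (auto simp: add_divide_distrib distrib_right)
      ultimately show ?thesis
        by (simp add: K_def right_diff_distrib diff_divide_distrib)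
    qed
    have "snd ` set K \<subseteq> S" using L(1) t(1) S(2) by (fastforce simp: K_def)
    moreover have "(\<Sum>(b, s)\<leftarrow>K. b * x s) = 1" using K[OF x] L(2) t(2) by simp
    moreover have "(\<Sum>(b, s)\<leftarrow>K. b * z s) = 0" if "z \<in> insert y D" for z
      using that K[of z] L(3) y insert.prems by auto
    ultimately show ?case by blast
  qed
  have "\<exists>L. snd ` set L \<subseteq> S \<and> (\<forall>x\<in>C. (if x \<in> D then g x else 0) = (\<Sum>(b, s)\<leftarrow>L. b * x s))"
    if "finite D" "D \<subseteq> C" for D
    using that
  proof (induction D rule: finite_induct)
    case empty
    then show ?case by (intro exI[of _ "[]"]) simp
  next
    case (insert y D)
    then obtain L where L: "snd ` set L \<subseteq> S"
      "\<And>x. x \<in> C \<Longrightarrow> (if x \<in> D then g x else 0) = (\<Sum>(b, s)\<leftarrow>L. b * x s)" by auto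
    obtain K where K: "snd ` set K \<subseteq> S" "(\<Sum>(b, s)\<leftarrow>K. b * y s) = 1"
      "\<And>x. x \<in> C - {y} \<Longrightarrow> (\<Sum>(b, s)\<leftarrow>K. b * x s) = 0"
      using delta[of y "C - {y}"] insert.prems C by auto
    define M where "M = L @ map (\<lambda>(b, s). (g y * b, s)) K"
    have "(\<Sum>(b, s)\<leftarrow>map (\<lambda>(b, s). (g y * b, s)) K. b * x s) = g y * (\<Sum>(b, s)\<leftarrow>K. b * x s)" for x
      by (induction K) (auto simp: algebra_simps)
    then have "(if x \<in> insert y D then g x else 0) = (\<Sum>(b, s)\<leftarrow>M. b * x s)" if "x \<in> C" for x
      using L(2)[OF that] K(2) K(3)[of x] that insert.hyps by (cases "x = y") (simp_all add: M_def)
    moreover have "snd ` set M \<subseteq> S" using L(1) K(1) by (force simp: M_def)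
    ultimately show ?case by blast
  qed
  from this[OF C order_refl] show ?thesis by auto
qed

definition diag_mat :: "('n \<Rightarrow> complex) \<Rightarrow> ('n::finite) cmat" where
  "diag_mat t = (\<chi> i j. if i = j then t i else 0)"

lemma diag_mat_component: "diag_mat t $ i $ j = (if i = j then t i else 0)"
  by (simp add: diag_mat_def)

lemma diag_mat_times_component: "(diag_mat t ** A) $ i $ j = t i * A $ i $ j"
  and times_diag_mat_component: "(A ** diag_mat t) $ i $ j = A $ i $ j * t j"
  by (simp_all add: matrix_matrix_mult_def diag_mat_component if_distrib[of "\<lambda>x. x * _"]
      if_distrib[of "\<lambda>x. _ * x"] sum.delta sum.delta' cong: if_cong)

text \<open>A polynomial in the diagonal entries, stored as a list of coefficients and exponent
  vectors. Repeated monomials are allowed, which makes sums and products immediate.\<close>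

lemma polyfun_diag:
  fixes A B :: "('n::finite) cmat"
  assumes "polyfun f"
  shows "\<exists>L :: (complex \<times> ('n \<Rightarrow> nat)) list. \<forall>t. f (A ** diag_mat t ** B) = (\<Sum>(c, m)\<leftarrow>L. c * (\<Prod>i\<in>UNIV. t i ^ m i))"
  using assms
proof induction
  case (1 c)
  then show ?case by (intro exI[of _ "[(c, \<lambda>_. 0)]"]) simp
next
  case (2 i j)
  have entry: "(A ** diag_mat t ** B) $ i $ j = (\<Sum>k\<in>UNIV. (A $ i $ k * B $ k $ j) * t k)" for t
    by (subst matrix_matrix_mult_def) (simp add: times_diag_mat_component mult_ac)
  obtain ks :: "'n list" where ks: "set ks = UNIV" "distinct ks"
    using finite_distinct_list[of "UNIV :: 'n set"] by auto
  have var: "(\<Prod>l\<in>UNIV. t l ^ (if l = k then 1 else 0)) = t k" for t :: "'n \<Rightarrow> complex" and k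
  proof -
    have "(\<Prod>l\<in>UNIV. t l ^ (if l = k then 1 else 0)) = (\<Prod>l\<in>UNIV. if l = k then t l else 1)"
      by (intro prod.cong) auto
    then show ?thesis by simp
  qed
  have "(A ** diag_mat t ** B) $ i $ j
      = (\<Sum>(c, m)\<leftarrow>map (\<lambda>k. (A $ i $ k * B $ k $ j, \<lambda>l. if l = k then 1 else 0)) ks. c * (\<Prod>l\<in>UNIV. t l ^ m l))" for t
    by (simp only: map_map o_def split_conv sum_list_distinct_conv_sum_set[OF ks(2)] ks(1) entry var)
  then show ?case by blast
next
  case (3 f h)
  then obtain K L :: "(complex \<times> ('n \<Rightarrow> nat)) list"
    where "\<forall>t. f (A ** diag_mat t ** B) = (\<Sum>(c, m)\<leftarrow>K. c * (\<Prod>i\<in>UNIV. t i ^ m i))"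
      "\<forall>t. h (A ** diag_mat t ** B) = (\<Sum>(c, m)\<leftarrow>L. c * (\<Prod>i\<in>UNIV. t i ^ m i))" by blast
  then show ?case by (intro exI[of _ "K @ L"]) simp
next
  case (4 f h)
  then obtain K L :: "(complex \<times> ('n \<Rightarrow> nat)) list"
    where KL: "\<forall>t. f (A ** diag_mat t ** B) = (\<Sum>(c, m)\<leftarrow>K. c * (\<Prod>i\<in>UNIV. t i ^ m i))"
      "\<forall>t. h (A ** diag_mat t ** B) = (\<Sum>(c, m)\<leftarrow>L. c * (\<Prod>i\<in>UNIV. t i ^ m i))" by blast
  define M where "M = concat (map (\<lambda>(c, m). map (\<lambda>(c', m'). (c * c', \<lambda>i. m i + m' i)) L) K)"
  have "(\<Sum>(c', m')\<leftarrow>map (\<lambda>(c', m'). (c * c', \<lambda>i. m i + m' i)) L. c' * (\<Prod>i\<in>UNIV. t i ^ m' i))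
     = c * (\<Prod>i\<in>UNIV. t i ^ m i) * (\<Sum>(c, m)\<leftarrow>L. c * (\<Prod>i\<in>UNIV. t i ^ m i))" for t c m
    by (induction L) (auto simp: algebra_simps power_add prod.distrib)
  then have "(\<Sum>(c, m)\<leftarrow>M. c * (\<Prod>i\<in>UNIV. t i ^ m i))
     = (\<Sum>(c, m)\<leftarrow>K. c * (\<Prod>i\<in>UNIV. t i ^ m i)) * (\<Sum>(c, m)\<leftarrow>L. c * (\<Prod>i\<in>UNIV. t i ^ m i))" for t
    unfolding M_def by (induction K) (auto simp: algebra_simps)
  then show ?case using KL by (intro exI[of _ M]) simp
qed

lemma rational_functional:
  fixes V :: "(rat ^ 'n::finite) set"
  assumes V: "vec.subspace V" and e: "e \<notin> V"
  obtains l :: "'n \<Rightarrow> rat" where "\<And>x. x \<in> V \<Longrightarrow> (\<Sum>i\<in>UNIV. x $ i * l i) = 0" "(\<Sum>i\<in>UNIV. e $ i * l i) = 1"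
proof -
  obtain B where B: "B \<subseteq> V" "vec.independent B" "V \<subseteq> vec.span B"
    using vec.basis_exists[of V] by metis
  have "vec.span B \<subseteq> V" using B(1) V by (rule vec.span_minimal)
  then have "e \<notin> vec.span B" using e by blast
  then have "vec.independent (insert e B)" using B(2) by (simp add: vec.independent_insert)
  then obtain g :: "rat ^ 'n \<Rightarrow> rat ^ 'n"
    where g: "Vector_Spaces.linear (*s) (*s) g" "\<And>x. x \<in> insert e B \<Longrightarrow> g x = (if x = e then (\<chi> i. 1) else 0)"
    using vec.linear_independent_extend[of "insert e B" "\<lambda>x. if x = e then (\<chi> i. 1) else 0"] by blast
  interpret g: Vector_Spaces.linear "(*s)" "(*s)" g by (rule g(1))
  \<comment> \<open>Since e is sent to the vector with all entries 1, every coordinate of g is a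
    functional with value 1 at e.\<close>
  define k :: 'n where "k = undefined"
  define l where "l i = g (axis i 1) $ k" for i
  have gl: "g x $ k = (\<Sum>i\<in>UNIV. x $ i * l i)" for x
  proof -
    have "g x = g (\<Sum>i\<in>UNIV. x $ i *s axis i 1)" by (simp add: basis_expansion)
    also have "\<dots> = (\<Sum>i\<in>UNIV. x $ i *s g (axis i 1))" by (simp add: g.sum g.scale)
    finally show ?thesis by (simp add: l_def)
  qed
  have "g x = 0" if "x \<in> vec.span B" for x
  proof (rule g.eq_0_on_span[OF _ that])
    fix b assume "b \<in> B"
    then show "g b = 0" using g(2)[of b] \<open>e \<notin> vec.span B\<close> vec.span_base by force
  qed
  then have "(\<Sum>i\<in>UNIV. x $ i * l i) = 0" if "x \<in> V" for x
    using that B(3) gl[of x] by auto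
  moreover have "(\<Sum>i\<in>UNIV. e $ i * l i) = 1" using gl[of e] g(2)[of e] by simp
  ultimately show ?thesis using that by blast
qed

section \<open>Weights of a simultaneously diagonalizable group\<close>

locale diagonal_group =
  fixes S :: "(('n::finite) cmat) set" and P Q :: "'n cmat"
  assumes S: "alg_group S" and PQ: "P ** Q = mat 1" "Q ** P = mat 1"
    and diag: "\<And>s i j. s \<in> S \<Longrightarrow> i \<noteq> j \<Longrightarrow> (P ** s ** Q) $ i $ j = 0"
begin

definition dg :: "'n \<Rightarrow> 'n cmat \<Rightarrow> complex" where
  "dg i s = (P ** s ** Q) $ i $ i"

text \<open>The weight of S, acting by conjugation, on the matrix unit (i, j) of the diagonalizing
  basis; the value 1 outside S follows the convention of \<open>chars\<close>.\<close>

definition wt :: "'n \<Rightarrow> 'n \<Rightarrow> 'n chr" where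
  "wt i j s = (if s \<in> S then dg i s / dg j s else 1)"

lemma conj_mult: "P ** (A ** B) ** Q = (P ** A ** Q) ** (P ** B ** Q)"
  using PQ(2) by (metis matrix_mul_assoc matrix_mul_rid)

lemma conj_cancel: "Q ** (P ** A ** Q) ** P = A"
  using PQ(2) by (metis matrix_mul_assoc matrix_mul_rid matrix_mul_lid)

lemma conj_cancel': "P ** (Q ** A ** P) ** Q = A"
  using PQ(1) by (metis matrix_mul_assoc matrix_mul_rid matrix_mul_lid)

lemma conj_diag: "s \<in> S \<Longrightarrow> P ** s ** Q = diag_mat (\<lambda>i. dg i s)"
  using diag by (auto simp: vec_eq_iff diag_mat_component dg_def)

lemma diag_form: "s \<in> S \<Longrightarrow> Q ** diag_mat (\<lambda>i. dg i s) ** P = s"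
  by (metis conj_diag conj_cancel)

lemma dg_mult: "s \<in> S \<Longrightarrow> t \<in> S \<Longrightarrow> dg i (s ** t) = dg i s * dg i t"
  by (simp add: dg_def[of i "s ** t"] conj_mult[of s t] conj_diag diag_mat_times_component
      diag_mat_component)

lemma dg_1: "dg i (mat 1) = 1"
  by (simp add: dg_def PQ(1)) (simp add: mat_def)

lemma dg_inv: "s \<in> S \<Longrightarrow> dg i s * dg i (matrix_inv s) = 1"
  using dg_mult[of s "matrix_inv s" i] alg_groupD[OF S] dg_1 by metis

lemma dg_nonzero: "s \<in> S \<Longrightarrow> dg i s \<noteq> 0"
  using dg_inv[of s i] by auto

lemma commutative: "s \<in> S \<Longrightarrow> t \<in> S \<Longrightarrow> s ** t = t ** s"
proof -
  assume "s \<in> S" "t \<in> S"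
  then have "P ** (s ** t) ** Q = P ** (t ** s) ** Q"
    by (simp only: conj_mult) (simp add: conj_diag vec_eq_iff diag_mat_times_component diag_mat_component)
  then show ?thesis by (metis conj_cancel)
qed

lemma polyfun_dg: "polyfun (dg i)"
proof -
  have "polyfun (\<lambda>g. g $ i $ i)" by (rule polyfun.intros)
  from polyfun_conjugate[OF this, of P Q] show ?thesis by (simp add: dg_def[abs_def])
qed

lemma det_eq_prod_dg: "s \<in> S \<Longrightarrow> det s = (\<Prod>i\<in>UNIV. dg i s)"
proof -
  assume s: "s \<in> S"
  have "det P * det Q = 1" using PQ(1) by (metis det_mul det_I)
  then have "det s = det (P ** s ** Q)" by (simp add: det_mul mult_ac)
  also have "\<dots> = (\<Prod>i\<in>UNIV. (P ** s ** Q) $ i $ i)" using diag[OF s] by (intro det_diagonal) auto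
  finally show ?thesis by (simp add: dg_def)
qed

text \<open>The inverse of the j-th diagonal entry is the product of the others divided by det,
  which is the form required in \<open>chars\<close>.\<close>

lemma wt_in_chars: "wt i j \<in> chars S"
proof -
  have "polyfun (\<lambda>s. dg i s * (\<Prod>k\<in>UNIV - {j}. dg k s))"
    by (intro polyfun.intros(4) polyfun_prod polyfun_dg)
  moreover have "wt i j s = (dg i s * (\<Prod>k\<in>UNIV - {j}. dg k s)) / det s ^ 1" if s: "s \<in> S" for s
  proof -
    have "(\<Prod>k\<in>UNIV. dg k s) = dg j s * (\<Prod>k\<in>UNIV - {j}. dg k s)"
      by (rule prod.remove) auto
    moreover have "(\<Prod>k\<in>UNIV - {j}. dg k s) \<noteq> 0" using dg_nonzero[OF s] by simp
    ultimately show ?thesis using s dg_nonzero[OF s] by (simp add: wt_def det_eq_prod_dg)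
  qed
  ultimately have "\<exists>f k. polyfun f \<and> (\<forall>s\<in>S. wt i j s = f s / det s ^ k)" by blast
  then show ?thesis
    using alg_groupD(2)[OF S] by (auto simp: chars_def wt_def dg_nonzero dg_mult)
qed

lemma conj_action:
  assumes s: "s \<in> S"
  shows "(P ** (s ** A ** matrix_inv s) ** Q) $ i $ j = wt i j s * (P ** A ** Q) $ i $ j"
proof -
  have s': "matrix_inv s \<in> S" using alg_groupD(3)[OF S s] .
  have "dg j (matrix_inv s) = 1 / dg j s" using dg_inv[OF s, of j] dg_nonzero[OF s] by (simp add: field_simps)
  then show ?thesis
    using s s' by (simp add: conj_mult conj_diag diag_mat_times_component times_diag_mat_component wt_def)
qed

lemma weight_iff:
  assumes s: "s \<in> S"
  shows "s ** A ** matrix_inv s = mat c ** A \<longleftrightarrow> (\<forall>i j. wt i j s * (P ** A ** Q) $ i $ j = c * (P ** A ** Q) $ i $ j)"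
proof -
  have "s ** A ** matrix_inv s = mat c ** A \<longleftrightarrow>
      P ** (s ** A ** matrix_inv s) ** Q = P ** (mat c ** A) ** Q"
    by (metis conj_cancel)
  moreover have "P ** (mat c ** A) ** Q = mat c ** (P ** A ** Q)"
    by (metis mat_commute matrix_mul_assoc)
  ultimately show ?thesis
    by (simp add: vec_eq_iff conj_action[OF s] mat_times_component)
qed

lemma root_weight:
  assumes "\<forall>s\<in>S. s ** A ** matrix_inv s = mat (x s) ** A" "\<forall>s. s \<notin> S \<longrightarrow> x s = 1"
    "(P ** A ** Q) $ i $ j \<noteq> 0"
  shows "x = wt i j"
proof
  fix s
  show "x s = wt i j s"
  proof (cases "s \<in> S")
    case True
    then have "wt i j s * (P ** A ** Q) $ i $ j = x s * (P ** A ** Q) $ i $ j"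
      using assms(1) weight_iff by blast
    then show ?thesis using assms(3) by simp
  qed (use assms(2) in \<open>simp add: wt_def\<close>)
qed

text \<open>A nonzero entry of a root vector in the diagonalizing basis determines its weight. In
  particular there are finitely many roots.\<close>

lemma roots_subset: "roots G S \<subseteq> (\<lambda>(i, j). wt i j) ` UNIV"
proof
  fix x assume "x \<in> roots G S"
  then obtain A where A: "A \<noteq> 0" "\<forall>s\<in>S. s ** A ** matrix_inv s = mat (x s) ** A"
    and x: "\<forall>s. s \<notin> S \<longrightarrow> x s = 1"
    by (auto simp: roots_def chars_def)
  have "P ** A ** Q \<noteq> 0" using A(1) conj_cancel[of A] by (metis matrix_mul_assoc times0_left times0_right)
  then obtain i j where "(P ** A ** Q) $ i $ j \<noteq> 0" by (auto simp: vec_eq_iff)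
  from root_weight[OF A(2) x this] show "x \<in> (\<lambda>(i, j). wt i j) ` UNIV" by auto
qed

text \<open>By independence of characters the projection to a weight space is a linear combination
  of conjugations by elements of S, and each of these preserves the Lie algebra.\<close>

lemma lie_algebra_weight_component:
  assumes G: "alg_group G" and SG: "S \<subseteq> G" and Y: "Y \<in> lie_algebra G"
  shows "Q ** (\<chi> i j. if wt i j = x then (P ** Y ** Q) $ i $ j else 0) ** P \<in> lie_algebra G"
proof -
  define C where "C = (\<lambda>(i, j). wt i j) ` UNIV"
  have C1: "wt i j \<in> C" for i j unfolding C_def by (metis UNIV_I case_prod_conv image_eqI)
  have "\<exists>L. snd ` set L \<subseteq> S \<and> (\<forall>y\<in>C. (if y = x then 1 else 0) = (\<Sum>(b, s)\<leftarrow>L. b * y s))"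
  proof (rule character_interpolation[where op = "(**)" and unt = "mat 1"])
    show "mat 1 \<in> S" "\<And>s t. s \<in> S \<Longrightarrow> t \<in> S \<Longrightarrow> s ** t \<in> S" using alg_groupD[OF S] by auto
    show "finite C" by (simp add: C_def)
    show "y (s ** t) = y s * y t" if "y \<in> C" "s \<in> S" "t \<in> S" for y s t
      using that wt_in_chars by (auto simp: C_def chars_def)
    show "y (mat 1) = 1" if "y \<in> C" for y
      using that by (auto simp: C_def wt_def dg_1)
    show "\<exists>s\<in>S. y s \<noteq> z s" if "y \<in> C" "z \<in> C" "y \<noteq> z" for y z
      using that by (auto simp: C_def wt_def fun_eq_iff split: if_splits)
  qed
  then obtain L where L: "snd ` set L \<subseteq> S"
    "\<And>y. y \<in> C \<Longrightarrow> (if y = x then 1 else 0) = (\<Sum>(b, s)\<leftarrow>L. b * y s)" by blast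
  define Z :: "(complex \<times> 'n cmat) list \<Rightarrow> 'n cmat" where "Z K = (\<Sum>(b, s)\<leftarrow>K. mat b ** (s ** Y ** matrix_inv s))" for K
  have "snd ` set K \<subseteq> S \<Longrightarrow> Z K \<in> lie_algebra G" for K
    by (induction K) (use SG in \<open>auto simp: Z_def intro!: lie_algebra_0 lie_algebra_add lie_algebra_scale lie_algebra_Ad[OF G Y]\<close>)
  moreover have "snd ` set K \<subseteq> S \<Longrightarrow>
     (P ** Z K ** Q) $ i $ j = (\<Sum>(b, s)\<leftarrow>K. b * wt i j s) * (P ** Y ** Q) $ i $ j" for K i j
  proof (induction K)
    case Nil
    then show ?case by (simp add: Z_def times0_left times0_right)
  next
    case (Cons a K)
    obtain b s where a: "a = (b, s)" by force
    have "P ** Z (a # K) ** Q = mat b ** (P ** (s ** Y ** matrix_inv s) ** Q) + P ** Z K ** Q"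
      unfolding Z_def a
      by (simp add: matrix_add_ldistrib matrix_add_rdistrib' matrix_mul_assoc mat_commute[of P])
    then show ?case using Cons a
      by (simp add: mat_times_component conj_action distrib_right mult.assoc)
  qed
  moreover have "(\<Sum>(b, s)\<leftarrow>L. b * wt i j s) = (if wt i j = x then 1 else 0)" for i j
    using L(2)[OF C1] by simp
  ultimately have "Z L \<in> lie_algebra G"
    "P ** Z L ** Q = (\<chi> i j. if wt i j = x then (P ** Y ** Q) $ i $ j else 0)"
    using L(1) by (simp_all add: vec_eq_iff)
  then show ?thesis by (metis conj_cancel)
qed

end

context diagonal_group begin

text \<open>A pair of exponent vectors, not their difference, because the monomials of a polynomial
  have nonnegative exponents.\<close>

definition relation :: "('n \<Rightarrow> nat) \<Rightarrow> ('n \<Rightarrow> nat) \<Rightarrow> bool" where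
  "relation m m' \<longleftrightarrow> (\<forall>s\<in>S. (\<Prod>i\<in>UNIV. dg i s ^ m i) = (\<Prod>i\<in>UNIV. dg i s ^ m' i))"

text \<open>A vector that is orthogonal to all multiplicative relations among the diagonal entries
  defines an element of the Lie algebra.\<close>

lemma diagonal_in_lie_algebra:
  assumes SG: "S \<subseteq> G"
    and l: "\<And>m m'. relation m m' \<Longrightarrow> (\<Sum>i\<in>UNIV. of_nat (m i) * l i) = (\<Sum>i\<in>UNIV. of_nat (m' i) * l i)"
  shows "Q ** diag_mat l ** P \<in> lie_algebra G"
  unfolding lie_algebra_def
proof (intro CollectI allI impI, elim conjE)
  fix f assume f: "polyfun f" "\<forall>g\<in>G. f g = 0"
  obtain L :: "(complex \<times> ('n \<Rightarrow> nat)) list"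
    where L: "\<And>t. f (Q ** diag_mat t ** P) = (\<Sum>(c, m)\<leftarrow>L. c * (\<Prod>i\<in>UNIV. t i ^ m i))"
    using polyfun_diag[OF f(1)] by blast
  define mon where "mon m s = (if s \<in> S then \<Prod>i\<in>UNIV. dg i s ^ m i else 1)" for m s
  define C where "C = mon ` snd ` set L"
  \<comment> \<open>The linear form l on exponents, transported to the functions that the monomials
    induce on S; it is well defined there because l respects relations.\<close>
  define w where "w y = (\<Sum>i\<in>UNIV. of_nat ((SOME m. mon m = y) i) * l i)" for y
  have rel_mon: "relation m m'" if "mon m = mon m'" for m m'
    unfolding relation_def
  proof
    fix s assume "s \<in> S"
    with fun_cong[OF that, of s] show "(\<Prod>i\<in>UNIV. dg i s ^ m i) = (\<Prod>i\<in>UNIV. dg i s ^ m' i)"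
      by (simp add: mon_def)
  qed
  have w: "w (mon m) = (\<Sum>i\<in>UNIV. of_nat (m i) * l i)" for m
  proof -
    have "mon (SOME m'. mon m' = mon m) = mon m" by (rule someI[of "\<lambda>m'. mon m' = mon m" m]) (rule refl)
    then have "relation (SOME m'. mon m' = mon m) m" by (rule rel_mon)
    from l[OF this] show ?thesis by (simp add: w_def)
  qed
  \<comment> \<open>Interpolation writes w as a combination of evaluations at points of S. The
    derivative of f along the diagonal matrix becomes the same combination of values of f on S,
    which vanish.\<close>
  have "\<exists>K. snd ` set K \<subseteq> S \<and> (\<forall>y\<in>C. w y = (\<Sum>(b, s)\<leftarrow>K. b * y s))"
  proof (rule character_interpolation[where op = "(**)" and unt = "mat 1"])
    show "mat 1 \<in> S" "\<And>s t. s \<in> S \<Longrightarrow> t \<in> S \<Longrightarrow> s ** t \<in> S" using alg_groupD[OF S] by auto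
    show "finite C" by (simp add: C_def)
    show "y (s ** t) = y s * y t" if "y \<in> C" "s \<in> S" "t \<in> S" for y s t
      using that alg_groupD(2)[OF S] by (auto simp: C_def mon_def dg_mult power_mult_distrib prod.distrib)
    show "y (mat 1) = 1" if "y \<in> C" for y
      using that by (auto simp: C_def mon_def dg_1)
    show "\<exists>s\<in>S. y s \<noteq> z s" if "y \<in> C" "z \<in> C" "y \<noteq> z" for y z
      using that by (auto simp: C_def mon_def fun_eq_iff split: if_splits)
  qed
  then obtain K where K: "snd ` set K \<subseteq> S" "\<And>y. y \<in> C \<Longrightarrow> w y = (\<Sum>(b, s)\<leftarrow>K. b * y s)" by blast
  have f0: "(\<Sum>(c, m)\<leftarrow>L. c * mon m s) = 0" if s: "s \<in> S" for s
    using L[of "\<lambda>i. dg i s"] f(2) s SG by (auto simp: diag_form mon_def)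
  have swap: "(\<Sum>(c, m)\<leftarrow>L. c * (\<Sum>(b, s)\<leftarrow>K. b * mon m s)) = (\<Sum>(b, s)\<leftarrow>K. b * (\<Sum>(c, m)\<leftarrow>L. c * mon m s))"
  proof (induction K)
    case (Cons a K)
    obtain b s where "a = (b, s)" by force
    then have "(\<Sum>(c, m)\<leftarrow>L. c * (\<Sum>(b, s)\<leftarrow>a # K. b * mon m s))
        = (\<Sum>(c, m)\<leftarrow>L. b * (c * mon m s) + c * (\<Sum>(b, s)\<leftarrow>K. b * mon m s))"
      by (simp add: algebra_simps split_def)
    also have "\<dots> = b * (\<Sum>(c, m)\<leftarrow>L. c * mon m s) + (\<Sum>(c, m)\<leftarrow>L. c * (\<Sum>(b, s)\<leftarrow>K. b * mon m s))"
      by (simp add: split_def sum_list_addf sum_list_const_mult)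
    finally show ?case using Cons \<open>a = (b, s)\<close> by simp
  qed (simp add: split_def)
  have "(\<Sum>(c, m)\<leftarrow>L. c * (\<Sum>i\<in>UNIV. of_nat (m i) * l i)) = (\<Sum>(c, m)\<leftarrow>L. c * (\<Sum>(b, s)\<leftarrow>K. b * mon m s))"
  proof (rule arg_cong[of _ _ sum_list], rule map_cong[OF refl])
    fix a assume a: "a \<in> set L"
    then have "mon (snd a) \<in> C" by (simp add: C_def)
    from K(2)[OF this] show "(case a of (c, m) \<Rightarrow> c * (\<Sum>i\<in>UNIV. of_nat (m i) * l i))
        = (case a of (c, m) \<Rightarrow> c * (\<Sum>(b, s)\<leftarrow>K. b * mon m s))"
      by (simp add: split_def w)
  qed
  also have "\<dots> = 0"
    unfolding swap
  proof -
    have "snd ` set K' \<subseteq> S \<Longrightarrow> (\<Sum>(b, s)\<leftarrow>K'. b * (\<Sum>(c, m)\<leftarrow>L. c * mon m s)) = 0" for K'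
      by (induction K') (auto simp: f0)
    from this[OF K(1)] show "(\<Sum>(b, s)\<leftarrow>K. b * (\<Sum>(c, m)\<leftarrow>L. c * mon m s)) = 0" .
  qed
  finally have zero: "(\<Sum>(c, m)\<leftarrow>L. c * (\<Sum>i\<in>UNIV. of_nat (m i) * l i)) = 0" .
  have eq: "mat 1 + mat t ** (Q ** diag_mat l ** P) = Q ** diag_mat (\<lambda>i. 1 + t * l i) ** P" for t
  proof -
    have "diag_mat (\<lambda>i. 1 + t * l i) = mat 1 + mat t ** diag_mat l"
      by (simp add: vec_eq_iff diag_mat_component mat_times_component) (simp add: mat_def)
    then show ?thesis
      using PQ(2) by (simp add: matrix_add_ldistrib matrix_add_rdistrib' matrix_mul_assoc mat_commute[of Q])
  qed
  have mono: "((\<lambda>t. \<Prod>i\<in>UNIV. (1 + t * l i) ^ m i) has_field_derivative (\<Sum>i\<in>UNIV. of_nat (m i) * l i)) (at 0)" for m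
  proof -
    have "((\<lambda>t. \<Prod>i\<in>UNIV. (1 + t * l i) ^ m i) has_field_derivative
      (\<Sum>i\<in>UNIV. (of_nat (m i) * l i) * (\<Prod>k\<in>UNIV - {i}. (1 + 0 * l k) ^ m k))) (at 0)"
      by (rule has_field_derivative_prod) (auto intro!: derivative_eq_intros)
    then show ?thesis by simp
  qed
  have "((\<lambda>t. \<Sum>(c, m)\<leftarrow>M. c * (\<Prod>i\<in>UNIV. (1 + t * l i) ^ m i)) has_field_derivative
     (\<Sum>(c, m)\<leftarrow>M. c * (\<Sum>i\<in>UNIV. of_nat (m i) * l i))) (at 0)" for M
    by (induction M) (auto simp: split_def intro!: DERIV_add DERIV_cmult mono)
  from this[of L] show "((\<lambda>t. f (mat 1 + mat t ** (Q ** diag_mat l ** P))) has_field_derivative 0) (at 0)"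
    unfolding eq L zero .
qed

text \<open>If no power of the weight is trivial, the difference of the basis vectors a and b lies
  outside the rational span of the relations. A rational form that kills the relations and is 1 on
  this difference gives a diagonal H whose bracket is the identity on the weight space.\<close>

lemma exists_derivation:
  assumes SG: "S \<subseteq> G" and ab: "\<And>N. N > 0 \<Longrightarrow> \<exists>s\<in>S. wt a b s ^ N \<noteq> 1"
  obtains H where "H \<in> lie_algebra G" "\<And>A. (\<And>i j. (P ** A ** Q) $ i $ j \<noteq> 0 \<Longrightarrow> wt i j = wt a b) \<Longrightarrow> H ** A - A ** H = A"
proof -
  \<comment> \<open>The rational span of the relations, with a common denominator N cleared so that
    membership speaks of natural exponents.\<close>
  define V :: "(rat ^ 'n) set" where
    "V = {x. \<exists>N>0. \<exists>m m'. relation m m' \<and> (\<forall>i. of_nat N * x $ i = of_nat (m i) - of_nat (m' i))}"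
  have sym: "relation m' m" if "relation m m'" for m m' using that by (simp add: relation_def)
  have scale: "relation (\<lambda>i. N * m i) (\<lambda>i. N * m' i)" if "relation m m'" for N m m'
    using that by (auto simp: relation_def mult.commute[of N] power_mult prod_power_distrib[symmetric])
  have plus: "relation (\<lambda>i. m i + k i) (\<lambda>i. m' i + k' i)" if "relation m m'" "relation k k'" for m m' k k'
    using that by (auto simp: relation_def power_add prod.distrib)
  have "vec.subspace V"
    unfolding vec.subspace_def
  proof (intro conjI ballI allI)
    have "relation (\<lambda>_. 0) (\<lambda>_. 0)" by (simp add: relation_def)
    then show "0 \<in> V" unfolding V_def by (intro CollectI exI[of _ 1]) force
  next
    fix x y assume "x \<in> V" "y \<in> V"
    then obtain N m m' M k k' where *: "N > 0" "relation m m'" "\<And>i. of_nat N * x $ i = of_nat (m i) - of_nat (m' i)"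
      "M > 0" "relation k k'" "\<And>i. of_nat M * y $ i = of_nat (k i) - of_nat (k' i)"
      unfolding V_def by blast
    have "of_nat (N * M) * (x + y) $ i = of_nat (M * m i + N * k i) - of_nat (M * m' i + N * k' i)" for i
    proof -
      have "of_nat (N * M) * (x + y) $ i = of_nat M * (of_nat N * x $ i) + of_nat N * (of_nat M * y $ i)"
        by (simp add: algebra_simps)
      then show ?thesis by (simp only: *) (simp add: algebra_simps)
    qed
    moreover have "relation (\<lambda>i. M * m i + N * k i) (\<lambda>i. M * m' i + N * k' i)"
      by (intro plus scale *)
    ultimately show "x + y \<in> V" unfolding V_def using *(1,4)
      by (intro CollectI exI[of _ "N * M"]) fastforce
  next
    fix c :: rat and x :: "rat ^ 'n" assume "x \<in> V"
    then obtain N m m' where *: "N > 0" "relation m m'" "\<And>i. of_nat N * x $ i = of_nat (m i) - of_nat (m' i)"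
      unfolding V_def by blast
    obtain p q where "c = Rat.Fract p q" "q > 0" by (cases c) auto
    then have pq: "c = of_int p / of_int q" "q > 0" by (simp_all add: Fract_of_int_quotient)
    have cx: "of_nat (N * nat q) * (c *s x) $ i = of_int p * (of_nat (m i) - of_nat (m' i))" for i
    proof -
      have "of_nat (N * nat q) * (c *s x) $ i = of_int p * (of_nat N * x $ i)"
        using pq by (simp add: field_simps)
      then show ?thesis by (simp only: *)
    qed
    show "c *s x \<in> V"
    proof (cases "p \<ge> 0")
      case True
      then have "of_nat (N * nat q) * (c *s x) $ i = of_nat (nat p * m i) - of_nat (nat p * m' i)" for i
        unfolding cx by (simp add: algebra_simps)
      then show ?thesis unfolding V_def using *(1) pq(2) scale[OF *(2)]
        by (intro CollectI exI[of _ "N * nat q"]) fastforce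
    next
      case False
      then have "of_nat (N * nat q) * (c *s x) $ i = of_nat (nat (- p) * m' i) - of_nat (nat (- p) * m i)" for i
        unfolding cx by (simp add: algebra_simps)
      then show ?thesis unfolding V_def using *(1) pq(2) scale[OF sym[OF *(2)]]
        by (intro CollectI exI[of _ "N * nat q"]) fastforce
    qed
  qed
  moreover have "(axis a 1 - axis b 1 :: rat ^ 'n) \<notin> V"
  proof
    assume "(axis a 1 - axis b 1 :: rat ^ 'n) \<in> V"
    then obtain N m m' where *: "N > 0" "relation m m'"
      "\<And>i. of_nat N * (axis a 1 - axis b 1 :: rat ^ 'n) $ i = of_nat (m i) - of_nat (m' i)"
      unfolding V_def by blast
    have m: "m i + (if i = b then N else 0) = m' i + (if i = a then N else 0)" for i
    proof -
      have "of_nat (m i + (if i = b then N else 0)) = (of_nat (m' i + (if i = a then N else 0)) :: rat)"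
        using *(3)[of i] by (auto simp: axis_def split: if_splits)
      then show ?thesis by (simp only: of_nat_eq_iff)
    qed
    obtain s where s: "s \<in> S" "wt a b s ^ N \<noteq> 1" using ab[OF *(1)] by blast
    have single: "(\<Prod>i\<in>UNIV. dg i s ^ (if i = k then N else 0)) = dg k s ^ N" for k
    proof -
      have "(\<Prod>i\<in>UNIV. dg i s ^ (if i = k then N else 0)) = (\<Prod>i\<in>UNIV. if i = k then dg i s ^ N else 1)"
        by (intro prod.cong) auto
      then show ?thesis by simp
    qed
    have "(\<Prod>i\<in>UNIV. dg i s ^ (m i + (if i = b then N else 0))) = (\<Prod>i\<in>UNIV. dg i s ^ (m' i + (if i = a then N else 0)))"
      by (simp only: m)
    then have "(\<Prod>i\<in>UNIV. dg i s ^ m i) * dg b s ^ N = (\<Prod>i\<in>UNIV. dg i s ^ m' i) * dg a s ^ N"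
      by (simp only: power_add prod.distrib single)
    moreover have "(\<Prod>i\<in>UNIV. dg i s ^ m i) = (\<Prod>i\<in>UNIV. dg i s ^ m' i)"
      using *(2) s(1) by (simp add: relation_def)
    moreover have "(\<Prod>i\<in>UNIV. dg i s ^ m' i) \<noteq> 0" using dg_nonzero[OF s(1)] by simp
    ultimately have "dg b s ^ N = dg a s ^ N" by simp
    then show False using s dg_nonzero[OF s(1)] by (simp add: wt_def power_divide)
  qed
  ultimately obtain l :: "'n \<Rightarrow> rat" where l: "\<And>x. x \<in> V \<Longrightarrow> (\<Sum>i\<in>UNIV. x $ i * l i) = 0"
    "(\<Sum>i\<in>UNIV. (axis a 1 - axis b 1) $ i * l i) = 1"
    using rational_functional by metis
  define l' where "l' i = (of_rat (l i) :: complex)" for i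
  have rel: "(\<Sum>i\<in>UNIV. of_nat (m i) * l' i) = (\<Sum>i\<in>UNIV. of_nat (m' i) * l' i)" if "relation m m'" for m m'
  proof -
    have "(\<chi> i. of_nat (m i) - of_nat (m' i)) \<in> V"
      unfolding V_def using that by (intro CollectI exI[of _ 1]) force
    from l(1)[OF this] have "(\<Sum>i\<in>UNIV. of_nat (m i) * l i) = (\<Sum>i\<in>UNIV. of_nat (m' i) * l i)"
      by (simp add: left_diff_distrib sum_subtractf)
    then have "of_rat (\<Sum>i\<in>UNIV. of_nat (m i) * l i) = (of_rat (\<Sum>i\<in>UNIV. of_nat (m' i) * l i) :: complex)"
      by simp
    then show ?thesis by (simp add: of_rat_sum of_rat_mult l'_def)
  qed
  have axis_sum: "(\<Sum>i\<in>UNIV. axis k 1 $ i * l i) = l k" for k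
    by (simp add: axis_def if_distrib[of "\<lambda>x. x * _"] sum.delta' cong: if_cong)
  have "l a - l b = 1" using l(2) by (simp add: left_diff_distrib sum_subtractf axis_sum)
  then have lab: "l' a - l' b = 1" by (simp add: l'_def flip: of_rat_diff)
  \<comment> \<open>Equality of the weights (i, j) and (a, b) is a relation between the exponents i
    + b and a + j, which the form respects.\<close>
  have lij: "l' i - l' j = 1" if ij: "wt i j = wt a b" for i j
  proof -
    have mon: "(\<Prod>k\<in>UNIV. f k ^ ((if k = p then 1 else 0) + (if k = q then 1 else 0))) = f p * f q" for f :: "'n \<Rightarrow> complex" and p q
    proof -
      have "(\<Prod>k\<in>UNIV. f k ^ (if k = p then 1 else 0)) = (\<Prod>k\<in>UNIV. if k = p then f k else 1)" for p
        by (intro prod.cong) auto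
      then show ?thesis by (simp add: power_add prod.distrib)
    qed
    have add: "(\<Sum>k\<in>UNIV. of_nat ((if k = p then 1 else 0) + (if k = q then 1 else 0)) * l' k) = l' p + l' q" for p q
      by (simp add: distrib_right sum.distrib if_distrib[of "\<lambda>x. x * _"] if_distrib[of of_nat] sum.delta' cong: if_cong)
    have "dg i s * dg b s = dg a s * dg j s" if "s \<in> S" for s
      using fun_cong[OF ij, of s] that dg_nonzero[OF that] by (simp add: wt_def field_simps)
    then have "relation (\<lambda>k. (if k = i then 1 else 0) + (if k = b then 1 else 0)) (\<lambda>k. (if k = a then 1 else 0) + (if k = j then 1 else 0))"
      unfolding relation_def by (simp only: mon) blast
    from rel[OF this] have "l' i + l' b = l' a + l' j" by (simp only: add)
    then show ?thesis using lab by (simp add: algebra_simps)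
  qed
  show ?thesis
  proof (rule that)
    show "Q ** diag_mat l' ** P \<in> lie_algebra G" by (rule diagonal_in_lie_algebra[OF SG rel])
    fix A assume A: "\<And>i j. (P ** A ** Q) $ i $ j \<noteq> 0 \<Longrightarrow> wt i j = wt a b"
    let ?H = "Q ** diag_mat l' ** P"
    have "P ** (?H ** A - A ** ?H) ** Q = diag_mat l' ** (P ** A ** Q) - (P ** A ** Q) ** diag_mat l'"
    proof -
      have "P ** (B - C) ** Q = P ** B ** Q - P ** C ** Q" for B C :: "'n cmat"
        by (simp add: vec_eq_iff matrix_matrix_mult_def left_diff_distrib right_diff_distrib sum_subtractf)
      then show ?thesis by (simp only: conj_mult[of ?H A] conj_mult[of A ?H] conj_cancel')
    qed
    moreover have "diag_mat l' ** (P ** A ** Q) - (P ** A ** Q) ** diag_mat l' = P ** A ** Q"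
    proof -
      have "l' i * (P ** A ** Q) $ i $ j - (P ** A ** Q) $ i $ j * l' j = (P ** A ** Q) $ i $ j" for i j
      proof (cases "(P ** A ** Q) $ i $ j = 0")
        case False
        have "l' i * (P ** A ** Q) $ i $ j - (P ** A ** Q) $ i $ j * l' j = (l' i - l' j) * (P ** A ** Q) $ i $ j"
          by (simp add: algebra_simps)
        then show ?thesis using lij[OF A[OF False]] by simp
      qed simp
      then show ?thesis by (simp add: vec_eq_iff diag_mat_times_component times_diag_mat_component)
    qed
    ultimately show "?H ** A - A ** ?H = A" by (metis conj_cancel)
  qed
qed

text \<open>The hypothesis \<open>free\<close> is torsion-freeness of the character group. It
  supplies H with [H, A] = A, so that a root vector A in the radical of the trace form lies in the
  bracket of the Lie algebra with the radical.\<close>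

lemma roots_cneg:
  assumes G: "connected_reductive G" and SG: "S \<subseteq> G"
    and free: "\<And>x N. x \<in> chars S \<Longrightarrow> N > 0 \<Longrightarrow> (\<forall>s\<in>S. x s ^ N = 1) \<Longrightarrow> x = (\<lambda>_. 1)"
    and x: "x \<in> roots G S"
  shows "cneg x \<in> roots G S"
proof (rule ccontr)
  assume neg: "cneg x \<notin> roots G S"
  have ag: "alg_group G" using G by (simp add: connected_reductive_def)
  obtain A where A: "A \<in> lie_algebra G" "A \<noteq> 0" "\<forall>s\<in>S. s ** A ** matrix_inv s = mat (x s) ** A"
    and xc: "x \<in> chars S" "x \<noteq> (\<lambda>_. 1)" "\<forall>s. s \<notin> S \<longrightarrow> x s = 1"
    using x by (auto simp: roots_def chars_def)
  obtain a b where ab: "x = wt a b" using subsetD[OF roots_subset x] by auto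
  have A_wt: "wt i j = x" if "(P ** A ** Q) $ i $ j \<noteq> 0" for i j
    by (rule root_weight[OF A(3) xc(3) that, symmetric])
  have cneg_wt: "cneg (wt i j) = wt j i" for i j by (auto simp: cneg_def wt_def fun_eq_iff)
  have "trace (A ** Y) = 0" if Y: "Y \<in> lie_algebra G" for Y
  proof -
    define Y' where "Y' = Q ** (\<chi> i j. if wt i j = cneg x then (P ** Y ** Q) $ i $ j else 0) ** P"
    have Y'G: "Y' \<in> lie_algebra G" unfolding Y'_def by (rule lie_algebra_weight_component[OF ag SG Y])
    have PY': "(P ** Y' ** Q) $ i $ j = (if wt i j = cneg x then (P ** Y ** Q) $ i $ j else 0)" for i j
      by (simp add: Y'_def conj_cancel')
    have "\<forall>s\<in>S. s ** Y' ** matrix_inv s = mat (cneg x s) ** Y'"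
      by (simp add: weight_iff PY')
    moreover have "cneg x \<in> chars S" by (simp add: ab cneg_wt wt_in_chars)
    moreover have "cneg x \<noteq> (\<lambda>_. 1)"
    proof
      assume "cneg x = (\<lambda>_. 1)"
      then have "inverse (x s) = 1" for s unfolding cneg_def by (rule fun_cong)
      then have "x s = 1" for s by (metis inverse_1 inverse_inverse_eq)
      then show False using xc(2) by blast
    qed
    ultimately have "Y' = 0" using neg Y'G by (auto simp: roots_def)
    then have zero: "(P ** Y ** Q) $ j $ i = 0" if "wt i j = x" for i j
      using PY'[of j i] that cneg_wt[of i j] by (simp add: times0_left times0_right)
    have "trace (A ** Y) = trace (P ** (A ** Y) ** Q)"
      using trace_mul_sym[of "P ** (A ** Y)" Q] PQ(2) by (simp add: matrix_mul_assoc)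
    also have "\<dots> = (\<Sum>i\<in>UNIV. \<Sum>j\<in>UNIV. (P ** A ** Q) $ i $ j * (P ** Y ** Q) $ j $ i)"
      by (simp only: conj_mult[of A Y]) (simp add: trace_def matrix_matrix_mult_def)
    also have "\<dots> = 0" using zero A_wt by (intro sum.neutral ballI) (metis mult_zero_left mult_zero_right)
    finally show ?thesis .
  qed
  moreover have "\<exists>s\<in>S. wt a b s ^ N \<noteq> 1" if "N > 0" for N
    using free[OF xc(1) that] xc(2) ab by blast
  then obtain H where "H \<in> lie_algebra G"
    "\<And>A. (\<And>i j. (P ** A ** Q) $ i $ j \<noteq> 0 \<Longrightarrow> wt i j = wt a b) \<Longrightarrow> H ** A - A ** H = A"
    using exists_derivation[OF SG] by blast
  ultimately have "A = 0"
    using reductive_bracket_radical[OF G _ A(1), of H] A_wt ab by metis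
  then show False using A(2) by blast
qed

end

lemma torus_diagonal_group:
  assumes "torus S"
  obtains P where "diagonal_group S P (matrix_inv P)"
proof -
  obtain P :: "'a cmat" where P: "invertible P" "\<forall>s\<in>S. \<forall>i j. i \<noteq> j \<longrightarrow> (P ** s ** matrix_inv P) $ i $ j = 0"
    using assms by (auto simp: torus_def)
  have "P ** matrix_inv P = mat 1" "matrix_inv P ** P = mat 1"
    using P(1) unfolding invertible_def matrix_inv_def by (metis (mono_tags, lifting) someI_ex)+
  then have "diagonal_group S P (matrix_inv P)"
    using assms P(2) by (auto simp: diagonal_group_def torus_def)
  then show ?thesis by (rule that)
qed

section \<open>Characters and cocharacters\<close>

lemma map_cnj_mult: "map_matrix cnj (A ** B) = map_matrix cnj A ** map_matrix cnj (B :: ('n::finite) cmat)"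
  by (simp add: vec_eq_iff matrix_matrix_mult_def)

lemma map_cnj_mat: "map_matrix cnj (mat c) = mat (cnj c)"
  by (simp add: vec_eq_iff mat_def)

lemma map_cnj_map_cnj [simp]: "map_matrix cnj (map_matrix cnj A) = A"
  by (simp add: vec_eq_iff)

lemma det_map_cnj: "det (map_matrix cnj A) = cnj (det (A :: ('n::finite) cmat))"
  by (simp add: det_def)

lemma polyfun_cnj: "polyfun f \<Longrightarrow> polyfun (\<lambda>g. cnj (f (map_matrix cnj g)))"
  by (induction rule: polyfun.induct) (auto intro: polyfun.intros)

lemma csig_cneg: "csig (cneg x) = cneg (csig x)"
  by (simp add: csig_def cneg_def)

lemma csig_csig [simp]: "csig (csig x) = x"
  by (simp add: csig_def)

lemma cneg_cneg [simp]: "cneg (cneg x) = x"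
  by (simp add: cneg_def)

lemma csig_inj: "csig x = csig y \<longleftrightarrow> x = y"
  by (metis csig_csig)

lemma cneg_inj: "cneg x = cneg y \<longleftrightarrow> x = y"
  by (metis cneg_cneg)

text \<open>Entrywise conjugation carries root vectors to root vectors: the ideal of G is stable
  under conjugating both argument and value of a function.\<close>

lemma roots_csig:
  assumes G: "alg_group G" "over_reals G" and S: "over_reals S" "S \<subseteq> G" and x: "x \<in> roots G S"
    and xc: "csig x \<in> chars S"
  shows "csig x \<in> roots G S"
proof -
  obtain A where A: "A \<in> lie_algebra G" "A \<noteq> 0" "\<forall>s\<in>S. s ** A ** matrix_inv s = mat (x s) ** A"
    and x1: "x \<noteq> (\<lambda>_. 1)"
    using x by (auto simp: roots_def)
  have "map_matrix cnj A \<in> lie_algebra G"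
    unfolding lie_algebra_def
  proof (intro CollectI allI impI, elim conjE)
    fix f assume f: "polyfun f" "\<forall>g\<in>G. f g = 0"
    let ?h = "\<lambda>g. cnj (f (map_matrix cnj g))"
    have "((\<lambda>t. ?h (mat 1 + mat t ** A)) has_field_derivative 0) (at 0)"
      using polyfun_cnj[OF f(1)] f(2) G(2) by (intro lie_algebraD[OF A(1)]) (auto simp: over_reals_def)
    then have "((cnj \<circ> (\<lambda>t. ?h (mat 1 + mat t ** A)) \<circ> cnj) has_field_derivative cnj 0) (at 0)"
      by (subst has_field_derivative_cnj_cnj) simp_all
    moreover have "map_matrix cnj (mat 1 + mat (cnj t) ** A) = mat 1 + mat t ** map_matrix cnj A" for t
    proof -
      have "map_matrix cnj (B + C) = map_matrix cnj B + map_matrix cnj (C :: 'a cmat)" for B C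
        by (simp add: vec_eq_iff)
      then show ?thesis by (simp add: map_cnj_mult map_cnj_mat)
    qed
    ultimately show "((\<lambda>t. f (mat 1 + mat t ** map_matrix cnj A)) has_field_derivative 0) (at 0)"
      by (simp add: o_def)
  qed
  moreover have "map_matrix cnj A \<noteq> 0" using A(2) by (auto simp: vec_eq_iff)
  moreover have "s ** map_matrix cnj A ** matrix_inv s = mat (csig x s) ** map_matrix cnj A" if s: "s \<in> S" for s
  proof -
    let ?c = "map_matrix cnj"
    have sc: "?c s \<in> S" "?c s \<in> G" "s \<in> G" using s S by (auto simp: over_reals_def)
    have "matrix_inv s = ?c (matrix_inv (?c s))"
    proof -
      have "?c (matrix_inv (?c s)) ** s = mat 1"
        using alg_groupD(5)[OF G(1) sc(2)] by (metis map_cnj_mult map_cnj_map_cnj map_cnj_mat complex_cnj_one)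
      then show ?thesis
        using alg_groupD(4)[OF G(1) sc(3)] by (metis matrix_mul_assoc matrix_mul_lid matrix_mul_rid)
    qed
    then have "s ** ?c A ** matrix_inv s = ?c (?c s ** A ** matrix_inv (?c s))"
      by (simp add: map_cnj_mult)
    also have "\<dots> = mat (csig x s) ** ?c A" using A(3) sc(1) by (simp add: map_cnj_mult map_cnj_mat csig_def)
    finally show ?thesis .
  qed
  moreover have "csig x \<noteq> (\<lambda>_. 1)"
  proof
    assume "csig x = (\<lambda>_. 1)"
    then have "csig (csig x) = (\<lambda>_. 1)" by (simp add: csig_def)
    then show False using x1 by simp
  qed
  ultimately show ?thesis using xc by (auto simp: roots_def)
qed

lemma powi_eq_imp_eq:
  assumes "\<And>z::complex. z \<noteq> 0 \<Longrightarrow> z powi k = z powi m"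
  shows "k = m"
proof -
  have "(2::complex) powi k = 2 powi m" using assms[of 2] by simp
  then have "norm ((2::complex) powi k) = norm ((2::complex) powi m)" by simp
  then have "(2::real) powi k = 2 powi m" by (simp add: norm_power_int)
  moreover have "(2::real) powi a < 2 powi b" if "a < b" for a b :: int
    using that by (intro power_int_strict_increasing) auto
  ultimately show ?thesis by (metis less_irrefl linorder_less_linear)
qed

locale real_group =
  fixes S :: "(('n::finite) cmat) set"
  assumes S: "alg_group S" and comm: "\<And>s t. s \<in> S \<Longrightarrow> t \<in> S \<Longrightarrow> s ** t = t ** s"
    and over: "over_reals S"
begin

lemma S_cnj: "s \<in> S \<Longrightarrow> map_matrix cnj s \<in> S"
  using over by (simp add: over_reals_def)

lemma S_cnj_iff: "map_matrix cnj s \<in> S \<longleftrightarrow> s \<in> S"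
  using S_cnj by (metis map_cnj_map_cnj)

lemma det_nonzero: "s \<in> S \<Longrightarrow> det s \<noteq> 0"
  using S by (auto simp: alg_group_def zclosed_def invertible_det_nz)

lemma charsD:
  assumes "x \<in> chars S"
  shows "s \<in> S \<Longrightarrow> x s \<noteq> 0" "s \<in> S \<Longrightarrow> t \<in> S \<Longrightarrow> x (s ** t) = x s * x t" "s \<notin> S \<Longrightarrow> x s = 1"
    "x (mat 1) = 1"
proof -
  show *: "s \<in> S \<Longrightarrow> x s \<noteq> 0" "s \<in> S \<Longrightarrow> t \<in> S \<Longrightarrow> x (s ** t) = x s * x t" "s \<notin> S \<Longrightarrow> x s = 1" for s t
    using assms by (auto simp: chars_def)
  show "x (mat 1) = 1" using *(1)[of "mat 1"] *(2)[of "mat 1" "mat 1"] alg_groupD(1)[OF S] by simp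
qed

lemma chars_1: "(\<lambda>_. 1) \<in> chars S"
proof -
  have "\<exists>f k. polyfun f \<and> (\<forall>s\<in>S. 1 = f s / det s ^ k)"
    by (intro exI[of _ "\<lambda>_. 1"] exI[of _ 0]) (auto intro: polyfun.intros)
  then show ?thesis by (auto simp: chars_def)
qed

lemma chars_mult:
  assumes "x \<in> chars S" "y \<in> chars S"
  shows "(\<lambda>s. x s * y s) \<in> chars S"
proof -
  obtain f k where f: "polyfun f" "\<forall>s\<in>S. x s = f s / det s ^ k" using assms(1) by (auto simp: chars_def)
  obtain g m where g: "polyfun g" "\<forall>s\<in>S. y s = g s / det s ^ m" using assms(2) by (auto simp: chars_def)
  have "\<exists>h k. polyfun h \<and> (\<forall>s\<in>S. x s * y s = h s / det s ^ k)"
    using f(2) g(2) by (intro exI[of _ "\<lambda>s. f s * g s"] exI[of _ "k + m"])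
      (auto simp: power_add intro: polyfun.intros f g)
  then show ?thesis using assms by (auto simp: chars_def)
qed

lemma chars_prod:
  "(\<And>x. x \<in> A \<Longrightarrow> f x \<in> chars S) \<Longrightarrow> (\<lambda>s. \<Prod>x\<in>A. f x s) \<in> chars S"
  by (induction A rule: infinite_finite_induct) (auto simp: chars_1 chars_mult)

lemma chars_csig:
  assumes "x \<in> chars S"
  shows "csig x \<in> chars S"
proof -
  obtain f k where f: "polyfun f" "\<forall>s\<in>S. x s = f s / det s ^ k" using assms by (auto simp: chars_def)
  have "\<exists>h k. polyfun h \<and> (\<forall>s\<in>S. csig x s = h s / det s ^ k)"
    using f(2) S_cnj by (intro exI[of _ "\<lambda>s. cnj (f (map_matrix cnj s))"] exI[of _ k])
      (auto simp: csig_def det_map_cnj intro: polyfun_cnj[OF f(1)])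
  then show ?thesis using assms S_cnj S_cnj_iff by (auto simp: chars_def csig_def map_cnj_mult)
qed

lemma chars_continuous: "x \<in> chars S \<Longrightarrow> continuous_on S x"
proof -
  assume "x \<in> chars S"
  then obtain f k where f: "polyfun f" "\<forall>s\<in>S. x s = f s / det s ^ k" by (auto simp: chars_def)
  have "continuous_on S (\<lambda>s. f s / det s ^ k)"
    using polyfun_continuous[OF f(1)] polyfun_continuous[OF polyfun_det] det_nonzero
    by (intro continuous_intros) (auto intro: continuous_on_subset)
  then show ?thesis using f(2) by (simp cong: continuous_on_cong)
qed

lemma cocharsD:
  assumes "l \<in> cochars S"
  shows "z \<noteq> 0 \<Longrightarrow> l z \<in> S" "z \<noteq> 0 \<Longrightarrow> w \<noteq> 0 \<Longrightarrow> l (z * w) = l z ** l w" "l 0 = mat 1"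
  using assms by (auto simp: cochars_def)

lemma cochar_polyfun:
  assumes "l \<in> cochars S" "polyfun f"
  shows "\<exists>P k. \<forall>z. z \<noteq> 0 \<longrightarrow> f (l z) = poly P z / z ^ k"
  using assms(2)
proof induction
  case (1 c)
  then show ?case by (intro exI[of _ "[:c:]"] exI[of _ 0]) simp
next
  case (2 i j)
  then show ?case using assms(1) by (auto simp: cochars_def)
next
  case (3 f h)
  then obtain P k Q m where "\<forall>z. z \<noteq> 0 \<longrightarrow> f (l z) = poly P z / z ^ k" "\<forall>z. z \<noteq> 0 \<longrightarrow> h (l z) = poly Q z / z ^ m"
    by blast
  then show ?case
    by (intro exI[of _ "P * monom 1 m + Q * monom 1 k"] exI[of _ "k + m"])
      (auto simp: poly_monom power_add field_simps)
next
  case (4 f h)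
  then obtain P k Q m where "\<forall>z. z \<noteq> 0 \<longrightarrow> f (l z) = poly P z / z ^ k" "\<forall>z. z \<noteq> 0 \<longrightarrow> h (l z) = poly Q z / z ^ m"
    by blast
  then show ?case
    by (intro exI[of _ "P * Q"] exI[of _ "k + m"]) (auto simp: power_add)
qed

text \<open>Along a cocharacter the numerator and the determinant become Laurent polynomials without
  zeros on the nonzero numbers, hence monomials; the constant is 1 by evaluation at 1. This gives
  the description operator in \<open>pairing\<close> its meaning.\<close>

lemma char_cochar_power:
  assumes x: "x \<in> chars S" and l: "l \<in> cochars S"
  shows "\<exists>k. \<forall>z. z \<noteq> 0 \<longrightarrow> x (l z) = z powi k"
proof -
  obtain f k where f: "polyfun f" "\<forall>s\<in>S. x s = f s / det s ^ k" using x by (auto simp: chars_def)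
  obtain P a where P: "\<And>z. z \<noteq> 0 \<Longrightarrow> f (l z) = poly P z / z ^ a" using cochar_polyfun[OF l f(1)] by blast
  obtain D d where D: "\<And>z. z \<noteq> 0 \<Longrightarrow> det (l z) = poly D z / z ^ d"
    using cochar_polyfun[OF l polyfun_det] by blast
  have Pnz: "poly P z \<noteq> 0" if z: "z \<noteq> 0" for z
  proof -
    have "x (l z) \<noteq> 0" using charsD(1)[OF x] cocharsD(1)[OF l z] .
    then show ?thesis using f(2) cocharsD(1)[OF l z] P[OF z] by auto
  qed
  have Dnz: "poly D z \<noteq> 0" if z: "z \<noteq> 0" for z
    using det_nonzero[OF cocharsD(1)[OF l z]] D[OF z] by auto
  obtain c m where c: "c \<noteq> 0" "P = monom c m" by (rule poly_no_nonzero_root[OF Pnz])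
  obtain c' m' where c': "c' \<noteq> 0" "D = monom c' m'" by (rule poly_no_nonzero_root[OF Dnz])
  define n where "n = int m + int (d * k) - int a - int (m' * k)"
  have eq: "x (l z) = c / c' ^ k * z powi n" if z: "z \<noteq> 0" for z
  proof -
    have "x (l z) = (c * z ^ m / z ^ a) / (c' * z ^ m' / z ^ d) ^ k"
      using f(2) cocharsD(1)[OF l z] P[OF z] D[OF z] by (simp add: c c' poly_monom)
    also have "\<dots> = c / c' ^ k * (z ^ m * z ^ (d * k) / (z ^ a * z ^ (m' * k)))"
      using z c'(1) by (simp add: power_divide power_mult_distrib field_simps flip: power_mult)
    also have "z ^ m * z ^ (d * k) / (z ^ a * z ^ (m' * k)) = z powi n"
      using z by (simp add: n_def power_int_diff power_int_add power_int_of_nat field_simps del: of_nat_mult)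
    finally show ?thesis .
  qed
  have "x (l 1) = 1"
  proof -
    have l1: "l 1 \<in> S" "l 1 = l 1 ** l 1" using cocharsD(1)[OF l, of 1] cocharsD(2)[OF l, of 1 1] by simp_all
    then have "x (l 1) = x (l 1) * x (l 1)" using charsD(2)[OF x l1(1) l1(1)] by metis
    then show ?thesis using charsD(1)[OF x l1(1)] by simp
  qed
  then have "c / c' ^ k = 1" using eq[of 1] by simp
  then show ?thesis using eq by auto
qed

lemma pairing_unique:
  assumes "\<And>z. z \<noteq> 0 \<Longrightarrow> x (l z) = z powi k"
  shows "pairing x l = k"
  unfolding pairing_def
proof (rule the_equality)
  show "\<forall>z. z \<noteq> 0 \<longrightarrow> x (l z) = z powi k" using assms by blast
  show "m = k" if "\<forall>z. z \<noteq> 0 \<longrightarrow> x (l z) = z powi m" for m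
    by (rule powi_eq_imp_eq) (metis assms that)
qed

lemma pairing:
  assumes "x \<in> chars S" "l \<in> cochars S" "z \<noteq> 0"
  shows "x (l z) = z powi pairing x l"
proof -
  obtain k where "\<And>z. z \<noteq> 0 \<Longrightarrow> x (l z) = z powi k" using char_cochar_power[OF assms(1,2)] by blast
  then show ?thesis using pairing_unique[of x l k] assms(3) by simp
qed

lemma pairing_mult:
  assumes "x \<in> chars S" "y \<in> chars S" "l \<in> cochars S"
  shows "pairing (\<lambda>s. x s * y s) l = pairing x l + pairing y l"
  by (rule pairing_unique) (simp add: pairing assms power_int_add)

lemma pairing_1: "pairing (\<lambda>_. 1) l = 0"
  by (rule pairing_unique) simp

lemma pairing_cneg:
  assumes "x \<in> chars S" "l \<in> cochars S"
  shows "pairing (cneg x) l = - pairing x l"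
  by (rule pairing_unique) (simp add: cneg_def pairing[OF assms] power_int_minus)

lemma cochars_ysig:
  assumes l: "l \<in> cochars S" shows "ysig l \<in> cochars S"
proof -
  have "\<exists>P k. \<forall>z. z \<noteq> 0 \<longrightarrow> ysig l z $ i $ j = poly P z / z ^ k" for i j
  proof -
    obtain P k where P: "\<And>z. z \<noteq> 0 \<Longrightarrow> l z $ i $ j = poly P z / z ^ k"
      using l unfolding cochars_def by blast
    show ?thesis by (intro exI[of _ "map_poly cnj P"] exI[of _ k]) (simp add: ysig_def P)
  qed
  then show ?thesis
    using cocharsD[OF l] S_cnj by (auto simp: cochars_def ysig_def map_cnj_mult map_cnj_mat)
qed

lemma ysig_ysig [simp]: "ysig (ysig l) = l"
  by (simp add: ysig_def)

lemma cochars_ysig_iff: "ysig l \<in> cochars S \<longleftrightarrow> l \<in> cochars S"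
  using cochars_ysig by (metis ysig_ysig)

lemma cochars_mult:
  assumes l: "l \<in> cochars S" and m: "m \<in> cochars S"
  shows "(\<lambda>z. l z ** m z) \<in> cochars S"
proof -
  have "\<exists>P k. \<forall>z. z \<noteq> 0 \<longrightarrow> (l z ** m z) $ i $ j = poly P z / z ^ k" for i j
  proof -
    have fin: "finite A \<Longrightarrow> \<exists>P k. \<forall>z. z \<noteq> 0 \<longrightarrow> (\<Sum>q\<in>A. l z $ i $ q * m z $ q $ j) = poly P z / z ^ k" for A
    proof (induction A rule: finite_induct)
      case empty
      then show ?case by (intro exI[of _ 0]) simp
    next
      case (insert q A)
      then obtain P k where P: "\<forall>z. z \<noteq> 0 \<longrightarrow> (\<Sum>q\<in>A. l z $ i $ q * m z $ q $ j) = poly P z / z ^ k" by blast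
      obtain Q a where Q: "\<forall>z. z \<noteq> 0 \<longrightarrow> l z $ i $ q = poly Q z / z ^ a" using l unfolding cochars_def by blast
      obtain T b where T: "\<forall>z. z \<noteq> 0 \<longrightarrow> m z $ q $ j = poly T z / z ^ b" using m unfolding cochars_def by blast
      show ?case
      proof (intro exI[of _ "Q * T * monom 1 k + P * monom 1 (a + b)"] exI[of _ "a + b + k"] allI impI)
        fix z :: complex assume z: "z \<noteq> 0"
        show "(\<Sum>q\<in>insert q A. l z $ i $ q * m z $ q $ j)
            = poly (Q * T * monom 1 k + P * monom 1 (a + b)) z / z ^ (a + b + k)"
          using z insert.hyps P[rule_format, OF z] Q[rule_format, OF z] T[rule_format, OF z]
          by (simp add: poly_monom power_add) (simp add: add_divide_distrib)
      qed
    qed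
    show ?thesis using fin[of UNIV] by (simp add: matrix_matrix_mult_def)
  qed
  moreover have "l (z * w) ** m (z * w) = (l z ** m z) ** (l w ** m w)" if "z \<noteq> 0" "w \<noteq> 0" for z w
    using cocharsD[OF l] cocharsD[OF m] comm[of "l w" "m z"] that by (metis matrix_mul_assoc)
  ultimately show ?thesis
    using cocharsD[OF l] cocharsD[OF m] alg_groupD(2)[OF S] by (auto simp: cochars_def)
qed

lemma pairing_csig:
  assumes "x \<in> chars S" "l \<in> cochars S"
  shows "pairing (csig x) l = pairing x (ysig l)"
proof (rule pairing_unique)
  fix z :: complex assume z: "z \<noteq> 0"
  have "csig x (l z) = cnj (x (ysig l (cnj z)))" by (simp add: csig_def ysig_def)
  also have "\<dots> = z powi pairing x (ysig l)"
    using z by (simp add: pairing[OF assms(1) cochars_ysig[OF assms(2)]])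
  finally show "csig x (l z) = z powi pairing x (ysig l)" .
qed

lemma pairing_cochar_mult:
  assumes x: "x \<in> chars S" and l: "l \<in> cochars S" and m: "m \<in> cochars S"
  shows "pairing x (\<lambda>z. l z ** m z) = pairing x l + pairing x m"
  by (rule pairing_unique)
    (simp add: charsD(2)[OF x] cocharsD(1)[OF l] cocharsD(1)[OF m] pairing[OF x l] pairing[OF x m] power_int_add)

lemma dual_torusD:
  assumes "s \<in> dual_torus S"
  shows "s l \<noteq> 0" "l \<in> cochars S \<Longrightarrow> m \<in> cochars S \<Longrightarrow> s (\<lambda>z. l z ** m z) = s l * s m" "l \<notin> cochars S \<Longrightarrow> s l = 1"
  using assms by (auto simp: dual_torus_def)

lemma dual_torus_1 [simp]: "(\<lambda>_. 1) \<in> dual_torus S"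
  by (simp add: dual_torus_def)

lemma dual_torus_mult: "s \<in> dual_torus S \<Longrightarrow> t \<in> dual_torus S \<Longrightarrow> (\<lambda>l. s l * t l) \<in> dual_torus S"
  by (simp add: dual_torus_def)

lemma dual_torus_inverse: "s \<in> dual_torus S \<Longrightarrow> (\<lambda>l. inverse (s l)) \<in> dual_torus S"
  by (simp add: dual_torus_def)

lemma dual_torus_prod: "(\<And>x. x \<in> A \<Longrightarrow> f x \<in> dual_torus S) \<Longrightarrow> (\<lambda>l. \<Prod>x\<in>A. f x l) \<in> dual_torus S"
  by (induction A rule: infinite_finite_induct) (auto intro: dual_torus_mult)

lemma tens_dual_torus:
  assumes "x \<in> chars S" "c \<noteq> 0"
  shows "tens S x c \<in> dual_torus S"
  using assms by (auto simp: dual_torus_def tens_def cochars_mult pairing_cochar_mult power_int_add)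

lemma tens_mult: "tens S x (c * d) l = tens S x c l * tens S x d l"
  by (simp add: tens_def power_int_mult_distrib)

lemma tens_1 [simp]: "tens S x 1 l = 1"
  by (simp add: tens_def)

lemma tens_inverse: "tens S x (inverse c) l = inverse (tens S x c l)"
  by (simp add: tens_def power_int_inverse)

lemma tens_cneg: "x \<in> chars S \<Longrightarrow> tens S (cneg x) c l = inverse (tens S x c l)"
  by (simp add: tens_def pairing_cneg power_int_minus)

lemma tens_char_mult:
  "x \<in> chars S \<Longrightarrow> y \<in> chars S \<Longrightarrow> c \<noteq> 0 \<Longrightarrow> tens S (\<lambda>s. x s * y s) c l = tens S x c l * tens S y c l"
  by (simp add: tens_def pairing_mult power_int_add)

lemma tens_char_prod:
  assumes "\<And>x. x \<in> A \<Longrightarrow> f x \<in> chars S" "c \<noteq> 0"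
  shows "tens S (\<lambda>s. \<Prod>x\<in>A. f x s) c l = (\<Prod>x\<in>A. tens S (f x) c l)"
  using assms
proof (induction A rule: infinite_finite_induct)
  case (insert x A)
  then show ?case
    using tens_char_mult[of "f x" "\<lambda>s. \<Prod>x\<in>A. f x s" c l] chars_prod[of A f] by simp
qed (simp_all add: tens_def pairing_1)

lemma dual_act_tens:
  "x \<in> chars S \<Longrightarrow> dual_act b (tens S x c) = tens S (gact b x) c"
  by (auto simp: fun_eq_iff dual_act_def tens_def gact_def pairing_csig cochars_ysig_iff)

lemma tens_minus_1_square: "tens S x (- 1) l * tens S x (- 1) l = 1"
  by (simp flip: tens_mult)

lemma real_points_cnj: "g \<in> real_points S \<Longrightarrow> map_matrix cnj g = g" "g \<in> real_points S \<Longrightarrow> g \<in> S"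
  by (simp_all add: real_points_def)

end

section \<open>The covers\<close>

text \<open>The properties of the roots on which covers, L-groups and correspondences rest.
  Stability under \<open>cneg\<close> is where reductivity enters.\<close>

locale root_datum = real_group S for S :: "(('n::finite) cmat) set" +
  fixes R :: "('n chr) set" and ord :: "('n chr \<times> 'n chr) set"
  assumes R: "finite R" "R \<subseteq> chars S" "(\<lambda>_. 1) \<notin> R"
    and R_csig: "x \<in> R \<Longrightarrow> csig x \<in> R" and R_cneg: "x \<in> R \<Longrightarrow> cneg x \<in> R"
    and ord: "group_order S ord"
begin

lemma ord_antisym: "(x, y) \<in> ord \<Longrightarrow> (y, x) \<in> ord \<Longrightarrow> x = y"
  using ord by (auto simp: group_order_def linear_order_on_def partial_order_on_def antisym_def)

lemma ord_total: "x \<in> chars S \<Longrightarrow> y \<in> chars S \<Longrightarrow> (x, y) \<in> ord \<or> (y, x) \<in> ord"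
  using ord by (cases "x = y") (auto simp: group_order_def linear_order_on_def partial_order_on_def
      preorder_on_def total_on_def refl_on_def)

lemma ord_mult:
  "x \<in> chars S \<Longrightarrow> y \<in> chars S \<Longrightarrow> z \<in> chars S \<Longrightarrow> (x, y) \<in> ord \<Longrightarrow>
    ((\<lambda>s. x s * z s), (\<lambda>s. y s * z s)) \<in> ord"
  using ord by (auto simp: group_order_def)

definition positive :: "'n chr \<Rightarrow> bool" where
  "positive x \<longleftrightarrow> ((\<lambda>_. 1), x) \<in> ord"

lemma char_nonzero: "x \<in> chars S \<Longrightarrow> x s \<noteq> 0"
  using charsD(1,3) by (metis zero_neq_one)

lemma positive_cneg:
  assumes x: "x \<in> chars S" "cneg x \<in> chars S" "x \<noteq> (\<lambda>_. 1)"
  shows "positive (cneg x) \<longleftrightarrow> \<not> positive x"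
proof -
  have eq: "(\<lambda>s. x s * cneg x s) = (\<lambda>_. 1)" "(\<lambda>s. cneg x s * x s) = (\<lambda>_. 1)"
    using char_nonzero[OF x(1)] by (auto simp: cneg_def)
  have "(x, (\<lambda>_. 1)) \<in> ord" if "positive (cneg x)"
    using ord_mult[OF chars_1 x(2,1)] that by (simp add: positive_def eq)
  moreover have "positive (cneg x)" if "(x, (\<lambda>_. 1)) \<in> ord"
    using ord_mult[OF x(1) chars_1 x(2) that] by (simp add: positive_def eq)
  ultimately show ?thesis
    using ord_antisym x(3) ord_total[OF chars_1 x(1)] unfolding positive_def by metis
qed

lemma R_chars: "x \<in> R \<Longrightarrow> x \<in> chars S"
  using R by blast

lemma R_positive_cneg: "x \<in> R \<Longrightarrow> positive (cneg x) \<longleftrightarrow> \<not> positive x"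
  using positive_cneg R R_cneg by blast

lemma R_cneg_neq: "x \<in> R \<Longrightarrow> cneg x \<noteq> x"
  using R_positive_cneg by metis

lemma R_cneg_iff: "cneg x \<in> R \<longleftrightarrow> x \<in> R" and R_csig_iff: "csig x \<in> R \<longleftrightarrow> x \<in> R"
  using R_cneg R_csig by (metis cneg_cneg, metis csig_csig)

lemma imaginary_csig: "imaginary x \<Longrightarrow> csig x = cneg x"
  by (simp add: imaginary_def)

lemma imaginary_cneg: "imaginary (cneg x) \<longleftrightarrow> imaginary x"
  by (metis imaginary_def csig_cneg cneg_cneg)

lemma Rsym_R: "x \<in> Rsym R \<Longrightarrow> x \<in> R" and Rsym_imaginary: "x \<in> Rsym R \<Longrightarrow> imaginary x"
  by (simp_all add: Rsym_def)

lemma Rsym_cneg_iff: "cneg x \<in> Rsym R \<longleftrightarrow> x \<in> Rsym R"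
  by (auto simp: Rsym_def R_cneg_iff imaginary_cneg)

definition PI :: "('n chr) set" where
  "PI = pos_imag R ord"

lemma PI_iff: "x \<in> PI \<longleftrightarrow> x \<in> Rsym R \<and> positive x"
  by (auto simp: PI_def pos_imag_def Rsym_def positive_def)

lemma finite_PI: "finite PI"
  using R(1) by (auto simp: PI_iff Rsym_def intro: finite_subset)

lemma Rsym_PI: "x \<in> Rsym R \<Longrightarrow> x \<in> PI \<longleftrightarrow> cneg x \<notin> PI"
  using R_positive_cneg Rsym_R Rsym_cneg_iff by (auto simp: PI_iff)

lemma Rsym_orbits: "pm_orbit ` Rsym R = pm_orbit ` PI" "inj_on pm_orbit PI"
proof -
  have "pm_orbit x = pm_orbit (cneg x)" for x :: "'n chr" by (auto simp: pm_orbit_def)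
  then show "pm_orbit ` Rsym R = pm_orbit ` PI"
    using Rsym_PI Rsym_cneg_iff PI_iff by (metis (no_types, lifting) image_eqI image_subsetI subset_antisym)
  show "inj_on pm_orbit PI"
  proof (rule inj_onI)
    fix x y assume "x \<in> PI" "y \<in> PI" "pm_orbit x = pm_orbit y"
    then show "x = y" using Rsym_PI[of x] PI_iff[of x] by (auto simp: pm_orbit_def doubleton_eq_iff)
  qed
qed

text \<open>The positive imaginary roots represent the sign orbits, and invariance of f under
  \<open>cneg\<close> removes the choice of an element in each orbit.\<close>

lemma orbit_prod_Rsym:
  assumes "\<And>x. x \<in> Rsym R \<Longrightarrow> f (cneg x) = f x"
  shows "orbit_prod (pm_orbit ` Rsym R) f = (\<Prod>x\<in>PI. f x)"
proof -
  have "f (SOME y. y \<in> pm_orbit x) = f x" if "x \<in> PI" for x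
  proof -
    have "(SOME y. y \<in> pm_orbit x) \<in> pm_orbit x" by (rule someI[of _ x]) (simp add: pm_orbit_def)
    then show ?thesis using assms that PI_iff by (auto simp: pm_orbit_def)
  qed
  then show ?thesis
    unfolding orbit_prod_def Rsym_orbits(1) by (simp add: prod.reindex[OF Rsym_orbits(2)])
qed

text \<open>At a real point g the condition \<sigma>x = -x reads cnj (x g) = 1 / x g: imaginary
  characters are unitary on real points.\<close>

lemma real_points_norm:
  assumes "g \<in> real_points S" "x \<in> chars S" "imaginary x"
  shows "cmod (x g) = 1"
proof -
  have "csig x g = cneg x g" using assms(3) by (simp add: imaginary_def)
  then have "cnj (x g) * x g = 1"
    using assms(1) char_nonzero[OF assms(2)] by (simp add: csig_def cneg_def real_points_cnj field_simps)
  then have "complex_of_real ((cmod (x g))\<^sup>2) = 1"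
    by (simp add: complex_norm_square mult.commute del: of_real_power)
  then have "(cmod (x g))\<^sup>2 = 1" by (metis of_real_eq_1_iff)
  then show ?thesis by (simp add: power2_eq_1_iff) (metis norm_ge_zero not_one_le_zero neg_0_le_iff_le le_minus_iff)
qed

lemma real_points_mult: "g \<in> real_points S \<Longrightarrow> h \<in> real_points S \<Longrightarrow> g ** h \<in> real_points S"
  using alg_groupD(2)[OF S] by (simp add: real_points_def map_cnj_mult)

lemma real_points_1: "mat 1 \<in> real_points S"
  using alg_groupD(1)[OF S] by (simp add: real_points_def map_cnj_mat)

lemma real_points_inv:
  assumes "g \<in> real_points S" shows "matrix_inv g \<in> real_points S"
proof -
  have g: "g \<in> S" "map_matrix cnj g = g" using assms by (simp_all add: real_points_def)
  have "map_matrix cnj (matrix_inv g) ** g = mat 1"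
    using alg_groupD(5)[OF S g(1)] g(2) by (metis map_cnj_mult map_cnj_mat complex_cnj_one)
  then have "map_matrix cnj (matrix_inv g) = matrix_inv g"
    using alg_groupD(4)[OF S g(1)] by (metis matrix_mul_assoc matrix_mul_lid matrix_mul_rid)
  then show ?thesis using alg_groupD(3)[OF S g(1)] by (simp add: real_points_def)
qed

lemma char_inv: "x \<in> chars S \<Longrightarrow> g \<in> S \<Longrightarrow> x (matrix_inv g) = inverse (x g)"
  using charsD(2,4)[of x] alg_groupD(3,4)[OF S] by (metis inverse_unique)

section \<open>The homomorphism from triples to the Adams-Vogan cover\<close>

abbreviation "T \<equiv> pm_triples S R"

lemma T_carrier: "(g, e, d) \<in> carrier T \<longleftrightarrow> g \<in> real_points S \<and> e \<in> {1, -1} \<and>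
       (\<forall>x\<in>Rsym R. d x \<noteq> 0 \<and> d (cneg x) = cnj (d x) \<and> d x / d (cneg x) = x g) \<and>
       (\<forall>x. x \<notin> Rsym R \<longrightarrow> d x = 1)"
  by (simp add: pm_triples_def)

lemma T_D:
  assumes "(g, e, d) \<in> carrier T"
  shows "x \<in> Rsym R \<Longrightarrow> d x \<noteq> 0" "x \<in> Rsym R \<Longrightarrow> d (cneg x) = cnj (d x)"
    "x \<in> Rsym R \<Longrightarrow> d x / d (cneg x) = x g" "g \<in> real_points S" "e \<in> {1, -1}"
  using assms unfolding T_carrier by blast+

lemma T_mult: "(g, e, d) \<otimes>\<^bsub>T\<^esub> (g', e', d') = (g ** g', e * e', (\<lambda>x. d x * d' x))"
  and T_one: "\<one>\<^bsub>T\<^esub> = (mat 1, 1, (\<lambda>_. 1))"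
  by (simp_all add: pm_triples_def)

lemma Rsym_hom:
  assumes "x \<in> Rsym R"
  shows "g \<in> real_points S \<Longrightarrow> h \<in> real_points S \<Longrightarrow> x (g ** h) = x g * x h"
    "g \<in> real_points S \<Longrightarrow> x (matrix_inv g) = inverse (x g)" "x (mat 1) = 1"
proof -
  have "x \<in> chars S" using assms R_chars Rsym_R by blast
  then show "g \<in> real_points S \<Longrightarrow> h \<in> real_points S \<Longrightarrow> x (g ** h) = x g * x h"
    "g \<in> real_points S \<Longrightarrow> x (matrix_inv g) = inverse (x g)" "x (mat 1) = 1"
    by (simp_all add: charsD(2,4) char_inv real_points_cnj(2))
qed

lemma group_T: "group T"
proof (rule groupI)
  fix a b assume ab: "a \<in> carrier T" "b \<in> carrier T"
  obtain g e d g' e' d' where eq: "a = (g, e, d)" "b = (g', e', d')" by (cases a; cases b)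
  have "d x * d' x / (d (cneg x) * d' (cneg x)) = x (g ** g')" if "x \<in> Rsym R" for x
  proof -
    have "d x / d (cneg x) = x g" "d' x / d' (cneg x) = x g'" "x (g ** g') = x g * x g'"
      using T_D(3,4)[OF ab(1)[unfolded eq]] T_D(3,4)[OF ab(2)[unfolded eq]] that Rsym_hom(1)[OF that]
      by blast+
    then show ?thesis by (simp flip: times_divide_times_eq)
  qed
  moreover have "e * e' \<in> {1, -1}" using ab by (auto simp: eq T_carrier)
  ultimately show "a \<otimes>\<^bsub>T\<^esub> b \<in> carrier T"
    using ab by (simp add: eq T_carrier T_mult real_points_mult)
next
  show "\<one>\<^bsub>T\<^esub> \<in> carrier T"
    by (simp add: T_one T_carrier real_points_1 Rsym_hom(3))
next
  fix a b c assume "a \<in> carrier T" "b \<in> carrier T" "c \<in> carrier T"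
  then show "a \<otimes>\<^bsub>T\<^esub> b \<otimes>\<^bsub>T\<^esub> c = a \<otimes>\<^bsub>T\<^esub> (b \<otimes>\<^bsub>T\<^esub> c)"
    by (cases a; cases b; cases c) (simp add: T_mult matrix_mul_assoc mult.assoc)
next
  fix a assume "a \<in> carrier T"
  then show "\<one>\<^bsub>T\<^esub> \<otimes>\<^bsub>T\<^esub> a = a" by (cases a) (simp add: T_one T_mult)
next
  fix a assume a: "a \<in> carrier T"
  obtain g e d where aa: "a = (g, e, d)" by (cases a)
  have "inverse (d x) / inverse (d (cneg x)) = x (matrix_inv g)" if "x \<in> Rsym R" for x
  proof -
    have "d x / d (cneg x) = x g" "x (matrix_inv g) = inverse (x g)"
      using T_D(3,4)[OF a[unfolded aa]] that Rsym_hom(2)[OF that] by blast+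
    moreover have "inverse (d x) / inverse (d (cneg x)) = inverse (d x / d (cneg x))"
      by (simp add: divide_inverse)
    ultimately show ?thesis by (simp only:)
  qed
  then have "(matrix_inv g, e, \<lambda>x. inverse (d x)) \<in> carrier T"
    using a by (simp add: aa T_carrier real_points_inv)
  moreover have "d x \<noteq> 0" for x using a by (cases "x \<in> Rsym R") (auto simp: aa T_carrier)
  moreover have "e * e = 1" "matrix_inv g ** g = mat 1"
    using a alg_groupD(5)[OF S] real_points_cnj(2) by (auto simp: aa T_carrier)
  ultimately show "\<exists>b\<in>carrier T. b \<otimes>\<^bsub>T\<^esub> a = \<one>\<^bsub>T\<^esub>"
    by (intro bexI[of _ "(matrix_inv g, e, \<lambda>x. inverse (d x))"]) (simp_all add: aa T_mult T_one)
qed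

definition rho2 :: "'n chr" where
  "rho2 = two_rho_i R ord"

lemma rho2: "rho2 s = (\<Prod>x\<in>PI. x s)"
  by (simp add: rho2_def two_rho_i_def PI_def)

lemma rho2_chars: "rho2 \<in> chars S"
  using chars_prod[of PI "\<lambda>x. x"] R_chars by (auto simp: rho2[abs_def] PI_iff Rsym_def)

abbreviation "V \<equiv> av_cover S rho2"

lemma V_carrier: "(s, z) \<in> carrier V \<longleftrightarrow> s \<in> real_points S \<and> z \<noteq> 0 \<and> rho2 s = z\<^sup>2"
  and V_mult: "(s, z) \<otimes>\<^bsub>V\<^esub> (s', z') = (s ** s', z * z')"
  and V_one: "\<one>\<^bsub>V\<^esub> = (mat 1, 1)"
  by (simp_all add: av_cover_def)

lemma group_V: "group V"
proof (rule groupI)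
  fix a b assume "a \<in> carrier V" "b \<in> carrier V"
  then show "a \<otimes>\<^bsub>V\<^esub> b \<in> carrier V"
    using charsD(2)[OF rho2_chars] real_points_cnj(2)
    by (cases a; cases b) (auto simp: V_carrier V_mult power_mult_distrib intro!: real_points_mult)
next
  show "\<one>\<^bsub>V\<^esub> \<in> carrier V"
    using charsD(4)[OF rho2_chars] by (auto simp: V_one V_carrier real_points_1)
next
  fix a b c assume "a \<in> carrier V" "b \<in> carrier V" "c \<in> carrier V"
  then show "a \<otimes>\<^bsub>V\<^esub> b \<otimes>\<^bsub>V\<^esub> c = a \<otimes>\<^bsub>V\<^esub> (b \<otimes>\<^bsub>V\<^esub> c)"
    by (cases a; cases b; cases c) (simp add: V_mult matrix_mul_assoc mult.assoc)
next
  fix a assume "a \<in> carrier V"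
  then show "\<one>\<^bsub>V\<^esub> \<otimes>\<^bsub>V\<^esub> a = a" by (cases a) (simp add: V_one V_mult)
next
  fix a assume a: "a \<in> carrier V"
  obtain s z where aa: "a = (s, z)" by (cases a)
  have "(matrix_inv s, inverse z) \<in> carrier V" "matrix_inv s ** s = mat 1" "z \<noteq> 0"
    using a real_points_inv char_inv[OF rho2_chars] real_points_cnj(2) alg_groupD(5)[OF S]
    by (auto simp: aa V_carrier power_inverse)
  then show "\<exists>b\<in>carrier V. b \<otimes>\<^bsub>V\<^esub> a = \<one>\<^bsub>V\<^esub>"
    by (intro bexI[of _ "(matrix_inv s, inverse z)"]) (simp_all add: aa V_mult V_one)
qed

definition to_V :: "'n cmat \<times> real \<times> ('n chr \<Rightarrow> complex) \<Rightarrow> 'n cmat \<times> complex" where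
  "to_V = (\<lambda>(g, e, d). (g, of_real e * (\<Prod>x\<in>PI. d x / of_real (cmod (d x)))))"

lemma PI_d_nonzero: "(g, e, d) \<in> carrier T \<Longrightarrow> x \<in> PI \<Longrightarrow> d x \<noteq> 0"
  by (auto simp: T_carrier PI_iff)

lemma to_V_carrier: "t \<in> carrier T \<Longrightarrow> to_V t \<in> carrier V"
proof -
  assume t: "t \<in> carrier T"
  obtain g e d where tt: "t = (g, e, d)" by (cases t)
  note t = t[unfolded tt]
  have "(d x / of_real (cmod (d x)))\<^sup>2 = x g" if x: "x \<in> PI" for x
  proof -
    have "x g = d x / cnj (d x)" using T_D(2,3)[OF t, of x] x by (simp add: PI_iff)
    also have "\<dots> = (d x)\<^sup>2 / (d x * cnj (d x))"
      using PI_d_nonzero[OF t x] by (simp add: power2_eq_square)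
    also have "d x * cnj (d x) = (of_real (cmod (d x)))\<^sup>2"
      by (simp only: of_real_power[symmetric] complex_norm_square)
    finally show ?thesis by (simp only: power_divide)
  qed
  then have "(\<Prod>x\<in>PI. d x / of_real (cmod (d x)))\<^sup>2 = rho2 g"
    unfolding rho2 prod_power_distrib by (intro prod.cong refl)
  moreover have "(of_real e :: complex)\<^sup>2 = 1" "e \<noteq> 0" using t by (auto simp: T_carrier)
  ultimately show ?thesis
    using t PI_d_nonzero[OF t] finite_PI by (simp add: tt to_V_def V_carrier power_mult_distrib T_carrier)
qed

lemma to_V_hom: "to_V \<in> hom T V"
proof (rule homI)
  fix a b :: "'n cmat \<times> real \<times> ('n chr \<Rightarrow> complex)"
  obtain g e d g' e' d' where ab: "a = (g, e, d)" "b = (g', e', d')" by (cases a; cases b)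
  have "(\<Prod>x\<in>PI. d x * d' x / of_real (cmod (d x * d' x)))
      = (\<Prod>x\<in>PI. d x / of_real (cmod (d x))) * (\<Prod>x\<in>PI. d' x / of_real (cmod (d' x)))"
    by (simp add: norm_mult flip: prod.distrib)
  then show "to_V (a \<otimes>\<^bsub>T\<^esub> b) = to_V a \<otimes>\<^bsub>V\<^esub> to_V b"
    by (simp only: ab T_mult V_mult to_V_def split_conv of_real_mult) (simp only: mult_ac)
qed (rule to_V_carrier)

text \<open>A section of \<open>to_V\<close> that is continuous near s0. Each d x is a square root
  of x s, built from one of x s0 and one of the quotient x s / x s0, which stays away from the
  branch cut. Since z and the product of the d x are square roots of the same number, their quotient
  is a sign, and \<open>Re\<close> makes it a real number.\<close>

definition sect :: "'n cmat \<Rightarrow> 'n cmat \<times> complex \<Rightarrow> 'n cmat \<times> real \<times> ('n chr \<Rightarrow> complex)" where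
  "sect s0 = (\<lambda>(s, z).
     let d = (\<lambda>x. if x \<in> PI then csqrt (x s0) * csqrt (x s / x s0)
         else if x \<in> Rsym R then cnj (csqrt (cneg x s0) * csqrt (cneg x s / cneg x s0)) else 1)
     in (s, Re (z / (\<Prod>x\<in>PI. d x)), d))"

lemma sect:
  assumes s0: "s0 \<in> real_points S" and sz: "(s, z) \<in> carrier V"
  shows "sect s0 (s, z) \<in> carrier T" "to_V (sect s0 (s, z)) = (s, z)"
proof -
  define d where "d = (\<lambda>x. if x \<in> PI then csqrt (x s0) * csqrt (x s / x s0)
         else if x \<in> Rsym R then cnj (csqrt (cneg x s0) * csqrt (cneg x s / cneg x s0)) else 1)"
  have eq: "sect s0 (s, z) = (s, Re (z / (\<Prod>x\<in>PI. d x)), d)" by (simp add: sect_def d_def Let_def)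
  have s: "s \<in> real_points S" using sz by (simp add: V_carrier)
  have dPI: "d x * d x = x s" "cmod (d x) = 1" "d (cneg x) = cnj (d x)" if x: "x \<in> PI" for x
  proof -
    have xc: "x \<in> chars S" "imaginary x" "x \<in> Rsym R" using x R_chars by (auto simp: PI_iff Rsym_def)
    have "(csqrt (x s0) * csqrt (x s / x s0))\<^sup>2 = x s"
      using char_nonzero[OF xc(1)] by (simp add: power_mult_distrib)
    then show "d x * d x = x s" using x by (simp add: d_def power2_eq_square)
    have "cmod (x s) = 1" "cmod (x s0) = 1" using real_points_norm s s0 xc by auto
    then show "cmod (d x) = 1" using x by (simp add: d_def norm_mult norm_divide)
    show "d (cneg x) = cnj (d x)" using x xc(3) Rsym_PI[OF xc(3)] Rsym_cneg_iff[of x] by (simp add: d_def)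
  qed
  have unit: "cnj w = inverse w" if "cmod w = 1" for w
  proof -
    have "w * cnj w = 1" using that complex_norm_square[of w] by simp
    then show ?thesis using inverse_unique by metis
  qed
  have dsym: "d x \<noteq> 0 \<and> d (cneg x) = cnj (d x) \<and> d x / d (cneg x) = x s" if x: "x \<in> Rsym R" for x
  proof (cases "x \<in> PI")
    case True
    then show ?thesis using dPI[OF True] unit[of "d x"] by (auto simp: field_simps)
  next
    case False
    then have y: "cneg x \<in> PI" using Rsym_PI[OF x] by blast
    have "d x = cnj (d (cneg x))" using dPI(3)[OF y] by simp
    moreover have "d (cneg x) * d (cneg x) = inverse (x s)" using dPI(1)[OF y] by (simp add: cneg_def)
    ultimately show ?thesis using dPI(2)[OF y] unit[of "d (cneg x)"]
      by (auto simp: field_simps)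
  qed
  define p where "p = (\<Prod>x\<in>PI. d x)"
  have "p * p = (\<Prod>x\<in>PI. d x * d x)" by (simp add: p_def prod.distrib)
  also have "\<dots> = rho2 s" using dPI(1) by (simp add: rho2)
  finally have pp: "p * p = z * z" using sz by (simp add: V_carrier power2_eq_square)
  have "d x \<noteq> 0" if "x \<in> PI" for x using dPI(2)[OF that] by auto
  then have p0: "p \<noteq> 0" using finite_PI by (simp add: p_def)
  have "(z / p)\<^sup>2 = 1" using p0 by (simp add: power_divide power2_eq_square flip: pp)
  then have zp: "z / p = 1 \<or> z / p = -1" by (simp add: power2_eq_1_iff)
  then have re: "Re (z / p) \<in> {1, -1}" "of_real (Re (z / p)) = z / p" by auto
  have d1: "d x = 1" if "x \<notin> Rsym R" for x using that by (simp add: d_def PI_iff)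
  show "sect s0 (s, z) \<in> carrier T"
    unfolding eq T_carrier p_def[symmetric] using s re(1) dsym d1 by blast
  have "(\<Prod>x\<in>PI. d x / of_real (cmod (d x))) = p" using dPI(2) by (simp add: p_def)
  then show "to_V (sect s0 (s, z)) = (s, z)"
    using re(2) p0 by (simp add: eq to_V_def flip: p_def)
qed

lemma to_V_surj: "to_V ` carrier T = carrier V"
proof
  show "carrier V \<subseteq> to_V ` carrier T"
  proof
    fix y assume y: "y \<in> carrier V"
    obtain s z where "y = (s, z)" by (cases y)
    then show "y \<in> to_V ` carrier T"
      using sect[of s s z] y V_carrier[of s z] by (metis image_eqI)
  qed
qed (use to_V_carrier in blast)

text \<open>Over g = 1 the conditions on d x force it to be real, and the second entry being 1 says
  that e is the product of the signs over the positive imaginary roots.\<close>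

lemma kernel_to_V: "kernel T V to_V = pm_scalings R"
proof (rule Set.set_eqI)
  fix t :: "'n cmat \<times> real \<times> ('n chr \<Rightarrow> complex)"
  obtain g e d where t: "t = (g, e, d)" by (cases t)
  note x1 = Rsym_hom(3)
  show "t \<in> kernel T V to_V \<longleftrightarrow> t \<in> pm_scalings R"
  proof
    assume "t \<in> kernel T V to_V"
    then have tc: "(g, e, d) \<in> carrier T" and v: "g = mat 1" "of_real e * (\<Prod>x\<in>PI. d x / of_real (cmod (d x))) = 1"
      by (auto simp: kernel_def t to_V_def V_one)
    define h where "h x = Re (d x)" for x
    have real: "d x = of_real (h x)" for x
    proof (cases "x \<in> Rsym R")
      case True
      then have "d x / cnj (d x) = 1" "d x \<noteq> 0" using T_D(1-3)[OF tc, of x] v(1) x1 by simp_all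
      then have "cnj (d x) = d x" by (simp add: field_simps)
      then show ?thesis by (simp add: h_def complex_eq_iff)
    next
      case False
      then show ?thesis using tc by (simp add: T_carrier h_def)
    qed
    have "h x \<noteq> 0 \<and> h (cneg x) = h x" if "x \<in> Rsym R" for x
    proof
      show "h x \<noteq> 0" using T_D(1)[OF tc that] real[of x] by (metis of_real_0)
      show "h (cneg x) = h x" by (simp add: h_def T_D(2)[OF tc that])
    qed
    moreover have "h x = 1" if "x \<notin> Rsym R" for x
      using tc that unfolding T_carrier h_def by simp
    ultimately have hs: "\<forall>x\<in>Rsym R. h x \<noteq> 0 \<and> h (cneg x) = h x" "\<forall>x. x \<notin> Rsym R \<longrightarrow> h x = 1"
      by blast+
    have "(\<Prod>x\<in>PI. d x / of_real (cmod (d x))) = of_real (\<Prod>x\<in>PI. sgn (h x))"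
      unfolding of_real_prod by (intro prod.cong refl) (simp add: real sgn_div_norm divide_inverse mult.commute)
    then have "complex_of_real (e * (\<Prod>x\<in>PI. sgn (h x))) = 1" using v(2) by simp
    then have "e * (\<Prod>x\<in>PI. sgn (h x)) = 1" by (metis of_real_eq_1_iff)
    moreover have "e = 1 \<or> e = -1" using tc by (auto simp: T_carrier)
    ultimately have "e = (\<Prod>x\<in>PI. sgn (h x))" by auto
    also have "\<dots> = orbit_prod (pm_orbit ` Rsym R) (\<lambda>x. sgn (h x))"
      using hs by (intro orbit_prod_Rsym[symmetric]) auto
    finally show "t \<in> pm_scalings R"
      unfolding pm_scalings_def t using v(1) real hs by (intro CollectI exI[of _ h]) auto
  next
    assume "t \<in> pm_scalings R"
    then obtain h where h: "\<forall>x\<in>Rsym R. h x \<noteq> 0 \<and> h (cneg x) = h x" "\<forall>x. x \<notin> Rsym R \<longrightarrow> h x = (1::real)"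
      and tt: "g = mat 1" "e = orbit_prod (pm_orbit ` Rsym R) (\<lambda>x. sgn (h x))" "d = (\<lambda>x. complex_of_real (h x))"
      by (auto simp: pm_scalings_def t)
    have e: "e = (\<Prod>x\<in>PI. sgn (h x))" unfolding tt(2) using h by (intro orbit_prod_Rsym) auto
    have ee: "e * e = 1"
    proof -
      have "e * e = (\<Prod>x\<in>PI. sgn (h x) * sgn (h x))" by (simp only: e prod.distrib)
      also have "\<dots> = 1" using h by (intro prod.neutral) (auto simp: PI_iff sgn_if)
      finally show ?thesis .
    qed
    have "(\<Prod>x\<in>PI. d x / of_real (cmod (d x))) = of_real e"
      unfolding e of_real_prod by (intro prod.cong refl) (simp add: tt(3) sgn_div_norm divide_inverse mult.commute)
    then have "of_real e * (\<Prod>x\<in>PI. d x / of_real (cmod (d x))) = complex_of_real (e * e)" by simp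
    moreover have "(g, e, d) \<in> carrier T"
    proof -
      have "e\<^sup>2 = 1" using ee by (simp add: power2_eq_square)
      then have "e \<in> {1, -1}" by (simp add: power2_eq_1_iff)
      then show ?thesis using h x1 real_points_1 by (auto simp: T_carrier tt(1,3))
    qed
    ultimately show "t \<in> kernel T V to_V" using ee by (simp add: kernel_def t to_V_def V_one tt(1))
  qed
qed

sublocale to_V: group_hom T V to_V
  by (simp add: group_hom_def group_hom_axioms_def group_T group_V to_V_hom)

definition cov :: "'n pm_pt \<Rightarrow> 'n cmat \<times> complex" where
  "cov = (\<lambda>X. the_elem (to_V ` X))"

lemma cov_iso: "cov \<in> iso (pm_cover S R) V"
  using to_V.FactGroup_iso_set[OF to_V_surj] by (simp add: cov_def pm_cover_def kernel_to_V)

lemma to_V_coset: "t \<in> carrier T \<Longrightarrow> t' \<in> pm_class S R t \<Longrightarrow> t' \<in> carrier T \<and> to_V t' = to_V t"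
proof -
  assume t: "t \<in> carrier T" and t': "t' \<in> pm_class S R t"
  then obtain k where k: "k \<in> kernel T V to_V" "t' = k \<otimes>\<^bsub>T\<^esub> t"
    by (auto simp: pm_class_def r_coset_def kernel_to_V)
  then have "k \<in> carrier T" "to_V k = \<one>\<^bsub>V\<^esub>" by (auto simp: kernel_def)
  then show ?thesis
    using k t to_V_carrier[OF t] to_V.hom_mult[of k t] to_V.G.m_closed
      group.is_monoid[OF group_V] by (simp add: monoid.l_one)
qed

lemma class_self: "t \<in> carrier T \<Longrightarrow> t \<in> pm_class S R t"
proof -
  assume t: "t \<in> carrier T"
  have "\<one>\<^bsub>T\<^esub> \<in> pm_scalings R"
    unfolding kernel_to_V[symmetric] by (simp add: kernel_def)
  then show ?thesis unfolding pm_class_def r_coset_def using t to_V.G.l_one by force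
qed

lemma cov_class: "t \<in> carrier T \<Longrightarrow> cov (pm_class S R t) = to_V t"
proof -
  assume t: "t \<in> carrier T"
  have "to_V ` pm_class S R t = (\<lambda>_. to_V t) ` pm_class S R t"
    by (rule image_cong[OF refl]) (use to_V_coset[OF t] in blast)
  also have "\<dots> = {to_V t}" using class_self[OF t] by (simp only: image_constant)
  finally show ?thesis by (simp add: cov_def)
qed

lemma carrier_cover: "carrier (pm_cover S R) = pm_class S R ` carrier T"
  by (auto simp: pm_cover_def FactGroup_def RCOSETS_def pm_class_def)

section \<open>The topology of the covers\<close>

lemma continuous_to_V: "continuous_on (carrier T) to_V"
proof -
  have [continuous_intros]: "continuous_on A (\<lambda>t :: 'n cmat \<times> real \<times> ('n chr \<Rightarrow> complex). snd (snd t) x)" for A x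
    by (rule continuous_on_product_then_coordinatewise[of A "\<lambda>t. snd (snd t)" x])
      (intro continuous_on_snd continuous_on_id)
  have "continuous_on (carrier T) (\<lambda>t. (fst t, of_real (fst (snd t)) *
      (\<Prod>x\<in>PI. snd (snd t) x / of_real (cmod (snd (snd t) x)))))"
    by (intro continuous_intros) (auto simp: PI_d_nonzero)
  then show ?thesis by (simp add: to_V_def case_prod_unfold)
qed

lemma continuous_sect:
  assumes s0: "s0 \<in> real_points S"
  shows "continuous_on {y \<in> carrier V. \<forall>x\<in>PI. Re (x (fst y) / x s0) > 0} (sect s0)"
proof -
  let ?N = "{y \<in> carrier V. \<forall>x\<in>PI. Re (x (fst y) / x s0) > 0}"
  have NS: "fst ` ?N \<subseteq> S" by (auto simp: V_carrier real_points_def)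
  have cs: "continuous_on ?N (\<lambda>y. csqrt (x (fst y) / x s0))" if x: "x \<in> PI" for x
  proof (rule continuous_on_compose2[OF continuous_on_csqrt])
    have "continuous_on ?N (\<lambda>y. x (fst y))"
      using x R_chars by (intro continuous_on_compose2[OF chars_continuous continuous_on_fst NS])
        (auto simp: PI_iff Rsym_def intro: continuous_intros)
    then show "continuous_on ?N (\<lambda>y. x (fst y) / x s0)"
      using x R_chars char_nonzero by (intro continuous_intros) (auto simp: PI_iff Rsym_def)
    show "(\<lambda>y. x (fst y) / x s0) ` ?N \<subseteq> - \<real>\<^sub>\<le>\<^sub>0"
      using x by (auto simp: complex_nonpos_Reals_iff)
  qed
  have d: "continuous_on ?N (\<lambda>y. snd (snd (sect s0 y)) x)" for x
  proof -
    have "continuous_on ?N (\<lambda>y. if x \<in> PI then csqrt (x s0) * csqrt (x (fst y) / x s0)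
         else if x \<in> Rsym R then cnj (csqrt (cneg x s0) * csqrt (cneg x (fst y) / cneg x s0)) else 1)"
    proof (cases "x \<in> PI")
      case True
      then show ?thesis by (simp only: if_True) (intro continuous_intros cs)
    next
      case False
      show ?thesis
      proof (cases "x \<in> Rsym R")
        case True
        then have "cneg x \<in> PI" using False Rsym_PI by blast
        then show ?thesis using False True by (simp only: if_True if_False) (intro continuous_intros cs)
      qed (use False in \<open>simp only: if_False continuous_on_const\<close>)
    qed
    then show ?thesis by (simp add: sect_def Let_def case_prod_unfold)
  qed
  have nz: "(\<Prod>x\<in>PI. snd (snd (sect s0 y)) x) \<noteq> 0" if "y \<in> ?N" for y
  proof -
    have "(fst (sect s0 y), fst (snd (sect s0 y)), snd (snd (sect s0 y))) \<in> carrier T"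
      using sect(1)[OF s0, of "fst y" "snd y"] that by simp
    from PI_d_nonzero[OF this] show ?thesis using finite_PI by (simp add: prod_zero_iff)
  qed
  have "continuous_on ?N (\<lambda>y. (fst y, Re (snd y / (\<Prod>x\<in>PI. snd (snd (sect s0 y)) x)), \<lambda>x. snd (snd (sect s0 y)) x))"
    using nz by (intro continuous_intros continuous_on_coordinatewise_then_product d) auto
  moreover have "(fst y, Re (snd y / (\<Prod>x\<in>PI. snd (snd (sect s0 y)) x)), \<lambda>x. snd (snd (sect s0 y)) x) = sect s0 y" for y
    by (simp add: sect_def Let_def case_prod_unfold)
  ultimately show ?thesis by simp
qed

text \<open>Local continuous sections make \<open>to_V\<close> a quotient map: near each of its
  points, U is the preimage under a section of an open set of triples.\<close>

lemma openin_to_V: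
  assumes U: "U \<subseteq> carrier V"
  shows "openin (top_of_set (carrier T)) {t \<in> carrier T. to_V t \<in> U} \<longleftrightarrow> openin (top_of_set (carrier V)) U"
proof
  assume U': "openin (top_of_set (carrier V)) U"
  have "to_V \<in> carrier T \<rightarrow> carrier V" using to_V_carrier by blast
  from continuous_openin_preimage[OF continuous_to_V this U']
  have "openin (top_of_set (carrier T)) (carrier T \<inter> to_V -` U)" .
  moreover have "carrier T \<inter> to_V -` U = {t \<in> carrier T. to_V t \<in> U}" by blast
  ultimately show "openin (top_of_set (carrier T)) {t \<in> carrier T. to_V t \<in> U}" by (simp only:)
next
  assume W: "openin (top_of_set (carrier T)) {t \<in> carrier T. to_V t \<in> U}"
  show "openin (top_of_set (carrier V)) U"
  proof (subst openin_subopen, intro ballI)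
    fix y assume y: "y \<in> U"
    then have yV: "y \<in> carrier V" using U by blast
    define s0 where "s0 = fst y"
    have s0: "s0 \<in> real_points S" using yV by (cases y) (simp add: s0_def V_carrier)
    define N where "N = {y \<in> carrier V. \<forall>x\<in>PI. Re (x (fst y) / x s0) > 0}"
    have "openin (top_of_set (carrier V)) (carrier V \<inter> (\<Inter>x\<in>PI. (\<lambda>y. Re (x (fst y) / x s0)) -` {0<..}))"
    proof -
      have "openin (top_of_set (carrier V)) (carrier V \<inter> (\<lambda>y. Re (x (fst y) / x s0)) -` {0<..})" if x: "x \<in> PI" for x
      proof (rule continuous_openin_preimage_gen)
        have "continuous_on (carrier V) (\<lambda>y. x (fst y))"
          using x R_chars by (intro continuous_on_compose2[OF chars_continuous continuous_on_fst])
            (auto simp: PI_iff Rsym_def V_carrier real_points_def intro: continuous_intros)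
        then show "continuous_on (carrier V) (\<lambda>y. Re (x (fst y) / x s0))"
          using x R_chars char_nonzero by (intro continuous_intros) (auto simp: PI_iff Rsym_def)
      qed simp
      \<comment> \<open>The extra index imposes no condition; it keeps the intersection nonempty
        when there are no imaginary roots.\<close>
      then have "openin (top_of_set (carrier V)) (\<Inter>x\<in>insert (\<lambda>_. 1) PI. carrier V \<inter> (if x \<in> PI then (\<lambda>y. Re (x (fst y) / x s0)) -` {0<..} else UNIV))"
        using finite_PI by (intro openin_INT2) auto
      moreover have "(\<Inter>x\<in>insert (\<lambda>_. 1) PI. carrier V \<inter> (if x \<in> PI then (\<lambda>y. Re (x (fst y) / x s0)) -` {0<..} else UNIV))
         = carrier V \<inter> (\<Inter>x\<in>PI. (\<lambda>y. Re (x (fst y) / x s0)) -` {0<..})"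
        by (auto split: if_splits)
      ultimately show ?thesis by simp
    qed
    moreover have "carrier V \<inter> (\<Inter>x\<in>PI. (\<lambda>y. Re (x (fst y) / x s0)) -` {0<..}) = N" by (auto simp: N_def)
    ultimately have N: "openin (top_of_set (carrier V)) N" by simp
    have NV: "N \<subseteq> carrier V" by (auto simp: N_def)
    have sN: "sect s0 y' \<in> carrier T" "to_V (sect s0 y') = y'" if "y' \<in> N" for y'
      using sect[OF s0, of "fst y'" "snd y'"] that NV by auto
    have "continuous_on N (sect s0)" unfolding N_def by (rule continuous_sect[OF s0])
    then have "openin (top_of_set N) (N \<inter> sect s0 -` {t \<in> carrier T. to_V t \<in> U})"
      using continuous_openin_preimage[OF _ _ W, of N "sect s0"] sN by auto
    moreover have "N \<inter> sect s0 -` {t \<in> carrier T. to_V t \<in> U} = N \<inter> U" using sN by auto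
    ultimately have "openin (top_of_set N) (N \<inter> U)" by (simp only:)
    then have "openin (top_of_set (carrier V)) (N \<inter> U)" by (rule openin_trans[OF _ N])
    moreover have "y \<in> N"
      using yV char_nonzero R_chars by (auto simp: N_def s0_def PI_iff Rsym_def)
    ultimately show "\<exists>T'. openin (top_of_set (carrier V)) T' \<and> y \<in> T' \<and> T' \<subseteq> U" using y by blast
  qed
qed

lemma openin_pm_topology:
  "openin (pm_topology S R) U \<longleftrightarrow> U \<subseteq> carrier (pm_cover S R) \<and>
     openin (top_of_set (carrier T)) {t \<in> carrier T. pm_class S R t \<in> U}"
proof -
  have "istopology (\<lambda>U. U \<subseteq> carrier (pm_cover S R) \<and>
     openin (top_of_set (carrier T)) {t \<in> carrier T. pm_class S R t \<in> U})"
    unfolding istopology_def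
  proof (intro conjI allI impI)
    fix A B assume AB: "A \<subseteq> carrier (pm_cover S R) \<and> openin (top_of_set (carrier T)) {t \<in> carrier T. pm_class S R t \<in> A}"
      "B \<subseteq> carrier (pm_cover S R) \<and> openin (top_of_set (carrier T)) {t \<in> carrier T. pm_class S R t \<in> B}"
    then show "A \<inter> B \<subseteq> carrier (pm_cover S R)" by blast
    have "{t \<in> carrier T. pm_class S R t \<in> A \<inter> B} = {t \<in> carrier T. pm_class S R t \<in> A} \<inter> {t \<in> carrier T. pm_class S R t \<in> B}"
      by blast
    then show "openin (top_of_set (carrier T)) {t \<in> carrier T. pm_class S R t \<in> A \<inter> B}"
      using AB by (simp only: openin_Int)
  next
    fix K assume K: "\<forall>A\<in>K. A \<subseteq> carrier (pm_cover S R) \<and> openin (top_of_set (carrier T)) {t \<in> carrier T. pm_class S R t \<in> A}"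
    then show "\<Union>K \<subseteq> carrier (pm_cover S R)" by blast
    have "{t \<in> carrier T. pm_class S R t \<in> \<Union>K} = (\<Union>A\<in>K. {t \<in> carrier T. pm_class S R t \<in> A})" by blast
    moreover have "openin (top_of_set (carrier T)) (\<Union>A\<in>K. {t \<in> carrier T. pm_class S R t \<in> A})"
      using K by (intro openin_Union) auto
    ultimately show "openin (top_of_set (carrier T)) {t \<in> carrier T. pm_class S R t \<in> \<Union>K}" by simp
  qed
  then show ?thesis unfolding pm_topology_def by (simp add: topology_inverse')
qed

lemma topspace_pm_topology: "topspace (pm_topology S R) = carrier (pm_cover S R)"
proof
  have "{t \<in> carrier T. pm_class S R t \<in> carrier (pm_cover S R)} = carrier T" by (auto simp: carrier_cover)
  then have "openin (pm_topology S R) (carrier (pm_cover S R))" by (simp add: openin_pm_topology)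
  then show "carrier (pm_cover S R) \<subseteq> topspace (pm_topology S R)" by (rule openin_subset)
  show "topspace (pm_topology S R) \<subseteq> carrier (pm_cover S R)"
    using openin_topspace[of "pm_topology S R", unfolded openin_pm_topology] by (rule conjunct1)
qed

lemma homeomorphic_cov: "homeomorphic_map (pm_topology S R) (top_of_set (carrier V)) cov"
  unfolding homeomorphic_map_def quotient_map_def topspace_pm_topology topspace_euclidean_subtopology
proof (intro conjI allI impI)
  show "cov ` carrier (pm_cover S R) = carrier V" "inj_on cov (carrier (pm_cover S R))"
    using cov_iso by (auto simp: iso_def bij_betw_def)
  fix U assume U: "U \<subseteq> carrier V"
  have "{t \<in> carrier T. pm_class S R t \<in> {X \<in> carrier (pm_cover S R). cov X \<in> U}} = {t \<in> carrier T. to_V t \<in> U}"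
    by (auto simp: carrier_cover cov_class)
  then show "openin (pm_topology S R) {x \<in> carrier (pm_cover S R). cov x \<in> U} = openin (top_of_set (carrier V)) U"
    by (simp add: openin_pm_topology openin_to_V[OF U])
qed

lemma minus_one_T: "(mat 1, -1, \<lambda>_. 1) \<in> carrier T"
  by (simp add: T_carrier real_points_1 Rsym_hom(3))

lemma genuine_iff: "X \<circ> cov \<in> pm_genuine S R \<longleftrightarrow> X \<in> av_genuine S rho2"
proof -
  have "X \<circ> cov \<in> hom (pm_cover S R) Cx \<longleftrightarrow> X \<in> hom V Cx"
  proof
    assume "X \<in> hom V Cx"
    then show "X \<circ> cov \<in> hom (pm_cover S R) Cx"
      using cov_iso hom_compose by (metis Group.iso_imp_homomorphism)
  next
    assume h: "X \<circ> cov \<in> hom (pm_cover S R) Cx"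
    have im: "cov ` carrier (pm_cover S R) = carrier V" using cov_iso by (auto simp: iso_def bij_betw_def)
    have c: "cov \<in> hom (pm_cover S R) V" using cov_iso by (rule Group.iso_imp_homomorphism)
    have "X (cov a) \<in> carrier Cx" if "a \<in> carrier (pm_cover S R)" for a
      using hom_in_carrier[OF h that] by simp
    moreover have "X (cov a \<otimes>\<^bsub>V\<^esub> cov b) = X (cov a) \<otimes>\<^bsub>Cx\<^esub> X (cov b)"
      if "a \<in> carrier (pm_cover S R)" "b \<in> carrier (pm_cover S R)" for a b
      using hom_mult[OF h that] hom_mult[OF c that] by simp
    ultimately show "X \<in> hom V Cx" by (intro homI) (auto simp flip: im)
  qed
  moreover have "continuous_map (pm_topology S R) euclidean (X \<circ> cov) \<longleftrightarrow> continuous_on (carrier V) X"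
    using continuous_compose_quotient_map_eq[of "pm_topology S R" "top_of_set (carrier V)" cov euclidean X]
      homeomorphic_cov by (simp add: homeomorphic_map_def)
  moreover have "cov (pm_class S R (mat 1, -1, \<lambda>_. 1)) = (mat 1, -1)"
    by (simp add: cov_class[OF minus_one_T] to_V_def)
  ultimately show ?thesis by (simp add: pm_genuine_def av_genuine_def)
qed

end

section \<open>The L-groups\<close>

lemma dual_act_False [simp]: "dual_act False s = s"
  by (simp add: dual_act_def)

lemma dual_act_mult: "dual_act b (\<lambda>l. s l * t l) = (\<lambda>l. dual_act b s l * dual_act b t l)"
  and dual_act_inverse: "dual_act b (\<lambda>l. inverse (s l)) = (\<lambda>l. inverse (dual_act b s l))"
  and dual_act_one: "dual_act b (\<lambda>_. 1) = (\<lambda>_. 1)"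
  and dual_act_prod: "dual_act b (\<lambda>l. \<Prod>x\<in>A. f x l) = (\<lambda>l. \<Prod>x\<in>A. dual_act b (f x) l)"
  by (simp_all add: dual_act_def)

lemma gact_simps [simp]: "gact False x = x" "gact True x = csig x"
  by (simp_all add: gact_def)

context root_datum
begin

lemma twisted_mult:
  "(s, a) \<otimes>\<^bsub>twisted_L S \<tau>\<^esub> (s', b) = ((\<lambda>l. s l * dual_act a s' l * \<tau> a b l), a \<noteq> b)"
  and twisted_carrier: "carrier (twisted_L S \<tau>) = dual_torus S \<times> UNIV"
  and twisted_one: "\<one>\<^bsub>twisted_L S \<tau>\<^esub> = ((\<lambda>_. 1), False)"
  by (simp_all add: twisted_L_def)

text \<open>Conjugation by u in the dual torus. For normalized cocycles it does not involve the
  cocycle, so one formula serves both kinds of L-groups.\<close>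

definition cj :: "'n dual \<Rightarrow> 'n dual \<times> bool \<Rightarrow> 'n dual \<times> bool" where
  "cj u = (\<lambda>(s, a). (\<lambda>l. u l * s l * inverse (dual_act a u l), a))"

lemma L_conj_eq:
  assumes "\<And>b. \<tau> False b = (\<lambda>_. 1)" "\<And>a. \<tau> a False = (\<lambda>_. 1)" "u \<in> dual_torus S"
  shows "L_conj (twisted_L S \<tau>) u = cj u"
proof -
  let ?L = "twisted_L S \<tau>"
  have "inv\<^bsub>?L\<^esub> (u, False) = ((\<lambda>l. inverse (u l)), False)"
    unfolding m_inv_def
  proof (rule the_equality)
    show "((\<lambda>l. inverse (u l)), False) \<in> carrier ?L \<and>
      (u, False) \<otimes>\<^bsub>?L\<^esub> ((\<lambda>l. inverse (u l)), False) = \<one>\<^bsub>?L\<^esub> \<and>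
      ((\<lambda>l. inverse (u l)), False) \<otimes>\<^bsub>?L\<^esub> (u, False) = \<one>\<^bsub>?L\<^esub>"
      using assms dual_torusD(1)[OF assms(3)]
      by (simp add: twisted_carrier twisted_mult twisted_one dual_torus_inverse fun_eq_iff)
    fix y assume "y \<in> carrier ?L \<and> (u, False) \<otimes>\<^bsub>?L\<^esub> y = \<one>\<^bsub>?L\<^esub> \<and> y \<otimes>\<^bsub>?L\<^esub> (u, False) = \<one>\<^bsub>?L\<^esub>"
    moreover obtain s b where "y = (s, b)" by (cases y)
    ultimately have ys: "y = (s, False)" "\<And>l. u l * s l = 1"
      by (simp_all add: twisted_mult twisted_one assms fun_eq_iff)
    have "inverse (u l) = s l" for l using ys(2) by (rule inverse_unique)
    then show "y = ((\<lambda>l. inverse (u l)), False)" using ys(1) by simp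
  qed
  then show ?thesis
    by (auto simp: L_conj_def cj_def twisted_mult assms dual_act_inverse fun_eq_iff)
qed

lemma cj_cj: "cj u (cj v y) = cj (\<lambda>l. u l * v l) y"
  by (cases y) (simp add: cj_def dual_act_mult fun_eq_iff mult_ac)

subsection \<open>Sign elements\<close>

definition sg :: "'n chr \<Rightarrow> 'n dual" where
  "sg x = tens S x (- 1)"

definition sgs :: "'n chr set \<Rightarrow> 'n dual" where
  "sgs A = (\<lambda>l. \<Prod>x\<in>A. sg x l)"

lemma sg_square: "sg x l * sg x l = 1"
  by (simp add: sg_def tens_minus_1_square)

lemma sg_inverse: "inverse (sg x l) = sg x l"
  using sg_square inverse_unique by blast

lemma sg_cneg: "x \<in> chars S \<Longrightarrow> sg (cneg x) = sg x"
  using sg_inverse by (simp add: sg_def tens_cneg fun_eq_iff)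

lemma sgs_square: "sgs A l * sgs A l = 1"
  by (simp add: sgs_def sg_square flip: prod.distrib)

lemma sgs_inverse: "inverse (sgs A l) = sgs A l"
  using sgs_square inverse_unique by blast

lemma sgs_dual_torus: "A \<subseteq> chars S \<Longrightarrow> sgs A \<in> dual_torus S"
  unfolding sgs_def by (intro dual_torus_prod) (auto simp: sg_def intro: tens_dual_torus)

lemma dual_act_sgs: "A \<subseteq> chars S \<Longrightarrow> dual_act True (sgs A) = sgs (csig ` A)"
proof -
  assume A: "A \<subseteq> chars S"
  have "inj_on csig A" by (simp add: inj_on_def csig_inj)
  then have "sgs (csig ` A) = (\<lambda>l. \<Prod>x\<in>A. sg (csig x) l)" by (simp add: sgs_def prod.reindex)
  also have "\<dots> = (\<lambda>l. \<Prod>x\<in>A. dual_act True (sg x) l)"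
    using A by (intro ext prod.cong) (auto simp: sg_def dual_act_tens)
  finally show ?thesis by (simp add: sgs_def dual_act_prod)
qed

lemma sgs_cneg_image: "A \<subseteq> chars S \<Longrightarrow> sgs (cneg ` A) = sgs A"
proof -
  assume A: "A \<subseteq> chars S"
  have "inj_on cneg A" by (simp add: inj_on_def cneg_inj)
  then have "sgs (cneg ` A) = (\<lambda>l. \<Prod>x\<in>A. sg (cneg x) l)" by (simp add: sgs_def prod.reindex)
  also have "\<dots> = sgs A" unfolding sgs_def using A sg_cneg by (intro ext prod.cong) auto
  finally show ?thesis .
qed

lemma sgs_Un: "finite A \<Longrightarrow> finite B \<Longrightarrow> A \<inter> B = {} \<Longrightarrow> sgs (A \<union> B) l = sgs A l * sgs B l"
  by (simp add: sgs_def prod.union_disjoint)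

subsection \<open>A Galois invariant gauge\<close>

text \<open>For asymmetric x the norm x + \<sigma>x, written as a product, is different from 0
  precisely because x is not imaginary. Its sign is a gauge value that is Galois invariant.\<close>

definition q0 :: "'n chr \<Rightarrow> int" where
  "q0 x = (if positive (if imaginary x then x else (\<lambda>s. x s * csig x s)) then 1 else - 1)"

lemma q0_values: "q0 x = 1 \<or> q0 x = - 1"
  by (simp add: q0_def)

lemma q0_cneg:
  assumes x: "x \<in> R" shows "q0 (cneg x) = - q0 x"
proof (cases "imaginary x")
  case True
  then show ?thesis using R_positive_cneg[OF x] by (simp add: q0_def imaginary_cneg)
next
  case False
  let ?n = "\<lambda>s. x s * csig x s"
  have eq: "(\<lambda>s. cneg x s * csig (cneg x) s) = cneg ?n" by (simp add: csig_cneg) (simp add: cneg_def)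
  have "?n \<in> chars S" using x by (intro chars_mult R_chars R_csig)
  moreover have "cneg ?n \<in> chars S" unfolding eq[symmetric]
    using x by (intro chars_mult R_chars R_csig R_cneg)
  moreover have "?n \<noteq> (\<lambda>_. 1)"
  proof
    assume "?n = (\<lambda>_. 1)"
    then have "x s * csig x s = 1" for s by (rule fun_cong)
    then have "csig x s = cneg x s" for s unfolding cneg_def by (metis inverse_unique)
    then show False using False by (auto simp: imaginary_def)
  qed
  ultimately have "positive (cneg ?n) \<longleftrightarrow> \<not> positive ?n" by (rule positive_cneg)
  then show ?thesis using False by (simp add: q0_def imaginary_cneg eq)
qed

lemma imaginary_csig_iff: "imaginary (csig x) \<longleftrightarrow> imaginary x"
  by (metis imaginary_def csig_cneg csig_csig cneg_cneg)

lemma q0_csig: "\<not> imaginary x \<Longrightarrow> q0 (csig x) = q0 x"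
  by (simp add: q0_def imaginary_csig_iff mult.commute)

lemma gauge_q0: "gauge_on R q0"
  using q0_values q0_cneg by (auto simp: gauge_on_def)

lemma gaugeD:
  assumes "gauge_on R p" "x \<in> R"
  shows "p x = 1 \<or> p x = - 1" "p (cneg x) = - p x"
  using assms by (auto simp: gauge_on_def)

text \<open>The asymmetric roots where p jumps from 1 to -1 are permuted by x -> -\<sigma>x, which
  flips \<open>q0\<close>; this set has one root of each pair. The product of (-1)^x over it is the
  cochain that corrects \<open>t_gauge\<close>.\<close>

definition Up :: "('n chr \<Rightarrow> int) \<Rightarrow> 'n chr set" where
  "Up p = {x \<in> R. \<not> imaginary x \<and> p x = 1 \<and> p (csig x) = - 1 \<and> q0 x = 1}"

lemma Up_chars: "Up p \<subseteq> chars S" and finite_Up: "finite (Up p)"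
  using R by (auto simp: Up_def)

lemma Up_symmetric: "(\<forall>x\<in>Rasym R. p (csig x) = p x) \<Longrightarrow> Up p = {}"
  by (auto simp: Up_def Rasym_def)

text \<open>(-1)^x is the same for x and -x, so any choice of one root from each sign pair gives the
  same product.\<close>

lemma sgs_half_imaginary:
  assumes p: "gauge_on R p"
  shows "sgs {x \<in> Rsym R. p x = 1} = sgs PI"
proof -
  let ?I = "{x \<in> Rsym R. p x = 1}"
  define f where "f x = (if x \<in> PI then x else cneg x)" for x
  have "bij_betw f ?I PI"
  proof (rule bij_betw_byWitness[where f' = "\<lambda>x. if p x = 1 then x else cneg x"])
    show "f ` ?I \<subseteq> PI" using Rsym_PI by (auto simp: f_def)
    show "(\<lambda>x. if p x = 1 then x else cneg x) ` PI \<subseteq> ?I"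
    proof (rule image_subsetI)
      fix x assume "x \<in> PI"
      then have "x \<in> Rsym R" by (simp add: PI_iff)
      then show "(if p x = 1 then x else cneg x) \<in> ?I"
        using gaugeD[OF p Rsym_R[of x]] Rsym_cneg_iff[of x] by auto
    qed
    show "\<forall>x\<in>?I. (if p (f x) = 1 then f x else cneg (f x)) = x"
      using gaugeD[OF p] Rsym_R by (auto simp: f_def)
    show "\<forall>x\<in>PI. f (if p x = 1 then x else cneg x) = x"
      using Rsym_PI by (auto simp: f_def PI_iff)
  qed
  then have "sgs PI l = (\<Prod>x\<in>?I. sg (f x) l)" for l
    unfolding sgs_def by (rule prod.reindex_bij_betw[symmetric])
  moreover have "sg (f x) = sg x" if "x \<in> ?I" for x
    using that sg_cneg R_chars Rsym_R by (auto simp: f_def)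
  ultimately show ?thesis by (auto simp: sgs_def fun_eq_iff intro!: prod.cong)
qed

text \<open>Both sides are the image of -1 under the character 2 rho_i, because exp (pi i k) =
  (-1)^k.\<close>

lemma exp_rho2: "exp_2pi_i_half S rho2 = sgs PI"
proof -
  have "exp_2pi_i_half S rho2 l = tens S rho2 (- 1) l" for l
  proof -
    have "exp (2 * of_real pi * \<i> * (of_int k / 2)) = (- 1 :: complex) powi k" for k
    proof -
      have "exp (2 * of_real pi * \<i> * (of_int k / 2)) = exp (of_int k * (of_real pi * \<i>))"
        by (simp add: mult_ac)
      also have "\<dots> = exp (of_real pi * \<i>) powi k" by (rule exp_power_int[symmetric])
      also have "exp (of_real pi * \<i>) = (- 1 :: complex)" by (simp add: exp_pi_i)
      finally show ?thesis .
    qed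
    then show ?thesis by (simp add: exp_2pi_i_half_def tens_def)
  qed
  moreover have "tens S rho2 (- 1) l = (\<Prod>x\<in>PI. tens S x (- 1) l)" for l
    using tens_char_prod[of PI "\<lambda>x. x" "- 1" l] R_chars
    by (simp add: rho2[abs_def] PI_iff Rsym_def)
  ultimately show ?thesis by (simp add: sgs_def sg_def fun_eq_iff)
qed

lemma t_gauge_trivial: "t_gauge S R p False b = (\<lambda>_. 1)" "t_gauge S R p a False = (\<lambda>_. 1)"
proof -
  have "{x \<in> R. p x = 1 \<and> p (gact False x) = -1 \<and> p (gact (False \<noteq> b) x) = 1} = {}" by auto
  then show "t_gauge S R p False b = (\<lambda>_. 1)" by (simp only: t_gauge_def prod.empty)
  have "{x \<in> R. p x = 1 \<and> p (gact a x) = -1 \<and> p (gact (a \<noteq> False) x) = 1} = {}" by (cases a) auto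
  then show "t_gauge S R p a False = (\<lambda>_. 1)" by (simp only: t_gauge_def prod.empty)
qed

text \<open>The roots where p jumps from 1 to -1 are \<open>Up p\<close>, its image under x ->
  -\<sigma>x, and one root of each imaginary sign pair. Since (-1)^x ignores signs, the first two
  contribute an element of the dual torus times its Galois conjugate.\<close>

lemma t_gauge_True:
  assumes p: "gauge_on R p"
  shows "t_gauge S R p True True l = sgs (Up p) l * dual_act True (sgs (Up p)) l * sgs PI l"
proof -
  let ?I = "{x \<in> Rsym R. p x = 1}" and ?t = "\<lambda>x. cneg (csig x)"
  have set: "{x \<in> R. p x = 1 \<and> p (csig x) = -1} = Up p \<union> ?t ` Up p \<union> ?I"
  proof
    show "{x \<in> R. p x = 1 \<and> p (csig x) = -1} \<subseteq> Up p \<union> ?t ` Up p \<union> ?I"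
    proof
      fix x assume x: "x \<in> {x \<in> R. p x = 1 \<and> p (csig x) = -1}"
      consider "imaginary x" | "\<not> imaginary x" "q0 x = 1" | "\<not> imaginary x" "q0 x = - 1"
        using q0_values by blast
      then show "x \<in> Up p \<union> ?t ` Up p \<union> ?I"
      proof cases
        case 3
        have "?t x \<in> Up p"
          using x 3 gaugeD[OF p] R_csig q0_cneg q0_csig
          by (auto simp: Up_def csig_cneg imaginary_cneg imaginary_csig_iff intro!: R_cneg)
        moreover have "x = ?t (?t x)" by (simp add: csig_cneg)
        ultimately show ?thesis by blast
      qed (use x in \<open>auto simp: Up_def Rsym_def\<close>)
    qed
    show "Up p \<union> ?t ` Up p \<union> ?I \<subseteq> {x \<in> R. p x = 1 \<and> p (csig x) = -1}"
    proof -
      have "p (csig x) = - p x" if "x \<in> R" "imaginary x" for x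
        using that gaugeD(2)[OF p] by (simp add: imaginary_csig)
      then show ?thesis
        using gaugeD[OF p] R_csig by (auto simp: Up_def Rsym_def csig_cneg intro!: R_cneg)
    qed
  qed
  have d1: "Up p \<inter> ?t ` Up p = {}"
    using q0_cneg q0_csig R_csig by (force simp: Up_def)
  have d2: "(Up p \<union> ?t ` Up p) \<inter> ?I = {}"
    by (auto simp: Up_def Rsym_def imaginary_cneg imaginary_csig_iff)
  have fin: "finite (Up p)" "finite (?t ` Up p)" "finite ?I"
    using finite_Up R(1) by (auto simp: Rsym_def)
  have "t_gauge S R p True True l = sgs {x \<in> R. p x = 1 \<and> p (csig x) = -1} l"
    unfolding t_gauge_def sgs_def sg_def by (intro prod.cong) auto
  also have "\<dots> = sgs (Up p) l * sgs (?t ` Up p) l * sgs ?I l"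
    unfolding set using sgs_Un[OF _ _ d2] sgs_Un[OF _ _ d1] fin by simp
  also have "sgs (?t ` Up p) = sgs (csig ` Up p)"
    using sgs_cneg_image[of "csig ` Up p"] Up_chars chars_csig by (auto simp: image_image)
  also have "sgs (csig ` Up p) = dual_act True (sgs (Up p))" using dual_act_sgs[OF Up_chars] by simp
  finally show ?thesis by (simp add: sgs_half_imaginary[OF p])
qed

subsection \<open>The isomorphism of L-groups\<close>

text \<open>The \<sigma>-component is rescaled by the cochain of \<open>Up p\<close>, which turns
  the cocycle of p into the Adams-Vogan one. The factor has order 2, so the map is its own inverse
  on underlying sets.\<close>

definition Fp :: "('n chr \<Rightarrow> int) \<Rightarrow> 'n dual \<times> bool \<Rightarrow> 'n dual \<times> bool" where
  "Fp p = (\<lambda>(s, a). (if a then (\<lambda>l. s l * sgs (Up p) l) else s, a))"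

lemma pm_L_carrier: "carrier (pm_L S R p) = dual_torus S \<times> UNIV"
  and av_L_carrier: "carrier (av_L S rho2) = dual_torus S \<times> UNIV"
  by (simp_all add: pm_L_def av_L_def twisted_carrier)

lemma L_conj_pm: "u \<in> dual_torus S \<Longrightarrow> L_conj (pm_L S R p) u = cj u"
  unfolding pm_L_def by (rule L_conj_eq) (simp_all add: t_gauge_trivial)

lemma L_conj_av: "u \<in> dual_torus S \<Longrightarrow> L_conj (av_L S rho2) u = cj u"
  unfolding av_L_def by (rule L_conj_eq) simp_all

lemma Up_dual: "sgs (Up p) \<in> dual_torus S"
  by (rule sgs_dual_torus[OF Up_chars])

lemma Fp_carrier: "y \<in> dual_torus S \<times> UNIV \<Longrightarrow> Fp p y \<in> dual_torus S \<times> UNIV"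
  using dual_torus_mult[OF _ Up_dual] by (auto simp: Fp_def)

lemma Fp_Fp: "Fp p (Fp p y) = y"
  using sgs_square by (cases y) (simp add: Fp_def fun_eq_iff mult.assoc)

lemma Fp_iso:
  assumes p: "gauge_on R p"
  shows "Fp p \<in> iso (pm_L S R p) (av_L S rho2)"
proof -
  have "Fp p \<in> hom (pm_L S R p) (av_L S rho2)"
  proof (rule homI)
    fix y assume "y \<in> carrier (pm_L S R p)"
    then show "Fp p y \<in> carrier (av_L S rho2)" using Fp_carrier by (simp only: pm_L_carrier av_L_carrier)
  next
    fix y y' assume "y \<in> carrier (pm_L S R p)" "y' \<in> carrier (pm_L S R p)"
    obtain s a s' b where y: "y = (s, a)" "y' = (s', b)" by (cases y; cases y')
    show "Fp p (y \<otimes>\<^bsub>pm_L S R p\<^esub> y') = Fp p y \<otimes>\<^bsub>av_L S rho2\<^esub> Fp p y'"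
    proof (cases a; cases b)
      assume ab: a b
      have "sgs (Up p) l * (sgs (Up p) l * z) = z" for l z
        using sgs_square[of "Up p" l] by (simp flip: mult.assoc)
      then show ?thesis using ab
        by (simp add: y pm_L_def av_L_def twisted_mult Fp_def t_gauge_True[OF p] exp_rho2 dual_act_mult fun_eq_iff mult_ac)
    qed (simp_all add: y pm_L_def av_L_def twisted_mult Fp_def t_gauge_trivial dual_act_mult fun_eq_iff mult_ac)
  qed
  moreover have "bij_betw (Fp p) (carrier (pm_L S R p)) (carrier (av_L S rho2))"
    unfolding pm_L_carrier av_L_carrier
  proof (rule bij_betw_byWitness[where f' = "Fp p"])
    show "Fp p ` (dual_torus S \<times> UNIV) \<subseteq> dual_torus S \<times> UNIV" using Fp_carrier by blast
    then show "Fp p ` (dual_torus S \<times> UNIV) \<subseteq> dual_torus S \<times> UNIV" .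
  qed (simp_all add: Fp_Fp)
  ultimately show ?thesis by (simp add: iso_def)
qed

lemma continuous_Fp: "continuous_on A (Fp p)"
proof -
  have c: "continuous_on A (\<lambda>y :: 'n dual \<times> bool. fst y l)" for l A
    by (rule continuous_on_product_then_coordinatewise[of A "\<lambda>y. fst y" l])
      (intro continuous_on_fst continuous_on_id)
  have closed: "closed {y :: 'n dual \<times> bool. snd y}" "closed {y :: 'n dual \<times> bool. \<not> snd y}"
  proof -
    have "closed (snd -` {True} :: ('n dual \<times> bool) set)" "closed (snd -` {False} :: ('n dual \<times> bool) set)"
      by (intro closed_vimage finite_imp_closed continuous_intros; simp)+
    then show "closed {y :: 'n dual \<times> bool. snd y}" "closed {y :: 'n dual \<times> bool. \<not> snd y}"
      by (simp_all add: vimage_def)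
  qed
  have "continuous_on UNIV (\<lambda>y :: 'n dual \<times> bool. if snd y then fst y l * sgs (Up p) l else fst y l)" for l
  proof -
    have "continuous_on ({y :: 'n dual \<times> bool. snd y} \<union> {y. \<not> snd y}) (\<lambda>y. if snd y then fst y l * sgs (Up p) l else fst y l)"
      using closed by (intro continuous_on_If) (auto intro!: continuous_intros c)
    moreover have "{y :: 'n dual \<times> bool. snd y} \<union> {y. \<not> snd y} = UNIV" by auto
    ultimately show ?thesis by simp
  qed
  then have "continuous_on UNIV (\<lambda>y :: 'n dual \<times> bool. ((\<lambda>l. if snd y then fst y l * sgs (Up p) l else fst y l), snd y))"
    by (intro continuous_intros continuous_on_coordinatewise_then_product) auto
  moreover have "Fp p y = ((\<lambda>l. if snd y then fst y l * sgs (Up p) l else fst y l), snd y)" for y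
    by (cases y) (auto simp: Fp_def)
  ultimately show ?thesis using continuous_on_subset[of UNIV "Fp p" A] by (simp add: fun_eq_iff[symmetric])
qed

lemma Fp_homeomorphism:
  "homeomorphism (carrier (pm_L S R p)) (carrier (av_L S rho2)) (Fp p) (Fp p)"
proof -
  have "Fp p ` (dual_torus S \<times> UNIV) = dual_torus S \<times> UNIV"
  proof
    show "Fp p ` (dual_torus S \<times> UNIV) \<subseteq> dual_torus S \<times> UNIV" using Fp_carrier by blast
    show "dual_torus S \<times> UNIV \<subseteq> Fp p ` (dual_torus S \<times> UNIV)"
    proof
      fix y :: "'n dual \<times> bool" assume "y \<in> dual_torus S \<times> UNIV"
      then have "Fp p (Fp p y) \<in> Fp p ` (dual_torus S \<times> UNIV)" using Fp_carrier by blast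
      then show "y \<in> Fp p ` (dual_torus S \<times> UNIV)" by (simp only: Fp_Fp)
    qed
  qed
  then show ?thesis
    unfolding homeomorphism_def pm_L_carrier av_L_carrier by (simp add: Fp_Fp continuous_Fp)
qed

lemma Fp_symmetric: "(\<forall>x\<in>Rasym R. p (csig x) = p x) \<Longrightarrow> Fp p y = y"
  using Up_symmetric by (cases y) (simp add: Fp_def sgs_def)

lemma Fp_cj: "Fp p (cj t y) = cj t (Fp p y)"
  by (cases y) (simp add: Fp_def cj_def fun_eq_iff mult_ac)

section \<open>Change of gauge\<close>

definition Spq :: "('n chr \<Rightarrow> int) \<Rightarrow> ('n chr \<Rightarrow> int) \<Rightarrow> 'n chr set" where
  "Spq p q = {x \<in> R. (p x = 1 \<and> p (csig x) = -1 \<and> q x = 1 \<and> q (csig x) = 1) \<or>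
                  (p x = 1 \<and> p (csig x) = 1 \<and> q x = -1 \<and> q (csig x) = 1)}"

lemma s_gauge_False: "s_gauge S R p q False l = 1"
proof -
  have "{x \<in> R. (p x = 1 \<and> p (gact False x) = -1 \<and> q x = 1 \<and> q (gact False x) = 1) \<or>
                  (p x = 1 \<and> p (gact False x) = 1 \<and> q x = -1 \<and> q (gact False x) = 1)} = {}" by auto
  then show ?thesis by (simp only: s_gauge_def prod.empty)
qed

lemma s_gauge_True: "s_gauge S R p q True = sgs (Spq p q)"
  by (simp add: s_gauge_def sgs_def sg_def Spq_def)

text \<open>Each asymmetric root is x or -x for a unique x with \<open>q0 x = 1\<close>, and both
  have the same sign element. Products over different sets become comparable by parities at these
  x.\<close>

lemma half_system_prod:
  assumes Z: "Z \<subseteq> Rasym R"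
  shows "sgs Z l = (\<Prod>x\<in>{x \<in> Rasym R. q0 x = 1}.
     (if x \<in> Z then sg x l else 1) * (if cneg x \<in> Z then sg x l else 1))"
proof -
  let ?Q = "{x \<in> Rasym R. q0 x = 1}"
  have fin: "finite (Rasym R)" using R(1) by (simp add: Rasym_def)
  have Rasym: "x \<in> Rasym R \<longleftrightarrow> x \<in> R \<and> \<not> imaginary x" for x by (auto simp: Rasym_def)
  have un: "Rasym R = ?Q \<union> cneg ` ?Q"
  proof
    show "Rasym R \<subseteq> ?Q \<union> cneg ` ?Q"
    proof
      fix x assume x: "x \<in> Rasym R"
      show "x \<in> ?Q \<union> cneg ` ?Q"
      proof (cases "q0 x = 1")
        case False
        then have "cneg x \<in> ?Q" using x q0_values[of x] q0_cneg R_cneg by (auto simp: Rasym imaginary_cneg)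
        then have "cneg (cneg x) \<in> cneg ` ?Q" by (rule imageI)
        then show ?thesis by simp
      qed (use x in blast)
    qed
    show "?Q \<union> cneg ` ?Q \<subseteq> Rasym R" using R_cneg by (auto simp: Rasym imaginary_cneg)
  qed
  have dis: "?Q \<inter> cneg ` ?Q = {}" using q0_cneg by (force simp: Rasym)
  have "sgs Z l = (\<Prod>x\<in>Rasym R. if x \<in> Z then sg x l else 1)"
    unfolding sgs_def using Z fin by (simp add: prod.inter_restrict[symmetric] Int_absorb1)
  also have "\<dots> = (\<Prod>x\<in>?Q. if x \<in> Z then sg x l else 1) * (\<Prod>x\<in>cneg ` ?Q. if x \<in> Z then sg x l else 1)"
    using fin dis by (subst un, subst prod.union_disjoint) auto
  also have "(\<Prod>x\<in>cneg ` ?Q. if x \<in> Z then sg x l else 1) = (\<Prod>x\<in>?Q. if cneg x \<in> Z then sg (cneg x) l else 1)"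
    by (subst prod.reindex) (auto simp: inj_on_def cneg_inj)
  also have "\<dots> = (\<Prod>x\<in>?Q. if cneg x \<in> Z then sg x l else 1)"
    using sg_cneg R_chars by (intro prod.cong) (auto simp: Rasym)
  finally show ?thesis by (simp only: prod.distrib)
qed

text \<open>The parity of the exponent with which \<open>x\<close> occurs is invariant under conjugation, so that the
  product is a coboundary.\<close>

lemma gauge_coboundary:
  assumes p: "gauge_on R p" and q: "gauge_on R q"
  obtains t where "t \<in> dual_torus S"
    "\<And>l. sgs (Spq p q) l * sgs (Up q) l = sgs (Up p) l * (t l * inverse (dual_act True t l))"
proof -
  let ?Q = "{x \<in> Rasym R. q0 x = 1}"
  \<comment> \<open>The parity with which (-1)^x occurs in the product of the three sign
    elements.\<close>
  define k where "k x \<longleftrightarrow> (((x \<in> Spq p q) \<noteq> (cneg x \<in> Spq p q)) \<noteq> (x \<in> Up q)) \<noteq> (x \<in> Up p)" for x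
  have Rasym: "x \<in> Rasym R \<longleftrightarrow> x \<in> R \<and> \<not> imaginary x" for x by (auto simp: Rasym_def)
  have QD: "x \<in> R" "\<not> imaginary x" "q0 x = 1" "csig x \<in> ?Q" if "x \<in> ?Q" for x
    using that R_csig q0_csig by (auto simp: Rasym imaginary_csig_iff)
  have fin: "finite ?Q" using R(1) by (simp add: Rasym_def)
  have "Spq p q \<subseteq> Rasym R"
    using gaugeD[OF p] gaugeD[OF q] imaginary_csig by (fastforce simp: Spq_def Rasym)
  moreover have "Up p \<subseteq> Rasym R" "Up q \<subseteq> Rasym R" by (auto simp: Up_def Rasym)
  moreover have "cneg x \<notin> Up p" "cneg x \<notin> Up q" if "x \<in> ?Q" for x
    using q0_cneg[OF QD(1)[OF that]] QD(3)[OF that] by (auto simp: Up_def)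
  ultimately have "sgs (Spq p q) l * sgs (Up q) l * sgs (Up p) l
      = (\<Prod>x\<in>?Q. if k x then sg x l else 1)" for l
    unfolding half_system_prod[OF \<open>Spq p q \<subseteq> Rasym R\<close>] half_system_prod[OF \<open>Up p \<subseteq> Rasym R\<close>]
      half_system_prod[OF \<open>Up q \<subseteq> Rasym R\<close>] prod.distrib[symmetric]
    by (intro prod.cong refl) (auto simp: k_def sg_square)
  then have c: "sgs (Spq p q) l * sgs (Up q) l = sgs (Up p) l * (\<Prod>x\<in>?Q. if k x then sg x l else 1)" for l
  proof -
    have "sgs (Spq p q) l * sgs (Up q) l = sgs (Spq p q) l * sgs (Up q) l * (sgs (Up p) l * sgs (Up p) l)"
      by (simp only: sgs_square mult_1_right)
    also have "\<dots> = sgs (Up p) l * (sgs (Spq p q) l * sgs (Up q) l * sgs (Up p) l)" by (simp only: mult_ac)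
    finally show ?thesis by (simp only: \<open>\<And>l. sgs (Spq p q) l * sgs (Up q) l * sgs (Up p) l
      = (\<Prod>x\<in>?Q. if k x then sg x l else 1)\<close>)
  qed
  have k_csig: "k (csig x) = k x" if x: "x \<in> ?Q" for x
  proof -
    note xR = QD(1)[OF x]
    note g = gaugeD[OF p xR] gaugeD[OF p R_csig[OF xR]] gaugeD[OF q xR] gaugeD[OF q R_csig[OF xR]]
    have "p (csig (cneg x)) = - p (csig x)" "q (csig (cneg x)) = - q (csig x)"
      using g by (simp_all add: csig_cneg)
    then show ?thesis
      using g QD[OF x] xR R_csig R_cneg_iff R_csig_iff q0_csig
      unfolding k_def Spq_def Up_def
      by (simp add: csig_cneg imaginary_csig_iff imaginary_cneg) (elim disjE; simp)
  qed
  \<comment> \<open>For \<sigma>x = x the defining conditions ask a gauge to take two values at the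
    same root.\<close>
  have k_real: "\<not> k x" if "x \<in> ?Q" "csig x = x" for x
    using that gaugeD[OF p QD(1)[OF that(1)]] gaugeD[OF q QD(1)[OF that(1)]]
    by (auto simp: k_def Spq_def Up_def csig_cneg)
  \<comment> \<open>One root of each Galois pair, selected by the order. The whole product is s
    \<sigma>(s) for the sign element s of this set, and \<sigma>(s) is its own inverse, so the
    product is a coboundary.\<close>
  define Q' where "Q' = {x \<in> ?Q. csig x \<noteq> x \<and> (csig x, x) \<in> ord \<and> k x}"
  have "{x \<in> ?Q. k x} = Q' \<union> csig ` Q'"
  proof
    show "{x \<in> ?Q. k x} \<subseteq> Q' \<union> csig ` Q'"
    proof
      fix x assume x: "x \<in> {x \<in> ?Q. k x}"
      then have xQ: "x \<in> ?Q" and kx: "k x" by auto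
      have ne: "csig x \<noteq> x" using k_real xQ kx by blast
      show "x \<in> Q' \<union> csig ` Q'"
      proof (cases "(csig x, x) \<in> ord")
        case False
        then have "(x, csig x) \<in> ord" using ord_total R_chars R_csig QD(1)[OF xQ] by blast
        then have "csig x \<in> Q'" using QD(4)[OF xQ] k_csig[OF xQ] kx ne by (auto simp: Q'_def)
        then show ?thesis by (metis UnI2 csig_csig image_eqI)
      qed (use xQ kx ne in \<open>auto simp: Q'_def\<close>)
    qed
    show "Q' \<union> csig ` Q' \<subseteq> {x \<in> ?Q. k x}" using QD(4) k_csig by (auto simp: Q'_def)
  qed
  moreover have "Q' \<inter> csig ` Q' = {}" using ord_antisym by (auto simp: Q'_def)
  moreover have finQ': "finite Q'" by (rule finite_subset[OF _ fin]) (auto simp: Q'_def)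
  moreover have Q'c: "Q' \<subseteq> chars S" using R_chars QD(1) by (auto simp: Q'_def)
  ultimately have "sgs {x \<in> ?Q. k x} l = sgs Q' l * dual_act True (sgs Q') l" for l
    using dual_act_sgs[OF Q'c] by (simp add: sgs_Un)
  moreover have "(\<Prod>x\<in>?Q. if k x then sg x l else 1) = sgs {x \<in> ?Q. k x} l" for l
    unfolding sgs_def by (rule prod.inter_filter[OF fin, symmetric])
  ultimately have "sgs (Spq p q) l * sgs (Up q) l = sgs (Up p) l * (sgs Q' l * inverse (dual_act True (sgs Q') l))" for l
    using c dual_act_sgs[OF Q'c] by (simp add: sgs_inverse)
  then show ?thesis using that sgs_dual_torus[OF Q'c] by blast
qed

text \<open>The correcting cochains of p and q match the identification of models up to a
  coboundary, which appears as conjugation by t. On the identity component this conjugation is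
  trivial.\<close>

lemma Fp_change_gauge:
  assumes "gauge_on R p" "gauge_on R q"
  obtains t where "t \<in> dual_torus S" "\<And>y. Fp q (change_gauge S R p q y) = cj t (Fp p y)"
proof -
  obtain t where t: "t \<in> dual_torus S"
    "\<And>l. sgs (Spq p q) l * sgs (Up q) l = sgs (Up p) l * (t l * inverse (dual_act True t l))"
    using gauge_coboundary[OF assms] by blast
  have "Fp q (change_gauge S R p q (s, a)) = cj t (Fp p (s, a))" for s a
  proof (cases a)
    case True
    have "s l * sgs (Spq p q) l * sgs (Up q) l = t l * (s l * sgs (Up p) l) * inverse (dual_act True t l)" for l
      using t(2)[of l] by (simp add: mult_ac)
    then have "(\<lambda>l. s l * sgs (Spq p q) l * sgs (Up q) l) = (\<lambda>l. t l * (s l * sgs (Up p) l) * inverse (dual_act True t l))"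
      by (rule ext)
    then show ?thesis
      by (simp only: True Fp_def change_gauge_def cj_def s_gauge_True split_conv if_True)
  next
    case False
    then show ?thesis using dual_torusD(1)[OF t(1)]
      by (simp add: Fp_def change_gauge_def cj_def s_gauge_False fun_eq_iff)
  qed
  then show ?thesis using that t(1) by (metis prod.collapse)
qed

lemma params_Fp:
  assumes "gauge_on R p" "\<phi> \<in> params (pm_L S R p)"
  shows "Fp p \<circ> \<phi> \<in> params (av_L S rho2)"
proof -
  have "Fp p \<circ> \<phi> \<in> hom weil (av_L S rho2)"
    using assms(2) Group.iso_imp_homomorphism[OF Fp_iso[OF assms(1)]] hom_compose by (auto simp: params_def)
  moreover have "continuous_on (carrier weil) (Fp p \<circ> \<phi>)"
    using assms(2) by (intro continuous_on_compose continuous_Fp) (simp add: params_def)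
  moreover have "snd (Fp p y) = snd y" for y by (cases y) (simp add: Fp_def)
  ultimately show ?thesis using assms(2) by (simp add: params_def)
qed

end

section \<open>The correspondences\<close>

lemma weil_mult: "(z, a) \<otimes>\<^bsub>weil\<^esub> (z', b) =
    (z * (if a then cnj z' else z') * (if a \<and> b then - 1 else 1), a \<noteq> b)"
  and weil_one: "\<one>\<^bsub>weil\<^esub> = (1, False)"
  and weil_carrier: "(z, b) \<in> carrier weil \<longleftrightarrow> z \<noteq> 0"
  by (simp_all add: weil_def)

lemma group_weil: "group weil"
proof (rule groupI)
  fix x y assume "x \<in> carrier weil" "y \<in> carrier weil"
  then show "x \<otimes>\<^bsub>weil\<^esub> y \<in> carrier weil" by (cases x; cases y) (auto simp: weil_mult weil_carrier)
next
  fix x y w assume "x \<in> carrier weil" "y \<in> carrier weil" "w \<in> carrier weil"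
  show "x \<otimes>\<^bsub>weil\<^esub> y \<otimes>\<^bsub>weil\<^esub> w = x \<otimes>\<^bsub>weil\<^esub> (y \<otimes>\<^bsub>weil\<^esub> w)"
    by (cases x; cases y; cases w) (auto simp: weil_mult)
next
  fix x assume x: "x \<in> carrier weil"
  obtain z a where xz: "x = (z, a)" by (cases x)
  have "((if a then - inverse (cnj z) else inverse z), a) \<otimes>\<^bsub>weil\<^esub> x = \<one>\<^bsub>weil\<^esub>"
    using x by (auto simp: xz weil_mult weil_one weil_carrier)
  moreover have "((if a then - inverse (cnj z) else inverse z), a) \<in> carrier weil"
    using x by (auto simp: xz weil_carrier)
  ultimately show "\<exists>y\<in>carrier weil. y \<otimes>\<^bsub>weil\<^esub> x = \<one>\<^bsub>weil\<^esub>" by blast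
qed (auto simp: weil_one weil_carrier weil_mult)

lemma weil_inv_closed: "v \<in> carrier weil \<Longrightarrow> inv\<^bsub>weil\<^esub> v \<in> carrier weil"
  by (rule group.inv_closed[OF group_weil])

lemma snd_weil_mult: "snd (v \<otimes>\<^bsub>weil\<^esub> w) = (snd v \<noteq> snd w)"
  by (cases v; cases w) (simp add: weil_mult)

lemma snd_weil_inv: "v \<in> carrier weil \<Longrightarrow> snd (inv\<^bsub>weil\<^esub> v) = snd v"
  using arg_cong[OF group.r_inv[OF group_weil], of v snd] by (simp add: snd_weil_mult weil_one)

lemma weil_ab_mult: "weil_ab (v \<otimes>\<^bsub>weil\<^esub> w) = weil_ab v * weil_ab w"
  by (cases v; cases w) (auto simp: weil_ab_def weil_mult)

lemma weil_ab_real: "weil_ab w \<in> \<real>"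
  by (simp add: weil_ab_def Reals_mult complex_is_Real_iff)

lemma weil_ab_nonzero: "w \<in> carrier weil \<Longrightarrow> weil_ab w \<noteq> 0"
  by (cases w) (simp add: weil_ab_def weil_carrier)

lemma continuous_on_bool_fun: "continuous_on A (\<lambda>w :: 'a::topological_space \<times> bool. f (snd w) :: 'b::topological_space)"
proof -
  have "continuous_on (range snd) (f :: bool \<Rightarrow> 'b)"
    unfolding continuous_on_open_invariant using open_discrete by blast
  then show ?thesis
    by (intro continuous_on_compose2[of "range snd" f A snd] continuous_intros) auto
qed

lemma mult_hom_powi:
  fixes h :: "complex \<Rightarrow> complex"
  assumes "\<And>u v. u \<in> K \<Longrightarrow> v \<in> K \<Longrightarrow> h (u * v) = h u * h v" "\<And>u. u \<in> K \<Longrightarrow> h u \<noteq> 0"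
    "\<And>u v. u \<in> K \<Longrightarrow> v \<in> K \<Longrightarrow> u * v \<in> K" "\<And>u. u \<in> K \<Longrightarrow> inverse u \<in> K" "0 \<notin> K" "1 \<in> K" "u \<in> K"
  shows "h (u powi k) = h u powi k" "h (inverse u) = inverse (h u)" "h 1 = 1" "u powi k \<in> K"
proof -
  have "h 1 * h 1 = h 1" using assms(1)[of 1 1] assms(6) by simp
  then show h1: "h 1 = 1" using assms(2,6) by simp
  have inv: "h (inverse v) = inverse (h v)" if "v \<in> K" for v
  proof -
    have "v \<noteq> 0" using that assms(5) by blast
    then have "h v * h (inverse v) = 1" using assms(1)[OF that assms(4)[OF that]] h1 by simp
    then show ?thesis by (metis inverse_unique)
  qed
  then show "h (inverse u) = inverse (h u)" using assms(7) .
  have pw: "v ^ n \<in> K \<and> h (v ^ n) = h v ^ n" if "v \<in> K" for v n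
    by (induction n) (use that assms h1 in auto)
  show "u powi k \<in> K"
    using pw[OF assms(7)] pw[OF assms(4)[OF assms(7)]] by (simp add: power_int_def)
  show "h (u powi k) = h u powi k"
    using pw[OF assms(7)] pw[OF assms(4)[OF assms(7)]] inv[OF assms(7)] by (simp add: power_int_def)
qed

section \<open>Langlands parameters of characters pulled back along characters of the torus\<close>

context root_datum
begin

lemma torus_llc_1: "torus_llc S (\<lambda>_. 1) (\<lambda>_ _. 1)"
  by (auto simp: torus_llc_def torus_characters_def weil_cocycles_def dual_act_one intro!: continuous_on_const)

lemma torus_llc_mult:
  assumes "torus_llc S \<psi> a" "torus_llc S \<psi>' a'"
  shows "torus_llc S (\<lambda>g. \<psi> g * \<psi>' g) (\<lambda>w l. a w l * a' w l)"
proof -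
  have c: "continuous_on (carrier weil) (\<lambda>w. b w l)" if "continuous_on (carrier weil) b"
    for b :: "complex \<times> bool \<Rightarrow> 'n dual" and l
    by (rule continuous_on_product_then_coordinatewise[of _ b l]) (rule that)
  have a: "a \<in> weil_cocycles S" "a' \<in> weil_cocycles S" using assms by (auto simp: torus_llc_def)
  have cont: "continuous_on (carrier weil) (\<lambda>w l. a w l * a' w l)"
  proof (rule continuous_on_coordinatewise_then_product)
    show "continuous_on (carrier weil) (\<lambda>w. a w l * a' w l)" for l
      using c[of a l] c[of a' l] a by (simp add: weil_cocycles_def continuous_on_mult)
  qed
  have "(\<lambda>w l. a w l * a' w l) \<in> weil_cocycles S"
    using a cont unfolding weil_cocycles_def
    by (simp add: dual_torus_mult dual_act_mult mult_ac)
  moreover have "(\<lambda>g. \<psi> g * \<psi>' g) \<in> torus_characters S"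
    using assms unfolding torus_llc_def torus_characters_def by (auto intro!: continuous_on_mult simp: mult_ac)
  ultimately show ?thesis using assms by (simp add: torus_llc_def)
qed

lemma torus_llc_prod:
  "(\<And>x. x \<in> A \<Longrightarrow> torus_llc S (\<psi> x) (a x)) \<Longrightarrow>
    torus_llc S (\<lambda>g. \<Prod>x\<in>A. \<psi> x g) (\<lambda>w l. \<Prod>x\<in>A. a x w l)"
  by (induction A rule: infinite_finite_induct) (simp_all add: torus_llc_1 torus_llc_mult)

lemma torus_llc_inverse:
  assumes "torus_llc S \<psi> a"
  shows "torus_llc S (\<lambda>g. inverse (\<psi> g)) (\<lambda>w l. inverse (a w l))"
proof -
  have c: "continuous_on (carrier weil) (\<lambda>w. a w l)" for l
    using assms unfolding torus_llc_def weil_cocycles_def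
    by (intro continuous_on_product_then_coordinatewise[of _ a l]) simp
  have nz: "a w l \<noteq> 0" if "w \<in> carrier weil" for w l
    using assms dual_torusD(1) that unfolding torus_llc_def weil_cocycles_def by blast
  have cont: "continuous_on (carrier weil) (\<lambda>w l. inverse (a w l))"
    using nz by (intro continuous_on_coordinatewise_then_product continuous_on_inverse c) simp
  have "(\<lambda>w l. inverse (a w l)) \<in> weil_cocycles S"
    using assms cont unfolding torus_llc_def weil_cocycles_def
    by (simp add: dual_torus_inverse dual_act_inverse)
  moreover have "(\<lambda>g. inverse (\<psi> g)) \<in> torus_characters S"
    using assms unfolding torus_llc_def torus_characters_def by (auto intro!: continuous_on_inverse)
  ultimately show ?thesis using assms by (simp add: torus_llc_def)
qed

lemma chars_norm:
  assumes "y \<in> chars S" "l \<in> cochars S" "z \<noteq> 0"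
  shows "y (l z ** map_matrix cnj (l z)) = z powi pairing y l * cnj z powi pairing (csig y) l"
proof -
  have "l z \<in> S" using cocharsD(1) assms by blast
  then have "y (l z ** map_matrix cnj (l z)) = y (l z) * cnj (csig y (l z))"
    using charsD(2)[OF assms(1)] S_cnj by (simp add: csig_def)
  then show ?thesis by (simp add: pairing assms chars_csig)
qed

lemma weil_cocyclesI:
  assumes "\<And>l. l \<in> cochars S \<Longrightarrow> continuous_on (carrier weil) (\<lambda>w. a w l)"
    "\<And>w l. l \<notin> cochars S \<Longrightarrow> a w l = 1"
    "\<And>w. w \<in> carrier weil \<Longrightarrow> a w \<in> dual_torus S"
    "\<And>z b z' b' l. z \<noteq> 0 \<Longrightarrow> z' \<noteq> 0 \<Longrightarrow>
       a ((z, b) \<otimes>\<^bsub>weil\<^esub> (z', b')) l = a (z, b) l * dual_act b (a (z', b')) l"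
  shows "a \<in> weil_cocycles S"
  unfolding weil_cocycles_def
proof (intro CollectI conjI ballI)
  show "continuous_on (carrier weil) a"
  proof (rule continuous_on_coordinatewise_then_product)
    fix l show "continuous_on (carrier weil) (\<lambda>w. a w l)"
      using assms(1,2) by (cases "l \<in> cochars S") (auto intro: continuous_on_const)
  qed
  show "a w \<in> dual_torus S" if "w \<in> carrier weil" for w using that by (rule assms(3))
  show "a (w \<otimes>\<^bsub>weil\<^esub> v) = (\<lambda>l. a w l * dual_act (snd w) (a v) l)" if "w \<in> carrier weil" "v \<in> carrier weil" for w v
    using that assms(4) by (cases w; cases v) (auto simp: weil_carrier fun_eq_iff)
qed

lemma real_char_real:
  assumes "csig y = y" "y \<in> chars S" "g \<in> real_points S"
  shows "y g \<in> \<real> - {0}"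
proof -
  have "cnj (y g) = y g" using fun_cong[OF assms(1), of g] assms(3) by (simp add: csig_def real_points_cnj)
  then show ?thesis using char_nonzero[OF assms(2)] by (simp add: Reals_cnj_iff)
qed

text \<open>Functoriality along y, which is defined over the reals: chi is composed with the
  reciprocity map \<open>weil_ab\<close>.\<close>

lemma torus_llc_real:
  assumes y: "y \<in> chars S" "csig y = y"
    and chi: "continuous_on (\<real> - {0}) chi" "\<And>u. u \<in> \<real> - {0} \<Longrightarrow> chi u \<noteq> 0"
      "\<And>u v. u \<in> \<real> - {0} \<Longrightarrow> v \<in> \<real> - {0} \<Longrightarrow> chi (u * v) = chi u * chi v"
  shows "torus_llc S (\<lambda>g. chi (y g)) (\<lambda>w. tens S y (chi (weil_ab w)))"
proof -
  have ab: "weil_ab w \<in> \<real> - {0}" if "w \<in> carrier weil" for w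
    using weil_ab_real weil_ab_nonzero[OF that] by blast
  have powi: "chi (u powi k) = chi u powi k" if "u \<in> \<real> - {0}" for u k
    by (rule mult_hom_powi(1)[of "\<real> - {0}"]) (use that chi in auto)
  have cpos: "cnj z * z \<in> \<real> - {0}" if "z \<noteq> 0" for z :: complex
    using that by (auto simp: complex_is_Real_iff)
  have "(\<lambda>w. tens S y (chi (weil_ab w))) \<in> weil_cocycles S"
  proof (rule weil_cocyclesI)
    fix l assume l: "l \<in> cochars S"
    have "continuous_on (carrier weil) weil_ab"
      unfolding weil_ab_def[abs_def] by (intro continuous_intros continuous_on_bool_fun)
    then have "continuous_on (carrier weil) (\<lambda>w. chi (weil_ab w))"
      using ab by (intro continuous_on_compose2[OF chi(1)]) auto
    then show "continuous_on (carrier weil) (\<lambda>w. tens S y (chi (weil_ab w)) l)"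
      using l ab chi(2) by (auto simp: tens_def intro!: continuous_intros)
  next
    show "tens S y (chi (weil_ab w)) \<in> dual_torus S" if "w \<in> carrier weil" for w
      using y(1) chi(2)[OF ab[OF that]] by (rule tens_dual_torus)
  next
    fix z z' :: complex and b b' :: bool and l assume z: "z \<noteq> 0" "z' \<noteq> 0"
    have "dual_act b (tens S y c) = tens S y c" for c
      using y by (simp add: dual_act_tens gact_def)
    then show "tens S y (chi (weil_ab ((z, b) \<otimes>\<^bsub>weil\<^esub> (z', b')))) l
      = tens S y (chi (weil_ab (z, b))) l * dual_act b (tens S y (chi (weil_ab (z', b')))) l"
      using z ab by (simp add: weil_ab_mult chi(3) weil_carrier tens_mult)
  qed (simp add: tens_def)
  moreover have "(\<lambda>g. chi (y g)) \<in> torus_characters S"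
  proof -
    have "continuous_on (real_points S) (\<lambda>g. chi (y g))"
      by (rule continuous_on_compose2[OF chi(1) continuous_on_subset[OF chars_continuous[OF y(1)]]])
        (use real_char_real[OF y(2,1)] in \<open>auto simp: real_points_def\<close>)
    then show ?thesis
      using real_char_real[OF y(2,1)] chi(2,3) charsD(2)[OF y(1)]
      by (simp add: torus_characters_def real_points_cnj(2))
  qed
  moreover have "chi (y (l z ** map_matrix cnj (l z))) = tens S y (chi (weil_ab (z, False))) l"
    if "l \<in> cochars S" "z \<noteq> 0" for l z
  proof -
    have "y (l z ** map_matrix cnj (l z)) = (cnj z * z) powi pairing y l"
      using chars_norm[OF y(1) that] by (simp add: y(2) power_int_mult_distrib)
    then show ?thesis using that powi[OF cpos[OF that(2)]] by (simp add: tens_def weil_ab_def mult.commute[of z])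
  qed
  moreover have "chi (y (l (weil_ab w))) = tens S y (chi (weil_ab w)) l"
    if "l \<in> cochars S" "w \<in> carrier weil" for l w
    using that powi[OF ab[OF that(2)]] pairing[OF y(1) that(1)] weil_ab_nonzero[OF that(2)] by (simp add: tens_def)
  ultimately show ?thesis by (simp add: torus_llc_def)
qed

text \<open>Here y maps S to the restriction of scalars of the multiplicative group, and the
  parameter is induced from that of chi. The constants at y and \<sigma>y over j multiply to chi (-
  1), reflecting j^2 = -1; another \<kappa> changes the cocycle by a coboundary.\<close>

lemma torus_llc_complex:
  assumes y: "y \<in> chars S" and k: "\<kappa> \<noteq> 0"
    and chi: "continuous_on (UNIV - {0}) chi" "\<And>u. u \<noteq> 0 \<Longrightarrow> chi u \<noteq> 0"
      "\<And>u v. u \<noteq> 0 \<Longrightarrow> v \<noteq> 0 \<Longrightarrow> chi (u * v) = chi u * chi v"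
  shows "torus_llc S (\<lambda>g. chi (y g)) (\<lambda>w l. tens S y (chi (fst w) * (if snd w then \<kappa> else 1)) l *
    tens S (csig y) (chi (cnj (fst w)) * (if snd w then chi (- 1) / \<kappa> else 1)) l)"
proof -
  have powi: "chi (u powi k) = chi u powi k" if "u \<noteq> 0" for u k
    by (rule mult_hom_powi(1)[of "- {0}"]) (use that chi in auto)
  have sy: "csig y \<in> chars S" by (rule chars_csig[OF y])
  have m1: "chi (- 1) \<noteq> 0" "chi (-1) * chi (-1) = 1"
    using chi(2)[of "- 1"] chi(3)[of "- 1" "- 1"] mult_hom_powi(3)[of "- {0}" chi 1] chi by auto
  have act: "dual_act b (tens S y c) = tens S (gact b y) c" "dual_act b (tens S (csig y) c) = tens S (gact b (csig y)) c" for b c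
    using y sy by (simp_all add: dual_act_tens)
  define a where "a = (\<lambda>w l. tens S y (chi (fst w) * (if snd w then \<kappa> else 1)) l *
    tens S (csig y) (chi (cnj (fst w)) * (if snd w then chi (- 1) / \<kappa> else 1)) l)"
  have cc: "continuous_on (carrier weil) (\<lambda>w. chi (fst w))" "continuous_on (carrier weil) (\<lambda>w. chi (cnj (fst w)))"
    by (intro continuous_on_compose2[OF chi(1)] continuous_intros; auto simp: weil_carrier)+
  have "a \<in> weil_cocycles S"
  proof (rule weil_cocyclesI)
    fix l assume l: "l \<in> cochars S"
    note b = continuous_on_bool_fun[of "carrier weil" "\<lambda>b. if b then _ else (1 :: complex)"]
    have nz: "fst w \<noteq> 0" if "w \<in> carrier weil" for w
      using that weil_carrier[of "fst w" "snd w"] by simp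
    have "continuous_on (carrier weil) (\<lambda>w. (chi (fst w) * (if snd w then \<kappa> else 1)) powi pairing y l)"
      by (rule continuous_on_power_int[OF continuous_on_mult[OF cc(1) b]])
        (use chi(2) nz k in \<open>simp split: if_split\<close>)
    moreover have "continuous_on (carrier weil)
        (\<lambda>w. (chi (cnj (fst w)) * (if snd w then chi (- 1) / \<kappa> else 1)) powi pairing (csig y) l)"
      by (rule continuous_on_power_int[OF continuous_on_mult[OF cc(2) b]])
        (use chi(2) nz k m1(1) in \<open>simp split: if_split\<close>)
    ultimately have "continuous_on (carrier weil) (\<lambda>w. (chi (fst w) * (if snd w then \<kappa> else 1)) powi pairing y l *
       (chi (cnj (fst w)) * (if snd w then chi (- 1) / \<kappa> else 1)) powi pairing (csig y) l)"
      by (rule continuous_on_mult)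
    then show "continuous_on (carrier weil) (\<lambda>w. a w l)" using l by (simp add: a_def tens_def)
  next
    show "a w \<in> dual_torus S" if w: "w \<in> carrier weil" for w
    proof -
      have "fst w \<noteq> 0" using w by (cases w) (simp add: weil_carrier)
      then show ?thesis unfolding a_def using chi(2) k m1(1)
        by (intro dual_torus_mult tens_dual_torus y sy) auto
    qed
  next
    fix z z' :: complex and b b' :: bool and l assume z: "z \<noteq> 0" "z' \<noteq> 0"
    have chim: "chi (- (z * cnj z')) = chi (- 1) * (chi z * chi (cnj z'))"
      "chi (- (cnj z * z')) = chi (- 1) * (chi (cnj z) * chi z')"
      using chi(3)[of "- 1" "z * cnj z'"] chi(3)[of "- 1" "cnj z * z'"] z by (simp_all add: chi(3))
    show "a ((z, b) \<otimes>\<^bsub>weil\<^esub> (z', b')) l = a (z, b) l * dual_act b (a (z', b')) l"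
    proof (cases "l \<in> cochars S")
      case True
      have dis: "tens S x (c * d) l = tens S x c l * tens S x d l" "tens S x (c / d) l = tens S x c l / tens S x d l" for x c d
        by (simp_all add: tens_def power_int_mult_distrib power_int_divide_distrib)
      have nz: "tens S y \<kappa> l \<noteq> 0" "tens S (csig y) \<kappa> l \<noteq> 0"
        using k by (simp_all add: tens_def)
      show ?thesis
        using z nz by (cases b; cases b')
          (simp_all add: a_def weil_mult chim chi(3) dual_act_mult act dis gact_def csig_csig)
    qed (simp add: a_def tens_def dual_act_def cochars_ysig_iff)
  qed (simp add: a_def tens_def)
  moreover have "(\<lambda>g. chi (y g)) \<in> torus_characters S"
  proof -
    have "continuous_on (real_points S) (\<lambda>g. chi (y g))"
      by (rule continuous_on_compose2[OF chi(1) continuous_on_subset[OF chars_continuous[OF y]]])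
        (use char_nonzero[OF y] in \<open>auto simp: real_points_def\<close>)
    then show ?thesis
      using char_nonzero[OF y] chi(2,3) charsD(2)[OF y]
      by (simp add: torus_characters_def real_points_cnj(2))
  qed
  moreover have "chi (y (l z ** map_matrix cnj (l z))) = a (z, False) l" if "l \<in> cochars S" "z \<noteq> 0" for l z
    using that by (simp add: chars_norm[OF y] chi(3) powi a_def tens_def)
  moreover have "chi (y (l (weil_ab w))) = a w l"
    if l: "l \<in> cochars S" "ysig l = l" and w: "w \<in> carrier weil" for l w
  proof -
    have pc: "pairing (csig y) l = pairing y l" using pairing_csig[OF y l(1)] l(2) by simp
    obtain z b where zb: "w = (z, b)" "z \<noteq> 0" using w by (cases w) (simp add: weil_carrier)
    have "chi (y (l (weil_ab w))) = chi (weil_ab w) powi pairing y l"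
      using pairing[OF y l(1) weil_ab_nonzero[OF w]] powi[OF weil_ab_nonzero[OF w]] by simp
    also have "chi (weil_ab w) = (chi z * (if b then \<kappa> else 1)) * (chi (cnj z) * (if b then chi (- 1) / \<kappa> else 1))"
      using zb(2) k chi(3)[of z "cnj z"] chi(3)[of "- 1" "z * cnj z"] by (auto simp: weil_ab_def zb(1) field_simps)
    finally show ?thesis using l by (simp add: a_def tens_def pc zb power_int_mult_distrib)
  qed
  ultimately show ?thesis unfolding a_def[symmetric] by (simp add: torus_llc_def)
qed

text \<open>The two square roots of v differ by -1, on which eta is trivial, so composing eta with
  \<open>csqrt\<close> involves no choice of a branch.\<close>

lemma even_char_csqrt:
  assumes "\<And>u v. u \<noteq> 0 \<Longrightarrow> v \<noteq> 0 \<Longrightarrow> eta (u * v) = (eta u * eta v :: complex)"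
    "\<And>c. c \<noteq> 0 \<Longrightarrow> eta (complex_of_real c) = 1" "w \<noteq> 0" "w * w = v"
  shows "eta (csqrt v) = eta w"
proof -
  have "csqrt v = w \<or> csqrt v = - w" using assms(4) by (metis power2_csqrt power2_eq_iff power2_eq_square)
  moreover have "eta (- w) = eta w" using assms(1)[of "- 1" w] assms(2)[of "- 1"] assms(3) by simp
  ultimately show ?thesis by auto
qed

text \<open>On real points y lies in the unit circle, where u = w / cnj w for a unit square root w
  of u (Hilbert 90), and eta w depends only on u. As \<sigma> inverts y, every value \<kappa> over j
  satisfies the cocycle condition, and different values are cohomologous.\<close>

lemma torus_llc_imaginary:
  assumes y: "y \<in> chars S" "imaginary y" and k: "\<kappa> \<noteq> 0"
    and eta: "continuous_on (UNIV - {0}) eta" "\<And>u. u \<noteq> 0 \<Longrightarrow> eta u \<noteq> 0"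
      "\<And>u v. u \<noteq> 0 \<Longrightarrow> v \<noteq> 0 \<Longrightarrow> eta (u * v) = eta u * eta v"
      "\<And>c. c \<noteq> 0 \<Longrightarrow> eta (complex_of_real c) = 1"
  shows "torus_llc S (\<lambda>g. eta (csqrt (y g))) (\<lambda>w. tens S y (eta (fst w) * (if snd w then \<kappa> else 1)))"
proof -
  have cs: "eta (csqrt v) = eta w" if "w \<noteq> 0" "w * w = v" for v w
    by (rule even_char_csqrt) (use eta that in auto)
  have powi: "eta (u powi k) = eta u powi k" if "u \<noteq> 0" for u k
    by (rule mult_hom_powi(1)[of "- {0}"]) (use that eta in auto)
  have eta_inv: "eta (inverse u) = inverse (eta u)" if "u \<noteq> 0" for u
    by (rule mult_hom_powi(2)[of "- {0}"]) (use that eta in auto)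
  have y0: "y g \<noteq> 0" for g by (rule char_nonzero[OF y(1)])
  have csy: "csig y = cneg y" by (rule imaginary_csig[OF y(2)])
  have eta_cnj: "eta (cnj z) = inverse (eta z)" if "z \<noteq> 0" for z
  proof -
    have "z * cnj z = complex_of_real ((cmod z)\<^sup>2)" by (rule complex_norm_square[symmetric])
    then have "eta z * eta (cnj z) = 1" using eta(3)[of z "cnj z"] eta(4)[of "(cmod z)\<^sup>2"] that by (simp del: of_real_power)
    then show ?thesis by (metis inverse_unique)
  qed
  have eta_m: "eta (- u) = eta u" if "u \<noteq> 0" for u using eta(3)[of "- 1" u] eta(4)[of "- 1"] that by simp
  define a where "a = (\<lambda>w. tens S y (eta (fst w) * (if snd w then \<kappa> else 1)))"
  have cocy: "a \<in> weil_cocycles S"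
  proof (rule weil_cocyclesI)
    fix l assume l: "l \<in> cochars S"
    note b = continuous_on_bool_fun[of "carrier weil" "\<lambda>b. if b then _ else (1 :: complex)"]
    have nz: "fst w \<noteq> 0" if "w \<in> carrier weil" for w
      using that weil_carrier[of "fst w" "snd w"] by simp
    have c: "continuous_on (carrier weil) (\<lambda>w. eta (fst w))"
      by (intro continuous_on_compose2[OF eta(1)] continuous_intros) (auto simp: weil_carrier)
    have "continuous_on (carrier weil) (\<lambda>w. (eta (fst w) * (if snd w then \<kappa> else 1)) powi pairing y l)"
      by (rule continuous_on_power_int[OF continuous_on_mult[OF c b]])
        (use eta(2) nz k in \<open>simp split: if_split\<close>)
    then show "continuous_on (carrier weil) (\<lambda>w. a w l)" using l by (simp add: a_def tens_def)
  next
    show "a w \<in> dual_torus S" if w: "w \<in> carrier weil" for w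
    proof -
      have "fst w \<noteq> 0" using w by (cases w) (simp add: weil_carrier)
      then show ?thesis unfolding a_def using eta(2) k by (intro tens_dual_torus y) auto
    qed
  next
    fix z z' :: complex and b b' :: bool and l assume z: "z \<noteq> 0" "z' \<noteq> 0"
    have act: "dual_act b (tens S y c) l = (if b then inverse (tens S y c l) else tens S y c l)" for b c
      using y(1) by (simp add: dual_act_tens csy tens_cneg)
    have dis: "tens S y (c * d) l = tens S y c l * tens S y d l" for c d by (rule tens_mult)
    have nz: "tens S y \<kappa> l \<noteq> 0" "tens S y (eta z) l \<noteq> 0" "tens S y (eta z') l \<noteq> 0"
      using k z eta(2) by (simp_all add: tens_def)
    show "a ((z, b) \<otimes>\<^bsub>weil\<^esub> (z', b')) l = a (z, b) l * dual_act b (a (z', b')) l"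
      using z nz by (cases b; cases b')
        (simp_all add: a_def weil_mult eta_m eta(3) eta_cnj act dis tens_inverse)
  qed (simp add: a_def tens_def)
  have char: "(\<lambda>g. eta (csqrt (y g))) \<in> torus_characters S"
  proof -
    have mult: "eta (csqrt (u * v)) = eta (csqrt u) * eta (csqrt v)" if "u \<noteq> 0" "v \<noteq> 0" for u v
    proof -
      have "(csqrt u * csqrt v) * (csqrt u * csqrt v) = u * v"
        by (metis power2_csqrt power2_eq_square power_mult_distrib)
      then have "eta (csqrt (u * v)) = eta (csqrt u * csqrt v)" using that by (intro cs) auto
      then show ?thesis using eta(3)[of "csqrt u" "csqrt v"] that by simp
    qed
    have "continuous_on (real_points S) (\<lambda>g. eta (csqrt (y g)))"
      unfolding continuous_on_eq_continuous_within
    proof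
      \<comment> \<open>\<open>csqrt\<close> jumps along the negative axis, but its composite with
        eta does not: multiplicativity reduces continuity at g0 to that of eta and
        \<open>csqrt\<close> at 1.\<close>
      fix g0 assume g0: "g0 \<in> real_points S"
      have "continuous_on (real_points S) (\<lambda>g. y g / y g0)"
        by (rule continuous_on_divide[OF continuous_on_subset[OF chars_continuous[OF y(1)]] continuous_on_const])
          (use y0 in \<open>auto simp: real_points_def\<close>)
      then have "((\<lambda>g. y g / y g0) \<longlongrightarrow> y g0 / y g0) (at g0 within real_points S)"
        using g0 by (simp only: continuous_on_def)
      then have 1: "((\<lambda>g. y g / y g0) \<longlongrightarrow> 1) (at g0 within real_points S)" using y0 by simp
      have "isCont csqrt 1" by (rule continuous_at_csqrt) (simp add: complex_nonpos_Reals_iff)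
      then have 2: "((\<lambda>g. csqrt (y g / y g0)) \<longlongrightarrow> csqrt 1) (at g0 within real_points S)"
        by (rule isCont_tendsto_compose[OF _ 1])
      have "isCont eta 1"
        using eta(1) by (subst (asm) continuous_on_eq_continuous_at) (auto intro: open_delete)
      then have "((\<lambda>g. eta (csqrt (y g / y g0))) \<longlongrightarrow> eta 1) (at g0 within real_points S)"
        using 2 by (intro isCont_tendsto_compose[of 1 eta]) simp_all
      then have "((\<lambda>g. eta (csqrt (y g0)) * eta (csqrt (y g / y g0))) \<longlongrightarrow> eta (csqrt (y g0)) * eta 1) (at g0 within real_points S)"
        by (intro tendsto_intros)
      moreover have "eta (csqrt (y g0)) * eta (csqrt (y g / y g0)) = eta (csqrt (y g))" for g
        using mult[of "y g0" "y g / y g0"] y0 by simp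
      ultimately show "continuous (at g0 within real_points S) (\<lambda>g. eta (csqrt (y g)))"
        using eta(4)[of 1] by (simp add: continuous_within)
    qed
    then show ?thesis
      using y0 eta(2) mult charsD(2)[OF y(1)] by (simp add: torus_characters_def real_points_cnj(2))
  qed
  have norm: "eta (csqrt (y (l z ** map_matrix cnj (l z)))) = a (z, False) l" if l: "l \<in> cochars S" and z: "z \<noteq> 0" for l z
  proof -
    define w where "w = z powi pairing y l"
    have w: "w \<noteq> 0" using z by (simp add: w_def)
    \<comment> \<open>The norm of a complex point is sent to w / cnj w, the square of w / |w|, and
      eta ignores the positive factor.\<close>
    have "y (l z ** map_matrix cnj (l z)) = w / cnj w"
      using chars_norm[OF y(1) l z] by (simp add: csy pairing_cneg[OF y(1) l] w_def power_int_minus divide_inverse)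
    also have "\<dots> = (w * inverse (of_real (cmod w))) * (w * inverse (of_real (cmod w)))"
      using w complex_norm_square[of w] by (simp add: field_simps power2_eq_square)
    finally have "eta (csqrt (y (l z ** map_matrix cnj (l z)))) = eta (w * inverse (of_real (cmod w)))"
      using w by (intro cs) auto
    also have "\<dots> = eta w" using w eta(3) eta(4)[of "inverse (cmod w)"] by simp
    also have "\<dots> = eta z powi pairing y l" using powi z by (simp add: w_def)
    finally show ?thesis using l by (simp add: a_def tens_def)
  qed
  have split: "eta (csqrt (y (l (weil_ab w)))) = a w l"
    if l: "l \<in> cochars S" "ysig l = l" and w: "w \<in> carrier weil" for l w
  proof -
    \<comment> \<open>A cocharacter defined over the reals pairs to 0 with an imaginary character,
      so both values are 1.\<close>
    have "pairing y l = - pairing y l"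
      using pairing_csig[OF y(1) l(1)] l(2) pairing_cneg[OF y(1) l(1)] by (simp add: csy)
    then have k0: "pairing y l = 0" by simp
    then have "y (l (weil_ab w)) = 1" using pairing[OF y(1) l(1) weil_ab_nonzero[OF w]] by simp
    then show ?thesis using l k0 eta(4)[of 1] by (simp add: a_def tens_def)
  qed
  show ?thesis unfolding a_def[symmetric] torus_llc_def using cocy char norm split by blast
qed

end

section \<open>Evaluation of \<open>r_chi\<close> orbit by orbit\<close>

lemma sigma_orbit_eq:
  assumes "y \<in> sigma_orbit x" shows "sigma_orbit y = sigma_orbit x"
  using assms by (auto simp: sigma_orbit_def csig_cneg)

lemma sigma_orbit_self: "x \<in> sigma_orbit x"
  by (simp add: sigma_orbit_def)

context root_datum
begin

lemma sigma_orbit_R: "x \<in> R \<Longrightarrow> sigma_orbit x \<subseteq> R"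
  by (auto simp: sigma_orbit_def intro: R_cneg R_csig)

lemma sigma_orbit_imaginary: "imaginary x \<Longrightarrow> sigma_orbit x = {x, cneg x}"
  by (auto simp: sigma_orbit_def imaginary_def)

lemma imaginary_not_real: "x \<in> R \<Longrightarrow> imaginary x \<Longrightarrow> csig x \<noteq> x"
  using R_cneg_neq by (simp add: imaginary_def)

lemma chi_dataD:
  assumes "chi_data R chi" "x \<in> R"
  shows "continuous_on (F_units x) (chi x)" "u \<in> F_units x \<Longrightarrow> chi x u \<noteq> 0"
    "u \<in> F_units x \<Longrightarrow> v \<in> F_units x \<Longrightarrow> chi x (u * v) = chi x u * chi x v"
    "u \<in> F_units x \<Longrightarrow> chi (csig x) u = chi x (cnj u)"
    "u \<in> F_units x \<Longrightarrow> chi (cneg x) u = inverse (chi x u)"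
    "imaginary x \<Longrightarrow> c \<noteq> 0 \<Longrightarrow> chi x (of_real c) = of_real (sgn c)"
  using assms unfolding chi_data_def by blast+

lemma F_units_complex: "csig x \<noteq> x \<Longrightarrow> F_units x = UNIV - {0}"
  and F_units_real: "csig x = x \<Longrightarrow> F_units x = \<real> - {0}"
  by (simp_all add: F_units_def)

lemma W_stab_iff: "w \<in> W_stab x \<longleftrightarrow> w \<in> carrier weil \<and> gact (snd w) x = x"
  and W_stab_pm_iff: "w \<in> W_stab_pm x \<longleftrightarrow> w \<in> carrier weil \<and> gact (snd w) x \<in> {x, cneg x}"
  by (simp_all add: W_stab_def W_stab_pm_def)

lemma W_stab_pm_all: "imaginary x \<or> csig x = x \<Longrightarrow> W_stab_pm x = carrier weil"
  by (auto simp: W_stab_pm_def gact_def imaginary_def)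

end

locale choice_datum = root_datum S R ord for S :: "(('n::finite) cmat) set" and R ord +
  fixes q :: "'n chr \<Rightarrow> int" and D :: "'n choices"
  assumes q: "gauge_on R q" and D: "valid_choices R q D"
begin

lemma reps_R: "reps D \<subseteq> R" and reps_unique: "x \<in> R \<Longrightarrow> \<exists>!y. y \<in> reps D \<and> y \<in> sigma_orbit x"
  using D unfolding valid_choices_def by blast+

lemma finite_reps: "finite (reps D)"
  using reps_R R(1) finite_subset by blast

lemma reps_eq: "x \<in> reps D \<Longrightarrow> y \<in> reps D \<Longrightarrow> y \<in> sigma_orbit x \<Longrightarrow> y = x"
  using reps_unique[of x] reps_R sigma_orbit_self[of x] by blast

lemma repD:
  assumes "x \<in> reps D"
  shows "x \<in> R" "transv D x \<subseteq> carrier weil"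
    "w \<in> carrier weil \<Longrightarrow> \<exists>!v. v \<in> transv D x \<and> w \<otimes>\<^bsub>weil\<^esub> inv\<^bsub>weil\<^esub> v \<in> W_stab_pm x"
    "v \<in> transv D x \<Longrightarrow> q (gact (snd v) x) = 1"
    "vzero D x \<in> W_stab x" "imaginary x \<Longrightarrow> vone D x \<in> W_stab_pm x - W_stab x"
proof -
  have V: "transv D x \<subseteq> carrier weil \<and>
        (\<forall>w\<in>carrier weil. \<exists>!v. v \<in> transv D x \<and> w \<otimes>\<^bsub>weil\<^esub> inv\<^bsub>weil\<^esub> v \<in> W_stab_pm x) \<and>
        (\<forall>v\<in>transv D x. q (gact (snd (inv\<^bsub>weil\<^esub> v)) x) = 1) \<and>
        vzero D x \<in> W_stab x \<and>
        (imaginary x \<longrightarrow> vone D x \<in> W_stab_pm x - W_stab x)"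
    using D assms unfolding valid_choices_def by blast
  then show "transv D x \<subseteq> carrier weil"
    "w \<in> carrier weil \<Longrightarrow> \<exists>!v. v \<in> transv D x \<and> w \<otimes>\<^bsub>weil\<^esub> inv\<^bsub>weil\<^esub> v \<in> W_stab_pm x"
    "vzero D x \<in> W_stab x" "imaginary x \<Longrightarrow> vone D x \<in> W_stab_pm x - W_stab x" by blast+
  show "q (gact (snd v) x) = 1" if "v \<in> transv D x"
  proof -
    have "v \<in> carrier weil" "q (gact (snd (inv\<^bsub>weil\<^esub> v)) x) = 1" using V that by blast+
    then show ?thesis by (simp add: snd_weil_inv)
  qed
  show "x \<in> R" using reps_R assms by blast
qed

lemma u_elt_eq:
  assumes x: "x \<in> reps D" and v: "v \<in> transv D x" "v' \<in> transv D x" and w: "w \<in> carrier weil"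
    and u: "u \<in> W_stab_pm x" "v \<otimes>\<^bsub>weil\<^esub> w = u \<otimes>\<^bsub>weil\<^esub> v'"
  shows "u_elt D x v w = u"
  unfolding u_elt_def
proof (rule the_equality)
  interpret W: group weil by (rule group_weil)
  note tc = repD(2)[OF x]
  show "u \<in> W_stab_pm x \<and> (\<exists>v'\<in>transv D x. v \<otimes>\<^bsub>weil\<^esub> w = u \<otimes>\<^bsub>weil\<^esub> v')" using u v by blast
  fix u2 assume "u2 \<in> W_stab_pm x \<and> (\<exists>v'\<in>transv D x. v \<otimes>\<^bsub>weil\<^esub> w = u2 \<otimes>\<^bsub>weil\<^esub> v')"
  then obtain v2 where u2: "u2 \<in> W_stab_pm x" "v2 \<in> transv D x" "v \<otimes>\<^bsub>weil\<^esub> w = u2 \<otimes>\<^bsub>weil\<^esub> v2" by blast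
  have uc: "u \<in> carrier weil" "u2 \<in> carrier weil" using u u2 by (simp_all add: W_stab_pm_iff)
  have vc: "v \<in> carrier weil" "v' \<in> carrier weil" "v2 \<in> carrier weil" using v u2 tc by blast+
  have "(v \<otimes>\<^bsub>weil\<^esub> w) \<otimes>\<^bsub>weil\<^esub> inv\<^bsub>weil\<^esub> v' = u" "(v \<otimes>\<^bsub>weil\<^esub> w) \<otimes>\<^bsub>weil\<^esub> inv\<^bsub>weil\<^esub> v2 = u2"
    using uc vc by (simp only: u(2) W.m_assoc W.inv_closed W.r_inv W.r_one, simp only: u2(3) W.m_assoc W.inv_closed W.r_inv W.r_one)
  then have "v' = v2" using repD(3)[OF x, of "v \<otimes>\<^bsub>weil\<^esub> w"] u(1) u2(1,2) v vc w W.m_closed by metis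
  then show "u2 = u" using u(2) u2(3) uc vc W.right_cancel by metis
qed

lemma v0_elt_eq:
  assumes x: "x \<in> reps D" and u: "u \<in> carrier weil" and y: "y \<in> W_stab x"
    and c: "vzero D x \<otimes>\<^bsub>weil\<^esub> u = y \<otimes>\<^bsub>weil\<^esub> vzero D x \<or>
      (imaginary x \<and> vzero D x \<otimes>\<^bsub>weil\<^esub> u = y \<otimes>\<^bsub>weil\<^esub> vone D x)"
  shows "v0_elt D x u = y"
  unfolding v0_elt_def
proof (rule the_equality)
  interpret W: group weil by (rule group_weil)
  show "y \<in> W_stab x \<and> (vzero D x \<otimes>\<^bsub>weil\<^esub> u = y \<otimes>\<^bsub>weil\<^esub> vzero D x \<or>
      (imaginary x \<and> vzero D x \<otimes>\<^bsub>weil\<^esub> u = y \<otimes>\<^bsub>weil\<^esub> vone D x))" using y c by blast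
  fix y' assume y': "y' \<in> W_stab x \<and> (vzero D x \<otimes>\<^bsub>weil\<^esub> u = y' \<otimes>\<^bsub>weil\<^esub> vzero D x \<or>
      (imaginary x \<and> vzero D x \<otimes>\<^bsub>weil\<^esub> u = y' \<otimes>\<^bsub>weil\<^esub> vone D x))"
  have car: "y \<in> carrier weil" "y' \<in> carrier weil" "vzero D x \<in> carrier weil"
    using y y' repD(5)[OF x] by (simp_all add: W_stab_iff)
  \<comment> \<open>The two alternatives exclude each other: \<open>vzero\<close> and
    \<open>vone\<close> lie over different elements of the Galois group, while the stabilizer of an
    imaginary root lies over the identity.\<close>
  have no: False if im: "imaginary x" and e: "a \<otimes>\<^bsub>weil\<^esub> vzero D x = b \<otimes>\<^bsub>weil\<^esub> vone D x"
    and ab: "a \<in> W_stab x" "b \<in> W_stab x" for a b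
  proof -
    have ne: "csig x \<noteq> x" using imaginary_not_real repD(1)[OF x] im by blast
    have F: "\<not> snd c" if "c \<in> W_stab x" for c
      using that ne by (cases "snd c") (auto simp: W_stab_iff)
    have "snd (vone D x)" using repD(6)[OF x im] by (cases "snd (vone D x)") (auto simp: W_stab_iff W_stab_pm_iff)
    then show False using arg_cong[OF e, of snd] F ab repD(5)[OF x] by (simp add: snd_weil_mult)
  qed
  show "y' = y"
  proof (cases "imaginary x")
    case False
    then show ?thesis using c y' car W.right_cancel by metis
  next
    case True
    have "vone D x \<in> carrier weil" using repD(6)[OF x True] by (simp add: W_stab_pm_iff)
    then show ?thesis using c y y' car W.right_cancel no[OF True] by metis
  qed
qed

definition cx :: "('n chr \<Rightarrow> complex \<Rightarrow> complex) \<Rightarrow> 'n chr \<Rightarrow> complex \<times> bool \<Rightarrow> 'n dual" where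
  "cx chi x w = (\<lambda>l. \<Prod>v\<in>transv D x. tens S (gact (snd v) x) (chi x (to_F x (v0_elt D x (u_elt D x v w)))) l)"

lemma r_chi_eq: "r_chi S chi D w l = (\<Prod>x\<in>reps D. cx chi x w l)"
proof -
  have "snd (inv\<^bsub>weil\<^esub> v) = snd v" if "x \<in> reps D" "v \<in> transv D x" for x v
    using that repD(2) snd_weil_inv by blast
  then show ?thesis unfolding r_chi_def cx_def by (intro prod.cong refl) simp
qed

lemma transv_single:
  assumes x: "x \<in> reps D" and t: "imaginary x \<or> csig x = x"
  obtains v where "transv D x = {v}" "v \<in> carrier weil"
proof -
  interpret W: group weil by (rule group_weil)
  have "w \<otimes>\<^bsub>weil\<^esub> inv\<^bsub>weil\<^esub> v \<in> W_stab_pm x" if "w \<in> carrier weil" "v \<in> transv D x" for w v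
    using that repD(2)[OF x] by (auto simp: W_stab_pm_all[OF t])
  then obtain v where "\<And>v'. v' \<in> transv D x \<longleftrightarrow> v' = v"
    using repD(3)[OF x W.one_closed] W.one_closed by metis
  then have "transv D x = {v}" by blast
  then show ?thesis using that repD(2)[OF x] by blast
qed

text \<open>\<open>W_stab_pm x\<close> is the whole Weil group, so there is a single representative
  v = (p, a), which replaces x by y = \<sigma>^a x. The remaining dependence on the choices is
  confined to one constant over j.\<close>

lemma cx_imaginary:
  assumes chi: "chi_data R chi" and x: "x \<in> reps D" "imaginary x"
  shows "\<exists>y \<kappa>. y \<in> {x, cneg x} \<and> \<kappa> \<noteq> 0 \<and>
    (\<forall>z b. z \<noteq> 0 \<longrightarrow> cx chi x (z, b) = tens S y (chi y z * (if b then \<kappa> else 1)))"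
proof -
  have xR: "x \<in> R" by (rule repD(1)[OF x(1)])
  have ne: "csig x \<noteq> x" by (rule imaginary_not_real[OF xR x(2)])
  note F = F_units_complex[OF ne] and cd = chi_dataD[OF chi xR]
  obtain v where v: "transv D x = {v}" "v \<in> carrier weil" using transv_single[OF x(1)] x(2) by blast
  obtain p a where pa: "v = (p, a)" "p \<noteq> 0" using v(2) by (cases v) (simp add: weil_carrier)
  obtain z0 where z0: "vzero D x = (z0, False)" "z0 \<noteq> 0"
    using repD(5)[OF x(1)] ne by (cases "vzero D x") (auto simp: W_stab_iff weil_carrier gact_def split: if_splits)
  obtain z1 where z1: "vone D x = (z1, True)" "z1 \<noteq> 0"
    using repD(6)[OF x] by (cases "vone D x") (auto simp: W_stab_iff W_stab_pm_iff weil_carrier gact_def split: if_splits)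
  define y where "y = gact a x"
  \<comment> \<open>The factor p / cnj p comes from moving v past j, and z0 / z1 from passing
    between the two cosets of the stabilizer.\<close>
  define \<kappa> where "\<kappa> = chi x (z0 * p / (cnj p * z1))"
  have yx: "y \<in> {x, cneg x}" using x(2) by (simp add: y_def gact_def imaginary_def)
  have k: "\<kappa> \<noteq> 0" unfolding \<kappa>_def using pa z0 z1 by (intro cd(2)) (simp add: F)
  have st: "(c, False) \<in> W_stab x" if "c \<noteq> 0" for c using that by (simp add: W_stab_iff weil_carrier)
  have pm: "(c, b) \<in> W_stab_pm x" if "c \<noteq> 0" for c b using that x(2) by (simp add: W_stab_pm_all weil_carrier)
  have chy: "chi x (if a then cnj z else z) = chi y z" if "z \<noteq> 0" for z
    using that cd(4)[of z] by (simp add: y_def gact_def F)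
  have "cx chi x (z, b) = tens S y (chi y z * (if b then \<kappa> else 1))" if z: "z \<noteq> 0" for z b
  proof (cases b)
    case False
    define u where "u = (if a then cnj z else z)"
    have u0: "u \<noteq> 0" using z by (simp add: u_def)
    have "u_elt D x v (z, False) = (u, False)"
      using z u0 by (intro u_elt_eq[OF x(1), of v v]) (auto simp: v pm weil_carrier weil_mult pa u_def)
    moreover have "v0_elt D x (u, False) = (u, False)"
      using u0 by (intro v0_elt_eq[OF x(1)]) (auto simp: weil_carrier st z0 weil_mult)
    ultimately show ?thesis using False chy[OF z] ne
      by (intro ext) (simp add: cx_def v(1) to_F_def y_def pa u_def)
  next
    case True
    define u where "u = (if a then cnj z else z) * (p / cnj p)"
    have u0: "u \<noteq> 0" using z pa by (simp add: u_def)
    have "u_elt D x v (z, True) = (u, True)"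
      using z u0 pa(2) by (intro u_elt_eq[OF x(1), of v v]) (auto simp: v pm weil_carrier weil_mult pa(1) u_def)
    moreover have "v0_elt D x (u, True) = (z0 * u / z1, False)"
      using u0 z0(2) z1(2) x(2) by (intro v0_elt_eq[OF x(1)]) (auto simp: weil_carrier st z0(1) z1(1) weil_mult)
    moreover have "chi x (z0 * u / z1) = chi y z * \<kappa>"
    proof -
      have "z0 * u / z1 = (if a then cnj z else z) * (z0 * p / (cnj p * z1))" by (simp add: u_def)
      then have "chi x (z0 * u / z1) = chi x (if a then cnj z else z) * \<kappa>"
        unfolding \<kappa>_def using z pa z0 z1 by (simp only:) (intro cd(3), auto simp: F)
      then show ?thesis by (simp add: chy[OF z])
    qed
    ultimately show ?thesis using True ne
      by (intro ext) (simp add: cx_def v(1) to_F_def y_def pa(1))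
  qed
  then show ?thesis using yx k by blast
qed

text \<open>Passing from y to -y inverts both the character and \<open>chi\<close>, so the tensor is
  unchanged once \<kappa> is inverted. Thus the positive root of each pair can be used.\<close>

lemma cx_imaginary_positive:
  assumes chi: "chi_data R chi" and x: "x \<in> reps D" "imaginary x" and y: "y \<in> {x, cneg x}"
  shows "\<exists>\<kappa>. \<kappa> \<noteq> 0 \<and> (\<forall>z b. z \<noteq> 0 \<longrightarrow> cx chi x (z, b) = tens S y (chi y z * (if b then \<kappa> else 1)))"
proof -
  obtain y' \<kappa> where y': "y' \<in> {x, cneg x}" "\<kappa> \<noteq> 0"
    "\<And>z b. z \<noteq> 0 \<Longrightarrow> cx chi x (z, b) = tens S y' (chi y' z * (if b then \<kappa> else 1))"
    using cx_imaginary[OF chi x] by metis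
  have xR: "x \<in> R" by (rule repD(1)[OF x(1)])
  show ?thesis
  proof (cases "y = y'")
    case True
    then show ?thesis using y' by blast
  next
    case False
    then have yy: "y = cneg y'" using y y'(1) by auto
    have y'R: "y' \<in> R" "imaginary y'" using y'(1) xR x(2) R_cneg imaginary_cneg by auto
    note F = F_units_complex[OF imaginary_not_real[OF y'R]]
    have "tens S y' (chi y' z * (if b then \<kappa> else 1)) = tens S y (chi y z * (if b then inverse \<kappa> else 1))" if "z \<noteq> 0" for z b
    proof -
      have "chi y z * (if b then inverse \<kappa> else 1) = inverse (chi y' z * (if b then \<kappa> else 1))"
        using that chi_dataD(5)[OF chi y'R(1), of z] by (simp add: yy F)
      then show ?thesis using tens_cneg[OF R_chars[OF y'R(1)]] by (simp only: yy tens_inverse fun_eq_iff inverse_inverse_eq) simp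
    qed
    then show ?thesis using y'(2,3) by (intro exI[of _ "inverse \<kappa>"]) simp
  qed
qed

text \<open>\<open>weil_ab\<close> is invariant under conjugation in the Weil group, so neither the
  representative nor \<open>vzero\<close> affects the value.\<close>

lemma cx_real:
  assumes chi: "chi_data R chi" and x: "x \<in> reps D" "csig x = x" and w: "w \<in> carrier weil"
  shows "cx chi x w = tens S x (chi x (weil_ab w))"
proof -
  interpret W: group weil by (rule group_weil)
  obtain v where v: "transv D x = {v}" "v \<in> carrier weil" using transv_single[OF x(1)] x(2) by blast
  have all: "W_stab x = carrier weil" "W_stab_pm x = carrier weil"
    using x(2) by (auto simp: W_stab_def W_stab_pm_def gact_def)
  have v0: "vzero D x \<in> carrier weil" using repD(5)[OF x(1)] all by simp
  define u where "u = v \<otimes>\<^bsub>weil\<^esub> w \<otimes>\<^bsub>weil\<^esub> inv\<^bsub>weil\<^esub> v"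
  have uc: "u \<in> carrier weil" using v w by (simp add: u_def)
  have "u_elt D x v w = u"
    using v w by (intro u_elt_eq[OF x(1), of v v]) (auto simp: all u_def W.m_assoc)
  moreover define y where "y = vzero D x \<otimes>\<^bsub>weil\<^esub> u \<otimes>\<^bsub>weil\<^esub> inv\<^bsub>weil\<^esub> (vzero D x)"
  have "v0_elt D x u = y"
    using v0 uc by (intro v0_elt_eq[OF x(1)]) (auto simp: all y_def W.m_assoc)
  moreover have "weil_ab (g \<otimes>\<^bsub>weil\<^esub> h \<otimes>\<^bsub>weil\<^esub> inv\<^bsub>weil\<^esub> g) = weil_ab h" if "g \<in> carrier weil" for g h
  proof -
    have "weil_ab g * weil_ab (inv\<^bsub>weil\<^esub> g) = 1"
      using that by (simp flip: weil_ab_mult) (simp add: weil_one weil_ab_def)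
    then show ?thesis by (simp add: weil_ab_mult mult_ac)
  qed
  then have "weil_ab y = weil_ab w" using v0 v(2) by (simp add: y_def u_def)
  ultimately show ?thesis using x(2) by (intro ext) (simp add: cx_def v(1) to_F_def gact_def)
qed

lemma transv_complex:
  assumes x: "x \<in> reps D" "\<not> imaginary x" "csig x \<noteq> x"
  obtains p1 p2 where "transv D x = {(p1, False), (p2, True)}" "p1 \<noteq> 0" "p2 \<noteq> 0"
proof -
  have Wpm: "w \<in> W_stab_pm x \<longleftrightarrow> w \<in> carrier weil \<and> \<not> snd w" for w
    using x(2,3) by (cases "snd w") (auto simp: W_stab_pm_iff imaginary_def)
  have mem: "(1, b) \<otimes>\<^bsub>weil\<^esub> inv\<^bsub>weil\<^esub> v \<in> W_stab_pm x \<longleftrightarrow> snd v = b" if "v \<in> carrier weil" for v b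
    using that weil_inv_closed[OF that] monoid.m_closed[OF group.is_monoid[OF group_weil], of "(1, b)" "inv\<^bsub>weil\<^esub> v"]
    by (auto simp: Wpm snd_weil_mult snd_weil_inv weil_carrier)
  have ex: "\<exists>!v. v \<in> transv D x \<and> snd v = b" for b
    using repD(3)[OF x(1), of "(1, b)"] mem repD(2)[OF x(1)] weil_carrier by (metis (no_types, lifting) subsetD zero_neq_one)
  obtain v1 where v1: "v1 \<in> transv D x" "snd v1 = False" using ex[of False] by blast
  obtain v2 where v2: "v2 \<in> transv D x" "snd v2 = True" using ex[of True] by blast
  have "transv D x = {v1, v2}"
  proof
    show "transv D x \<subseteq> {v1, v2}"
    proof
      fix v assume v: "v \<in> transv D x"
      show "v \<in> {v1, v2}" using ex[of "snd v"] v v1 v2 by (cases "snd v") auto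
    qed
  qed (use v1 v2 in blast)
  moreover have "fst v1 \<noteq> 0" "fst v2 \<noteq> 0" using v1 v2 repD(2)[OF x(1)] by (auto simp: weil_def)
  ultimately show ?thesis using that[of "fst v1" "fst v2"] v1(2) v2(2) by (metis prod.collapse)
qed

text \<open>There are two cosets, with representatives over the identity and over \<sigma>. Elements
  over \<sigma> interchange them with factors p1 / p2 and - p2 / p1, whose product -1 comes from
  j^2.\<close>

lemma cx_complex:
  assumes chi: "chi_data R chi" and x: "x \<in> reps D" "\<not> imaginary x" "csig x \<noteq> x"
  shows "\<exists>\<kappa>. \<kappa> \<noteq> 0 \<and> (\<forall>w\<in>carrier weil. cx chi x w =
    (\<lambda>l. tens S x (chi x (fst w) * (if snd w then \<kappa> else 1)) l *
       tens S (csig x) (chi x (cnj (fst w)) * (if snd w then chi x (- 1) / \<kappa> else 1)) l))"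
proof -
  have xR: "x \<in> R" by (rule repD(1)[OF x(1)])
  note F = F_units_complex[OF x(3)] and cd = chi_dataD[OF chi xR]
  obtain p1 p2 where p: "transv D x = {(p1, False), (p2, True)}" "p1 \<noteq> 0" "p2 \<noteq> 0"
    using transv_complex[OF x] by blast
  obtain z0 where z0: "vzero D x = (z0, False)" "z0 \<noteq> 0"
    using repD(5)[OF x(1)] x(3) by (cases "vzero D x") (auto simp: W_stab_iff weil_carrier gact_def split: if_splits)
  have st: "(c, False) \<in> W_stab x" "(c, False) \<in> W_stab_pm x" if "c \<noteq> 0" for c
    using that by (simp_all add: W_stab_iff W_stab_pm_iff weil_carrier)
  have v0: "v0_elt D x (u, False) = (u, False)" if "u \<noteq> 0" for u
    using that by (intro v0_elt_eq[OF x(1)]) (auto simp: weil_carrier st z0 weil_mult)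
  have uF: "u_elt D x (p1, False) (z, False) = (z, False)" "u_elt D x (p2, True) (z, False) = (cnj z, False)" if "z \<noteq> 0" for z
    using that p(2,3)
    by (intro u_elt_eq[OF x(1), of _ "(p1, False)"], auto simp: p(1) st weil_carrier weil_mult)
       (intro u_elt_eq[OF x(1), of _ "(p2, True)"], auto simp: p(1) st weil_carrier weil_mult)
  have uT: "u_elt D x (p1, False) (z, True) = (p1 * z / p2, False)"
    "u_elt D x (p2, True) (z, True) = (- p2 * cnj z / p1, False)" if "z \<noteq> 0" for z
    using that p(2,3)
    by (intro u_elt_eq[OF x(1), of _ "(p2, True)"], auto simp: p(1) st weil_carrier weil_mult)
       (intro u_elt_eq[OF x(1), of _ "(p1, False)"], auto simp: p(1) st weil_carrier weil_mult)
  define \<kappa> where "\<kappa> = chi x (p1 / p2)"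
  have k: "\<kappa> \<noteq> 0" unfolding \<kappa>_def using p by (intro cd(2)) (simp add: F)
  have k': "chi x (- p2 / p1) = chi x (- 1) / \<kappa>"
  proof -
    have "chi x (- p2 / p1) * \<kappa> = chi x ((- p2 / p1) * (p1 / p2))"
      unfolding \<kappa>_def using p by (intro cd(3)[symmetric]) (auto simp: F)
    then show ?thesis using k p by (simp add: eq_divide_eq)
  qed
  have "cx chi x (z, b) = (\<lambda>l. tens S x (chi x z * (if b then \<kappa> else 1)) l *
       tens S (csig x) (chi x (cnj z) * (if b then chi x (- 1) / \<kappa> else 1)) l)" if z: "z \<noteq> 0" for z b
  proof (cases b)
    case False
    then show ?thesis using z x(3) by (simp add: cx_def p(1) uF v0 to_F_def)
  next
    case True
    have "chi x (p1 * z / p2) = chi x z * \<kappa>"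
      using cd(3)[of z "p1 / p2"] p z by (simp add: F \<kappa>_def mult.commute)
    moreover have "chi x (- (p2 * cnj z / p1)) = chi x (cnj z) * (chi x (- 1) / \<kappa>)"
      using cd(3)[of "cnj z" "- p2 / p1"] p z by (simp add: F mult.commute flip: k')
    ultimately show ?thesis using True z p(2,3) x(3) by (simp add: cx_def p(1) uT v0 to_F_def)
  qed
  then show ?thesis using k by (intro exI[of _ \<kappa>]) (auto simp: weil_def)
qed

text \<open>For a complex orbit the representatives lie over both elements of the Galois group, so q
  is 1 at y and at \<sigma>y. Hence a gauge that admits valid choices is one for which
  \<open>Fp\<close> is the identity.\<close>

lemma symmetric_gauge: "x \<in> Rasym R \<Longrightarrow> q (csig x) = q x"
proof -
  assume xa: "x \<in> Rasym R"
  then have xR: "x \<in> R" "\<not> imaginary x" by (auto simp: Rasym_def)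
  obtain y where y: "y \<in> reps D" "y \<in> sigma_orbit x" using reps_unique[OF xR(1)] by blast
  have x_or: "x \<in> sigma_orbit y" using sigma_orbit_eq[OF y(2)] sigma_orbit_self by blast
  have yR: "y \<in> R" by (rule repD(1)[OF y(1)])
  have ny: "\<not> imaginary y"
    using xR(2) x_or by (auto simp: sigma_orbit_def imaginary_cneg imaginary_csig_iff)
  have "q (csig y) = q y"
  proof (cases "csig y = y")
    case False
    obtain p1 p2 where "transv D y = {(p1, False), (p2, True)}" using transv_complex[OF y(1) ny False] by blast
    then show ?thesis using repD(4)[OF y(1), of "(p1, False)"] repD(4)[OF y(1), of "(p2, True)"] by simp
  qed simp
  then show ?thesis
    using x_or gaugeD(2)[OF q yR] gaugeD(2)[OF q R_csig[OF yR]] by (auto simp: sigma_orbit_def csig_cneg)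
qed

definition pos_part :: "'n chr \<Rightarrow> 'n chr" where
  "pos_part x = (if x \<in> PI then x else cneg x)"

lemma pos_part_bij: "bij_betw pos_part (reps D \<inter> Rsym R) PI"
  unfolding bij_betw_def
proof
  have im: "pos_part x \<in> sigma_orbit x" for x by (auto simp: pos_part_def sigma_orbit_def)
  show "inj_on pos_part (reps D \<inter> Rsym R)"
  proof (rule inj_onI)
    fix x y assume xy: "x \<in> reps D \<inter> Rsym R" "y \<in> reps D \<inter> Rsym R" "pos_part x = pos_part y"
    then have "sigma_orbit x = sigma_orbit y" using im sigma_orbit_eq by metis
    then show "x = y" using reps_eq[of y x] xy sigma_orbit_self[of x] by blast
  qed
  show "pos_part ` (reps D \<inter> Rsym R) = PI"
  proof
    show "pos_part ` (reps D \<inter> Rsym R) \<subseteq> PI" using Rsym_PI by (auto simp: pos_part_def)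
    show "PI \<subseteq> pos_part ` (reps D \<inter> Rsym R)"
    proof
      fix y assume y: "y \<in> PI"
      then have yR: "y \<in> R" "imaginary y" "y \<in> Rsym R" by (auto simp: PI_iff Rsym_def)
      obtain x where x: "x \<in> reps D" "x \<in> sigma_orbit y" using reps_unique[OF yR(1)] by blast
      have "x = y \<or> x = cneg y" using x(2) sigma_orbit_imaginary[OF yR(2)] by auto
      then have "x \<in> Rsym R" "pos_part x = y"
        using yR(3) y Rsym_PI[OF yR(3)] Rsym_cneg_iff by (auto simp: pos_part_def)
      then show "y \<in> pos_part ` (reps D \<inter> Rsym R)" using x(1) by (metis IntI image_eqI)
    qed
  qed
qed

lemma orbit_prod_Rasym:
  assumes f: "\<And>x y. x \<in> Rasym R \<Longrightarrow> y \<in> sigma_orbit x \<Longrightarrow> f y = f x"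
  shows "orbit_prod (sigma_orbit ` Rasym R) f = (\<Prod>x\<in>reps D \<inter> Rasym R. f x)"
proof -
  have inj: "inj_on sigma_orbit (reps D \<inter> Rasym R)"
    using reps_eq sigma_orbit_self by (intro inj_onI) blast
  have "sigma_orbit ` Rasym R = sigma_orbit ` (reps D \<inter> Rasym R)"
  proof
    show "sigma_orbit ` Rasym R \<subseteq> sigma_orbit ` (reps D \<inter> Rasym R)"
    proof
      fix B assume "B \<in> sigma_orbit ` Rasym R"
      then obtain x where x: "x \<in> R" "\<not> imaginary x" "B = sigma_orbit x" by (auto simp: Rasym_def)
      obtain y where y: "y \<in> reps D" "y \<in> sigma_orbit x" using reps_unique[OF x(1)] by blast
      have "\<not> imaginary y" using y(2) x(2) by (auto simp: sigma_orbit_def imaginary_cneg imaginary_csig_iff)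
      then have "y \<in> reps D \<inter> Rasym R" using y(1) reps_R by (auto simp: Rasym_def)
      then show "B \<in> sigma_orbit ` (reps D \<inter> Rasym R)" using sigma_orbit_eq[OF y(2)] x(3) by blast
    qed
  qed blast
  moreover have "f (SOME y. y \<in> sigma_orbit x) = f x" if "x \<in> Rasym R" for x
    using f[OF that] someI[of "\<lambda>y. y \<in> sigma_orbit x", OF sigma_orbit_self] by blast
  ultimately show ?thesis by (simp add: orbit_prod_def prod.reindex[OF inj])
qed

text \<open>Root and \<open>chi\<close> change together: \<open>cneg\<close> inverts both, and
  \<open>csig\<close> conjugates both because g is real. The asymmetric factor of
  \<open>chi_S_triple\<close> is therefore independent of representatives.\<close>

lemma chi_asym_invariant:
  assumes chi: "chi_data R chi" and g: "g \<in> real_points S" and x: "x \<in> Rasym R" "y \<in> sigma_orbit x"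
  shows "chi y (y g) = chi x (x g)"
proof -
  have xR: "x \<in> R" using x(1) by (simp add: Rasym_def)
  have Fu: "x g \<in> F_units x" if "x \<in> R" for x
    using that char_nonzero[OF R_chars[OF that]] real_char_real[OF _ R_chars[OF that] g]
    by (cases "csig x = x") (auto simp: F_units_real F_units_complex)
  have neg: "chi (cneg x) (cneg x g) = chi x (x g)" if x: "x \<in> R" for x
  proof -
    have K: "u \<in> F_units x \<Longrightarrow> inverse u \<in> F_units x" "0 \<notin> F_units x" "1 \<in> F_units x"
      "u \<in> F_units x \<Longrightarrow> v \<in> F_units x \<Longrightarrow> u * v \<in> F_units x" for u v
      by (auto simp: F_units_def split: if_splits)
    have "chi x (inverse (x g)) = inverse (chi x (x g))"
      by (rule mult_hom_powi(2)[of "F_units x"]) (use chi_dataD(2,3)[OF chi x] K Fu[OF x] in auto)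
    then show ?thesis using chi_dataD(5)[OF chi x K(1)[OF Fu[OF x]]] by (simp add: cneg_def)
  qed
  have sig: "chi (csig x) (csig x g) = chi x (x g)" if x: "x \<in> R" for x
  proof -
    have "csig x g = cnj (x g)" using g by (simp add: csig_def real_points_cnj)
    moreover have "cnj (x g) \<in> F_units x" using Fu[OF x] by (auto simp: F_units_def Reals_cnj_iff split: if_splits)
    ultimately show ?thesis using chi_dataD(4)[OF chi x] by simp
  qed
  show ?thesis using x(2) neg[OF xR] sig[OF xR] neg[OF R_csig[OF xR]] by (auto simp: sigma_orbit_def)
qed

text \<open>The twist by which the genuine character \<open>\<chi>\<^sub>S\<close> differs from \<open>\<rho>\<^sub>i\<close>, and its parameter.\<close>

lemma chi_decomposition:
  assumes chi: "chi_data R chi"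
  obtains \<psi> a where "torus_llc S \<psi> a"
    "\<And>g e d. (g, e, d) \<in> carrier T \<Longrightarrow> chi_S_triple R chi (g, e, d) = snd (to_V (g, e, d)) * \<psi> g"
    "\<And>w l. w \<in> carrier weil \<Longrightarrow> r_chi S chi D w l = a w l * tens S rho2 (fst w / of_real (cmod (fst w))) l"
proof -
  define eta where "eta y z = chi y z / (z / of_real (cmod z))" for y z
  have PIR: "y \<in> R" "imaginary y" "y \<in> chars S" "y \<in> Rsym R" if "y \<in> PI" for y
    using that R_chars by (auto simp: PI_iff Rsym_def)
  have cd: "continuous_on (UNIV - {0}) (chi y)" "\<And>u. u \<noteq> 0 \<Longrightarrow> chi y u \<noteq> 0"
    "\<And>u v. u \<noteq> 0 \<Longrightarrow> v \<noteq> 0 \<Longrightarrow> chi y (u * v) = chi y u * chi y v"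
    "\<And>u. u \<noteq> 0 \<Longrightarrow> chi (cneg y) u = inverse (chi y u)"
    if "y \<in> R" "csig y \<noteq> y" for y
    using chi_dataD(1-3,5)[OF chi that(1)] F_units_complex[OF that(2)] by simp_all
  have eta: "continuous_on (UNIV - {0}) (eta y)" "\<And>u. u \<noteq> 0 \<Longrightarrow> eta y u \<noteq> 0"
    "\<And>u v. u \<noteq> 0 \<Longrightarrow> v \<noteq> 0 \<Longrightarrow> eta y (u * v) = eta y u * eta y v"
    "\<And>c. c \<noteq> 0 \<Longrightarrow> eta y (complex_of_real c) = 1" if y: "y \<in> PI" for y
  proof -
    note c = cd[OF PIR(1)[OF y] imaginary_not_real[OF PIR(1,2)[OF y]]]
    show "continuous_on (UNIV - {0}) (eta y)" unfolding eta_def[abs_def]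
      by (intro continuous_intros c) auto
    show "eta y u \<noteq> 0" if "u \<noteq> 0" for u using that c(2) by (simp add: eta_def)
    show "eta y (u * v) = eta y u * eta y v" if "u \<noteq> 0" "v \<noteq> 0" for u v
      using that c(3) by (simp add: eta_def norm_mult)
    show "eta y (complex_of_real r) = 1" if "r \<noteq> 0" for r
      using that chi_dataD(6)[OF chi PIR(1,2)[OF y], of r] by (simp add: eta_def sgn_if)
  qed
  \<comment> \<open>Imaginary representatives correspond bijectively to positive imaginary roots, so
    \<kappa> can be indexed by the latter.\<close>
  have "\<forall>y\<in>PI. \<exists>\<kappa>. \<kappa> \<noteq> 0 \<and> (\<forall>x\<in>reps D \<inter> Rsym R. pos_part x = y \<longrightarrow>
      (\<forall>z b. z \<noteq> 0 \<longrightarrow> cx chi x (z, b) = tens S y (chi y z * (if b then \<kappa> else 1))))"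
  proof
    fix y assume "y \<in> PI"
    then obtain x where x: "x \<in> reps D \<inter> Rsym R" "pos_part x = y"
      using bij_betw_imp_surj_on[OF pos_part_bij] by (metis imageE)
    have uniq: "x' = x" if "x' \<in> reps D \<inter> Rsym R" "pos_part x' = y" for x'
      using that x pos_part_bij by (auto simp: bij_betw_def inj_on_def)
    have "y \<in> {x, cneg x}" using x(2) by (auto simp: pos_part_def)
    then obtain \<kappa> where "\<kappa> \<noteq> 0" "\<forall>z b. z \<noteq> 0 \<longrightarrow> cx chi x (z, b) = tens S y (chi y z * (if b then \<kappa> else 1))"
      using cx_imaginary_positive[OF chi, of x y] x Rsym_imaginary by blast
    then show "\<exists>\<kappa>. \<kappa> \<noteq> 0 \<and> (\<forall>x\<in>reps D \<inter> Rsym R. pos_part x = y \<longrightarrow>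
      (\<forall>z b. z \<noteq> 0 \<longrightarrow> cx chi x (z, b) = tens S y (chi y z * (if b then \<kappa> else 1))))" using uniq by blast
  qed
  then obtain \<kappa> where \<kappa>: "\<And>y. y \<in> PI \<Longrightarrow> \<kappa> y \<noteq> 0"
    "\<And>x z b. x \<in> reps D \<inter> Rsym R \<Longrightarrow> pos_part x \<in> PI \<Longrightarrow> z \<noteq> 0 \<Longrightarrow>
      cx chi x (z, b) = tens S (pos_part x) (chi (pos_part x) z * (if b then \<kappa> (pos_part x) else 1))"
    by (elim bchoice[THEN exE]) blast
  define ai where "ai y w = tens S y (eta y (fst w) * (if snd w then \<kappa> y else 1))" for y w
  have llc_i: "torus_llc S (\<lambda>g. eta y (csqrt (y g))) (ai y)" if "y \<in> PI" for y
    unfolding ai_def using torus_llc_imaginary[OF PIR(3,2)[OF that] \<kappa>(1)[OF that] eta[OF that]] by simp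
  have "\<exists>a. torus_llc S (\<lambda>g. chi x (x g)) a \<and> (\<forall>w\<in>carrier weil. cx chi x w = a w)" if x: "x \<in> reps D \<inter> Rasym R" for x
  proof -
    have xr: "x \<in> reps D" "\<not> imaginary x" "x \<in> R" using x by (auto simp: Rasym_def)
    show ?thesis
    proof (cases "csig x = x")
      case True
      have "torus_llc S (\<lambda>g. chi x (x g)) (\<lambda>w. tens S x (chi x (weil_ab w)))"
        by (rule torus_llc_real[OF R_chars[OF xr(3)] True])
          (use chi_dataD(1-3)[OF chi xr(3)] F_units_real[OF True] in simp_all)
      then show ?thesis using cx_real[OF chi xr(1) True] by blast
    next
      case False
      obtain k where k: "k \<noteq> 0" "\<forall>w\<in>carrier weil. cx chi x w =
        (\<lambda>l. tens S x (chi x (fst w) * (if snd w then k else 1)) l *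
           tens S (csig x) (chi x (cnj (fst w)) * (if snd w then chi x (- 1) / k else 1)) l)"
        using cx_complex[OF chi xr(1,2) False] by blast
      show ?thesis
        using torus_llc_complex[OF R_chars[OF xr(3)] k(1) cd(1-3)[OF xr(3) False]] k(2) by blast
    qed
  qed
  then obtain aa where aa: "\<And>x. x \<in> reps D \<inter> Rasym R \<Longrightarrow> torus_llc S (\<lambda>g. chi x (x g)) (aa x)"
    "\<And>x w. x \<in> reps D \<inter> Rasym R \<Longrightarrow> w \<in> carrier weil \<Longrightarrow> cx chi x w = aa x w" by metis
  show ?thesis
  proof (rule that)
    show "torus_llc S (\<lambda>g. (\<Prod>x\<in>reps D \<inter> Rasym R. chi x (x g)) * (\<Prod>y\<in>PI. eta y (csqrt (y g))))
       (\<lambda>w l. (\<Prod>x\<in>reps D \<inter> Rasym R. aa x w l) * (\<Prod>y\<in>PI. ai y w l))"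
      by (intro torus_llc_mult torus_llc_prod aa(1) llc_i)
  next
    fix g e d assume t: "(g, e, d) \<in> carrier T"
    have g: "g \<in> real_points S" by (rule T_D(4)[OF t])
    have "gal_orbit x = pm_orbit x" if "x \<in> Rsym R" for x
      using Rsym_imaginary[OF that] by (simp add: gal_orbit_def pm_orbit_def imaginary_def)
    then have "gal_orbit ` Rsym R = pm_orbit ` Rsym R" by (intro image_cong) simp_all
    moreover have "orbit_prod (pm_orbit ` Rsym R) (\<lambda>x. chi x (d x)) = (\<Prod>x\<in>PI. chi x (d x))"
    proof (rule orbit_prod_Rsym)
      fix x assume x: "x \<in> Rsym R"
      have xR: "x \<in> R" "imaginary x" using x by (auto simp: Rsym_def)
      note c = cd[OF xR(1) imaginary_not_real[OF xR]]
      have d0: "d x \<noteq> 0" by (rule T_D(1)[OF t x])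
      have "d x * cnj (d x) = complex_of_real ((cmod (d x))\<^sup>2)" by (rule complex_norm_square[symmetric])
      then have "chi x (d x) * chi x (cnj (d x)) = 1"
        using c(3)[of "d x" "cnj (d x)"] chi_dataD(6)[OF chi xR, of "(cmod (d x))\<^sup>2"] d0 by (simp del: of_real_power)
      then have "inverse (chi x (cnj (d x))) = chi x (d x)" by (metis inverse_unique mult.commute)
      then show "chi (cneg x) (d (cneg x)) = chi x (d x)" using T_D(2)[OF t x] c(4)[of "cnj (d x)"] d0 by simp
    qed
    moreover have "chi y (d y) = d y / of_real (cmod (d y)) * eta y (csqrt (y g))" if y: "y \<in> PI" for y
    proof -
      have d0: "d y \<noteq> 0" by (rule T_D(1)[OF t PIR(4)[OF y]])
      \<comment> \<open>As d y / cnj (d y) = y g, the unit vector of d y is a square root of y g;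
        eta ignores the positive factor 1 / |d y|.\<close>
      define w where "w = d y * of_real (inverse (cmod (d y)))"
      have "w * w = d y / cnj (d y)"
        using d0 complex_norm_square[of "d y"] by (simp add: w_def field_simps power2_eq_square)
      then have "w * w = y g" using T_D(2,3)[OF t PIR(4)[OF y]] by simp
      moreover have "w \<noteq> 0" using d0 by (simp add: w_def)
      ultimately have "eta y (csqrt (y g)) = eta y w" using even_char_csqrt[OF eta(3,4)[OF y]] by blast
      also have "\<dots> = eta y (d y)" using eta(3,4)[OF y] d0 by (simp add: w_def del: of_real_inverse)
      finally show ?thesis using d0 by (simp add: eta_def)
    qed
    then have "(\<Prod>x\<in>PI. chi x (d x)) = (\<Prod>x\<in>PI. d x / of_real (cmod (d x))) * (\<Prod>y\<in>PI. eta y (csqrt (y g)))"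
      by (simp add: prod.distrib[symmetric])
    ultimately show "chi_S_triple R chi (g, e, d) = snd (to_V (g, e, d)) *
        ((\<Prod>x\<in>reps D \<inter> Rasym R. chi x (x g)) * (\<Prod>y\<in>PI. eta y (csqrt (y g))))"
      using orbit_prod_Rasym[of "\<lambda>x. chi x (x g)"] chi_asym_invariant[OF chi g]
      by (simp add: chi_S_triple_def to_V_def mult_ac)
  next
    fix w l assume w: "w \<in> carrier weil"
    obtain z b where zb: "w = (z, b)" "z \<noteq> 0" using w by (cases w) (simp add: weil_carrier)
    let ?t = "z / of_real (cmod z)"
    have split: "reps D = (reps D \<inter> Rasym R) \<union> (reps D \<inter> Rsym R)"
      "(reps D \<inter> Rasym R) \<inter> (reps D \<inter> Rsym R) = {}"
      using reps_R by (auto simp: Rasym_def Rsym_def)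
    have "r_chi S chi D w l = (\<Prod>x\<in>reps D \<inter> Rasym R. cx chi x w l) * (\<Prod>x\<in>reps D \<inter> Rsym R. cx chi x w l)"
      unfolding r_chi_eq using finite_reps split(2) by (subst split(1), subst prod.union_disjoint) auto
    also have "(\<Prod>x\<in>reps D \<inter> Rasym R. cx chi x w l) = (\<Prod>x\<in>reps D \<inter> Rasym R. aa x w l)"
      using aa(2) w by (intro prod.cong) auto
    also have "(\<Prod>x\<in>reps D \<inter> Rsym R. cx chi x w l) =
        (\<Prod>x\<in>reps D \<inter> Rsym R. ai (pos_part x) w l * tens S (pos_part x) ?t l)"
    proof (rule prod.cong[OF refl])
      fix x assume x: "x \<in> reps D \<inter> Rsym R"
      have y: "pos_part x \<in> PI" using pos_part_bij x by (auto simp: bij_betw_def)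
      have "chi (pos_part x) z * (if b then \<kappa> (pos_part x) else 1) = eta (pos_part x) z * (if b then \<kappa> (pos_part x) else 1) * ?t"
        using zb(2) by (simp add: eta_def)
      then show "cx chi x w l = ai (pos_part x) w l * tens S (pos_part x) ?t l"
        using \<kappa>(2)[OF x y zb(2), of b] by (simp only: zb(1) ai_def fst_conv snd_conv tens_mult)
    qed
    also have "\<dots> = (\<Prod>y\<in>PI. ai y w l * tens S y ?t l)"
      by (rule prod.reindex_bij_betw[OF pos_part_bij])
    also have "\<dots> = (\<Prod>y\<in>PI. ai y w l) * tens S rho2 ?t l"
      using tens_char_prod[of PI "\<lambda>x. x" ?t l] PIR(3) zb(2) by (simp add: prod.distrib rho2[abs_def])
    finally show "r_chi S chi D w l = (\<Prod>x\<in>reps D \<inter> Rasym R. aa x w l) * (\<Prod>y\<in>PI. ai y w l) *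
        tens S rho2 (fst w / of_real (cmod (fst w))) l" by (simp add: zb(1) mult_ac)
  qed
qed

end

section \<open>Comparison of the two correspondences\<close>

context root_datum
begin

text \<open>\<open>q0\<close> is Galois invariant on asymmetric roots, so representatives with
  \<open>q0 x = 1\<close> meet the condition at every coset. \<open>pm_llc\<close> asks for such a
  witness when it is derived from \<open>av_llc\<close>.\<close>

lemma exists_choices: "\<exists>D. valid_choices R q0 D"
proof -
  interpret W: group weil by (rule group_weil)
  define rep where "rep B = (SOME x. x \<in> B \<and> q0 x = 1)" for B :: "'n chr set"
  have rep: "rep (sigma_orbit x) \<in> sigma_orbit x" "q0 (rep (sigma_orbit x)) = 1" if "x \<in> R" for x
  proof -
    have "\<exists>y. y \<in> sigma_orbit x \<and> q0 y = 1"
      using q0_values[of x] q0_cneg[OF that] by (auto simp: sigma_orbit_def)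
    then show "rep (sigma_orbit x) \<in> sigma_orbit x" "q0 (rep (sigma_orbit x)) = 1"
      unfolding rep_def by (metis (mono_tags, lifting) someI_ex)+
  qed
  define D :: "'n choices" where "D = \<lparr>reps = rep ` sigma_orbit ` R,
     transv = (\<lambda>x. if imaginary x \<or> csig x = x then {(1, False)} else {(1, False), (1, True)}),
     vzero = (\<lambda>_. (1, False)), vone = (\<lambda>_. (1, True))\<rparr>"
  have inv: "inv\<^bsub>weil\<^esub> (1, False) = (1, False)" "snd (inv\<^bsub>weil\<^esub> (1, True)) = True"
    using W.inv_one snd_weil_inv[of "(1, True)"] by (simp_all add: weil_one weil_carrier)
  have invc: "inv\<^bsub>weil\<^esub> (1, b) \<in> carrier weil" for b by (rule weil_inv_closed) (simp add: weil_carrier)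
  have "valid_choices R q0 D"
    unfolding valid_choices_def
  proof (intro conjI ballI)
    show "reps D \<subseteq> R" using rep(1) sigma_orbit_R by (auto simp: D_def)
    show "\<exists>!y. y \<in> reps D \<and> y \<in> sigma_orbit x" if x: "x \<in> R" for x
    proof (rule ex1I[of _ "rep (sigma_orbit x)"])
      show "rep (sigma_orbit x) \<in> reps D \<and> rep (sigma_orbit x) \<in> sigma_orbit x"
        using rep(1)[OF x] x by (simp add: D_def)
      fix y assume y: "y \<in> reps D \<and> y \<in> sigma_orbit x"
      then obtain x' where x': "x' \<in> R" "y = rep (sigma_orbit x')" by (auto simp: D_def)
      then have "sigma_orbit x' = sigma_orbit x"
        using rep(1)[OF x'(1)] y sigma_orbit_eq by metis
      then show "y = rep (sigma_orbit x)" using x'(2) by simp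
    qed
    fix x assume "x \<in> reps D"
    then have xR: "x \<in> R" and qx: "q0 x = 1" using rep sigma_orbit_R by (auto simp: D_def)
    show "transv D x \<subseteq> carrier weil" by (auto simp: D_def weil_carrier)
    show "\<exists>!v. v \<in> transv D x \<and> w \<otimes>\<^bsub>weil\<^esub> inv\<^bsub>weil\<^esub> v \<in> W_stab_pm x" if w: "w \<in> carrier weil" for w
    proof (cases "imaginary x \<or> csig x = x")
      case True
      have "w \<otimes>\<^bsub>weil\<^esub> inv\<^bsub>weil\<^esub> (1, False) \<in> W_stab_pm x"
        using W.m_closed[OF w invc] unfolding W_stab_pm_all[OF True] .
      moreover have "transv D x = {(1, False)}" using True by (simp add: D_def)
      ultimately show ?thesis by (intro ex1I[of _ "(1, False)"]) simp_all
    next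
      case False
      have mem: "w \<otimes>\<^bsub>weil\<^esub> inv\<^bsub>weil\<^esub> (1, b) \<in> W_stab_pm x \<longleftrightarrow> b = snd w" for b
      proof -
        define u where "u = w \<otimes>\<^bsub>weil\<^esub> inv\<^bsub>weil\<^esub> (1, b)"
        have u: "u \<in> carrier weil" "snd u \<longleftrightarrow> snd w \<noteq> b"
          using W.m_closed[OF w invc[of b]] snd_weil_inv[of "(1, b)"]
          by (simp_all add: u_def snd_weil_mult weil_carrier)
        have "u \<in> W_stab_pm x \<longleftrightarrow> \<not> snd u"
          using False u(1) by (cases "snd u") (auto simp: W_stab_pm_iff imaginary_def)
        then show ?thesis using u(2) by (auto simp: u_def)
      qed
      have tv: "transv D x = {(1, False), (1, True)}" using False by (simp add: D_def)
      show ?thesis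
        unfolding tv
      proof (rule ex1I[of _ "(1, snd w)"])
        show "(1, snd w) \<in> {(1, False), (1, True)} \<and> w \<otimes>\<^bsub>weil\<^esub> inv\<^bsub>weil\<^esub> (1, snd w) \<in> W_stab_pm x"
          using mem[of "snd w"] by (cases "snd w") simp_all
        show "v = (1, snd w)"
          if v: "v \<in> {(1, False), (1, True)} \<and> w \<otimes>\<^bsub>weil\<^esub> inv\<^bsub>weil\<^esub> v \<in> W_stab_pm x" for v
        proof -
          obtain b where "v = (1, b)" using v by blast
          then show ?thesis using v mem[of b] by simp
        qed
      qed
    qed
    show "q0 (gact (snd (inv\<^bsub>weil\<^esub> v)) x) = 1" if "v \<in> transv D x" for v
    proof (cases "imaginary x \<or> csig x = x")
      case True
      then have "v = (1, False)" using that by (simp add: D_def)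
      then show ?thesis using qx by (simp add: inv(1))
    next
      case False
      then have "v = (1, False) \<or> v = (1, True)" using that by (simp add: D_def)
      then have "q0 (gact (snd (inv\<^bsub>weil\<^esub> v)) x) = q0 x"
        using q0_csig[of x] False inv xR by auto
      then show ?thesis using qx by simp
    qed
    show "vzero D x \<in> W_stab x" by (simp add: D_def W_stab_iff weil_carrier)
    show "imaginary x \<longrightarrow> vone D x \<in> W_stab_pm x - W_stab x"
      using imaginary_not_real[OF xR] by (auto simp: D_def W_stab_iff W_stab_pm_iff weil_carrier imaginary_def)
  qed
  then show ?thesis by blast
qed

text \<open>\<open>chi_S\<close> evaluates at a selected triple of the class, and the given formula
  depends only on the image under \<open>to_V\<close>, which is constant on the class.\<close>

lemma chi_S_class:
  assumes \<psi>: "\<And>g e d. (g, e, d) \<in> carrier T \<Longrightarrow> chi_S_triple R chi (g, e, d) = snd (to_V (g, e, d)) * \<psi> g"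
    and t: "(g, e, d) \<in> carrier T"
  shows "chi_S R chi (pm_class S R (g, e, d)) = snd (to_V (g, e, d)) * \<psi> g"
proof -
  let ?t = "SOME t. t \<in> pm_class S R (g, e, d)"
  have "?t \<in> pm_class S R (g, e, d)" using class_self[OF t] by (rule someI)
  then have t': "?t \<in> carrier T" "to_V ?t = to_V (g, e, d)" using to_V_coset[OF t] by blast+
  obtain g' e' d' where eq: "?t = (g', e', d')" by (cases ?t)
  have "g' = g" using t'(2) by (simp add: eq to_V_def)
  then show ?thesis using \<psi>[of g' e' d'] t' by (simp add: chi_S_def eq)
qed

text \<open>One correspondence is translated into the other by multiplying or dividing by the twist
  that separates \<open>chi_S\<close> from rho_i: the character absorbs \<open>\<psi>0\<close>, the
  cocycle absorbs \<open>a0\<close>, and the conjugating element absorbs the \<open>t2\<close> from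
  change of gauge.\<close>

lemma llc_compatible:
  assumes chi: "chi_data R chi" and p: "gauge_on R p" and phi: "\<phi> \<in> params (pm_L S R p)"
  shows "pm_llc S R chi p (X \<circ> cov) \<phi> \<longleftrightarrow> av_llc S rho2 X (Fp p \<circ> \<phi>)"
proof
  assume "pm_llc S R chi p (X \<circ> cov) \<phi>"
  then obtain q D \<psi> a t where t: "t \<in> dual_torus S" and qD: "gauge_on R q" "valid_choices R q D"
    and llc: "torus_llc S \<psi> a"
    and X': "\<forall>(g, e, d)\<in>carrier T.
      (X \<circ> cov) (pm_class S R (g, e, d)) = chi_S R chi (pm_class S R (g, e, d)) * \<psi> g"
    and ph': "\<forall>w\<in>carrier weil. \<phi> w = L_conj (pm_L S R p) t
      (change_gauge S R q p ((\<lambda>l. a w l * r_chi S chi D w l), snd w))"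
    unfolding pm_llc_def by blast
  have X: "X (cov (pm_class S R (g, e, d))) = chi_S R chi (pm_class S R (g, e, d)) * \<psi> g"
    if "(g, e, d) \<in> carrier T" for g e d using bspec[OF X' that] by simp
  note ph = bspec[OF ph']
  interpret choice_datum S R ord q D
    using qD by (simp add: choice_datum_def choice_datum_axioms_def root_datum_axioms)
  obtain \<psi>0 a0 where d: "torus_llc S \<psi>0 a0"
    "\<And>g e d. (g, e, d) \<in> carrier T \<Longrightarrow> chi_S_triple R chi (g, e, d) = snd (to_V (g, e, d)) * \<psi>0 g"
    "\<And>w l. w \<in> carrier weil \<Longrightarrow> r_chi S chi D w l = a0 w l * tens S rho2 (fst w / of_real (cmod (fst w))) l"
    by (rule chi_decomposition[OF chi]) blast
  obtain t2 where t2: "t2 \<in> dual_torus S" "\<And>y. Fp p (change_gauge S R q p y) = cj t2 (Fp q y)"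
    by (rule Fp_change_gauge[OF q p]) blast
  \<comment> \<open>A gauge with valid choices is symmetric, so no sign correction occurs in the
    model where r is defined.\<close>
  have Fq: "Fp q y = y" for y using Fp_symmetric symmetric_gauge by blast
  have tt: "(\<lambda>l. t l * t2 l) \<in> dual_torus S" by (rule dual_torus_mult[OF t t2(1)])
  show "av_llc S rho2 X (Fp p \<circ> \<phi>)"
    unfolding av_llc_def
  proof (intro exI bexI conjI ballI)
    show "torus_llc S (\<lambda>g. \<psi> g * \<psi>0 g) (\<lambda>w l. a w l * a0 w l)" by (rule torus_llc_mult[OF llc d(1)])
    show "(\<lambda>l. t l * t2 l) \<in> dual_torus S" by (rule tt)
    show "case y of (s, z) \<Rightarrow> X (s, z) = z * (\<psi> s * \<psi>0 s)" if y: "y \<in> carrier V" for y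
    proof -
      obtain u where "u \<in> carrier T" "to_V u = y" using to_V_surj y by (metis imageE)
      moreover obtain g e d where "u = (g, e, d)" by (cases u)
      ultimately have u: "(g, e, d) \<in> carrier T" "to_V (g, e, d) = y" by simp_all
      have "fst y = g" using u(2) by (auto simp: to_V_def)
      then show ?thesis using X[OF u(1)] chi_S_class[OF d(2) u(1)] cov_class[OF u(1)] u(2)
        by (simp add: case_prod_unfold mult_ac)
    qed
    show "case w of (z, b) \<Rightarrow> (Fp p \<circ> \<phi>) (z, b) = L_conj (av_L S rho2) (\<lambda>l. t l * t2 l)
              ((\<lambda>l. a (z, b) l * a0 (z, b) l * tens S rho2 (z / of_real (cmod z)) l), b)" if w: "w \<in> carrier weil" for w
    proof -
      have "(Fp p \<circ> \<phi>) w = cj t (Fp p (change_gauge S R q p ((\<lambda>l. a w l * r_chi S chi D w l), snd w)))"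
        by (simp add: ph[OF w] L_conj_pm[OF t] Fp_cj)
      also have "\<dots> = cj (\<lambda>l. t l * t2 l) ((\<lambda>l. a w l * r_chi S chi D w l), snd w)"
        by (simp only: t2(2) Fq cj_cj)
      also have "(\<lambda>l. a w l * r_chi S chi D w l) = (\<lambda>l. a w l * a0 w l * tens S rho2 (fst w / of_real (cmod (fst w))) l)"
        using d(3)[OF w] by (simp add: mult.assoc)
      finally show ?thesis by (simp add: case_prod_unfold L_conj_av[OF tt])
    qed
  qed
next
  assume "av_llc S rho2 X (Fp p \<circ> \<phi>)"
  then obtain \<psi> a t where t: "t \<in> dual_torus S" and llc: "torus_llc S \<psi> a"
    and X: "\<And>s z. (s, z) \<in> carrier V \<Longrightarrow> X (s, z) = z * \<psi> s"
    and ph: "\<And>z b. (z, b) \<in> carrier weil \<Longrightarrow> (Fp p \<circ> \<phi>) (z, b) = L_conj (av_L S rho2) t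
              ((\<lambda>l. a (z, b) l * tens S rho2 (z / of_real (cmod z)) l), b)"
    unfolding av_llc_def by fast
  obtain D where D: "valid_choices R q0 D" using exists_choices by blast
  interpret choice_datum S R ord q0 D
    using gauge_q0 D by (simp add: choice_datum_def choice_datum_axioms_def root_datum_axioms)
  obtain \<psi>0 a0 where d: "torus_llc S \<psi>0 a0"
    "\<And>g e d. (g, e, d) \<in> carrier T \<Longrightarrow> chi_S_triple R chi (g, e, d) = snd (to_V (g, e, d)) * \<psi>0 g"
    "\<And>w l. w \<in> carrier weil \<Longrightarrow> r_chi S chi D w l = a0 w l * tens S rho2 (fst w / of_real (cmod (fst w))) l"
    by (rule chi_decomposition[OF chi]) blast
  obtain t2 where t2: "t2 \<in> dual_torus S" "\<And>y. Fp p (change_gauge S R q0 p y) = cj t2 (Fp q0 y)"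
    by (rule Fp_change_gauge[OF gauge_q0 p]) blast
  have Fq: "Fp q0 y = y" for y using Fp_symmetric symmetric_gauge by blast
  define t' where "t' = (\<lambda>l. t l * inverse (t2 l))"
  have t': "t' \<in> dual_torus S" unfolding t'_def by (rule dual_torus_mult[OF t dual_torus_inverse[OF t2(1)]])
  have \<psi>0: "\<psi>0 g \<noteq> 0" if "g \<in> real_points S" for g
    using d(1) that by (simp add: torus_llc_def torus_characters_def)
  have a0: "a0 w l \<noteq> 0" if "w \<in> carrier weil" for w l
    using d(1) that dual_torusD(1) unfolding torus_llc_def weil_cocycles_def by blast
  show "pm_llc S R chi p (X \<circ> cov) \<phi>"
    unfolding pm_llc_def
  proof (intro exI bexI conjI ballI)
    show "gauge_on R q0" by (rule gauge_q0)
    show "valid_choices R q0 D" by (rule D)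
    show "torus_llc S (\<lambda>g. \<psi> g * inverse (\<psi>0 g)) (\<lambda>w l. a w l * inverse (a0 w l))"
      by (intro torus_llc_mult llc torus_llc_inverse d)
    show "t' \<in> dual_torus S" by (rule t')
    show "case u of (g, e, d) \<Rightarrow> (X \<circ> cov) (pm_class S R (g, e, d)) =
      chi_S R chi (pm_class S R (g, e, d)) * (\<psi> g * inverse (\<psi>0 g))" if u: "u \<in> carrier T" for u
    proof -
      obtain g e d where uu: "u = (g, e, d)" by (cases u)
      note u = u[unfolded uu]
      have g: "g \<in> real_points S" by (rule T_D(4)[OF u])
      have "to_V (g, e, d) = (g, snd (to_V (g, e, d)))" by (simp add: to_V_def)
      then have "X (to_V (g, e, d)) = snd (to_V (g, e, d)) * \<psi> g"
        using X[of g "snd (to_V (g, e, d))"] to_V_carrier[OF u] by simp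
      then show ?thesis using chi_S_class[OF d(2) u] cov_class[OF u] \<psi>0[OF g]
        by (simp add: uu)
    qed
    show "\<phi> w = L_conj (pm_L S R p) t' (change_gauge S R q0 p ((\<lambda>l. a w l * inverse (a0 w l) * r_chi S chi D w l), snd w))"
      if w: "w \<in> carrier weil" for w
    proof -
      obtain z b where zb: "w = (z, b)" by (cases w)
      let ?y = "((\<lambda>l. a w l * inverse (a0 w l) * r_chi S chi D w l), snd w)"
      have y: "?y = ((\<lambda>l. a (z, b) l * tens S rho2 (z / of_real (cmod z)) l), b)"
        using d(3)[OF w] a0[OF w] by (simp add: zb fun_eq_iff)
      have "Fp p (\<phi> w) = cj t ?y"
        unfolding y using ph[of z b] w by (simp add: zb L_conj_av[OF t])
      also have "\<dots> = cj t' (cj t2 ?y)"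
      proof -
        have "(\<lambda>l. t' l * t2 l) = t" using dual_torusD(1)[OF t2(1)] by (simp add: t'_def mult.assoc)
        then show ?thesis by (simp only: cj_cj)
      qed
      also have "\<dots> = Fp p (cj t' (change_gauge S R q0 p ?y))" by (simp only: Fp_cj t2(2) Fq)
      finally have "Fp p (Fp p (\<phi> w)) = Fp p (Fp p (cj t' (change_gauge S R q0 p ?y)))" by simp
      then show ?thesis by (simp only: Fp_Fp L_conj_pm[OF t'])
    qed
  qed
qed

end

section \<open>From a reductive group to its roots\<close>

text \<open>The order makes the character group torsion-free: if x is at least 1, its positive
  powers are at least x, so x^N = 1 with positive N forces x = 1. This is what the symmetry of the
  roots requires.\<close>

lemma root_datum_of_reductive:
  fixes G S :: "(('n::finite) cmat) set"
  assumes G: "connected_reductive G" "over_reals G" and S: "maximal_torus S G" "over_reals S"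
    and ord: "group_order S ord"
  shows "root_datum S (roots G S) ord"
proof -
  note S_real = S(2)
  have SG: "S \<subseteq> G" and tor: "torus S" using S(1) by (simp_all add: maximal_torus_def)
  have agG: "alg_group G" using G(1) by (simp add: connected_reductive_def)
  obtain P where "diagonal_group S P (matrix_inv P)" using torus_diagonal_group[OF tor] by blast
  then interpret D: diagonal_group S P "matrix_inv P" .
  interpret real_group S
    using D.S D.commutative S_real by unfold_locales
  have cneg: "cneg x \<in> roots G S" if "x \<in> roots G S" for x
  proof (rule D.roots_cneg[OF G(1) SG _ that])
    fix x :: "'n chr" and N :: nat
    assume x: "x \<in> chars S" and N: "N > 0" and e: "\<forall>s\<in>S. x s ^ N = 1"
    have eN: "(\<lambda>s. x s ^ N) = (\<lambda>_. 1)" using e charsD(3)[OF x] by (metis power_one)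
    have pc: "(\<lambda>s. x s ^ n) \<in> chars S" for n
      by (induction n) (use chars_1 chars_mult[OF x] in auto)
    have om: "((\<lambda>s. y s * z s), (\<lambda>s. y' s * z s)) \<in> ord"
      if "y \<in> chars S" "y' \<in> chars S" "z \<in> chars S" "(y, y') \<in> ord" for y y' z
      using ord that by (auto simp: group_order_def)
    have lin: "linear_order_on (chars S) ord" using ord by (simp add: group_order_def)
    have refl: "(y, y) \<in> ord" if "y \<in> chars S" for y
      using lin that by (auto simp: linear_order_on_def partial_order_on_def preorder_on_def refl_on_def)
    have trans: "(y, z) \<in> ord" if "(y, y') \<in> ord" "(y', z) \<in> ord" for y y' z
      using lin that by (auto simp: linear_order_on_def partial_order_on_def preorder_on_def trans_def)
    have antisym: "y = z" if "(y, z) \<in> ord" "(z, y) \<in> ord" for y z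
      using lin that by (auto simp: linear_order_on_def partial_order_on_def antisym_def)
    obtain M where M: "N = Suc M" using N not0_implies_Suc by blast
    consider "x = (\<lambda>_. 1)" | "((\<lambda>_. 1), x) \<in> ord" | "(x, (\<lambda>_. 1)) \<in> ord"
      using lin x chars_1 by (auto simp: linear_order_on_def total_on_def)
    then show "x = (\<lambda>_. 1)"
    proof cases
      case 2
      have "(x, (\<lambda>s. x s ^ Suc n)) \<in> ord" for n
      proof (induction n)
        case (Suc n)
        have "((\<lambda>s. 1 * x s ^ Suc n), (\<lambda>s. x s * x s ^ Suc n)) \<in> ord" using 2 x pc chars_1 by (intro om)
        then show ?case using Suc trans by simp
      qed (use refl[OF x] in simp)
      then have "(x, (\<lambda>_. 1)) \<in> ord" using eN M by metis
      then show ?thesis using antisym 2 by blast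
    next
      case 3
      have "((\<lambda>s. x s ^ Suc n), x) \<in> ord" for n
      proof (induction n)
        case (Suc n)
        have "((\<lambda>s. x s * x s ^ Suc n), (\<lambda>s. 1 * x s ^ Suc n)) \<in> ord" using 3 x pc chars_1 by (intro om)
        then show ?case using Suc trans by simp
      qed (use refl[OF x] in simp)
      then have "((\<lambda>_. 1), x) \<in> ord" using eN M by metis
      then show ?thesis using antisym 3 by blast
    qed
  qed
  show ?thesis
  proof unfold_locales
    show "finite (roots G S)" using D.roots_subset finite_subset by (metis finite finite_imageI)
    show "roots G S \<subseteq> chars S" "(\<lambda>_. 1) \<notin> roots G S" by (auto simp: roots_def)
    show "csig x \<in> roots G S" if "x \<in> roots G S" for x
      using roots_csig[OF agG G(2) S_real SG that] chars_csig that by (auto simp: roots_def)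
  qed (use cneg ord in auto)
qed

text \<open>Naturality is expressed by the explicit formula for f on classes, by F p being the
  identity on the dual torus and compatible with the projection to the Galois group, and by
  compatibility with change of gauge up to conjugacy. As all \<chi>-data are compared with the same
  Adams-Vogan correspondence, the correspondence for the cover is independent of them.\<close>

theorem corollary5p8:
  fixes G S :: "(complex ^ 'n::finite ^ 'n) set"
    and ord :: "('n chr \<times> 'n chr) set"
    and R :: "('n chr) set"
    and two_rho :: "'n chr"
  assumes "connected_reductive G" and "over_reals G"
    and "maximal_torus S G" and "over_reals S"
    and "R = roots G S"
    and "group_order S ord"
    and "two_rho = two_rho_i R ord"
  shows "\<exists>f F.
     f \<in> iso (pm_cover S R) (av_cover S two_rho) \<and>
     homeomorphic_map (pm_topology S R) (top_of_set (carrier (av_cover S two_rho))) f \<and>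
     (\<forall>(g, e, d)\<in>carrier (pm_triples S R).
        f (pm_class S R (g, e, d)) =
          (g, of_real e * (\<Prod>x\<in>pos_imag R ord. d x / of_real (cmod (d x))))) \<and>
     (\<forall>p. gauge_on R p \<longrightarrow>
        F p \<in> iso (pm_L S R p) (av_L S two_rho) \<and>
        (\<exists>H. homeomorphism (carrier (pm_L S R p)) (carrier (av_L S two_rho)) (F p) H) \<and>
        (\<forall>s\<in>dual_torus S. F p (s, False) = (s, False) \<and> snd (F p (s, True)) = True) \<and>
        ((\<forall>x\<in>Rasym R. p (csig x) = p x) \<longrightarrow> (\<forall>y\<in>carrier (pm_L S R p). F p y = y))) \<and>
     (\<forall>p q. gauge_on R p \<longrightarrow> gauge_on R q \<longrightarrow>
        (\<exists>t\<in>dual_torus S. \<forall>y\<in>carrier (pm_L S R p).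
           F q (change_gauge S R p q y) = L_conj (av_L S two_rho) t (F p y))) \<and>
     (\<forall>X. X \<circ> f \<in> pm_genuine S R \<longleftrightarrow> X \<in> av_genuine S two_rho) \<and>
     (\<forall>p \<phi>. gauge_on R p \<longrightarrow> \<phi> \<in> params (pm_L S R p) \<longrightarrow>
        F p \<circ> \<phi> \<in> params (av_L S two_rho)) \<and>
     (\<forall>chi p. chi_data R chi \<longrightarrow> gauge_on R p \<longrightarrow>
        (\<forall>X\<in>av_genuine S two_rho. \<forall>\<phi>\<in>params (pm_L S R p).
           pm_llc S R chi p (X \<circ> f) \<phi> \<longleftrightarrow> av_llc S two_rho X (F p \<circ> \<phi>)))"
proof -
  interpret root_datum S R ord
    using root_datum_of_reductive[OF assms(1-4,6)] assms(5) by simp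
  have rho: "two_rho = rho2" using assms(7) by (simp add: rho2_def)
  show ?thesis
    unfolding rho
  proof (intro exI[of _ cov] exI[of _ Fp] conjI allI impI ballI)
    show "cov \<in> iso (pm_cover S R) V" by (rule cov_iso)
    show "homeomorphic_map (pm_topology S R) (top_of_set (carrier V)) cov" by (rule homeomorphic_cov)
    show "case t of (g, e, d) \<Rightarrow> cov (pm_class S R (g, e, d)) =
          (g, of_real e * (\<Prod>x\<in>pos_imag R ord. d x / of_real (cmod (d x))))" if "t \<in> carrier T" for t
      using that cov_class by (cases t) (simp add: to_V_def PI_def)
    show "Fp p \<in> iso (pm_L S R p) (av_L S rho2)" if "gauge_on R p" for p using that by (rule Fp_iso)
    show "\<exists>H. homeomorphism (carrier (pm_L S R p)) (carrier (av_L S rho2)) (Fp p) H" for p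
      using Fp_homeomorphism by blast
    show "Fp p (s, False) = (s, False)" "snd (Fp p (s, True)) = True" for p s by (simp_all add: Fp_def)
    show "Fp p y = y" if "\<forall>x\<in>Rasym R. p (csig x) = p x" for p y using that by (rule Fp_symmetric)
    show "\<exists>t\<in>dual_torus S. \<forall>y\<in>carrier (pm_L S R p). Fp q (change_gauge S R p q y) = L_conj (av_L S rho2) t (Fp p y)"
      if pq: "gauge_on R p" "gauge_on R q" for p q
    proof -
      obtain t where "t \<in> dual_torus S" "\<And>y. Fp q (change_gauge S R p q y) = cj t (Fp p y)"
        by (rule Fp_change_gauge[OF pq]) blast
      then show ?thesis using L_conj_av by (intro bexI[of _ t]) auto
    qed
    show "(X \<circ> cov \<in> pm_genuine S R) = (X \<in> av_genuine S rho2)" for X by (rule genuine_iff)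
    show "Fp p \<circ> \<phi> \<in> params (av_L S rho2)" if "gauge_on R p" "\<phi> \<in> params (pm_L S R p)" for p \<phi>
      using that by (rule params_Fp)
    show "pm_llc S R chi p (X \<circ> cov) \<phi> = av_llc S rho2 X (Fp p \<circ> \<phi>)"
      if "chi_data R chi" "gauge_on R p" "\<phi> \<in> params (pm_L S R p)" for chi p X \<phi>
      using that by (rule llc_compatible)
  qed
qed

end
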